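(* Let $n\geq 3$ and $m\geq 3$ be integers and let $$P(z)=\sum_{i=0}^{m}\binom{m}{i}\frac{(-1)^{i}}{n+m+1-i}\, z^{n+m+1-i}+1 .$$ Let $S=\{z\in\mathbb{C}: P(z)=0\}$. Let $f$ and $g$ be two non-constant meromorphic functions on $\mathbb{C}$ such that $E_{f}(S,l)=E_{g}(S,l)$, where $l$ is a non-negative integer or $\infty$. Put $$\Theta_f=2\Theta(0,f)+2\Theta(\infty,f)+\Theta(1,f)+\tfrac12\min\{\Theta(1,f),\Theta(1,g)\},$$ $$\Theta_g=2\Theta(0,g)+2\Theta(\infty,g)+\Theta(1,g)+\tfrac12\min\{\Theta(1,f),\Theta(1,g)\}.$$ If one of the following conditions holds: (a) $l\geq 2$ and $\Theta_f+\Theta_g>9-(n+m)$; (b) $l=1$ and $\Theta_f+\Theta_g>10-(n+m)$; (c) $l=0$ and $\Theta_f+\Theta_g>15-(n+m)$; then $f\equiv g$.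
   Context: Standard Nevanlinna theory notation is used: $T(r,f)$ is the Nevanlinna characteristic and $\overline N(r,a;f)$ the reduced counting function of $a$-points of $f$ (distinct $a$-points counted once). For $a\in\mathbb{C}\cup\{\infty\}$, $\Theta(a,f)=1-\limsup_{r\to\infty}\frac{\overline N(r,a;f)}{T(r,f)}$. Weighted sharing: for a non-negative integer or infinity $k$ and $a\in\mathbb{C}\cup\{\infty\}$, $E_k(a;f)$ denotes the set of $a$-points of $f$ where an $a$-point of multiplicity $m$ is counted $m$ times if $m\leq k$ and $k+1$ times if $m>k$; for a set $S\subset\mathbb{C}\cup\{\infty\}$, $E_f(S,k)=\bigcup_{a\in S}E_k(a;f)$ (as a multiset of points with these counts). Thus $E_f(S,\infty)=E_g(S,\infty)$ is sharing $S$ counting multiplicities and $E_f(S,0)=E_g(S,0)$ is sharing $S$ ignoring multiplicities. *)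

theory Defs
  imports "HOL-Complex_Analysis.Complex_Analysis" "HOL-Library.Extended_Nat" "HOL-Library.Extended_Real"
begin

text \<open>Meromorphic functions on the plane are represented by functions
  f :: complex => complex with f nicely_meromorphic_on UNIV (value 0 at poles,
  continuous elsewhere).  A value in the extended plane is a complex option:
  Some a is the finite value a, None is infinity.\<close>

definition apt_mult :: "(complex \<Rightarrow> complex) \<Rightarrow> complex option \<Rightarrow> complex \<Rightarrow> nat" where
  "apt_mult f a z =
     (case a of
        None \<Rightarrow> (if is_pole f z then nat (- zorder f z) else 0)
      | Some c \<Rightarrow> (if \<not> is_pole f z \<and> f z = c then nat (zorder (\<lambda>w. f w - c) z) else 0))"

definition apts_disc :: "(complex \<Rightarrow> complex) \<Rightarrow> complex option \<Rightarrow> real \<Rightarrow> complex set" where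
  "apts_disc f a t = {z. cmod z \<le> t \<and> apt_mult f a z > 0}"

definition n_count :: "(complex \<Rightarrow> complex) \<Rightarrow> complex option \<Rightarrow> real \<Rightarrow> real" where
  "n_count f a t = real (\<Sum>z\<in>apts_disc f a t. apt_mult f a z)"

definition nbar_count :: "(complex \<Rightarrow> complex) \<Rightarrow> complex option \<Rightarrow> real \<Rightarrow> real" where
  "nbar_count f a t = real (card (apts_disc f a t))"

definition integrated_count :: "(real \<Rightarrow> real) \<Rightarrow> real \<Rightarrow> real" where
  "integrated_count nf r = integral {0..r} (\<lambda>t. (nf t - nf 0) / t) + nf 0 * ln r"

definition N_count :: "(complex \<Rightarrow> complex) \<Rightarrow> complex option \<Rightarrow> real \<Rightarrow> real" where
  "N_count f a r = integrated_count (n_count f a) r"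

definition Nbar_count :: "(complex \<Rightarrow> complex) \<Rightarrow> complex option \<Rightarrow> real \<Rightarrow> real" where
  "Nbar_count f a r = integrated_count (nbar_count f a) r"

definition log_plus :: "real \<Rightarrow> real" where
  "log_plus x = max 0 (ln x)"

definition prox :: "(complex \<Rightarrow> complex) \<Rightarrow> real \<Rightarrow> real" where
  "prox f r = integral {0..2*pi} (\<lambda>\<theta>. log_plus (cmod (f (of_real r * cis \<theta>)))) / (2*pi)"

definition nev_char :: "(complex \<Rightarrow> complex) \<Rightarrow> real \<Rightarrow> real" where
  "nev_char f r = prox f r + N_count f None r"

definition Theta :: "complex option \<Rightarrow> (complex \<Rightarrow> complex) \<Rightarrow> ereal" where
  "Theta a f = 1 - Limsup at_top (\<lambda>r. ereal (Nbar_count f a r / nev_char f r))"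

text \<open>E_f(S,l) as a multiset of points, i.e. a function complex => enat:
  an a-point (a in S) of multiplicity m counts m times if m <= l, and l+1 times if m > l.\<close>
definition E_weighted :: "(complex \<Rightarrow> complex) \<Rightarrow> complex set \<Rightarrow> enat \<Rightarrow> complex \<Rightarrow> enat" where
  "E_weighted f S l z = (\<Sum>a\<in>S. min (enat (apt_mult f (Some a) z)) (l + 1))"

definition P_poly :: "nat \<Rightarrow> nat \<Rightarrow> complex \<Rightarrow> complex" where
  "P_poly n m z = (\<Sum>i=0..m. of_nat (m choose i) * (-1) ^ i / of_nat (n + m + 1 - i)
                              * z ^ (n + m + 1 - i)) + 1"

end

theory Submission
  imports Defs "HOL-Computational_Algebra.Fundamental_Theorem_Algebra"
begin

text \<open>Since $P' = z^n (z-1)^m$, the function $\<Phi> = (1/P(f))' / (1/P(g))'$ is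
  $f' f^n (f-1)^m P(g)^2 / (g' g^n (g-1)^m P(f)^2)$. If \<open>\<Phi>\<close> is not constant, its logarithmic derivative $H$ has
  small proximity function, vanishes at the common simple zeros of $P(f)$ and $P(g)$ and has at most simple poles;
  counting these and applying the second main theorem to $f$ with the values $0$, $1$, \<open>\<infinity>\<close> and the zeros of $P$
  contradicts the deficiency condition, whichever of $f$, $g$ has the larger characteristic infinitely often.

  If \<open>\<Phi>\<close> is constant, then $1/P(f) = c/P(g) + b$ with $c \<noteq> 0$. For $b \<noteq> 0$ the points of $g$ over three simple roots
  of $P = -c/b$ are poles of $P(f)$, hence of multiplicity at least $n+m+1$: too ramified. So $P(g) = c P(f)$.
  For $c \<noteq> 1$ some regular value of $P$ is carried by $c$ to a critical value, and comparing the
  fibres bounds the characteristic of $f$ by a multiple less than one of that of $g$, and symmetrically. For $c = 1$ the pair $(f, g)$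
  parametrises the curve $P(x) = P(y)$, whose components other than the diagonal carry nonzero holomorphic differentials.\<close>

section \<open>Divisors and weighted counting functions\<close>

text \<open>Deficiencies enter only as limsup bounds, and these survive restriction to one sequence
  of radii tending to infinity. All error terms are therefore measured along a sequence
  \<open>s\<close> against \<open>\<phi>\<close>, the sum of the two characteristics. With S the
  zero set of P, the values S, 0, 1 have n+m+3 elements, so (n+m+2) T(f) is bounded by reduced
  counts of 0, 1, \<infinity> for both functions. In the cheapest case their coefficients 2, 2, 2
  for f and 2, 1, 2 for g add up to 11, and 9 = 11 - 2. The resulting 2\<Theta>(1,f) +
  \<Theta>(1,g), and its mirror image, both dominate \<Theta>(1,f) + \<Theta>(1,g) + min, the
  symmetric form in the hypothesis. Weak sharing costs more: shared points with unequal
  multiplicities are poles of H and are paid for by ramification, that of f with weight \<alpha> and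
  that of g with weight \<gamma>. Ramification is at most N(0) + N(\<infinity>) \<le> 2T up to small
  terms, so 9 grows to 9 + 2\<alpha> + 2(\<gamma> - 1); the pairs (0,1), (1/2,1), (2,2) are
  admissible for l \<ge> 2, l = 1, l = 0 and give 9, 10, 15.\<close>

definition nzmero :: "(complex \<Rightarrow> complex) \<Rightarrow> bool" where
  "nzmero h \<longleftrightarrow> h meromorphic_on UNIV \<and> eventually (\<lambda>z. h z \<noteq> 0) (cosparse UNIV)"

definition regular_at :: "(complex \<Rightarrow> complex) \<Rightarrow> complex \<Rightarrow> bool" where
  "regular_at h z \<longleftrightarrow> h analytic_on {z} \<and> h z \<noteq> 0"

text \<open>Removable singularities count as bad too: quotients are formed with total division and
  may carry a wrong value there. The set is countable for the functions in question, and on every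
  other circle ln |h| is continuous.\<close>

definition bad_radii :: "(complex \<Rightarrow> complex) \<Rightarrow> real set" where
  "bad_radii h = cmod ` {z. \<not> regular_at h z}"

definition locfin :: "(complex \<Rightarrow> real) \<Rightarrow> bool" where
  "locfin D \<longleftrightarrow> (\<forall>r. finite {z. cmod z \<le> r \<and> D z \<noteq> 0})"

text \<open>The integral of dt/t from |z| to r, with the usual convention ln r for a point at the
  origin.\<close>

definition wt :: "real \<Rightarrow> complex \<Rightarrow> real" where
  "wt r z = (if z = 0 then ln r else ln (r / cmod z))"

text \<open>The integrated counting function of a divisor. Real coefficients allow a linear
  inequality between several counting functions to be proved as one pointwise inequality between
  divisors.\<close>

definition vcount :: "(complex \<Rightarrow> real) \<Rightarrow> real \<Rightarrow> real" where
  "vcount D r = (\<Sum>z | cmod z \<le> r \<and> D z \<noteq> 0. D z * wt r z)"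

definition cmean :: "(complex \<Rightarrow> real) \<Rightarrow> real \<Rightarrow> real" where
  "cmean u r = integral {0..2*pi} (\<lambda>\<theta>. u (of_real r * cis \<theta>)) / (2*pi)"

definition zord :: "(complex \<Rightarrow> complex) \<Rightarrow> complex \<Rightarrow> real" where
  "zord h z = real_of_int (zorder h z)"

section \<open>Meromorphic functions on the plane that do not vanish identically, and their
  divisors\<close>

lemma eventually_cosparse_UNIV_at:
  "eventually P (cosparse (UNIV :: complex set)) \<Longrightarrow> eventually P (at z)"
  by (rule eventually_cosparse_imp_eventually_at[where A = UNIV]) auto

lemma cosparse_UNIV_ex: "eventually P (cosparse (UNIV :: complex set)) \<Longrightarrow> \<exists>z. P z"
  using eventually_cosparse_UNIV_at[of P 0] by (metis eventually_happens at_neq_bot)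

lemma nzmeroD:
  assumes "nzmero h"
  shows "h meromorphic_on A" "eventually (\<lambda>w. h w \<noteq> 0) (at z)" "frequently (\<lambda>w. h w \<noteq> 0) (at z)"
    "isolated_singularity_at h z" "not_essential h z"
proof -
  show 1: "h meromorphic_on A"
    using assms meromorphic_on_subset unfolding nzmero_def by blast
  show "eventually (\<lambda>w. h w \<noteq> 0) (at z)"
    using assms eventually_cosparse_UNIV_at unfolding nzmero_def by blast
  then show "frequently (\<lambda>w. h w \<noteq> 0) (at z)"
    by (simp add: eventually_frequently)
  have "h meromorphic_on {z}"
    using assms meromorphic_on_subset unfolding nzmero_def by blast
  then show "isolated_singularity_at h z" "not_essential h z"
    by (auto simp: meromorphic_at_iff)
qed

lemma nzmero_mult: "nzmero f \<Longrightarrow> nzmero g \<Longrightarrow> nzmero (\<lambda>z. f z * g z)"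
  unfolding nzmero_def by (auto intro!: meromorphic_intros eventually_conj)

lemma nzmero_divide: "nzmero f \<Longrightarrow> nzmero g \<Longrightarrow> nzmero (\<lambda>z. f z / g z)"
  unfolding nzmero_def by (auto intro!: meromorphic_intros eventually_conj)

lemma nzmero_inverse: "nzmero f \<Longrightarrow> nzmero (\<lambda>z. inverse (f z))"
  unfolding nzmero_def by (auto intro!: meromorphic_intros elim!: eventually_mono)

lemma nzmero_const: "c \<noteq> 0 \<Longrightarrow> nzmero (\<lambda>z. c)"
  unfolding nzmero_def by (auto intro!: meromorphic_intros)

lemma nzmero_power: "nzmero f \<Longrightarrow> nzmero (\<lambda>z. f z ^ k)"
  by (induction k) (auto intro!: nzmero_mult nzmero_const)

lemma nzmero_prod:
  assumes "finite A" "\<And>a. a \<in> A \<Longrightarrow> nzmero (f a)"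
  shows "nzmero (\<lambda>z. \<Prod>a\<in>A. f a z)"
  using assms by (induction A rule: finite_induct) (auto intro!: nzmero_mult nzmero_const)

lemma eventually_regular_at:
  assumes "nzmero h"
  shows "eventually (regular_at h) (cosparse UNIV)"
proof -
  have "eventually (\<lambda>z. h analytic_on {z}) (cosparse UNIV)"
    using assms nzmero_def meromorphic_on_imp_analytic_cosparse by blast
  moreover have "eventually (\<lambda>z. h z \<noteq> 0) (cosparse UNIV)"
    using assms nzmero_def by blast
  ultimately show ?thesis
    by eventually_elim (auto simp: regular_at_def)
qed

lemma cosparse_finite_exceptions:
  assumes "eventually P (cosparse (UNIV :: complex set))"
  shows "finite {z. cmod z \<le> r \<and> \<not> P z}"
proof -
  have "{z. \<not> P z} sparse_in UNIV"
    using assms by (simp add: eventually_cosparse)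
  then have "finite (cball 0 r \<inter> {z. \<not> P z})"
    by (intro sparse_in_compact_finite) (auto intro: sparse_in_subset)
  moreover have "cball 0 r \<inter> {z. \<not> P z} = {z. cmod z \<le> r \<and> \<not> P z}"
    by auto
  ultimately show ?thesis by simp
qed

lemma countable_bad_radii:
  assumes "nzmero h"
  shows "countable (bad_radii h)"
proof -
  have "{z. \<not> regular_at h z} = (\<Union>n. {z. cmod z \<le> real n \<and> \<not> regular_at h z})"
    using real_arch_simple by auto
  also have "countable \<dots>"
    using cosparse_finite_exceptions[OF eventually_regular_at[OF assms]]
    by (intro countable_UN) (auto intro: countable_finite)
  finally show ?thesis
    unfolding bad_radii_def by (rule countable_image)
qed

lemma zorder_regular_at: "regular_at h z \<Longrightarrow> zorder h z = 0"
  unfolding regular_at_def by (auto intro: zorder_eq_0I)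

lemma locfin_zord:
  assumes "nzmero h"
  shows "locfin (zord h)"
  unfolding locfin_def
proof
  fix r
  show "finite {z. cmod z \<le> r \<and> zord h z \<noteq> 0}"
    by (rule finite_subset[OF _ cosparse_finite_exceptions[OF eventually_regular_at[OF assms]]])
      (auto simp: zord_def zorder_regular_at)
qed

lemma locfin_subset:
  assumes "locfin D" "\<And>z. E z \<noteq> 0 \<Longrightarrow> D z \<noteq> 0"
  shows "locfin E"
  unfolding locfin_def
proof
  fix r
  show "finite {z. cmod z \<le> r \<and> E z \<noteq> 0}"
    by (rule finite_subset[of _ "{z. cmod z \<le> r \<and> D z \<noteq> 0}"])
      (use assms in \<open>auto simp: locfin_def\<close>)
qed

lemma locfin_add:
  assumes "locfin D" "locfin E"
  shows "locfin (\<lambda>z. D z + E z)"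
  unfolding locfin_def
proof
  fix r
  show "finite {z. cmod z \<le> r \<and> D z + E z \<noteq> 0}"
    by (rule finite_subset[of _ "{z. cmod z \<le> r \<and> D z \<noteq> 0} \<union> {z. cmod z \<le> r \<and> E z \<noteq> 0}"])
      (use assms in \<open>auto simp: locfin_def\<close>)
qed

lemma locfin_cmult: "locfin D \<Longrightarrow> locfin (\<lambda>z. c * D z)"
  by (erule locfin_subset) auto

lemma locfin_diff:
  assumes "locfin D" "locfin E" shows "locfin (\<lambda>z. D z - E z)"
  using locfin_add[OF assms(1) locfin_cmult[OF assms(2), of "-1"]] by simp

lemma locfin_sum:
  assumes "finite A" "\<And>a. a \<in> A \<Longrightarrow> locfin (D a)"
  shows "locfin (\<lambda>z. \<Sum>a\<in>A. D a z)"
  using assms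
proof (induction A rule: finite_induct)
  case empty
  then show ?case by (simp add: locfin_def)
next
  case (insert x F)
  then show ?case by (simp add: locfin_add)
qed

section \<open>Linearity and monotonicity of integrated counts\<close>

lemma wt_nonneg: "r \<ge> 1 \<Longrightarrow> cmod z \<le> r \<Longrightarrow> wt r z \<ge> 0"
  by (auto simp: wt_def intro!: ln_ge_zero)

lemma vcount_superset:
  assumes "finite Z" "\<And>z. cmod z \<le> r \<Longrightarrow> D z \<noteq> 0 \<Longrightarrow> z \<in> Z" "\<And>z. z \<in> Z \<Longrightarrow> cmod z \<le> r"
  shows "vcount D r = (\<Sum>z\<in>Z. D z * wt r z)"
  unfolding vcount_def by (rule sum.mono_neutral_left) (use assms in auto)

lemma vcount_add:
  assumes "locfin D" "locfin E"
  shows "vcount (\<lambda>z. D z + E z) r = vcount D r + vcount E r"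
proof -
  let ?Z = "{z. cmod z \<le> r \<and> D z \<noteq> 0} \<union> {z. cmod z \<le> r \<and> E z \<noteq> 0}"
  have fin: "finite ?Z" using assms by (auto simp: locfin_def)
  have "vcount F r = (\<Sum>z\<in>?Z. F z * wt r z)" if "F = D \<or> F = E \<or> F = (\<lambda>z. D z + E z)" for F
    by (rule vcount_superset[OF fin]) (use that in auto)
  then show ?thesis by (simp add: sum.distrib algebra_simps)
qed

lemma vcount_cmult: "vcount (\<lambda>z. c * D z) r = c * vcount D r"
  unfolding vcount_def by (cases "c = 0") (auto simp: sum_distrib_left mult.assoc)

lemma vcount_diff:
  assumes "locfin D" "locfin E"
  shows "vcount (\<lambda>z. D z - E z) r = vcount D r - vcount E r"
  using vcount_add[OF assms(1) locfin_cmult[OF assms(2), of "-1"], of r] vcount_cmult[of "-1" E r]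
  by simp

lemma vcount_sum:
  assumes "finite A" "\<And>a. a \<in> A \<Longrightarrow> locfin (D a)"
  shows "vcount (\<lambda>z. \<Sum>a\<in>A. D a z) r = (\<Sum>a\<in>A. vcount (D a) r)"
  using assms
proof (induction A rule: finite_induct)
  case empty
  then show ?case by (simp add: vcount_def)
next
  case (insert x F)
  then show ?case by (simp add: vcount_add locfin_sum)
qed

lemma vcount_nonneg: "r \<ge> 1 \<Longrightarrow> (\<And>z. D z \<ge> 0) \<Longrightarrow> vcount D r \<ge> 0"
  unfolding vcount_def by (auto intro!: sum_nonneg mult_nonneg_nonneg wt_nonneg)

lemma vcount_mono:
  assumes "locfin D" "locfin E" "r \<ge> 1" "\<And>z. D z \<le> E z"
  shows "vcount D r \<le> vcount E r"
  using vcount_nonneg[of r "\<lambda>z. E z - D z"] vcount_diff[OF assms(2,1), of r] assms by simp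

lemma vcount_ge_point:
  assumes "locfin D" "r \<ge> 1" "\<And>z. D z \<ge> 0" "cmod z0 \<le> r" "D z0 \<ge> 1"
  shows "vcount D r \<ge> wt r z0"
proof -
  have "wt r z0 \<le> D z0 * wt r z0"
    using assms wt_nonneg[of r z0] by (simp add: mult_le_cancel_right1)
  also have "\<dots> \<le> vcount D r"
    unfolding vcount_def
    by (rule member_le_sum) (use assms in \<open>auto simp: locfin_def intro!: mult_nonneg_nonneg wt_nonneg\<close>)
  finally show ?thesis .
qed

lemma wt_mono: "0 < r \<Longrightarrow> r \<le> R \<Longrightarrow> wt r z \<le> wt R z"
  by (auto simp: wt_def divide_right_mono)

lemma vcount_mono_radius:
  assumes "locfin D" "1 \<le> r" "r \<le> R" "\<And>z. D z \<ge> 0"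
  shows "vcount D r \<le> vcount D R"
proof -
  have "vcount D r \<le> (\<Sum>z | cmod z \<le> r \<and> D z \<noteq> 0. D z * wt R z)"
    unfolding vcount_def by (intro sum_mono mult_left_mono wt_mono) (use assms in auto)
  also have "\<dots> \<le> vcount D R"
    unfolding vcount_def
    by (rule sum_mono2)
      (use assms in \<open>auto simp: locfin_def intro!: mult_nonneg_nonneg wt_nonneg\<close>)
  finally show ?thesis .
qed

lemma has_integral_indicator_over_t:
  assumes "0 < a" "a \<le> (r::real)"
  shows "((\<lambda>t. of_bool (a \<le> t) / t) has_integral ln (r / a)) {0..r}"
proof -
  have "((\<lambda>t. 1 / t) has_integral (ln r - ln a)) {a..r}"
    using assms
    by (intro fundamental_theorem_of_calculus)
      (auto intro!: derivative_eq_intros simp: has_real_derivative_iff_has_vector_derivative[symmetric])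
  then have "((\<lambda>t. if t \<in> {a..r} then 1 / t else 0) has_integral (ln r - ln a)) {0..r}"
    by (subst has_integral_restrict) (use assms in auto)
  then have "((\<lambda>t. of_bool (a \<le> t) / t) has_integral (ln r - ln a)) {0..r}"
    by (rule has_integral_eq[rotated]) auto
  then show ?thesis
    using assms by (simp add: ln_div)
qed

text \<open>The counting function is a finite sum of step functions on \<open>{0..r}\<close>, and a
  point z other than 0 contributes the integral of 1/t from |z| to r. The origin is taken out by
  subtracting \<open>nf 0\<close> and returns through the term \<open>nf 0 * ln r\<close>.\<close>

lemma integrated_count_eq_count:
  assumes D: "locfin D" and r: "r > 0"
    and nf: "\<And>t. nf t = (\<Sum>z | cmod z \<le> t \<and> D z \<noteq> 0. D z)"
  shows "integrated_count nf r = vcount D r"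
proof -
  define Z where "Z = {z. cmod z \<le> r \<and> D z \<noteq> 0}"
  have fin: "finite Z" using D by (auto simp: Z_def locfin_def)
  have nf0: "nf 0 = D 0"
  proof -
    have "{z. cmod z \<le> 0 \<and> D z \<noteq> 0} = (if D 0 = 0 then {} else {0})" by auto
    then show ?thesis by (simp add: nf)
  qed
  have diff: "nf t - nf 0 = (\<Sum>z\<in>Z - {0}. D z * of_bool (cmod z \<le> t))" if "t \<in> {0..r}" for t
  proof -
    have "nf t = (\<Sum>z\<in>Z. D z * of_bool (cmod z \<le> t))"
    proof -
      have "{z. cmod z \<le> t \<and> D z \<noteq> 0} = {z\<in>Z. cmod z \<le> t}" using that by (auto simp: Z_def)
      then have "nf t = (\<Sum>z\<in>{z\<in>Z. cmod z \<le> t}. D z)" by (simp add: nf)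
      also have "\<dots> = (\<Sum>z\<in>Z. if cmod z \<le> t then D z else 0)" by (rule sum.inter_filter[OF fin])
      also have "\<dots> = (\<Sum>z\<in>Z. D z * of_bool (cmod z \<le> t))" by (intro sum.cong) auto
      finally show ?thesis .
    qed
    also have "\<dots> = (\<Sum>z\<in>Z - {0}. D z * of_bool (cmod z \<le> t)) + D 0"
    proof (cases "0 \<in> Z")
      case True
      then show ?thesis using fin that by (subst sum.remove[of _ 0]) auto
    next
      case False
      then have "D 0 = 0" using r by (auto simp: Z_def)
      then show ?thesis using False by simp
    qed
    finally show ?thesis using nf0 by simp
  qed
  have "((\<lambda>t. \<Sum>z\<in>Z - {0}. D z * (of_bool (cmod z \<le> t) / t)) has_integral
          (\<Sum>z\<in>Z - {0}. D z * ln (r / cmod z))) {0..r}"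
    using fin
    by (intro has_integral_sum has_integral_mult_right has_integral_indicator_over_t)
      (auto simp: Z_def)
  then have "((\<lambda>t. (nf t - nf 0) / t) has_integral (\<Sum>z\<in>Z - {0}. D z * ln (r / cmod z))) {0..r}"
    by (elim has_integral_eq[rotated]) (auto simp: diff sum_divide_distrib)
  then have "integral {0..r} (\<lambda>t. (nf t - nf 0) / t) = (\<Sum>z\<in>Z - {0}. D z * ln (r / cmod z))"
    by (rule integral_unique)
  then have "integrated_count nf r = (\<Sum>z\<in>Z - {0}. D z * wt r z) + D 0 * wt r 0"
    unfolding integrated_count_def nf0 by (simp add: wt_def)
  also have "\<dots> = (\<Sum>z\<in>Z. D z * wt r z)"
  proof (cases "0 \<in> Z")
    case True
    then show ?thesis using fin by (subst (2) sum.remove[of _ 0]) auto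
  next
    case False
    then have "D 0 = 0" using r by (auto simp: Z_def)
    then show ?thesis using False by simp
  qed
  finally show ?thesis unfolding vcount_def Z_def .
qed

section \<open>Jensen's formula\<close>

text \<open>Analyticity and nonvanishing are open conditions, so by compactness of the closed disc
  they persist on a slightly larger ball. The extra room makes the logarithm taken later continuous
  up to the circle.\<close>

lemma analytic_on_cball_imp_holomorphic_ball:
  assumes "v analytic_on cball 0 r" "\<And>z. z \<in> cball 0 r \<Longrightarrow> v z \<noteq> 0"
  obtains R where "R > r" "v holomorphic_on ball 0 R" "\<And>z. z \<in> ball 0 R \<Longrightarrow> v z \<noteq> 0"
proof (cases "r \<ge> 0")
  case False
  then show ?thesis by (intro that[of 0]) (auto simp: holomorphic_on_def)
next
  case True
  obtain U where U: "open U" "cball 0 r \<subseteq> U" "v holomorphic_on U"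
    using assms(1) analytic_on_holomorphic by blast
  define V where "V = U \<inter> v -` (- {0})"
  have "open V"
    unfolding V_def using U holomorphic_on_imp_continuous_on
    by (intro continuous_open_preimage) auto
  moreover have "cball 0 r \<subseteq> V" using U assms by (auto simp: V_def)
  ultimately obtain e where e: "e > 0" "(\<Union>x\<in>cball 0 r. ball x e) \<subseteq> V"
    using compact_subset_open_imp_ball_epsilon_subset[of "cball (0::complex) r" V] compact_cball by blast
  have "ball 0 (r + e) \<subseteq> (\<Union>x\<in>cball (0::complex) r. ball x e)"
  proof
    fix z :: complex assume z: "z \<in> ball 0 (r + e)"
    show "z \<in> (\<Union>x\<in>cball 0 r. ball x e)"
    proof (cases "cmod z \<le> r")
      case True
      then show ?thesis using e by (intro UN_I[of z]) auto
    next
      case False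
      let ?x = "of_real (r / cmod z) * z"
      have "cmod z > 0" using False True by linarith
      then have 1: "cmod ?x = r" using True by (simp add: norm_mult norm_divide)
      have "z - ?x = of_real (1 - r / cmod z) * z" by (simp add: algebra_simps)
      then have "cmod (z - ?x) = \<bar>1 - r / cmod z\<bar> * cmod z" by (metis norm_mult norm_of_real)
      also have "\<dots> = cmod z - r" using False \<open>cmod z > 0\<close> by (simp add: field_simps abs_if)
      also have "\<dots> < e" using z by simp
      finally show ?thesis using 1 by (intro UN_I[of ?x]) (auto simp: dist_norm norm_minus_commute)
    qed
  qed
  then have "ball 0 (r + e) \<subseteq> V" using e by blast
  then show ?thesis
    using e U by (intro that[of "r + e"]) (auto simp: V_def intro: holomorphic_on_subset)
qed

lemma circle_mean_value_complex:
  fixes F :: "complex \<Rightarrow> complex"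
  assumes "continuous_on (cball 0 r) F" "F holomorphic_on ball 0 r" "r > 0"
  shows "((\<lambda>t. F (of_real r * cis t)) has_integral 2 * pi * F 0) {0..2*pi}"
proof -
  have "((\<lambda>u. F u / (u - 0)) has_contour_integral 2 * of_real pi * \<i> * F 0) (circlepath 0 r)"
    by (rule Cauchy_integral_circlepath) (use assms in auto)
  then have "((\<lambda>t. F (0 + r * cis t) / (0 + r * cis t - 0) * r * \<i> * cis t) has_integral 2 * of_real pi * \<i> * F 0) {0..2*pi}"
    unfolding circlepath_def by (subst (asm) has_contour_integral_part_circlepath_iff) auto
  then have "((\<lambda>t. F (r * cis t) * \<i>) has_integral 2 * of_real pi * F 0 * \<i>) {0..2*pi}"
    using assms(3) by (simp add: field_simps)
  then have "((\<lambda>t. F (r * cis t) * \<i> * (-\<i>)) has_integral 2 * of_real pi * F 0 * \<i> * (-\<i>)) {0..2*pi}"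
    by (rule has_integral_mult_left)
  then show ?thesis by (simp add: mult.assoc)
qed

lemma zero_free_imp_exp:
  assumes "v analytic_on cball 0 r" "\<And>z. z \<in> cball 0 r \<Longrightarrow> v z \<noteq> 0"
  obtains R L where "R > r" "L holomorphic_on ball 0 R" "\<And>z. z \<in> ball 0 R \<Longrightarrow> v z = exp (L z)"
proof -
  obtain R where R: "R > r" "v holomorphic_on ball 0 R" "\<And>z. z \<in> ball 0 R \<Longrightarrow> v z \<noteq> 0"
    using analytic_on_cball_imp_holomorphic_ball[OF assms] by blast
  have "contractible (ball (0::complex) R)"
    by (intro convex_imp_contractible convex_ball)
  from contractible_imp_holomorphic_log[OF R(2) this R(3)]
  obtain L where "L holomorphic_on ball 0 R" "\<And>z. z \<in> ball 0 R \<Longrightarrow> v z = exp (L z)"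
    by blast
  with R(1) show ?thesis by (rule that)
qed

lemma cmean_ln_zero_free:
  assumes "v analytic_on cball 0 r" "\<And>z. z \<in> cball 0 r \<Longrightarrow> v z \<noteq> 0" "r > 0"
  shows "cmean (\<lambda>z. ln (cmod (v z))) r = ln (cmod (v 0))"
proof -
  obtain R L where R: "R > r" "L holomorphic_on ball 0 R" "\<And>z. z \<in> ball 0 R \<Longrightarrow> v z = exp (L z)"
    using zero_free_imp_exp[OF assms(1,2)] by blast
  have ln: "ln (cmod (v z)) = Re (L z)" if "z \<in> ball 0 R" for z
    using R(3)[OF that] by simp
  have sub: "cball 0 r \<subseteq> ball (0::complex) R" "ball 0 r \<subseteq> ball (0::complex) R" using R by auto
  have "((\<lambda>t. L (of_real r * cis t)) has_integral 2 * pi * L 0) {0..2*pi}"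
    using R sub assms(3)
    by (intro circle_mean_value_complex[of r L])
      (auto intro: holomorphic_on_imp_continuous_on continuous_on_subset holomorphic_on_subset)
  then have "((\<lambda>t. Re (L (of_real r * cis t))) has_integral Re (2 * pi * L 0)) {0..2*pi}"
    by (rule has_integral_Re)
  then have "((\<lambda>t. ln (cmod (v (of_real r * cis t)))) has_integral 2 * pi * Re (L 0)) {0..2*pi}"
    using R assms(3) by (subst (asm) has_integral_cong[where g = "\<lambda>t. ln (cmod (v (of_real r * cis t)))"])
      (auto simp: ln norm_mult)
  then have "integral {0..2*pi} (\<lambda>t. ln (cmod (v (of_real r * cis t)))) = 2 * pi * Re (L 0)"
    by (rule integral_unique)
  then show ?thesis using R assms(3) ln[of 0] by (simp add: cmean_def)
qed

section \<open>Means over circles\<close>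

lemma sphere_circle: "continuous_on (sphere 0 r) u \<Longrightarrow> r \<ge> 0 \<Longrightarrow>
  continuous_on {0..2*pi} (\<lambda>\<theta>. u (of_real r * cis \<theta>))"
  by (rule continuous_on_compose2[of "sphere 0 r" u]) (auto intro!: continuous_intros simp: norm_mult)

lemma circle_integrable: "continuous_on (sphere 0 r) u \<Longrightarrow> r \<ge> 0 \<Longrightarrow>
  (\<lambda>\<theta>. u (of_real r * cis \<theta>) :: 'a :: banach) integrable_on {0..2*pi}"
  by (intro integrable_continuous_real sphere_circle)

lemma cmean_add:
  assumes "continuous_on (sphere 0 r) u" "continuous_on (sphere 0 r) v" "r \<ge> 0"
  shows "cmean (\<lambda>z. u z + v z) r = cmean u r + cmean v r"
  unfolding cmean_def by (subst Henstock_Kurzweil_Integration.integral_add)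
    (use assms in \<open>auto intro!: circle_integrable simp: add_divide_distrib\<close>)

lemma cmean_cmult: "cmean (\<lambda>z. c * u z) r = c * cmean u r"
  unfolding cmean_def by simp

lemma cmean_const [simp]: "cmean (\<lambda>z. c) r = c"
  unfolding cmean_def by simp

lemma cmean_mono:
  assumes "continuous_on (sphere 0 r) u" "continuous_on (sphere 0 r) v" "r \<ge> 0"
    "\<And>z. cmod z = r \<Longrightarrow> u z \<le> v z"
  shows "cmean u r \<le> cmean v r"
  unfolding cmean_def
  by (intro divide_right_mono integral_le circle_integrable) (use assms in \<open>auto simp: norm_mult\<close>)

lemma cmean_cong:
  assumes "\<And>z. cmod z = r \<Longrightarrow> u z = v z" "r \<ge> 0"
  shows "cmean u r = cmean v r"
  unfolding cmean_def by (intro arg_cong2[where f = "(/)"] integral_cong) (use assms in \<open>auto simp: norm_mult\<close>)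

lemma cmean_sum:
  assumes "finite A" "\<And>a. a \<in> A \<Longrightarrow> continuous_on (sphere 0 r) (u a)" "r \<ge> 0"
  shows "cmean (\<lambda>z. \<Sum>a\<in>A. u a z) r = (\<Sum>a\<in>A. cmean (u a) r)"
  using assms
proof (induction A rule: finite_induct)
  case (insert x F)
  then show ?case by (simp add: cmean_add continuous_on_sum)
qed simp

text \<open>On the circle, |z - a| equals the modulus of r - cnj(a) z / r. The only possible zero of
  that function is the reflection of \<open>a\<close>, outside the closed disc, so the mean value
  property of a zero-free function applies to it.\<close>

lemma cmean_ln_linear:
  assumes "cmod a < r"
  shows "cmean (\<lambda>z. ln (cmod (z - a))) r = ln r"
proof -
  have r: "r > 0" using assms norm_ge_zero le_less_trans by blast
  define v where "v = (\<lambda>z. of_real r - cnj a * z / of_real r)"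
  have v: "cmod (r * cis t - a) = cmod (v (r * cis (t)))" for t
  proof -
    have "r * cis t - a = cis t * cnj (v (r * cis t))"
      using r by (simp add: v_def algebra_simps cis_cnj flip: cis_inverse)
    then show ?thesis by (simp add: norm_mult)
  qed
  have "cmean (\<lambda>z. ln (cmod (z - a))) r = cmean (\<lambda>z. ln (cmod (v z))) r"
    unfolding cmean_def using v by simp
  also have "\<dots> = ln (cmod (v 0))"
  proof (rule cmean_ln_zero_free)
    show "v analytic_on cball 0 r" unfolding v_def using r by (intro analytic_intros) auto
    fix z :: complex assume z: "z \<in> cball 0 r"
    have "cmod (cnj a * z / of_real r) = cmod a * cmod z / r" using r by (simp add: norm_mult norm_divide)
    also have "\<dots> \<le> cmod a * r / r" using z r by (intro divide_right_mono mult_left_mono) auto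
    also have "\<dots> < r" using assms r by simp
    finally have "cmod (cnj a * z / of_real r) \<noteq> cmod (of_real r :: complex)" using r by simp
    then show "v z \<noteq> 0" by (auto simp: v_def)
  qed fact
  also have "\<dots> = ln r" using r by (simp add: v_def)
  finally show ?thesis .
qed

lemma zorder_linear: "zorder (\<lambda>w. w - a) z = (if z = a then 1 else 0)"
proof (cases "z = a")
  case True
  have "zorder (\<lambda>w. w - a) z = 1"
    by (rule zorder_eqI[of UNIV _ "\<lambda>_. 1"]) (use True in auto)
  then show ?thesis using True by simp
next
  case False
  then show ?thesis by (auto intro!: zorder_eq_0I analytic_intros)
qed

lemma nzmero_linear: "nzmero (\<lambda>w. w - a)"
proof -
  have "{z. \<not> z - a \<noteq> 0} sparse_in UNIV" by simp
  then show ?thesis unfolding nzmero_def eventually_cosparse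
    by (auto intro!: meromorphic_intros)
qed

lemma zorder_linear_powi: "zorder (\<lambda>w. (w - a) powi k) z = (if z = a then k else 0)"
proof -
  have "zorder (\<lambda>w. (w - a) powi k) z = k * zorder (\<lambda>w. w - a) z"
    using nzmeroD[OF nzmero_linear] by (intro zorder_power_int) auto
  then show ?thesis by (simp add: zorder_linear)
qed

lemma nzmero_power_int: "nzmero f \<Longrightarrow> nzmero (\<lambda>z. f z powi k)"
  by (cases "k \<ge> 0") (auto simp: power_int_def intro!: nzmero_power nzmero_inverse)

text \<open>The product of linear factors cancels every zero and pole in the disc, and
  \<open>remove_sings\<close> repairs the values left at the singular points. Hence the
  factorisation of \<open>h\<close> itself is asserted only where \<open>h\<close> is
  regular.\<close>

lemma nzmero_factor_out_divisor:
  fixes r :: real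
  assumes h: "nzmero h"
  defines "Z \<equiv> {z. cmod z \<le> r \<and> zord h z \<noteq> 0}"
  obtains u where "u analytic_on cball 0 r" "\<And>z. cmod z \<le> r \<Longrightarrow> u z \<noteq> 0"
    "\<And>z. regular_at h z \<Longrightarrow> cmod z \<le> r \<Longrightarrow> h z = u z * (\<Prod>a\<in>Z. (z - a) powi zorder h a)"
proof -
  have fin: "finite Z" using locfin_zord[OF h] by (auto simp: Z_def locfin_def)
  define p where "p = (\<lambda>z. \<Prod>a\<in>Z. (z - a) powi (- zorder h a))"
  have p: "nzmero p" unfolding p_def using fin by (intro nzmero_prod nzmero_power_int nzmero_linear)
  define w where "w = (\<lambda>z. h z * p z)"
  have w: "nzmero w" unfolding w_def using h p by (rule nzmero_mult)
  have zp: "zorder p z = (\<Sum>a\<in>Z. if z = a then - zorder h a else 0)" for z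
    unfolding p_def using nzmeroD[OF p] 
    by (subst zorder_prod) (auto simp: zorder_linear_powi p_def intro!: meromorphic_intros)
  have zw: "zorder w z = 0" if "cmod z \<le> r" for z
  proof -
    have "zorder w z = zorder h z + zorder p z"
      unfolding w_def using nzmeroD[OF h] nzmeroD[OF p] by (intro zorder_mult) auto
    also have "\<dots> = 0"
      using that fin by (cases "z \<in> Z") (auto simp: zp Z_def zord_def)
    finally show ?thesis .
  qed
  define u where "u = remove_sings w"
  have u: "u analytic_on {z}" "u z \<noteq> 0" if "cmod z \<le> r" for z
  proof -
    obtain r' where r': "zor_poly w z z \<noteq> 0" "r' > 0" "zor_poly w z holomorphic_on cball z r'"
        "\<forall>x\<in>cball z r' - {z}. w x = zor_poly w z x * (x - z) powi zorder w z"
      using zorder_exist[OF nzmeroD(4,5,3)[OF w], of z] by blast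
    have ev: "eventually (\<lambda>x. w x = zor_poly w z x) (at z)"
      using r'(2,4) zw[OF that] unfolding eventually_at
      by (intro exI[of _ r']) (auto simp: dist_commute)
    have "zor_poly w z \<midarrow>z\<rightarrow> zor_poly w z z"
    proof -
      have "continuous_on (ball z r') (zor_poly w z)"
        using r'(3) by (intro holomorphic_on_imp_continuous_on) (auto intro: holomorphic_on_subset)
      then show ?thesis using r'(2) by (simp add: continuous_on_eq_continuous_at isCont_def)
    qed
    then have lim: "w \<midarrow>z\<rightarrow> zor_poly w z z"
      using ev by (subst tendsto_cong[OF ev])
    then show "u analytic_on {z}" unfolding u_def using nzmeroD(4)[OF w] by (intro remove_sings_analytic_at)
    show "u z \<noteq> 0" using remove_sings_eqI[OF lim] r'(1) by (simp add: u_def)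
  qed
  show ?thesis
  proof
    show "u analytic_on cball 0 r" using u(1) by (subst analytic_on_analytic_at) auto
    show "u z \<noteq> 0" if "cmod z \<le> r" for z by (rule u(2)[OF that])
    fix z assume z: "regular_at h z" "cmod z \<le> r"
    have nZ: "z \<notin> Z" using zorder_regular_at[OF z(1)] by (auto simp: Z_def zord_def)
    have "p analytic_on {z}" unfolding p_def
      using nZ by (auto intro!: analytic_intros)
    then have "w analytic_on {z}" unfolding w_def using z by (intro analytic_intros) (auto simp: regular_at_def)
    then have "u z = h z * p z" by (simp add: u_def w_def)
    moreover have "p z * (\<Prod>a\<in>Z. (z - a) powi zorder h a) = 1"
      unfolding p_def prod.distrib[symmetric] using nZ
      by (intro prod.neutral) (auto simp: power_int_minus intro!: left_inverse)
    ultimately show "h z = u z * (\<Prod>a\<in>Z. (z - a) powi zorder h a)"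
      by (simp add: mult.assoc)
  qed
qed

lemma ln_cmod_powi: "x \<noteq> 0 \<Longrightarrow> ln (cmod (x powi k)) = real_of_int k * ln (cmod x)"
  by (cases "k \<ge> 0") (auto simp: power_int_def norm_power norm_inverse ln_realpow ln_inverse)

lemma regular_at_continuous_ln:
  assumes "\<And>z. cmod z = r \<Longrightarrow> regular_at h z"
  shows "continuous_on (sphere 0 r) (\<lambda>z. ln (cmod (h z)))"
proof -
  have "h analytic_on sphere 0 r"
    by (subst analytic_on_analytic_at) (use assms in \<open>auto simp: regular_at_def\<close>)
  then have "continuous_on (sphere 0 r) h"
    by (intro holomorphic_on_imp_continuous_on analytic_imp_holomorphic)
  then show ?thesis using assms by (intro continuous_intros) (auto simp: regular_at_def)
qed

lemma good_radius_regular: "r \<notin> bad_radii h \<Longrightarrow> cmod z = r \<Longrightarrow> regular_at h z"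
  by (auto simp: bad_radii_def)

text \<open>The constant is ln of the modulus of the leading Laurent coefficient at the origin,
  \<open>zor_poly h 0 0\<close>. The zero-free factor u depends on r, so ln |u(0)| alone cannot
  serve; it becomes independent of r only together with the sum of the ln |a| over the
  divisor.\<close>

theorem jensen:
  assumes h: "nzmero h"
  obtains c where "\<And>r. r > 0 \<Longrightarrow> r \<notin> bad_radii h \<Longrightarrow>
    cmean (\<lambda>z. ln (cmod (h z))) r = vcount (zord h) r + c"
proof
  fix r :: real
  assume r: "r > 0" "r \<notin> bad_radii h"
  define Z where "Z = {z. cmod z \<le> r \<and> zord h z \<noteq> 0}"
  have fin: "finite Z" using locfin_zord[OF h] by (auto simp: Z_def locfin_def)
  have reg: "regular_at h z" if "cmod z = r" for z using good_radius_regular r that by blast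
  have Zr: "cmod a < r" if "a \<in> Z" for a
    using that reg[of a] zorder_regular_at[of h a] by (force simp: Z_def zord_def less_le)
  obtain u where u: "u analytic_on cball 0 r" "\<And>z. cmod z \<le> r \<Longrightarrow> u z \<noteq> 0"
    "\<And>z. regular_at h z \<Longrightarrow> cmod z \<le> r \<Longrightarrow> h z = u z * (\<Prod>a\<in>Z. (z - a) powi zorder h a)"
    using nzmero_factor_out_divisor[OF h] unfolding Z_def by blast
  have lnh: "ln (cmod (h z)) = ln (cmod (u z)) + (\<Sum>a\<in>Z. zord h a * ln (cmod (z - a)))"
    if "cmod z = r" for z
  proof -
    have nz: "z - a \<noteq> 0" if "a \<in> Z" for a using Zr[OF that] \<open>cmod z = r\<close> by auto
    have "ln (cmod (h z)) = ln (cmod (u z)) + ln (\<Prod>a\<in>Z. cmod ((z - a) powi zorder h a))"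
      using u(2)[of z] u(3)[OF reg, of z] that nz fin
      by (subst u(3)) (auto simp: reg norm_mult prod_norm ln_mult)
    also have "ln (\<Prod>a\<in>Z. cmod ((z - a) powi zorder h a)) = (\<Sum>a\<in>Z. zord h a * ln (cmod (z - a)))"
      using nz fin by (subst ln_prod) (auto simp: ln_cmod_powi zord_def)
    finally show ?thesis .
  qed
  have contu: "continuous_on (sphere 0 r) (\<lambda>z. ln (cmod (u z)))"
    using u(2) r by (intro continuous_intros holomorphic_on_imp_continuous_on analytic_imp_holomorphic
      analytic_on_subset[OF u(1)]) auto
  have conta: "continuous_on (sphere 0 r) (\<lambda>z. zord h a * ln (cmod (z - a)))" if "a \<in> Z" for a
    using Zr[OF that] by (intro continuous_intros) auto
  have "cmean (\<lambda>z. ln (cmod (h z))) r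
      = cmean (\<lambda>z. ln (cmod (u z)) + (\<Sum>a\<in>Z. zord h a * ln (cmod (z - a)))) r"
    using r lnh by (intro cmean_cong) auto
  also have "\<dots> = cmean (\<lambda>z. ln (cmod (u z))) r + (\<Sum>a\<in>Z. cmean (\<lambda>z. zord h a * ln (cmod (z - a))) r)"
    using r fin contu conta by (subst cmean_add) (auto simp: cmean_sum intro!: continuous_on_sum)
  also have "\<dots> = ln (cmod (u 0)) + (\<Sum>a\<in>Z. zord h a * ln r)"
  proof -
    have "cmean (\<lambda>z. ln (cmod (u z))) r = ln (cmod (u 0))"
      by (rule cmean_ln_zero_free) (use r u in auto)
    then show ?thesis using Zr by (simp add: cmean_cmult cmean_ln_linear)
  qed
  also have "(\<Sum>a\<in>Z. zord h a * ln r) = (\<Sum>a\<in>Z. zord h a * wt r a) + (\<Sum>a\<in>Z-{0}. zord h a * ln (cmod a))"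
  proof -
    have "(\<Sum>a\<in>Z. zord h a * ln r) = (\<Sum>a\<in>Z. zord h a * wt r a + (if a = 0 then 0 else zord h a * ln (cmod a)))"
      using r by (intro sum.cong) (auto simp: wt_def ln_div algebra_simps)
    also have "\<dots> = (\<Sum>a\<in>Z. zord h a * wt r a) + (\<Sum>a\<in>Z. if a = 0 then 0 else zord h a * ln (cmod a))"
      by (rule sum.distrib)
    also have "(\<Sum>a\<in>Z. if a = 0 then 0 else zord h a * ln (cmod a)) = (\<Sum>a\<in>Z-{0}. zord h a * ln (cmod a))"
      using fin by (intro sum.mono_neutral_cong_right) auto
    finally show ?thesis .
  qed
  also have "(\<Sum>a\<in>Z. zord h a * wt r a) = vcount (zord h) r" by (simp add: vcount_def Z_def)
  also have "ln (cmod (u 0)) + (vcount (zord h) r + (\<Sum>a\<in>Z-{0}. zord h a * ln (cmod a)))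
      = vcount (zord h) r + ln (cmod (zor_poly h 0 0))"
  proof -
    \<comment> \<open>This is h near 0 with its power of z removed, hence equal to
      \<open>zor_poly h 0\<close> on a punctured neighbourhood and, by continuity, at 0.\<close>
    define q where "q = (\<lambda>z. u z * (\<Prod>a\<in>Z-{0}. (z - a) powi zorder h a))"
    obtain r' where r': "zor_poly h 0 0 \<noteq> 0" "r' > 0" "zor_poly h 0 holomorphic_on cball 0 r'"
        "\<forall>x\<in>cball 0 r' - {0}. h x = zor_poly h 0 x * (x - 0) powi zorder h 0"
      using zorder_exist[OF nzmeroD(4,5,3)[OF h], of 0] by blast
    have ev: "eventually (\<lambda>x. zor_poly h 0 x = q x) (at 0)"
    proof -
      have "eventually (\<lambda>x. x \<in> ball 0 (min r' r) - {0}) (at (0::complex))"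
        using r' r by (intro eventually_at_in_open) auto
      moreover have "eventually (regular_at h) (at 0)"
        using eventually_regular_at[OF h] by (rule eventually_cosparse_UNIV_at)
      ultimately show ?thesis
      proof eventually_elim
        case (elim x)
        have "zor_poly h 0 x * x powi zorder h 0 = u x * (\<Prod>a\<in>Z. (x - a) powi zorder h a)"
          using u(3)[OF elim(2)] r'(4) elim by auto
        also have "(\<Prod>a\<in>Z. (x - a) powi zorder h a) = (\<Prod>a\<in>Z-{0}. (x - a) powi zorder h a) * x powi zorder h 0"
        proof (cases "0 \<in> Z")
          case True
          then show ?thesis using fin by (subst prod.remove[of _ 0]) auto
        next
          case False
          then have "zorder h 0 = 0" using r by (auto simp: Z_def zord_def)
          then show ?thesis using False by simp
        qed
        finally show ?case using elim by (simp add: q_def)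
      qed
    qed
    have "zor_poly h 0 \<midarrow>0\<rightarrow> zor_poly h 0 0"
    proof -
      have "continuous_on (ball 0 r') (zor_poly h 0)"
        using r'(3) by (intro holomorphic_on_imp_continuous_on) (auto intro: holomorphic_on_subset)
      then show ?thesis using r'(2) by (simp add: continuous_on_eq_continuous_at isCont_def)
    qed
    moreover have "q \<midarrow>0\<rightarrow> q 0"
    proof -
      have "q analytic_on {0}" unfolding q_def
        using r by (auto intro!: analytic_intros analytic_on_subset[OF u(1)])
      then show ?thesis using analytic_at_imp_isCont isCont_def by blast
    qed
    ultimately have "zor_poly h 0 0 = q 0"
      unfolding tendsto_cong[OF ev] by (rule LIM_unique)
    moreover have "ln (cmod (q 0)) = ln (cmod (u 0)) + (\<Sum>a\<in>Z-{0}. zord h a * ln (cmod a))"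
    proof -
      have "ln (cmod (q 0)) = ln (cmod (u 0)) + ln (\<Prod>a\<in>Z-{0}. cmod ((0 - a) powi zorder h a))"
        using u(2)[of 0] r fin unfolding q_def by (auto simp: norm_mult prod_norm ln_mult)
      also have "ln (\<Prod>a\<in>Z-{0}. cmod ((0 - a) powi zorder h a)) = (\<Sum>a\<in>Z-{0}. zord h a * ln (cmod a))"
        using fin by (subst ln_prod) (auto simp: ln_cmod_powi zord_def)
      finally show ?thesis .
    qed
    ultimately show ?thesis by simp
  qed
  finally show "cmean (\<lambda>z. ln (cmod (h z))) r = vcount (zord h) r + ln (cmod (zor_poly h 0 0))" .
qed

section \<open>The first main theorem\<close>

text \<open>The antiderivative is 2 sqrt(t - c) to the right of c and -2 sqrt(c - t) to the left.
  Written with \<open>max 0\<close> it is one continuous function, so a single use of the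
  fundamental theorem with exceptional point c covers every position of c.\<close>

lemma has_integral_inverse_sqrt:
  fixes c a b :: real
  assumes "a \<le> b"
  shows "((\<lambda>t. 1 / sqrt \<bar>t - c\<bar>) has_integral
    (2 * sqrt (max 0 (b - c)) - 2 * sqrt (max 0 (c - b))) - (2 * sqrt (max 0 (a - c)) - 2 * sqrt (max 0 (c - a)))) {a..b}"
proof (rule fundamental_theorem_of_calculus_interior_strong[where S = "{c}"])
  show "continuous_on {a..b} (\<lambda>t. 2 * sqrt (max 0 (t - c)) - 2 * sqrt (max 0 (c - t)))"
    by (intro continuous_intros)
  fix t assume t: "t \<in> {a<..<b} - {c}"
  show "((\<lambda>t. 2 * sqrt (max 0 (t - c)) - 2 * sqrt (max 0 (c - t))) has_vector_derivative 1 / sqrt \<bar>t - c\<bar>) (at t)"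
  proof (cases "t > c")
    case True
    have "((\<lambda>t. 2 * sqrt (t - c)) has_real_derivative 1 / sqrt \<bar>t - c\<bar>) (at t)"
      using True by (auto intro!: derivative_eq_intros simp: field_simps)
    then show ?thesis unfolding has_real_derivative_iff_has_vector_derivative[symmetric]
      by (rule has_field_derivative_transform_within_open[where S = "{c<..}"]) (use True in auto)
  next
    case False
    then have tc: "t < c" using t by auto
    have "((\<lambda>t. - 2 * sqrt (c - t)) has_real_derivative 1 / sqrt \<bar>t - c\<bar>) (at t)"
      using tc by (auto intro!: derivative_eq_intros simp: field_simps)
    then show ?thesis unfolding has_real_derivative_iff_has_vector_derivative[symmetric]
      by (rule has_field_derivative_transform_within_open[where S = "{..<c}"]) (use tc in auto)
  qed
qed (use assms in auto)

text \<open>The Taylor remainder |y|^3 / 6 is at most 2|y| / 3, since |y| \<le> pi/2 < 2.\<close>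

lemma abs_sin_ge_third:
  assumes "\<bar>y\<bar> \<le> pi / 2"
  shows "\<bar>sin y\<bar> \<ge> \<bar>y\<bar> / 3"
proof -
  have "\<bar>sin y - (\<Sum>k<3. sin_coeff k * y ^ k)\<bar> \<le> inverse (fact 3) * \<bar>y\<bar> ^ 3"
    by (rule Maclaurin_sin_bound)
  then have 1: "\<bar>sin y - y\<bar> \<le> \<bar>y\<bar> ^ 3 / 6"
    by (simp add: eval_nat_numeral sin_coeff_def fact_numeral divide_simps)
  have "\<bar>y\<bar> \<le> 2" using assms pi_less_4 by linarith
  then have "\<bar>y\<bar> ^ 2 \<le> 2 ^ 2" by (intro power_mono) auto
  then have "\<bar>y\<bar> * \<bar>y\<bar> ^ 2 \<le> \<bar>y\<bar> * 4" by (intro mult_left_mono) auto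
  then have "\<bar>y\<bar> ^ 3 \<le> 4 * \<bar>y\<bar>" by (simp add: power3_eq_cube power2_eq_square mult.assoc mult.commute)
  then show ?thesis using 1 by linarith
qed

text \<open>After rotation by -Arg a the point \<open>a\<close> is a nonnegative real, and the
  imaginary part of the difference is r sin(t - Arg a). With k pi the nearest multiple of pi, the
  sine is compared with its argument; t - Arg a lies between -pi and 3 pi, whence the range of
  k.\<close>

lemma cmod_circle_minus_ge:
  assumes r: "r \<ge> 1" and t: "t \<in> {0..2*pi}"
  obtains k :: int where "k \<in> {-1..3}" "cmod (of_real r * cis t - a) \<ge> \<bar>t - (Arg a + of_int k * pi)\<bar> / 3"
proof -
  define x where "x = t - Arg a"
  have x: "- pi \<le> x" "x \<le> 3 * pi" using t Arg_bounded[of a] by (auto simp: x_def)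
  define k where "k = \<lfloor>x / pi + 1/2\<rfloor>"
  have k1: "of_int k \<le> x / pi + 1/2" "x / pi + 1/2 < of_int k + 1" unfolding k_def by linarith+
  have k2: "\<bar>x - of_int k * pi\<bar> \<le> pi / 2"
  proof -
    have "2 * x < pi + 2 * (of_int k * pi)" "2 * (of_int k * pi) \<le> pi + 2 * x"
      using k1 pi_gt_zero by (auto simp: field_simps)
    then show ?thesis by linarith
  qed
  have "x / pi \<ge> -1" "x / pi \<le> 3" using x pi_gt_zero by (auto simp: field_simps)
  then have k3: "k \<in> {-1..3}" using k1 by auto
  have a: "a = of_real (cmod a) * cis (Arg a)" by (metis rcis_cmod_Arg rcis_def)
  have "r * cis t - a = cis (Arg a) * (r * cis x - cmod a)"
    by (subst (1) a) (simp add: x_def algebra_simps cis_mult)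
  then have "cmod (r * cis t - a) = cmod (r * cis x - cmod a)" by (simp add: norm_mult)
  also have "\<dots> \<ge> \<bar>Im (r * cis x - cmod a)\<bar>" by (rule abs_Im_le_cmod)
  also have "\<bar>Im (r * cis x - cmod a)\<bar> = r * \<bar>sin x\<bar>" using r by (simp add: abs_mult)
  finally have 1: "cmod (r * cis t - a) \<ge> r * \<bar>sin x\<bar>" .
  have "\<bar>sin x\<bar> = \<bar>sin (x - of_int k * pi)\<bar>"
  proof -
    have "sin (of_int k * pi) = 0" using sin_zero_iff_int2 by blast
    moreover from this have "\<bar>cos (of_int k * pi)\<bar> = 1" using sin_zero_abs_cos_one by blast
    ultimately show ?thesis by (simp add: sin_diff abs_mult)
  qed
  then have "\<bar>sin x\<bar> \<ge> \<bar>x - of_int k * pi\<bar> / 3" using abs_sin_ge_third[OF k2] by simp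
  moreover have "r * \<bar>sin x\<bar> \<ge> 1 * \<bar>sin x\<bar>" using r by (intro mult_right_mono) auto
  ultimately have "cmod (r * cis t - a) \<ge> \<bar>t - (Arg a + of_int k * pi)\<bar> / 3"
    using 1 by (simp add: x_def diff_diff_eq)
  then show ?thesis using k3 that by blast
qed

text \<open>A singularity of order 1/2 on or near the circle is integrable with a bound independent
  of both r and \<open>a\<close>; for 1/|z - a| such a bound fails. This is why logarithmic
  derivatives are later estimated through their square roots.\<close>

lemma cmean_inverse_sqrt_bounded:
  obtains K where "K > 0" "\<And>r a. r \<ge> 1 \<Longrightarrow> cmod a \<noteq> r \<Longrightarrow> cmean (\<lambda>z. 1 / sqrt (cmod (z - a))) r \<le> K"
proof -
  define M where "M = 4 * sqrt (6 * pi)"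
  have M: "M > 0" by (simp add: M_def)
  have "cmean (\<lambda>z. 1 / sqrt (cmod (z - a))) r \<le> 2 * 5 * M" if r: "r \<ge> 1" "cmod a \<noteq> r" for r a
  proof -
    define c where "c = (\<lambda>k::int. Arg a + of_int k * pi)"
    define I where "I = (\<lambda>k. (2 * sqrt (max 0 (2*pi - c k)) - 2 * sqrt (max 0 (c k - 2*pi)))
        - (2 * sqrt (max 0 (0 - c k)) - 2 * sqrt (max 0 (c k - 0))))"
    have I: "((\<lambda>t. 1 / sqrt \<bar>t - c k\<bar>) has_integral I k) {0..2*pi}" for k
      unfolding I_def by (rule has_integral_inverse_sqrt) simp
    have IM: "I k \<le> M" if "k \<in> {-1..3}" for k
    proof -
      have "real_of_int k \<le> 3" "real_of_int k \<ge> -1"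
        using that by auto
      then have "of_int k * pi \<le> 3 * pi" "of_int k * pi \<ge> (-1) * pi"
        by (intro mult_right_mono pi_ge_zero; simp)+
      then have c: "c k \<ge> -2 * pi" "c k \<le> 4 * pi"
        using Arg_bounded[of a] unfolding c_def by linarith+
      have 1: "sqrt (max 0 (2*pi - c k)) \<le> sqrt (6 * pi)" "sqrt (max 0 (c k - 0)) \<le> sqrt (6*pi)"
        using c by (auto intro!: real_sqrt_le_mono)
      have 2: "sqrt (max 0 (c k - 2*pi)) \<ge> 0" "sqrt (max 0 (0 - c k)) \<ge> 0" by auto
      show ?thesis unfolding I_def M_def using 1 2 by linarith
    qed
    define u where "u = (\<lambda>t. 1 / sqrt (cmod (of_real r * cis t - a)))"
    have cont: "continuous_on {0..2*pi} u" unfolding u_def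
      using r by (auto intro!: continuous_intros simp: norm_mult)
    then have "(u has_integral (integral {0..2*pi} u)) {0..2*pi}"
      by (intro integrable_integral integrable_continuous_real)
    \<comment> \<open>At t = c k the majorant contains 1 / sqrt 0, which is 0 by convention, so the
      integrand is set to 0 at these five points before the comparison.\<close>
    then have u': "((\<lambda>t. if t \<in> c ` {-1..3} then 0 else u t) has_integral (integral {0..2*pi} u)) {0..2*pi}"
      by (rule has_integral_spike_finite[where S = "c ` {-1..3}", rotated 2]) auto
    have R: "((\<lambda>t. \<Sum>k\<in>{-1..3}. 2 * (1 / sqrt \<bar>t - c k\<bar>)) has_integral (\<Sum>k\<in>{-1..3}. 2 * I k)) {0..2*pi}"
      by (intro has_integral_sum has_integral_mult_right I) auto
    have "integral {0..2*pi} u \<le> (\<Sum>k\<in>{-1..3}. 2 * I k)"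
    proof (rule has_integral_le[OF u' R])
      fix t assume t: "t \<in> {0..2*pi}"
      obtain k where k: "k \<in> {-1..3}" "cmod (of_real r * cis t - a) \<ge> \<bar>t - c k\<bar> / 3"
        using cmod_circle_minus_ge[OF r(1) t] unfolding c_def by blast
      show "(if t \<in> c ` {-1..3} then 0 else u t) \<le> (\<Sum>k\<in>{-1..3}. 2 * (1 / sqrt \<bar>t - c k\<bar>))"
      proof (cases "t \<in> c ` {-1..3}")
        case True
        then show ?thesis by (auto intro!: sum_nonneg)
      next
        case False
        then have pos: "\<bar>t - c k\<bar> > 0" using k by auto
        \<comment> \<open>The constant 3 is weakened to 4 to make the square root rational. Since k
          varies with t, the final majorant sums over all five values of k.\<close>
        have "sqrt (\<bar>t - c k\<bar> / 4) \<le> sqrt (cmod (of_real r * cis t - a))"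
          by (intro real_sqrt_le_mono order.trans[OF _ k(2)]) simp
        then have "sqrt \<bar>t - c k\<bar> / 2 \<le> sqrt (cmod (of_real r * cis t - a))"
          by (simp add: real_sqrt_divide)
        moreover have "sqrt \<bar>t - c k\<bar> / 2 > 0" using pos by simp
        ultimately have "u t \<le> 1 / (sqrt \<bar>t - c k\<bar> / 2)"
          unfolding u_def by (intro divide_left_mono) (auto intro!: mult_pos_pos)
        then have "u t \<le> 2 * (1 / sqrt \<bar>t - c k\<bar>)" by simp
        also have "\<dots> \<le> (\<Sum>k\<in>{-1..3}. 2 * (1 / sqrt \<bar>t - c k\<bar>))"
          by (rule member_le_sum) (use k in auto)
        finally show ?thesis using False by simp
      qed
    qed
    also have "\<dots> \<le> (\<Sum>k\<in>{-1..3::int}. 2 * M)" using IM by (intro sum_mono) auto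
    also have "\<dots> = 2 * 5 * M" by simp
    finally have "integral {0..2*pi} u / (2*pi) \<le> 2 * 5 * M / 1"
      using M pi_gt3 by (intro frac_le) auto
    then show ?thesis by (simp add: cmean_def u_def)
  qed
  with M show ?thesis by (intro that[of "2*5*M"]) auto
qed

section \<open>The positive logarithm and the proximity function\<close>

lemma log_plus_alt: "x \<ge> 0 \<Longrightarrow> log_plus x = ln (max 1 x)"
  by (cases "x = 0") (auto simp: log_plus_def max_def)

lemma log_plus_nonneg [simp]: "log_plus x \<ge> 0"
  by (simp add: log_plus_def)

lemma log_plus_mono: "0 \<le> x \<Longrightarrow> x \<le> y \<Longrightarrow> log_plus x \<le> log_plus y"
  by (subst (1 2) log_plus_alt) auto

lemma ln_le_log_plus: "ln x \<le> log_plus x"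
  by (simp add: log_plus_def)

lemma log_plus_mult: "0 \<le> x \<Longrightarrow> 0 \<le> y \<Longrightarrow> log_plus (x * y) \<le> log_plus x + log_plus y"
proof (cases "x = 0 \<or> y = 0")
  case False
  moreover assume "0 \<le> x" "0 \<le> y"
  ultimately have "ln (x * y) = ln x + ln y" by (simp add: ln_mult)
  then show ?thesis unfolding log_plus_def by linarith
qed (auto simp: log_plus_def)

lemma ln_eq_log_plus_diff: "x > 0 \<Longrightarrow> ln x = log_plus x - log_plus (inverse x)"
  by (auto simp: log_plus_def ln_inverse)

lemma log_plus_le_ln: "x \<ge> 1 \<Longrightarrow> log_plus x = ln x"
  by (simp add: log_plus_def)

lemma continuous_on_log_plus:
  assumes "continuous_on A h"
  shows "continuous_on A (\<lambda>z. log_plus (cmod (h z)))"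
proof -
  have "continuous_on A (\<lambda>z. ln (max 1 (cmod (h z))))"
    using assms by (intro continuous_intros) auto
  then show ?thesis by (simp add: log_plus_alt)
qed

lemma good_radius_continuous:
  assumes "r \<notin> bad_radii h"
  shows "continuous_on (sphere 0 r) h"
proof -
  have "h analytic_on sphere 0 r"
    by (subst analytic_on_analytic_at) (use good_radius_regular[OF assms] in \<open>auto simp: regular_at_def\<close>)
  then show ?thesis
    by (intro holomorphic_on_imp_continuous_on analytic_imp_holomorphic)
qed

lemma prox_eq_cmean: "prox f r = cmean (\<lambda>z. log_plus (cmod (f z))) r"
  by (simp add: prox_def cmean_def)

lemma prox_nonneg:
  assumes "r \<ge> 0" "continuous_on (sphere 0 r) f"
  shows "prox f r \<ge> 0"
  using cmean_mono[of r "\<lambda>_. 0" "\<lambda>z. log_plus (cmod (f z))"] assms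
  by (simp add: prox_eq_cmean continuous_on_log_plus)

lemma prox_mult:
  assumes "r \<ge> 0" "continuous_on (sphere 0 r) f" "continuous_on (sphere 0 r) g"
  shows "prox (\<lambda>z. f z * g z) r \<le> prox f r + prox g r"
proof -
  have "prox (\<lambda>z. f z * g z) r \<le> cmean (\<lambda>z. log_plus (cmod (f z)) + log_plus (cmod (g z))) r"
    unfolding prox_eq_cmean
    using assms
    by (intro cmean_mono continuous_on_add continuous_on_log_plus continuous_on_mult)
      (auto simp: norm_mult log_plus_mult)
  also have "\<dots> = prox f r + prox g r"
    using assms by (subst cmean_add) (auto simp: prox_eq_cmean intro!: continuous_on_log_plus)
  finally show ?thesis .
qed

lemma log_plus_sum_le:
  assumes "finite A" "A \<noteq> {}" "\<And>a. a \<in> A \<Longrightarrow> x a \<ge> 0"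
  shows "log_plus (\<Sum>a\<in>A. x a) \<le> (\<Sum>a\<in>A. log_plus (x a)) + ln (real (card A))"
proof -
  obtain m where m: "m \<in> A" "\<And>a. a \<in> A \<Longrightarrow> x a \<le> x m"
  proof -
    have "Max (x ` A) \<in> x ` A" using assms by (intro Max_in) auto
    then obtain m where "m \<in> A" "x m = Max (x ` A)" by auto
    then show ?thesis using assms by (intro that[of m]) auto
  qed
  have c: "real (card A) \<ge> 1" using assms by (simp add: Suc_leI card_gt_0_iff)
  have "(\<Sum>a\<in>A. x a) \<le> real (card A) * x m"
    using sum_mono[of A x "\<lambda>_. x m"] m by simp
  then have "log_plus (\<Sum>a\<in>A. x a) \<le> log_plus (real (card A) * x m)"
    using assms by (intro log_plus_mono sum_nonneg) auto
  also have "\<dots> \<le> log_plus (real (card A)) + log_plus (x m)"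
    using assms m by (intro log_plus_mult) auto
  also have "log_plus (x m) \<le> (\<Sum>a\<in>A. log_plus (x a))"
    using assms m by (intro member_le_sum) auto
  finally show ?thesis using c by (simp add: log_plus_le_ln)
qed

lemma prox_le_sum:
  assumes "r \<ge> 0" "finite A" "A \<noteq> {}" "C \<ge> 1" "continuous_on (sphere 0 r) f"
    "\<And>a. a \<in> A \<Longrightarrow> continuous_on (sphere 0 r) (g a)"
    "\<And>z. cmod z = r \<Longrightarrow> cmod (f z) \<le> C * (\<Sum>a\<in>A. cmod (g a z))"
  shows "prox f r \<le> (\<Sum>a\<in>A. prox (g a) r) + ln (C * real (card A))"
proof -
  have c: "real (card A) \<ge> 1" using assms by (simp add: Suc_leI card_gt_0_iff)
  have "prox f r \<le> cmean (\<lambda>z. (\<Sum>a\<in>A. log_plus (cmod (g a z))) + ln (C * real (card A))) r"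
    unfolding prox_eq_cmean
  proof (rule cmean_mono)
    fix z assume z: "cmod z = r"
    have "log_plus (cmod (f z)) \<le> log_plus (C * (\<Sum>a\<in>A. cmod (g a z)))"
      using assms(7)[OF z] by (intro log_plus_mono) auto
    also have "\<dots> \<le> log_plus C + log_plus (\<Sum>a\<in>A. cmod (g a z))"
      using assms by (intro log_plus_mult sum_nonneg) auto
    also have "log_plus (\<Sum>a\<in>A. cmod (g a z)) \<le> (\<Sum>a\<in>A. log_plus (cmod (g a z))) + ln (real (card A))"
      using assms by (intro log_plus_sum_le) auto
    finally show "log_plus (cmod (f z)) \<le> (\<Sum>a\<in>A. log_plus (cmod (g a z))) + ln (C * real (card A))"
      using assms c by (simp add: log_plus_le_ln ln_mult)
  qed (use assms in \<open>auto intro!: continuous_intros continuous_on_log_plus\<close>)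
  also have "\<dots> = cmean (\<lambda>z. \<Sum>a\<in>A. log_plus (cmod (g a z))) r + ln (C * real (card A))"
    using assms by (subst cmean_add) (auto intro!: continuous_on_sum continuous_on_log_plus)
  also have "cmean (\<lambda>z. \<Sum>a\<in>A. log_plus (cmod (g a z))) r = (\<Sum>a\<in>A. prox (g a) r)"
    unfolding prox_eq_cmean using assms by (intro cmean_sum continuous_on_log_plus)
  finally show ?thesis .
qed

lemma cmean_ln_eq_prox_diff:
  assumes "r \<ge> 0" "r \<notin> bad_radii h"
  shows "cmean (\<lambda>z. ln (cmod (h z))) r = prox h r - prox (\<lambda>z. inverse (h z)) r"
proof -
  have c: "continuous_on (sphere 0 r) h" by (rule good_radius_continuous[OF assms(2)])
  have nz: "h z \<noteq> 0" if "cmod z = r" for z using good_radius_regular[OF assms(2) that] by (simp add: regular_at_def)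
  have "cmean (\<lambda>z. ln (cmod (h z))) r = cmean (\<lambda>z. log_plus (cmod (h z)) + (-1) * log_plus (cmod (inverse (h z)))) r"
  proof (rule cmean_cong)
    fix z assume "cmod z = r"
    then show "ln (cmod (h z)) = log_plus (cmod (h z)) + (-1) * log_plus (cmod (inverse (h z)))"
      using nz[of z] by (subst ln_eq_log_plus_diff) (auto simp: norm_inverse)
  qed fact
  also have "\<dots> = prox h r + (-1) * prox (\<lambda>z. inverse (h z)) r"
    unfolding prox_eq_cmean cmean_cmult[symmetric]
    using c nz assms by (intro cmean_add continuous_on_log_plus continuous_intros) auto
  finally show ?thesis by simp
qed

section \<open>The characteristic in terms of divisors, and its behaviour under inversion and
  products\<close>

definition zeros_of :: "(complex \<Rightarrow> complex) \<Rightarrow> complex \<Rightarrow> real" where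
  "zeros_of h z = max 0 (zord h z)"

definition poles_of :: "(complex \<Rightarrow> complex) \<Rightarrow> complex \<Rightarrow> real" where
  "poles_of h z = max 0 (- zord h z)"

definition nev :: "(complex \<Rightarrow> complex) \<Rightarrow> real \<Rightarrow> real" where
  "nev h r = prox h r + vcount (poles_of h) r"

lemma zord_eq: "zord h z = zeros_of h z - poles_of h z"
  by (auto simp: zeros_of_def poles_of_def)

lemma zeros_of_nonneg [simp]: "zeros_of h z \<ge> 0" and poles_of_nonneg [simp]: "poles_of h z \<ge> 0"
  by (auto simp: zeros_of_def poles_of_def)

lemma locfin_zeros_of: "nzmero h \<Longrightarrow> locfin (zeros_of h)"
  by (rule locfin_subset[OF locfin_zord]) (auto simp: zeros_of_def)

lemma locfin_poles_of: "nzmero h \<Longrightarrow> locfin (poles_of h)"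
  by (rule locfin_subset[OF locfin_zord]) (auto simp: poles_of_def)

lemma zord_mult: "nzmero f \<Longrightarrow> nzmero g \<Longrightarrow> zord (\<lambda>z. f z * g z) z = zord f z + zord g z"
  unfolding zord_def by (subst zorder_mult) (auto intro: nzmeroD)

lemma zord_divide: "nzmero f \<Longrightarrow> nzmero g \<Longrightarrow> zord (\<lambda>z. f z / g z) z = zord f z - zord g z"
  unfolding zord_def by (subst zorder_divide) (auto intro: nzmeroD)

lemma zord_inverse: "nzmero f \<Longrightarrow> zord (\<lambda>z. inverse (f z)) z = - zord f z"
  using zord_divide[OF nzmero_const[of 1], of f z] by (simp add: zord_def divide_inverse)

lemma zord_power: "nzmero f \<Longrightarrow> zord (\<lambda>z. f z ^ k) z = real k * zord f z"
  unfolding zord_def by (subst zorder_power) (auto intro: nzmeroD)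

lemma zord_prod:
  assumes "finite A" "\<And>a. a \<in> A \<Longrightarrow> nzmero (f a)"
  shows "zord (\<lambda>z. \<Prod>a\<in>A. f a z) z = (\<Sum>a\<in>A. zord (f a) z)"
  using assms
proof (induction A rule: finite_induct)
  case empty
  then show ?case by (simp add: zord_def)
next
  case (insert x F)
  then show ?case by (simp add: zord_mult nzmero_prod)
qed

text \<open>Jensen's formula with ln |h| split into log+ |h| - log+ |1/h|; this is the first main
  theorem for the value 0.\<close>

lemma prox_inverse:
  assumes "nzmero h"
  obtains c where "\<And>r. r > 0 \<Longrightarrow> r \<notin> bad_radii h \<Longrightarrow>
    prox (\<lambda>z. inverse (h z)) r = prox h r - vcount (zeros_of h) r + vcount (poles_of h) r + c"
proof -
  obtain c where c: "\<And>r. r > 0 \<Longrightarrow> r \<notin> bad_radii h \<Longrightarrow>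
    cmean (\<lambda>z. ln (cmod (h z))) r = vcount (zord h) r + c"
    using jensen[OF assms] by blast
  have "vcount (zord h) r = vcount (zeros_of h) r - vcount (poles_of h) r" for r
    using vcount_diff[OF locfin_zeros_of locfin_poles_of, OF assms assms, of r]
    by (simp flip: zord_eq)
  then show ?thesis
    using c cmean_ln_eq_prox_diff[of _ h] by (intro that[of "-c"]) fastforce
qed

lemma nev_inverse:
  assumes "nzmero h"
  obtains c where "\<And>r. r > 0 \<Longrightarrow> r \<notin> bad_radii h \<Longrightarrow> nev (\<lambda>z. inverse (h z)) r = nev h r + c"
proof -
  have "poles_of (\<lambda>z. inverse (h z)) = zeros_of h"
    using assms by (auto simp: poles_of_def zeros_of_def zord_inverse)
  moreover obtain c where c: "\<And>r. r > 0 \<Longrightarrow> r \<notin> bad_radii h \<Longrightarrow>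
    prox (\<lambda>z. inverse (h z)) r = prox h r - vcount (zeros_of h) r + vcount (poles_of h) r + c"
    using prox_inverse[OF assms] by blast
  ultimately show ?thesis by (intro that[of c]) (simp add: nev_def)
qed

lemma zeros_count_le_nev:
  assumes "nzmero h"
  obtains C where "\<And>r. r > 0 \<Longrightarrow> r \<notin> bad_radii h \<Longrightarrow> vcount (zeros_of h) r \<le> nev h r + C"
proof -
  obtain c where c: "\<And>r. r > 0 \<Longrightarrow> r \<notin> bad_radii h \<Longrightarrow>
    prox (\<lambda>z. inverse (h z)) r = prox h r - vcount (zeros_of h) r + vcount (poles_of h) r + c"
    using prox_inverse[OF assms] by blast
  have "vcount (zeros_of h) r \<le> nev h r + c" if "r > 0" "r \<notin> bad_radii h" for r
  proof -
    have "continuous_on (sphere 0 r) (\<lambda>z. inverse (h z))"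
      using good_radius_continuous[OF that(2)] good_radius_regular[OF that(2)]
      by (intro continuous_intros) (auto simp: regular_at_def)
    then have "prox (\<lambda>z. inverse (h z)) r \<ge> 0" using that by (intro prox_nonneg) auto
    then show ?thesis using c[OF that] by (simp add: nev_def)
  qed
  then show ?thesis by (rule that)
qed

lemma prox_le_nev:
  assumes "nzmero h" "r \<ge> 1"
  shows "prox h r \<le> nev h r"
  using vcount_nonneg[of r "poles_of h"] assms by (simp add: nev_def)

lemma nev_nonneg:
  assumes "nzmero h" "r \<ge> 1" "r \<notin> bad_radii h"
  shows "nev h r \<ge> 0"
  using prox_le_nev[OF assms(1,2)] prox_nonneg[OF _ good_radius_continuous[OF assms(3)]] assms by simp

lemma poles_count_le_nev:
  assumes "nzmero h" "r \<ge> 1" "r \<notin> bad_radii h"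
  shows "vcount (poles_of h) r \<le> nev h r"
  using prox_nonneg[OF _ good_radius_continuous[OF assms(3)]] assms by (simp add: nev_def)

lemma nev_mult:
  assumes "nzmero f" "nzmero g" "r \<ge> 1" "r \<notin> bad_radii f" "r \<notin> bad_radii g"
  shows "nev (\<lambda>z. f z * g z) r \<le> nev f r + nev g r"
proof -
  have "vcount (poles_of (\<lambda>z. f z * g z)) r \<le> vcount (\<lambda>z. poles_of f z + poles_of g z) r"
    using assms by (intro vcount_mono locfin_add locfin_poles_of nzmero_mult)
      (auto simp: poles_of_def zord_mult)
  also have "\<dots> = vcount (poles_of f) r + vcount (poles_of g) r"
    using assms by (intro vcount_add locfin_poles_of)
  finally show ?thesis
    using prox_mult[of r f g] good_radius_continuous assms by (simp add: nev_def)
qed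

lemma bad_radii_mult: "bad_radii (\<lambda>z. f z * g z) \<subseteq> bad_radii f \<union> bad_radii g"
  unfolding bad_radii_def regular_at_def by (force intro!: analytic_intros)

lemma bad_radii_inverse: "bad_radii (\<lambda>z. inverse (f z)) \<subseteq> bad_radii f"
  unfolding bad_radii_def regular_at_def by (force intro!: analytic_intros)

lemma bad_radii_divide: "bad_radii (\<lambda>z. f z / g z) \<subseteq> bad_radii f \<union> bad_radii g"
  unfolding bad_radii_def regular_at_def by (force intro!: analytic_intros)

lemma log_plus_inverse_le: "x > 0 \<Longrightarrow> log_plus (inverse x) \<le> 2 * (1 / sqrt x)"
proof -
  assume x: "x > 0"
  have "ln (inverse x) = 2 * ln (1 / sqrt x)"
    using x by (simp add: ln_sqrt ln_div ln_inverse)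
  also have "\<dots> \<le> 2 * (1 / sqrt x)" using ln_bound[of "1 / sqrt x"] x by simp
  finally show ?thesis using x by (simp add: log_plus_def)
qed

text \<open>Required by the growth argument, which must exclude that the characteristic explodes
  within a bounded range of radii. The divisor in the disc of radius R is factored out; the
  logarithms of the linear factors are bounded on circles by 1/sqrt |z - a|, whose means have a
  bound independent of the radius.\<close>

lemma nev_locally_bounded:
  assumes h: "nzmero h" and R: "R \<ge> 1"
  obtains C where "\<And>r. 1 \<le> r \<Longrightarrow> r \<le> R \<Longrightarrow> r \<notin> bad_radii h \<Longrightarrow> nev h r \<le> C"
proof -
  define Z where "Z = {z. cmod z \<le> R \<and> zord h z \<noteq> 0}"
  have fin: "finite Z" using locfin_zord[OF h] by (auto simp: Z_def locfin_def)
  obtain u where u: "u analytic_on cball 0 R" "\<And>z. cmod z \<le> R \<Longrightarrow> u z \<noteq> 0"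
    "\<And>z. regular_at h z \<Longrightarrow> cmod z \<le> R \<Longrightarrow> h z = u z * (\<Prod>a\<in>Z. (z - a) powi zorder h a)"
    using nzmero_factor_out_divisor[OF h] unfolding Z_def by blast
  have "continuous_on (cball 0 R) u"
    by (intro holomorphic_on_imp_continuous_on analytic_imp_holomorphic u)
  then have "compact (u ` cball 0 R)" by (intro compact_continuous_image compact_cball)
  then obtain M where M: "\<And>z. cmod z \<le> R \<Longrightarrow> cmod (u z) \<le> M"
    by (meson bounded_iff compact_imp_bounded imageI mem_cball_0)
  obtain K where K: "K > 0" "\<And>r a. r \<ge> 1 \<Longrightarrow> cmod a \<noteq> r \<Longrightarrow> cmean (\<lambda>z. 1 / sqrt (cmod (z - a))) r \<le> K"
    using cmean_inverse_sqrt_bounded by blast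
  define C where "C = \<bar>M\<bar> + (\<Sum>a\<in>Z. \<bar>zord h a\<bar> * (2 * R)) + (\<Sum>a\<in>Z. \<bar>zord h a\<bar> * 2 * K) + vcount (poles_of h) R"
  have "nev h r \<le> C" if r: "1 \<le> r" "r \<le> R" "r \<notin> bad_radii h" for r
  proof -
    have aZ: "cmod a \<noteq> r" if "a \<in> Z" for a
      using that r(3) good_radius_regular[OF r(3), of a] zorder_regular_at[of h a] by (auto simp: Z_def zord_def)
    have pt: "log_plus (cmod (h z)) \<le> (\<bar>M\<bar> + (\<Sum>a\<in>Z. \<bar>zord h a\<bar> * (2 * R))) + (\<Sum>a\<in>Z. (\<bar>zord h a\<bar> * 2) * (1 / sqrt (cmod (z - a))))"
      if z: "cmod z = r" for z
    proof -
      have reg: "regular_at h z" using good_radius_regular r z by blast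
      have nz: "z - a \<noteq> 0" if "a \<in> Z" for a using aZ[OF that] z by auto
      have hz: "h z \<noteq> 0" using reg by (simp add: regular_at_def)
      have "ln (cmod (h z)) = ln (cmod (u z)) + ln (\<Prod>a\<in>Z. cmod ((z - a) powi zorder h a))"
        using u(2)[of z] z r nz fin reg by (subst u(3)) (auto simp: norm_mult prod_norm ln_mult)
      also have "ln (\<Prod>a\<in>Z. cmod ((z - a) powi zorder h a)) = (\<Sum>a\<in>Z. zord h a * ln (cmod (z - a)))"
        using nz fin by (subst ln_prod) (auto simp: ln_cmod_powi zord_def)
      also have "\<dots> \<le> (\<Sum>a\<in>Z. \<bar>zord h a\<bar> * (2 * R) + (\<bar>zord h a\<bar> * 2) * (1 / sqrt (cmod (z - a))))"
      proof (rule sum_mono)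
        fix a assume a: "a \<in> Z"
        define x where "x = cmod (z - a)"
        have x: "x > 0" using nz[OF a] by (simp add: x_def)
        have "x \<le> 2 * R" using norm_triangle_ineq4[of z a] a z r by (auto simp: x_def Z_def)
        then have "log_plus x \<le> 2 * R" using x ln_bound[of x] R by (auto simp: log_plus_def)
        then have "\<bar>ln x\<bar> \<le> 2 * R + 2 * (1 / sqrt x)"
          using log_plus_inverse_le[OF x] ln_eq_log_plus_diff[OF x] log_plus_nonneg[of x] log_plus_nonneg[of "inverse x"]
          unfolding abs_le_iff by linarith
        then have "\<bar>zord h a\<bar> * \<bar>ln x\<bar> \<le> \<bar>zord h a\<bar> * (2 * R + 2 * (1 / sqrt x))" by (intro mult_left_mono) auto
        moreover have "zord h a * ln x \<le> \<bar>zord h a\<bar> * \<bar>ln x\<bar>" by (metis abs_ge_self abs_mult)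
        ultimately show "zord h a * ln (cmod (z - a)) \<le> \<bar>zord h a\<bar> * (2 * R) + (\<bar>zord h a\<bar> * 2) * (1 / sqrt (cmod (z - a)))"
          unfolding x_def by (simp add: algebra_simps)
      qed
      also have "\<dots> = (\<Sum>a\<in>Z. \<bar>zord h a\<bar> * (2 * R)) + (\<Sum>a\<in>Z. (\<bar>zord h a\<bar> * 2) * (1 / sqrt (cmod (z - a))))"
        by (rule sum.distrib)
      finally have "ln (cmod (h z)) \<le> ln (cmod (u z)) + (\<Sum>a\<in>Z. \<bar>zord h a\<bar> * (2 * R)) + (\<Sum>a\<in>Z. (\<bar>zord h a\<bar> * 2) * (1 / sqrt (cmod (z - a))))"
        by linarith
      moreover have "ln (cmod (u z)) \<le> \<bar>M\<bar>"
        using ln_bound[of "cmod (u z)"] u(2)[of z] M[of z] z r by auto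
      moreover have "(\<Sum>a\<in>Z. \<bar>zord h a\<bar> * (2 * R)) \<ge> 0" using R by (intro sum_nonneg) auto
      moreover have "(\<Sum>a\<in>Z. (\<bar>zord h a\<bar> * 2) * (1 / sqrt (cmod (z - a)))) \<ge> 0" by (intro sum_nonneg) auto
      ultimately show ?thesis unfolding log_plus_def by linarith
    qed
    have conts: "continuous_on (sphere 0 r) (\<lambda>z. 1 / sqrt (cmod (z - a)))" if "a \<in> Z" for a
      using aZ[OF that] by (intro continuous_intros) auto
    have "prox h r \<le> cmean (\<lambda>z. (\<bar>M\<bar> + (\<Sum>a\<in>Z. \<bar>zord h a\<bar> * (2 * R))) + (\<Sum>a\<in>Z. (\<bar>zord h a\<bar> * 2) * (1 / sqrt (cmod (z - a))))) r"
      unfolding prox_eq_cmean using r conts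
      by (intro cmean_mono pt continuous_on_add continuous_on_const continuous_on_sum continuous_on_mult_left continuous_on_log_plus good_radius_continuous) auto
    also have "\<dots> = (\<bar>M\<bar> + (\<Sum>a\<in>Z. \<bar>zord h a\<bar> * (2 * R))) + (\<Sum>a\<in>Z. (\<bar>zord h a\<bar> * 2) * cmean (\<lambda>z. 1 / sqrt (cmod (z - a))) r)"
    proof -
      have "cmean (\<lambda>z. \<Sum>a\<in>Z. (\<bar>zord h a\<bar> * 2) * (1 / sqrt (cmod (z - a)))) r
          = (\<Sum>a\<in>Z. cmean (\<lambda>z. (\<bar>zord h a\<bar> * 2) * (1 / sqrt (cmod (z - a)))) r)"
        using r by (intro cmean_sum fin continuous_on_mult_left conts) auto
      moreover have "continuous_on (sphere 0 r) (\<lambda>z. \<Sum>a\<in>Z. (\<bar>zord h a\<bar> * 2) * (1 / sqrt (cmod (z - a))))"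
        by (intro continuous_on_sum continuous_on_mult_left conts)
      ultimately show ?thesis
        using r by (subst cmean_add) (auto simp only: cmean_cmult cmean_const continuous_on_const)
    qed
    also have "\<dots> \<le> (\<bar>M\<bar> + (\<Sum>a\<in>Z. \<bar>zord h a\<bar> * (2 * R))) + (\<Sum>a\<in>Z. (\<bar>zord h a\<bar> * 2) * K)"
      using K(2) r aZ by (intro add_left_mono sum_mono mult_left_mono) auto
    finally have "prox h r \<le> (\<bar>M\<bar> + (\<Sum>a\<in>Z. \<bar>zord h a\<bar> * (2 * R))) + (\<Sum>a\<in>Z. (\<bar>zord h a\<bar> * 2) * K)" .
    moreover have "vcount (poles_of h) r \<le> vcount (poles_of h) R"
      using r by (intro vcount_mono_radius locfin_poles_of h) auto
    ultimately show ?thesis by (simp add: nev_def C_def)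
  qed
  then show ?thesis by (rule that)
qed

section \<open>Pointwise estimate of the logarithmic derivative\<close>

text \<open>The conjugate of $L$ contributes nothing to the Cauchy integral below, since on the circle it
  is a holomorphic function of $1/\zeta$; this turns Cauchy's formula for $L'$ into one involving
  only the real part of $L$.\<close>

lemma deriv_bound_by_mean_Re:
  fixes L :: "complex \<Rightarrow> complex"
  assumes L: "L holomorphic_on ball 0 S" and R: "0 < R" "R < S" and z: "cmod z < R"
  shows "cmod (deriv L z) \<le> 2 * R / (R - cmod z)\<^sup>2 * cmean (\<lambda>w. \<bar>Re (L w)\<bar>) R"
proof -
  have cont: "continuous_on (cball 0 R) L" and hol: "L holomorphic_on ball 0 R"
    using L R by (auto intro: holomorphic_on_imp_continuous_on holomorphic_on_subset continuous_on_subset)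
  define k where "k = (\<lambda>t. of_real R * cis t / (of_real R * cis t - z)\<^sup>2)"
  have nz: "of_real R * cis t - z \<noteq> 0" for t
  proof
    assume "of_real R * cis t - z = 0"
    then have "cmod (of_real R * cis t) = cmod z" by simp
    then show False using z R by (simp add: norm_mult)
  qed
  have "((\<lambda>u. L u / (u - z) ^ Suc 1) has_contour_integral (2 * pi * \<i>) / fact 1 * (deriv ^^ 1) L z) (circlepath 0 R)"
    by (rule Cauchy_has_contour_integral_higher_derivative_circlepath) (use cont hol z in auto)
  then have "((\<lambda>u. L u / (u - z)\<^sup>2) has_contour_integral (2 * pi * \<i>) * deriv L z) (part_circlepath 0 R 0 (2*pi))"
    by (simp add: circlepath_def power2_eq_square)
  then have "((\<lambda>t. L (0 + R * cis t) / (0 + R * cis t - z)\<^sup>2 * R * \<i> * cis t) has_integral (2 * pi * \<i>) * deriv L z) {0..2*pi}"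
    by (subst (asm) has_contour_integral_part_circlepath_iff) auto
  then have "((\<lambda>t. (L (0 + R * cis t) / (0 + R * cis t - z)\<^sup>2 * R * \<i> * cis t) * (-\<i>)) has_integral ((2 * pi * \<i>) * deriv L z) * (-\<i>)) {0..2*pi}"
    by (rule has_integral_mult_left)
  then have 1: "((\<lambda>t. L (R * cis t) * k t) has_integral 2 * pi * deriv L z) {0..2*pi}"
    by (simp add: k_def field_simps)
  define F where "F = (\<lambda>w. L w * (of_real (R\<^sup>2) * w / (of_real (R\<^sup>2) - cnj z * w)\<^sup>2))"
  have nz2: "of_real (R\<^sup>2) - cnj z * w \<noteq> 0" if "cmod w \<le> R" for w
  proof
    assume "of_real (R\<^sup>2) - cnj z * w = 0"
    then have "of_real (R\<^sup>2) = cnj z * w" by simp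
    then have "cmod (of_real (R\<^sup>2)) = cmod z * cmod w" by (simp only: norm_mult complex_mod_cnj)
    then have "R\<^sup>2 = cmod z * cmod w" by (simp del: of_real_power)
    also have "\<dots> \<le> cmod z * R" using that by (intro mult_left_mono) auto
    also have "\<dots> < R * R" using z R by (intro mult_strict_right_mono) auto
    finally show False by (simp add: power2_eq_square)
  qed
  have "((\<lambda>t. F (of_real R * cis t)) has_integral 2 * pi * F 0) {0..2*pi}"
  proof (rule circle_mean_value_complex)
    show "continuous_on (cball 0 R) F" unfolding F_def
      using nz2 by (intro continuous_intros cont) auto
    show "F holomorphic_on ball 0 R" unfolding F_def
      using nz2 by (intro holomorphic_intros hol) auto
  qed fact
  then have F0: "((\<lambda>t. F (of_real R * cis t)) has_integral 0) {0..2*pi}" by (simp add: F_def)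
  have cF: "cnj (F (of_real R * cis t)) = cnj (L (R * cis t)) * k t" for t
  proof -
    have c1: "cnj (cis t) * cis t = 1" by (simp add: cis_cnj cis_mult)
    have e: "of_real (R\<^sup>2) - z * cnj (R * cis t) = (R * cis t - z) * (R * cnj (cis t))"
      using c1 by (simp add: algebra_simps power2_eq_square)
    have "cnj (F (of_real R * cis t)) = cnj (L (R * cis t)) * (of_real (R\<^sup>2) * (R * cnj (cis t)) / ((R * cis t - z) * (R * cnj (cis t)))\<^sup>2)"
      unfolding F_def by (simp add: e[simplified] del: cis_cnj)
    also have "of_real (R\<^sup>2) * (R * cnj (cis t)) / ((R * cis t - z) * (R * cnj (cis t)))\<^sup>2 = k t"
    proof -
      have x: "cnj (cis t) = inverse (cis t)" by (simp add: cis_cnj)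
      have aux: "\<And>Y c R :: complex. Y \<noteq> 0 \<Longrightarrow> c \<noteq> 0 \<Longrightarrow> R \<noteq> 0 \<Longrightarrow>
          R\<^sup>2 * (R * inverse c) / (Y * (R * inverse c))\<^sup>2 = R * c / Y\<^sup>2"
        by (simp add: field_simps power2_eq_square)
      show ?thesis unfolding k_def x of_real_power by (rule aux) (use nz[of t] R in auto)
    qed
    finally show ?thesis .
  qed
  have "((\<lambda>t. cnj (F (of_real R * cis t))) has_integral cnj 0) {0..2*pi}"
    using has_integral_linear[OF F0 bounded_linear_cnj] by (simp add: o_def)
  then have 2: "((\<lambda>t. cnj (L (R * cis t)) * k t) has_integral 0) {0..2*pi}"
    by (simp add: cF)
  have "((\<lambda>t. L (R * cis t) * k t + cnj (L (R * cis t)) * k t) has_integral (2 * pi * deriv L z + 0)) {0..2*pi}"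
    by (rule has_integral_add[OF 1 2])
  then have 3: "((\<lambda>t. of_real (2 * Re (L (R * cis t))) * k t) has_integral (2 * pi * deriv L z)) {0..2*pi}"
    by (simp add: complex_add_cnj flip: distrib_right)
  have kb: "cmod (k t) \<le> R / (R - cmod z)\<^sup>2" for t
  proof -
    have "cmod (R * cis t - z) \<ge> R - cmod z"
      using norm_triangle_ineq2[of "R * cis t" z] R by (simp add: norm_mult)
    then have "(R - cmod z)\<^sup>2 \<le> (cmod (R * cis t - z))\<^sup>2" using z by (intro power_mono) auto
    then show ?thesis unfolding k_def using R z nz[of t]
      by (auto simp: norm_divide norm_mult norm_power intro!: divide_left_mono)
  qed
  have sub: "continuous_on (sphere 0 R) L" using cont by (rule continuous_on_subset) auto
  have "cmod (2 * pi * deriv L z) = cmod (integral {0..2*pi} (\<lambda>t. of_real (2 * Re (L (R * cis t))) * k t))"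
    using integral_unique[OF 3] by simp
  also have "\<dots> \<le> integral {0..2*pi} (\<lambda>t. 2 * R / (R - cmod z)\<^sup>2 * \<bar>Re (L (R * cis t))\<bar>)"
  proof (rule integral_norm_bound_integral)
    show "(\<lambda>t. of_real (2 * Re (L (R * cis t))) * k t) integrable_on {0..2*pi}" using 3 by blast
    show "(\<lambda>t. 2 * R / (R - cmod z)\<^sup>2 * \<bar>Re (L (R * cis t))\<bar>) integrable_on {0..2*pi}"
      using R by (intro integrable_continuous_real continuous_intros sphere_circle[OF sub]) auto
    fix t
    have "cmod (of_real (2 * Re (L (R * cis t))) * k t) = 2 * \<bar>Re (L (R * cis t))\<bar> * cmod (k t)"
      by (simp add: norm_mult)
    also have "\<dots> \<le> 2 * \<bar>Re (L (R * cis t))\<bar> * (R / (R - cmod z)\<^sup>2)"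
      using kb by (intro mult_left_mono) auto
    finally show "cmod (of_real (2 * Re (L (R * cis t))) * k t) \<le> 2 * R / (R - cmod z)\<^sup>2 * \<bar>Re (L (R * cis t))\<bar>"
      by (simp add: mult_ac)
  qed
  also have "\<dots> = 2 * R / (R - cmod z)\<^sup>2 * integral {0..2*pi} (\<lambda>t. \<bar>Re (L (R * cis t))\<bar>)"
    by simp
  finally have "2 * pi * cmod (deriv L z) \<le> 2 * R / (R - cmod z)\<^sup>2 * integral {0..2*pi} (\<lambda>t. \<bar>Re (L (R * cis t))\<bar>)"
    by (simp add: norm_mult)
  from divide_right_mono[OF this, of "2 * pi"] show ?thesis unfolding cmean_def by simp
qed

text \<open>Replacing each linear factor by a Blaschke factor leaves a zero-free function v with |v|
  = |h| on the circle of radius R. Its logarithm L has real part ln |h| there, which bounds L'; the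
  Blaschke factors contribute the sum over zeros and poles.\<close>

lemma log_deriv_pointwise:
  assumes h: "nzmero h" and R: "R > 0" "R \<notin> bad_radii h"
    and z: "cmod z < R" "regular_at h z"
  defines "Z \<equiv> {z. cmod z \<le> R \<and> zord h z \<noteq> 0}"
  shows "cmod (deriv h z / h z) \<le> 2 * R / (R - cmod z)\<^sup>2 * cmean (\<lambda>w. \<bar>ln (cmod (h w))\<bar>) R
     + (\<Sum>a\<in>Z. \<bar>zord h a\<bar> * (2 / cmod (z - a)))"
proof -
  have fin: "finite Z" using locfin_zord[OF h] by (auto simp: Z_def locfin_def)
  have Zr: "cmod a < R" if "a \<in> Z" for a
    using that good_radius_regular[OF R(2), of a] zorder_regular_at[of h a] by (force simp: Z_def zord_def less_le)
  obtain u where u: "u analytic_on cball 0 R" "\<And>z. cmod z \<le> R \<Longrightarrow> u z \<noteq> 0"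
    "\<And>z. regular_at h z \<Longrightarrow> cmod z \<le> R \<Longrightarrow> h z = u z * (\<Prod>a\<in>Z. (z - a) powi zorder h a)"
    using nzmero_factor_out_divisor[OF h] unfolding Z_def by blast
  \<comment> \<open>The factor is normalised so that |q a w| = |w - a| for |w| = R; then (w - a) / q
    a w has modulus one on the circle.\<close>
  define q where "q = (\<lambda>a w. (of_real (R\<^sup>2) - cnj a * w) / of_real R)"
  have qnz: "of_real (R\<^sup>2) - cnj a * w \<noteq> 0" if "cmod a < R" "cmod w \<le> R" for a w
  proof
    assume "of_real (R\<^sup>2) - cnj a * w = 0"
    then have "of_real (R\<^sup>2) = cnj a * w" by simp
    then have "cmod (of_real (R\<^sup>2)) = cmod a * cmod w" by (simp only: norm_mult complex_mod_cnj)
    then have "R\<^sup>2 = cmod a * cmod w" by (simp del: of_real_power)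
    also have "\<dots> \<le> cmod a * R" using that by (intro mult_left_mono) auto
    also have "\<dots> < R * R" using that R by (intro mult_strict_right_mono) auto
    finally show False by (simp add: power2_eq_square)
  qed
  define v where "v = (\<lambda>w. u w * (\<Prod>a\<in>Z. q a w powi zorder h a))"
  have qnz': "q a w \<noteq> 0" if "a \<in> Z" "cmod w \<le> R" for a w
    using qnz[OF Zr[OF that(1)] that(2)] R by (simp add: q_def)
  have v_an: "v analytic_on cball 0 R" unfolding v_def
    using qnz' R by (intro analytic_intros u(1)) (auto simp: q_def intro!: analytic_intros)
  have v_nz: "v w \<noteq> 0" if "w \<in> cball 0 R" for w
    unfolding v_def using that qnz' u(2) fin by auto
  obtain S L where L: "S > R" "L holomorphic_on ball 0 S" "\<And>w. w \<in> ball 0 S \<Longrightarrow> v w = exp (L w)"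
    using zero_free_imp_exp[OF v_an v_nz] by blast
  define b where "b = (\<lambda>a w. (w - a) / q a w)"
  have hv: "h w = v w * (\<Prod>a\<in>Z. b a w powi zorder h a)" if "regular_at h w" "cmod w \<le> R" for w
  proof -
    have "(\<Prod>a\<in>Z. (w - a) powi zorder h a) = (\<Prod>a\<in>Z. q a w powi zorder h a * b a w powi zorder h a)"
      using qnz'[OF _ that(2)] by (intro prod.cong) (auto simp: b_def power_int_divide_distrib)
    then show ?thesis using u(3)[OF that] by (simp add: v_def prod.distrib mult.assoc)
  qed
  have b1: "cmod (b a w) = 1" if "a \<in> Z" "cmod w = R" for a w
  proof -
    have "w * cnj w = of_real (R\<^sup>2)" using that by (metis complex_norm_square)
    then have "of_real (R\<^sup>2) - cnj a * w = w * cnj (w - a)" by (simp add: algebra_simps)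
    then have "cmod (of_real (R\<^sup>2) - cnj a * w) = R * cmod (w - a)"
      using that by (simp add: norm_mult del: complex_cnj_diff)
    moreover have "w \<noteq> a" using Zr that by auto
    ultimately show ?thesis using R by (simp add: b_def q_def norm_divide norm_mult)
  qed
  have Re_L: "\<bar>Re (L w)\<bar> = \<bar>ln (cmod (h w))\<bar>" if "cmod w = R" for w
  proof -
    have "cmod (h w) = cmod (v w) * (\<Prod>a\<in>Z. cmod (b a w powi zorder h a))"
      using hv[of w] good_radius_regular[OF R(2) that] that by (simp add: norm_mult prod_norm)
    also have "(\<Prod>a\<in>Z. cmod (b a w powi zorder h a)) = 1"
      using b1[OF _ that] by (intro prod.neutral) (auto simp: norm_power_int)
    finally show ?thesis using L(1) L(3)[of w] that by simp
  qed
  have zS: "z \<in> ball 0 S" using z L(1) by simp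
  have znZ: "z \<noteq> a" if "a \<in> Z" for a using that zorder_regular_at[OF z(2)] by (auto simp: Z_def zord_def)
  define B where "B = (\<lambda>w. \<Prod>a\<in>Z. b a w powi zorder h a)"
  have q_der: "(q a has_field_derivative - cnj a / of_real R) (at z)" for a
    unfolding q_def using R by (auto intro!: derivative_eq_intros)
  have b_der: "(b a has_field_derivative (1 * q a z - (z - a) * (- cnj a / of_real R)) / (q a z * q a z)) (at z)" if "a \<in> Z" for a
    unfolding b_def using qnz'[OF that] z
    by (intro DERIV_divide q_der) (auto intro!: derivative_eq_intros)
  \<comment> \<open>The numerator of the logarithmic derivative collapses to (R^2 - |a|^2) / R.
    Since |q a z| \<ge> R - |a| inside the disc, it is at most 2 |q a z|.\<close>
  have b_log: "cmod (deriv (b a) z / b a z) \<le> 2 / cmod (z - a)" if a: "a \<in> Z" for a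
  proof -
    have qa: "q a z \<noteq> 0" using qnz'[OF a] z by simp
    have "deriv (b a) z / b a z = (q a z + (z - a) * (cnj a / of_real R)) / (q a z * (z - a))"
    proof -
      have aux: "\<And>N q y :: complex. q \<noteq> 0 \<Longrightarrow> y \<noteq> 0 \<Longrightarrow> (N / (q * q)) / (y / q) = N / (q * y)"
        by (simp add: field_simps)
      have "1 * q a z - (z - a) * (- cnj a / of_real R) = q a z + (z - a) * (cnj a / of_real R)" by simp
      then show ?thesis
        using DERIV_imp_deriv[OF b_der[OF a]] aux[OF qa, of "z - a"] znZ[OF a] by (simp add: b_def)
    qed
    also have "q a z + (z - a) * (cnj a / of_real R) = of_real ((R\<^sup>2 - (cmod a)\<^sup>2) / R)"
    proof -
      have "a * cnj a = of_real ((cmod a)\<^sup>2)" using complex_norm_square by (metis of_real_power)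
      then show ?thesis using R by (simp add: q_def field_simps)
    qed
    finally have "cmod (deriv (b a) z / b a z) = (R\<^sup>2 - (cmod a)\<^sup>2) / R / (cmod (q a z) * cmod (z - a))"
      using R Zr[OF a] by (simp add: norm_divide norm_mult abs_of_nonneg power_mono del: of_real_divide of_real_diff of_real_power)
    moreover have "(R\<^sup>2 - (cmod a)\<^sup>2) / R \<le> 2 * cmod (q a z)"
    proof -
      have "cmod (cnj a * z) \<le> cmod a * R" using z by (auto simp: norm_mult intro!: mult_left_mono)
      then have "cmod (of_real (R\<^sup>2) - cnj a * z) \<ge> R\<^sup>2 - cmod a * R"
        using norm_triangle_ineq2[of "of_real (R\<^sup>2)" "cnj a * z"] by (simp del: of_real_power)
      then have "2 * (R * cmod (q a z)) \<ge> 2 * (R * (R - cmod a))"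
        using R by (simp add: q_def norm_divide algebra_simps power2_eq_square)
      moreover have "(R - cmod a) * (R + cmod a) \<le> (R - cmod a) * (2 * R)" using Zr[OF a] by (intro mult_left_mono) auto
      ultimately have "R\<^sup>2 - (cmod a)\<^sup>2 \<le> 2 * cmod (q a z) * R" by (simp add: algebra_simps power2_eq_square)
      then show ?thesis using R by (simp add: pos_divide_le_eq)
    qed
    moreover have "cmod (q a z) > 0" "cmod (z - a) > 0" using qa znZ[OF a] by auto
    ultimately have "cmod (deriv (b a) z / b a z) \<le> 2 * cmod (q a z) / (cmod (q a z) * cmod (z - a))"
      by (simp only:) (intro divide_right_mono; simp)
    then show ?thesis using qa by simp
  qed
  have bnz: "b a z \<noteq> 0" if "a \<in> Z" for a using that znZ qnz' z by (auto simp: b_def)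
  define D where "D = (\<Sum>a\<in>Z. of_int (zorder h a) * (deriv (b a) z / b a z))"
  have B_der: "(B has_field_derivative B z * D) (at z)"
  proof -
    have "((\<lambda>w. \<Prod>a\<in>F. b a w powi zorder h a) has_field_derivative
        (\<Prod>a\<in>F. b a z powi zorder h a) * (\<Sum>a\<in>F. of_int (zorder h a) * (deriv (b a) z / b a z))) (at z)"
      if "finite F" "F \<subseteq> Z" for F
      using that
    proof (induction F rule: finite_induct)
      case (insert a F)
      have "b a z \<noteq> 0" using insert bnz by auto
      then have "((\<lambda>w. b a w powi zorder h a) has_field_derivative
          of_int (zorder h a) * b a z powi (zorder h a - 1) * deriv (b a) z) (at z)"
        using insert b_der[of a] DERIV_imp_deriv[OF b_der[of a]] by (intro DERIV_power_int) auto
      also have "of_int (zorder h a) * b a z powi (zorder h a - 1) * deriv (b a) z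
        = b a z powi zorder h a * (of_int (zorder h a) * (deriv (b a) z / b a z))"
        using \<open>b a z \<noteq> 0\<close> by (simp add: power_int_diff)
      finally have d: "((\<lambda>w. b a w powi zorder h a) has_field_derivative
          b a z powi zorder h a * (of_int (zorder h a) * (deriv (b a) z / b a z))) (at z)" .
      have IH: "((\<lambda>w. \<Prod>a\<in>F. b a w powi zorder h a) has_field_derivative
        (\<Prod>a\<in>F. b a z powi zorder h a) * (\<Sum>a\<in>F. of_int (zorder h a) * (deriv (b a) z / b a z))) (at z)"
        using insert by auto
      show ?case using DERIV_mult[OF d IH] insert by (simp add: algebra_simps)
    qed auto
    from this[OF fin] show ?thesis by (simp add: B_def D_def)
  qed
  have L_der: "(L has_field_derivative deriv L z) (at z)"
    using L(2) zS by (intro holomorphic_derivI) auto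
  have v_der: "(v has_field_derivative v z * deriv L z) (at z)"
  proof (rule has_field_derivative_transform_within_open[where S = "ball 0 S"])
    show "((\<lambda>w. exp (L w)) has_field_derivative v z * deriv L z) (at z)"
      using L(3)[OF zS] by (auto intro!: derivative_eq_intros L_der)
  qed (use zS L(3) in auto)
  have vB: "((\<lambda>w. v w * B w) has_field_derivative v z * B z * (deriv L z + D)) (at z)"
    using DERIV_mult[OF v_der B_der] by (simp add: algebra_simps)
  have "eventually (regular_at h) (nhds z)"
    using eventually_cosparse_UNIV_at[OF eventually_regular_at[OF h], of z] z(2)
    by (simp add: eventually_at_filter eventually_nhds_x_imp_x) (auto elim: eventually_mono)
  moreover have "eventually (\<lambda>w. w \<in> ball 0 R) (nhds z)"
    using z by (intro eventually_nhds_in_open) auto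
  ultimately have "eventually (\<lambda>w. h w = v w * B w) (nhds z)"
    by eventually_elim (use hv in \<open>auto simp: B_def\<close>)
  then have "deriv h z = v z * B z * (deriv L z + D)"
    using DERIV_imp_deriv[OF vB] by (metis deriv_cong_ev)
  moreover have "h z = v z * B z" using hv[OF z(2)] z(1) by (simp add: B_def)
  moreover have "h z \<noteq> 0" using z by (simp add: regular_at_def)
  ultimately have "deriv h z / h z = deriv L z + D" by simp
  then have "cmod (deriv h z / h z) \<le> cmod (deriv L z) + cmod D" by (simp add: norm_triangle_ineq)
  moreover have "cmod D \<le> (\<Sum>a\<in>Z. \<bar>zord h a\<bar> * (2 / cmod (z - a)))"
    unfolding D_def
  proof (rule sum_norm_le)
    fix a assume "a \<in> Z"
    then show "cmod (of_int (zorder h a) * (deriv (b a) z / b a z)) \<le> \<bar>zord h a\<bar> * (2 / cmod (z - a))"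
      using b_log[of a] unfolding norm_mult zord_def by (intro mult_mono) auto
  qed
  moreover have "cmod (deriv L z) \<le> 2 * R / (R - cmod z)\<^sup>2 * cmean (\<lambda>w. \<bar>ln (cmod (h w))\<bar>) R"
  proof -
    have "cmean (\<lambda>w. \<bar>Re (L w)\<bar>) R = cmean (\<lambda>w. \<bar>ln (cmod (h w))\<bar>) R"
      using R Re_L by (intro cmean_cong) auto
    then show ?thesis using deriv_bound_by_mean_Re[OF L(2) R(1) L(1) z(1)] by simp
  qed
  ultimately show ?thesis by linarith
qed

section \<open>The lemma on the logarithmic derivative\<close>

lemma countable_avoid:
  assumes "countable B" "a < (b::real)"
  obtains x where "a < x" "x < b" "x \<notin> B"
proof -
  have "\<not> {a<..<b} \<subseteq> B"
    using assms uncountable_open_interval countable_subset by blast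
  then obtain x where "x \<in> {a<..<b}" "x \<notin> B" by blast
  then show ?thesis by (intro that[of x]) auto
qed

lemma sqrt_add_le: "0 \<le> x \<Longrightarrow> 0 \<le> y \<Longrightarrow> sqrt (x + y) \<le> sqrt x + sqrt y"
  by (intro real_le_lsqrt) (auto simp: power2_sum)

lemma sqrt_sum_le:
  assumes "finite A" "\<And>a. a \<in> A \<Longrightarrow> x a \<ge> 0"
  shows "sqrt (\<Sum>a\<in>A. x a) \<le> (\<Sum>a\<in>A. sqrt (x a))"
  using assms
proof (induction A rule: finite_induct)
  case (insert a A)
  have "sqrt (x a + (\<Sum>a\<in>A. x a)) \<le> sqrt (x a) + sqrt (\<Sum>a\<in>A. x a)"
    using insert by (intro sqrt_add_le sum_nonneg) auto
  then show ?case using insert by auto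
qed simp

text \<open>log+ x \<le> 2 ln(1 + sqrt x), and the concave function ln(1 + y) lies below its tangent
  at Y. With Y at least the mean of sqrt x, integration yields at most 2 ln(1 + Y): Jensen's
  inequality in a form that uses only monotonicity of the integral.\<close>

lemma log_plus_le_tangent:
  assumes "x \<ge> 0" "Y \<ge> 0"
  shows "log_plus x \<le> 2 * ln (1 + Y) + 2 / (1 + Y) * (sqrt x - Y)"
proof -
  have p: "1 + sqrt x > 0" using assms by (simp add: add_pos_nonneg)
  have "ln ((1 + sqrt x) / (1 + Y)) \<le> (1 + sqrt x) / (1 + Y) - 1"
    using assms p by (intro ln_le_minus_one divide_pos_pos) auto
  then have 1: "ln (1 + sqrt x) \<le> ln (1 + Y) + (1 + sqrt x) / (1 + Y) - 1"
    using assms p by (simp add: ln_div)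
  have lp: "log_plus x = ln (max 1 x)" using assms by (rule_tac log_plus_alt)
  have "max 1 x \<le> (1 + sqrt x)\<^sup>2" using assms by (auto simp: power2_sum)
  then have "log_plus x \<le> ln ((1 + sqrt x)\<^sup>2)" unfolding lp using p by (subst ln_le_cancel_iff) auto
  also have "\<dots> = 2 * ln (1 + sqrt x)" using p by (simp add: ln_realpow)
  also have "\<dots> \<le> 2 * (ln (1 + Y) + (1 + sqrt x) / (1 + Y) - 1)" using 1 by (intro mult_left_mono) auto
  finally have "log_plus x \<le> 2 * (ln (1 + Y) + (1 + sqrt x) / (1 + Y) - 1)" .
  also have "(1 + sqrt x) / (1 + Y) = 1 + (sqrt x - Y) * inverse (1 + Y)" using assms by (simp add: field_simps)
  also have "2 * (ln (1 + Y) + (1 + (sqrt x - Y) * inverse (1 + Y)) - 1) = 2 * ln (1 + Y) + 2 / (1 + Y) * (sqrt x - Y)"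
    by (simp add: divide_inverse)
  finally show ?thesis .
qed

text \<open>A point of the disc of radius R has weight at least ln(R'/R) in the count up to R', so
  the unintegrated number of zeros and poles is controlled by integrated counts at a larger
  radius.\<close>

lemma sum_zord_le_count:
  assumes h: "nzmero h" and R: "1 \<le> R" "R < R'"
  shows "(\<Sum>a | cmod a \<le> R \<and> zord h a \<noteq> 0. \<bar>zord h a\<bar>) * ln (R' / R)
    \<le> vcount (zeros_of h) R' + vcount (poles_of h) R'"
proof -
  let ?Z = "{a. cmod a \<le> R \<and> zord h a \<noteq> 0}" and ?Z' = "{a. cmod a \<le> R' \<and> \<bar>zord h a\<bar> \<noteq> 0}"
  have lf: "locfin (\<lambda>z. \<bar>zord h z\<bar>)" by (rule locfin_subset[OF locfin_zord[OF h]]) auto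
  have "(\<Sum>a\<in>?Z. \<bar>zord h a\<bar>) * ln (R' / R) = (\<Sum>a\<in>?Z. \<bar>zord h a\<bar> * ln (R' / R))"
    by (rule sum_distrib_right)
  also have "\<dots> \<le> (\<Sum>a\<in>?Z. \<bar>zord h a\<bar> * wt R' a)"
  proof (intro sum_mono mult_left_mono)
    fix a assume a: "a \<in> ?Z"
    show "ln (R' / R) \<le> wt R' a"
    proof (cases "a = 0")
      case True
      then show ?thesis using R by (simp add: wt_def field_simps)
    next
      case False
      then show ?thesis using R a by (auto simp: wt_def intro!: divide_left_mono)
    qed
  qed auto
  also have "\<dots> \<le> (\<Sum>a\<in>?Z'. \<bar>zord h a\<bar> * wt R' a)"
    using lf R by (intro sum_mono2) (auto simp: locfin_def intro!: mult_nonneg_nonneg wt_nonneg)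
  also have "\<dots> = vcount (\<lambda>z. \<bar>zord h z\<bar>) R'" by (simp add: vcount_def)
  also have "vcount (\<lambda>z. \<bar>zord h z\<bar>) R' = vcount (\<lambda>z. zeros_of h z + poles_of h z) R'"
    by (rule arg_cong[where f = "\<lambda>D. vcount D R'"]) (auto simp: zeros_of_def poles_of_def)
  also have "\<dots> = vcount (zeros_of h) R' + vcount (poles_of h) R'"
    by (intro vcount_add locfin_zeros_of locfin_poles_of h)
  finally show ?thesis .
qed

lemma cmean_abs_ln:
  assumes "r \<ge> 0" "r \<notin> bad_radii h"
  shows "cmean (\<lambda>z. \<bar>ln (cmod (h z))\<bar>) r = prox h r + prox (\<lambda>z. inverse (h z)) r"
proof -
  have c: "continuous_on (sphere 0 r) h" by (rule good_radius_continuous[OF assms(2)])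
  have nz: "h z \<noteq> 0" if "cmod z = r" for z using good_radius_regular[OF assms(2) that] by (simp add: regular_at_def)
  have "cmean (\<lambda>z. \<bar>ln (cmod (h z))\<bar>) r = cmean (\<lambda>z. log_plus (cmod (h z)) + log_plus (cmod (inverse (h z)))) r"
  proof (rule cmean_cong)
    fix z assume "cmod z = r"
    then show "\<bar>ln (cmod (h z))\<bar> = log_plus (cmod (h z)) + log_plus (cmod (inverse (h z)))"
      using nz[of z] by (simp add: log_plus_def norm_inverse ln_inverse)
  qed fact
  also have "\<dots> = prox h r + prox (\<lambda>z. inverse (h z)) r"
    unfolding prox_eq_cmean
    using c nz assms by (intro cmean_add continuous_on_log_plus continuous_intros) auto
  finally show ?thesis .
qed

lemma regular_log_deriv_analytic: "regular_at h z \<Longrightarrow> (\<lambda>z. deriv h z / h z) analytic_on {z}"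
  unfolding regular_at_def by (auto intro!: analytic_intros analytic_deriv)

lemma good_radius_continuous_log_deriv:
  assumes "r \<notin> bad_radii h"
  shows "continuous_on (sphere 0 r) (\<lambda>z. deriv h z / h z)"
proof -
  have "(\<lambda>z. deriv h z / h z) analytic_on sphere 0 r"
    by (subst analytic_on_analytic_at)
      (use good_radius_regular[OF assms] regular_log_deriv_analytic in auto)
  then show ?thesis
    by (intro holomorphic_on_imp_continuous_on analytic_imp_holomorphic)
qed

text \<open>Three radii separate the two losses: the Cauchy estimate on the circle of radius R
  deteriorates as R approaches r, and the number of zeros and poles inside R is visible only through
  a count at some R' > R.\<close>

lemma log_deriv_prox_radii:
  assumes h: "nzmero h"
  obtains A where "A \<ge> 1" "\<And>r R R'. 1 \<le> r \<Longrightarrow> r < R \<Longrightarrow> R < R' \<Longrightarrow> r \<notin> bad_radii h \<Longrightarrow> R \<notin> bad_radii h \<Longrightarrow> R' \<notin> bad_radii h \<Longrightarrow>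
    prox (\<lambda>z. deriv h z / h z) r \<le>
      2 * ln (1 + sqrt (2 * R / (R - r)\<^sup>2 * (2 * nev h R + A)) + A * ((2 * nev h R' + A) / ln (R' / R)))"
proof -
  obtain K where K: "K > 0" "\<And>r a. r \<ge> 1 \<Longrightarrow> cmod a \<noteq> r \<Longrightarrow> cmean (\<lambda>z. 1 / sqrt (cmod (z - a))) r \<le> K"
    using cmean_inverse_sqrt_bounded by blast
  obtain c1 where c1: "\<And>r. r > 0 \<Longrightarrow> r \<notin> bad_radii h \<Longrightarrow> nev (\<lambda>z. inverse (h z)) r = nev h r + c1"
    using nev_inverse[OF h] by blast
  obtain c2 where c2: "\<And>r. r > 0 \<Longrightarrow> r \<notin> bad_radii h \<Longrightarrow> vcount (zeros_of h) r \<le> nev h r + c2"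
    using zeros_count_le_nev[OF h] by blast
  define A where "A = 1 + \<bar>c1\<bar> + \<bar>c2\<bar> + 2 * K"
  have A: "A \<ge> 1" "A \<ge> c1" "A \<ge> c2" "A \<ge> 2 * K" using K by (auto simp: A_def)
  have "prox (\<lambda>z. deriv h z / h z) r \<le>
      2 * ln (1 + sqrt (2 * R / (R - r)\<^sup>2 * (2 * nev h R + A)) + A * ((2 * nev h R' + A) / ln (R' / R)))"
    if r: "1 \<le> r" "r < R" "R < R'" and good: "r \<notin> bad_radii h" "R \<notin> bad_radii h" "R' \<notin> bad_radii h" for r R R'
  proof -
    define Z where "Z = {z. cmod z \<le> R \<and> zord h z \<noteq> 0}"
    have fin: "finite Z" using locfin_zord[OF h] by (auto simp: Z_def locfin_def)
    define X where "X = 2 * R / (R - r)\<^sup>2 * cmean (\<lambda>w. \<bar>ln (cmod (h w))\<bar>) R"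
    define n where "n = (\<Sum>a\<in>Z. \<bar>zord h a\<bar>)"
    have X1: "X \<le> 2 * R / (R - r)\<^sup>2 * (2 * nev h R + A)" and X0: "X \<ge> 0"
    proof -
      have R1: "R \<ge> 1" using r by simp
      have "prox (\<lambda>z. inverse (h z)) R \<le> nev h R + c1"
        using c1[of R] R1 good prox_le_nev[OF nzmero_inverse[OF h] R1] by simp
      moreover have "prox h R \<le> nev h R" using prox_le_nev[OF h R1] .
      ultimately have "cmean (\<lambda>w. \<bar>ln (cmod (h w))\<bar>) R \<le> 2 * nev h R + A"
        using cmean_abs_ln[of R h] R1 good A by linarith
      then show "X \<le> 2 * R / (R - r)\<^sup>2 * (2 * nev h R + A)" unfolding X_def using R1 by (intro mult_left_mono) auto
      have "continuous_on (sphere 0 R) (\<lambda>w. \<bar>ln (cmod (h w))\<bar>)"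
        using good_radius_regular[OF good(2)] by (intro continuous_on_rabs regular_at_continuous_ln) auto
      then have "cmean (\<lambda>w. 0) R \<le> cmean (\<lambda>w. \<bar>ln (cmod (h w))\<bar>) R"
        using R1 by (intro cmean_mono) auto
      then show "X \<ge> 0" unfolding X_def using R1 by simp
    qed
    have lnpos: "ln (R' / R) > 0" using r by simp
    have n0: "n \<ge> 0" unfolding n_def by (intro sum_nonneg) auto
    have n1: "n \<le> (2 * nev h R' + A) / ln (R' / R)"
    proof -
      have R1: "R' \<ge> 1" using r by simp
      have "n * ln (R' / R) \<le> vcount (zeros_of h) R' + vcount (poles_of h) R'"
        unfolding n_def Z_def using sum_zord_le_count[OF h] r by simp
      also have "\<dots> \<le> 2 * nev h R' + A"
        using c2[of R'] poles_count_le_nev[OF h R1 good(3)] R1 good A by simp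
      finally show ?thesis using lnpos by (simp add: pos_le_divide_eq)
    qed
    \<comment> \<open>An upper bound for the mean of sqrt |h'/h| over the circle of radius r: sqrt X
      comes from the Cauchy term, 2 K n from the n zeros and poles. The linear part of the tangent
      estimate then cancels.\<close>
    define Y where "Y = sqrt X + 2 * K * n"
    have Y0: "Y \<ge> 0" using X0 n0 K by (simp add: Y_def)
    have aZ: "cmod a \<noteq> r" if "a \<in> Z" for a
      using that good_radius_regular[OF good(1), of a] zorder_regular_at[of h a] by (auto simp: Z_def zord_def)
    have conts: "continuous_on (sphere 0 r) (\<lambda>z. 1 / sqrt (cmod (z - a)))" if "a \<in> Z" for a
      using aZ[OF that] by (intro continuous_intros) auto
    have pt: "log_plus (cmod (deriv h z / h z)) \<le> (2 * ln (1 + Y) + 2 / (1 + Y) * (sqrt X - Y))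
        + 2 / (1 + Y) * (\<Sum>a\<in>Z. (2 * \<bar>zord h a\<bar>) * (1 / sqrt (cmod (z - a))))" if z: "cmod z = r" for z
    proof -
      have "cmod (deriv h z / h z) \<le> X + (\<Sum>a\<in>Z. \<bar>zord h a\<bar> * (2 / cmod (z - a)))"
        using log_deriv_pointwise[OF h _ good(2), of z] good_radius_regular[OF good(1) z] z r
        unfolding Z_def X_def by simp
      then have "sqrt (cmod (deriv h z / h z)) \<le> sqrt (X + (\<Sum>a\<in>Z. \<bar>zord h a\<bar> * (2 / cmod (z - a))))"
        by (rule real_sqrt_le_mono)
      also have "\<dots> \<le> sqrt X + sqrt (\<Sum>a\<in>Z. \<bar>zord h a\<bar> * (2 / cmod (z - a)))"
        using X0 by (intro sqrt_add_le sum_nonneg) auto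
      also have "sqrt (\<Sum>a\<in>Z. \<bar>zord h a\<bar> * (2 / cmod (z - a))) \<le> (\<Sum>a\<in>Z. sqrt (\<bar>zord h a\<bar> * (2 / cmod (z - a))))"
        using fin by (intro sqrt_sum_le) auto
      also have "\<dots> \<le> (\<Sum>a\<in>Z. (2 * \<bar>zord h a\<bar>) * (1 / sqrt (cmod (z - a))))"
      proof (rule sum_mono)
        \<comment> \<open>Orders in Z are nonzero integers, so |ord| \<le> |ord|^2, which makes
          sqrt(2 |ord|) linear in |ord|.\<close>
        fix a assume "a \<in> Z"
        then have "zorder h a \<noteq> 0" by (simp add: Z_def zord_def)
        then have "\<bar>zorder h a\<bar> \<ge> 1" by linarith
        then have k: "\<bar>zord h a\<bar> \<ge> 1" unfolding zord_def by linarith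
        then have "\<bar>zord h a\<bar> * 1 \<le> \<bar>zord h a\<bar> * \<bar>zord h a\<bar>" by (intro mult_left_mono) auto
        then have "\<bar>zord h a\<bar> * 2 \<le> (2 * \<bar>zord h a\<bar>)\<^sup>2" by (simp add: power2_eq_square)
        then have "sqrt (\<bar>zord h a\<bar> * 2) \<le> 2 * \<bar>zord h a\<bar>" by (intro real_le_lsqrt) auto
        then have "sqrt (\<bar>zord h a\<bar> * 2) * (1 / sqrt (cmod (z - a))) \<le> (2 * \<bar>zord h a\<bar>) * (1 / sqrt (cmod (z - a)))"
          by (intro mult_right_mono) auto
        then show "sqrt (\<bar>zord h a\<bar> * (2 / cmod (z - a))) \<le> (2 * \<bar>zord h a\<bar>) * (1 / sqrt (cmod (z - a)))"
          by (simp add: real_sqrt_divide real_sqrt_mult)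
      qed
      finally have s: "sqrt (cmod (deriv h z / h z)) \<le> sqrt X + (\<Sum>a\<in>Z. (2 * \<bar>zord h a\<bar>) * (1 / sqrt (cmod (z - a))))"
        by simp
      have "log_plus (cmod (deriv h z / h z)) \<le> 2 * ln (1 + Y) + 2 / (1 + Y) * (sqrt (cmod (deriv h z / h z)) - Y)"
        using Y0 by (intro log_plus_le_tangent) auto
      also have "\<dots> \<le> 2 * ln (1 + Y) + 2 / (1 + Y) * (sqrt X + (\<Sum>a\<in>Z. (2 * \<bar>zord h a\<bar>) * (1 / sqrt (cmod (z - a)))) - Y)"
        using s Y0 by (intro add_left_mono mult_left_mono) auto
      also have "\<dots> = (2 * ln (1 + Y) + 2 / (1 + Y) * (sqrt X - Y))
        + 2 / (1 + Y) * (\<Sum>a\<in>Z. (2 * \<bar>zord h a\<bar>) * (1 / sqrt (cmod (z - a))))"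
        by (simp only: distrib_left right_diff_distrib)
      finally show ?thesis .
    qed
    have r0: "r \<ge> 0" using r by simp
    have c1: "continuous_on (sphere 0 r) (\<lambda>z. \<Sum>a\<in>Z. (2 * \<bar>zord h a\<bar>) * (1 / sqrt (cmod (z - a))))"
      by (intro continuous_on_sum continuous_on_mult_left conts)
    have "prox (\<lambda>z. deriv h z / h z) r \<le> cmean (\<lambda>z. (2 * ln (1 + Y) + 2 / (1 + Y) * (sqrt X - Y))
        + 2 / (1 + Y) * (\<Sum>a\<in>Z. (2 * \<bar>zord h a\<bar>) * (1 / sqrt (cmod (z - a))))) r"
      unfolding prox_eq_cmean
      by (intro cmean_mono pt r0 continuous_on_add continuous_on_const continuous_on_mult_left[OF c1]
          continuous_on_log_plus good_radius_continuous_log_deriv good)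
    also have "\<dots> = (2 * ln (1 + Y) + 2 / (1 + Y) * (sqrt X - Y))
        + 2 / (1 + Y) * cmean (\<lambda>z. \<Sum>a\<in>Z. (2 * \<bar>zord h a\<bar>) * (1 / sqrt (cmod (z - a)))) r"
      using r0 by (subst cmean_add) (auto simp only: cmean_cmult cmean_const continuous_on_const intro!: continuous_on_mult_left c1)
    also have "cmean (\<lambda>z. \<Sum>a\<in>Z. (2 * \<bar>zord h a\<bar>) * (1 / sqrt (cmod (z - a)))) r
       = (\<Sum>a\<in>Z. (2 * \<bar>zord h a\<bar>) * cmean (\<lambda>z. 1 / sqrt (cmod (z - a))) r)"
      unfolding cmean_cmult[symmetric] by (intro cmean_sum fin r0 continuous_on_mult_left conts)
    also have "2 / (1 + Y) * (\<Sum>a\<in>Z. (2 * \<bar>zord h a\<bar>) * cmean (\<lambda>z. 1 / sqrt (cmod (z - a))) r)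
      \<le> 2 / (1 + Y) * (\<Sum>a\<in>Z. (2 * \<bar>zord h a\<bar>) * K)"
      using Y0 K(2) r aZ by (intro mult_left_mono sum_mono) auto
    also have "(\<Sum>a\<in>Z. (2 * \<bar>zord h a\<bar>) * K) = 2 * K * n"
      by (simp add: n_def sum_distrib_left sum_distrib_right mult_ac)
    also have "(2 * ln (1 + Y) + 2 / (1 + Y) * (sqrt X - Y)) + 2 / (1 + Y) * (2 * K * n) = 2 * ln (1 + Y)"
      by (simp add: Y_def algebra_simps)
    finally have 1: "prox (\<lambda>z. deriv h z / h z) r \<le> 2 * ln (1 + Y)" by simp
    have "Y \<le> sqrt (2 * R / (R - r)\<^sup>2 * (2 * nev h R + A)) + A * ((2 * nev h R' + A) / ln (R' / R))"
      unfolding Y_def using X1 n1 n0 A K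
      by (intro add_mono real_sqrt_le_mono mult_mono) auto
    then have "ln (1 + Y) \<le> ln (1 + sqrt (2 * R / (R - r)\<^sup>2 * (2 * nev h R + A)) + A * ((2 * nev h R' + A) / ln (R' / R)))"
      using Y0 by (subst ln_le_cancel_iff) auto
    with 1 show ?thesis by linarith
  qed
  with A(1) show ?thesis by (rule that)
qed

text \<open>R is taken in the second and R' in the fourth quarter of the interval from r to r (1 +
  \<delta>), so all gaps are at least r \<delta> / 4. Every power of M and 1/\<delta> ends up inside
  one logarithm; hence \<delta> may be as small as 1/T at the price of a term ln T.\<close>

lemma log_deriv_prox:
  assumes h: "nzmero h"
  obtains C where "C \<ge> 1" "\<And>r \<delta> M B. 1 \<le> r \<Longrightarrow> 0 < \<delta> \<Longrightarrow> \<delta> \<le> 1 \<Longrightarrow> M \<ge> 1 \<Longrightarrow> r \<notin> bad_radii h \<Longrightarrow> countable B \<Longrightarrow>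
    (\<And>\<rho>. r < \<rho> \<Longrightarrow> \<rho> < r * (1 + \<delta>) \<Longrightarrow> \<rho> \<notin> B \<Longrightarrow> nev h \<rho> \<le> M) \<Longrightarrow>
    prox (\<lambda>z. deriv h z / h z) r \<le> C + 2 * (ln M + ln (1 / \<delta>))"
proof -
  obtain A where A: "A \<ge> 1" "\<And>r R R'. 1 \<le> r \<Longrightarrow> r < R \<Longrightarrow> R < R' \<Longrightarrow> r \<notin> bad_radii h \<Longrightarrow> R \<notin> bad_radii h \<Longrightarrow> R' \<notin> bad_radii h \<Longrightarrow>
    prox (\<lambda>z. deriv h z / h z) r \<le>
      2 * ln (1 + sqrt (2 * R / (R - r)\<^sup>2 * (2 * nev h R + A)) + A * ((2 * nev h R' + A) / ln (R' / R)))"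
    using log_deriv_prox_radii[OF h] by blast
  define D where "D = 1 + 8 * (2 + A) + A * (8 * (2 + A))"
  have D: "D \<ge> 1" using A by (simp add: D_def)
  have "prox (\<lambda>z. deriv h z / h z) r \<le> (1 + 2 * ln D) + 2 * (ln M + ln (1 / \<delta>))"
    if r: "1 \<le> r" and d: "0 < \<delta>" "\<delta> \<le> 1" and M: "M \<ge> 1" and good: "r \<notin> bad_radii h" and B: "countable B"
      and nev: "\<And>\<rho>. r < \<rho> \<Longrightarrow> \<rho> < r * (1 + \<delta>) \<Longrightarrow> \<rho> \<notin> B \<Longrightarrow> nev h \<rho> \<le> M" for r \<delta> M B
  proof -
    have cB: "countable (B \<union> bad_radii h)" using B countable_bad_radii[OF h] by simp
    have rd: "r * \<delta> > 0" using r d by simp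
    have "r + r * \<delta> / 4 < r + r * \<delta> / 2" "r + r * \<delta> * 3 / 4 < r + r * \<delta>" using rd by linarith+
    note lt = this
    obtain R where R: "r + r * \<delta> / 4 < R" "R < r + r * \<delta> / 2" "R \<notin> B \<union> bad_radii h"
      using countable_avoid[OF cB lt(1)] by blast
    obtain R' where R': "r + r * \<delta> * 3 / 4 < R'" "R' < r + r * \<delta>" "R' \<notin> B \<union> bad_radii h"
      using countable_avoid[OF cB lt(2)] by blast
    have ord: "r < R" "R < R'" "R' < r * (1 + \<delta>)" "R < r * (1 + \<delta>)" "r < R'"
      using R R' rd by (auto simp: algebra_simps)
    have rdr: "r * \<delta> \<le> r" using mult_left_mono[OF d(2), of r] r by simp
    have N: "nev h R \<le> M" "nev h R' \<le> M" using nev ord R R' by auto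
    have N0: "nev h R \<ge> 0" "nev h R' \<ge> 0" using nev_nonneg[OF h] ord r R R' by auto
    have MA: "2 * M + A \<le> (2 + A) * M" using mult_left_mono[OF M, of A] A by (simp add: algebra_simps)
    have R2: "R \<le> 2 * r" "R' \<le> 2 * r" "R - r \<ge> r * \<delta> / 4" "R' - R \<ge> r * \<delta> / 4" "r * \<delta> / 4 > 0"
      using R R' rd rdr r by linarith+
    have "2 * R / (R - r)\<^sup>2 \<le> 2 * (2 * r) / (r * \<delta> / 4)\<^sup>2"
      using R2 r by (intro frac_le power_mono) auto
    also have "\<dots> = 64 / (r * \<delta>\<^sup>2)" using r d by (simp add: field_simps power2_eq_square)
    also have "\<dots> \<le> 64 / \<delta>\<^sup>2" using r d by (intro divide_left_mono) (auto simp: mult_le_cancel_right1)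
    finally have "2 * R / (R - r)\<^sup>2 * (2 * nev h R + A) \<le> 64 / \<delta>\<^sup>2 * ((2 + A) * M)"
      using N N0 A MA d by (intro mult_mono) auto
    also have "\<dots> \<le> 64 / \<delta>\<^sup>2 * ((2 + A) * M)\<^sup>2"
    proof -
      have "(2 + A) * M \<ge> 1 * 1" using A M by (intro mult_mono) auto
      then have "(2 + A) * M \<le> ((2 + A) * M)\<^sup>2" by (intro self_le_power) auto
      then show ?thesis using d by (intro mult_left_mono) auto
    qed
    also have "\<dots> = (8 * (2 + A) * M / \<delta>)\<^sup>2" by (simp add: power2_eq_square algebra_simps add_divide_distrib)
    finally have s: "sqrt (2 * R / (R - r)\<^sup>2 * (2 * nev h R + A)) \<le> 8 * (2 + A) * M / \<delta>"
      using A M d by (intro real_le_lsqrt) auto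
    have "ln (R / R') \<le> R / R' - 1" using ord r by (intro ln_le_minus_one) auto
    then have "ln (R' / R) \<ge> 1 - R / R'" using ord r by (simp add: ln_div)
    also have "1 - R / R' = (R' - R) / R'" using ord r by (simp add: field_simps)
    moreover have "(R' - R) / R' \<ge> (r * \<delta> / 4) / (2 * r)"
      using R2 ord r by (intro frac_le) auto
    moreover have "(r * \<delta> / 4) / (2 * r) = \<delta> / 8" using r by simp
    ultimately have l: "ln (R' / R) \<ge> \<delta> / 8" by linarith
    have "(2 * nev h R' + A) / ln (R' / R) \<le> (2 + A) * M / (\<delta> / 8)"
      using N N0 MA A d l M by (intro frac_le) auto
    then have "A * ((2 * nev h R' + A) / ln (R' / R)) \<le> A * ((2 + A) * M / (\<delta> / 8))"
      using A by (intro mult_left_mono) auto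
    also have "\<dots> = A * (8 * (2 + A)) * (M / \<delta>)" using d by simp
    finally have t: "A * ((2 * nev h R' + A) / ln (R' / R)) \<le> A * (8 * (2 + A)) * (M / \<delta>)" .
    have Md: "M / \<delta> \<ge> 1" using M d by (simp add: field_simps)
    have "1 + sqrt (2 * R / (R - r)\<^sup>2 * (2 * nev h R + A)) + A * ((2 * nev h R' + A) / ln (R' / R)) \<le> D * (M / \<delta>)"
    proof -
      have "8 * (2 + A) * M / \<delta> = 8 * (2 + A) * (M / \<delta>)" by simp
      moreover have "D * (M / \<delta>) = 1 * (M / \<delta>) + 8 * (2 + A) * (M / \<delta>) + A * (8 * (2 + A)) * (M / \<delta>)"
        unfolding D_def by (simp only: distrib_right)
      ultimately show ?thesis using s t Md by linarith
    qed
    moreover have "1 + sqrt (2 * R / (R - r)\<^sup>2 * (2 * nev h R + A)) + A * ((2 * nev h R' + A) / ln (R' / R)) > 0"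
    proof -
      have "A * ((2 * nev h R' + A) / ln (R' / R)) \<ge> 0" using A N0 l d by (intro mult_nonneg_nonneg divide_nonneg_nonneg) auto
      moreover have "sqrt (2 * R / (R - r)\<^sup>2 * (2 * nev h R + A)) \<ge> 0" using A N0 ord r by (intro real_sqrt_ge_zero) auto
      ultimately show ?thesis by linarith
    qed
    ultimately have "ln (1 + sqrt (2 * R / (R - r)\<^sup>2 * (2 * nev h R + A)) + A * ((2 * nev h R' + A) / ln (R' / R))) \<le> ln (D * (M / \<delta>))"
      using D Md by (subst ln_le_cancel_iff) (auto intro: mult_pos_pos)
    also have "\<dots> = ln D + ln M + ln (1 / \<delta>)" using D M d by (simp add: ln_mult ln_div)
    finally show ?thesis using A(2)[of r R R'] r ord good R R' by fastforce
  qed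
  with D show ?thesis by (intro that[of "1 + 2 * ln D"]) auto
qed

text \<open>Otherwise every candidate radius would have a successor at which \<open>T\<close> more
  than doubles. Since the relative step is at most 1 / T \<le> 2^(-n), all radii stay below s0 exp 2
  while \<open>T\<close> grows beyond every bound, contrary to local boundedness.\<close>

lemma growth_radius:
  fixes T :: "real \<Rightarrow> real"
  assumes B: "countable B"
    and bdd: "\<And>R. \<exists>C. \<forall>r. 1 \<le> r \<longrightarrow> r \<le> R \<longrightarrow> r \<notin> B \<longrightarrow> T r \<le> C"
    and unb: "\<And>K. \<exists>R. \<forall>r\<ge>R. r \<notin> B \<longrightarrow> T r \<ge> K"
    and K: "K \<ge> 1"
  obtains s where "s \<ge> K" "s \<notin> B" "T s \<ge> K"
    "\<And>\<rho>. s < \<rho> \<Longrightarrow> \<rho> < s * (1 + 1 / T s) \<Longrightarrow> \<rho> \<notin> B \<Longrightarrow> T \<rho> \<le> 2 * T s"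
proof (rule ccontr)
  note obt = that
  assume nt: "\<not> thesis"
  have step: "\<exists>\<rho>. s < \<rho> \<and> \<rho> < s * (1 + 1 / T s) \<and> \<rho> \<notin> B \<and> T \<rho> > 2 * T s"
    if "s \<ge> K" "s \<notin> B" "T s \<ge> K" for s
  proof (rule ccontr)
    assume "\<not> ?thesis"
    then have "T \<rho> \<le> 2 * T s" if "s < \<rho>" "\<rho> < s * (1 + 1 / T s)" "\<rho> \<notin> B" for \<rho>
      using that by force
    then show False using obt[OF that] nt by blast
  qed
  obtain R where R: "\<And>r. r \<ge> R \<Longrightarrow> r \<notin> B \<Longrightarrow> T r \<ge> K" using unb by blast
  obtain s0 where s0: "max K R < s0" "s0 \<notin> B" using countable_avoid[OF B, of "max K R" "max K R + 1"] by auto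
  \<comment> \<open>The exponent 2 - 2 (1/2)^n is the sum of (1/2)^j over j < n, the accumulated
    bound for the relative steps.\<close>
  have "\<exists>\<sigma>. \<forall>n. (\<sigma> n \<ge> K \<and> \<sigma> n \<notin> B \<and> T (\<sigma> n) \<ge> K * 2 ^ n \<and> \<sigma> n \<le> s0 * exp (2 - 2 * (1/2) ^ n)) \<and> T (\<sigma> (Suc n)) > 2 * T (\<sigma> n)"
  proof (rule dependent_nat_choice)
    show "\<exists>x. K \<le> x \<and> x \<notin> B \<and> K * 2 ^ 0 \<le> T x \<and> x \<le> s0 * exp (2 - 2 * (1 / 2) ^ 0)"
      using s0 R[of s0] by (intro exI[of _ s0]) auto
  next
    fix s n
    assume s: "K \<le> s \<and> s \<notin> B \<and> K * 2 ^ n \<le> T s \<and> s \<le> s0 * exp (2 - 2 * (1 / 2) ^ n)"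
    have "1 * 2 ^ n \<le> K * 2 ^ n" using K by (intro mult_right_mono) auto
    then have T1: "T s \<ge> 2 ^ n" using s by linarith
    have "K * 1 \<le> K * 2 ^ n" using K by (intro mult_left_mono) auto
    then have "T s \<ge> K" using s by linarith
    then obtain \<rho> where \<rho>: "s < \<rho>" "\<rho> < s * (1 + 1 / T s)" "\<rho> \<notin> B" "T \<rho> > 2 * T s"
      using step s by blast
    have "1 / T s \<le> 1 / 2 ^ n" using T1 by (intro divide_left_mono mult_pos_pos) (auto intro: less_le_trans[of 0 "2 ^ n"])
    then have "1 + 1 / T s \<le> 1 + (1/2) ^ n" by (simp add: power_one_over)
    also have "\<dots> \<le> exp ((1/2) ^ n)" by (rule exp_ge_add_one_self)
    finally have "s * (1 + 1 / T s) \<le> (s0 * exp (2 - 2 * (1 / 2) ^ n)) * exp ((1/2) ^ n)"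
      using s K T1 \<open>T s \<ge> K\<close> s0 by (intro mult_mono) auto
    also have "\<dots> = s0 * exp (2 - 2 * (1/2) ^ Suc n)"
      by (simp add: mult.assoc flip: exp_add)
    finally show "\<exists>y. (K \<le> y \<and> y \<notin> B \<and> K * 2 ^ Suc n \<le> T y \<and> y \<le> s0 * exp (2 - 2 * (1 / 2) ^ Suc n)) \<and> 2 * T s < T y"
      using \<rho> s by (intro exI[of _ \<rho>]) auto
  qed
  then obtain \<sigma> where \<sigma>: "\<And>n. \<sigma> n \<ge> K" "\<And>n. \<sigma> n \<notin> B" "\<And>n. T (\<sigma> n) \<ge> K * 2 ^ n" "\<And>n. \<sigma> n \<le> s0 * exp (2 - 2 * (1/2) ^ n)"
    by blast
  obtain C where C: "\<And>r. 1 \<le> r \<Longrightarrow> r \<le> s0 * exp 2 \<Longrightarrow> r \<notin> B \<Longrightarrow> T r \<le> C"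
    using bdd[of "s0 * exp 2"] by blast
  obtain n where n: "C < 2 ^ n" using real_arch_pow[of 2 C] by auto
  have "\<sigma> n \<le> s0 * exp 2" using \<sigma>(4)[of n] s0 K by (rule_tac order.trans) (auto intro!: mult_left_mono)
  then have "T (\<sigma> n) \<le> C" using C \<sigma> K by (meson order.trans)
  moreover have "1 * 2 ^ n \<le> K * 2 ^ n" using K by (intro mult_right_mono) auto
  ultimately show False using n \<sigma>(3)[of n] by linarith
qed

section \<open>The second main theorem along a sequence of radii\<close>

lemma zord_shift_pole:
  assumes "nzmero f" "nzmero (\<lambda>z. f z - a)"
  shows "poles_of (\<lambda>z. f z - a) z = poles_of f z"
proof (cases "a = 0")
  case False
  have c: "(\<lambda>z. a) meromorphic_on {z}" "frequently (\<lambda>z. a \<noteq> 0) (at z)" using False by (auto intro: meromorphic_intros)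
  have 1: "zorder f z < 0 \<Longrightarrow> zorder (\<lambda>z. f z - a) z = zorder f z"
    using zorder_diff1[of f z "\<lambda>_. a"] nzmeroD[OF assms(1)] c False by simp
  have "zorder (\<lambda>z. (f z - a) + a) z = zorder (\<lambda>z. f z - a) z" if "zorder (\<lambda>z. f z - a) z < 0"
    using zorder_add1[of "\<lambda>z. f z - a" z "\<lambda>_. a"] nzmeroD[OF assms(2)] c False that by simp
  with 1 show ?thesis by (fastforce simp: poles_of_def zord_def)
qed simp

lemma zord_shift_zero:
  assumes "nzmero (\<lambda>z. f z - a)" "a \<noteq> b" "zord (\<lambda>z. f z - a) z > 0"
  shows "zord (\<lambda>z. f z - b) z = 0"
proof -
  have "zorder (\<lambda>z. (f z - a) + (a - b)) z = zorder (\<lambda>_. a - b) z"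
    using assms nzmeroD[OF assms(1)] by (intro zorder_add2) (auto intro: meromorphic_intros simp: zord_def)
  then show ?thesis using assms by (simp add: zord_def)
qed

lemma deriv_shift: "deriv (\<lambda>z. f z - a) = deriv f"
proof -
  have "((\<lambda>z. f z - a) has_field_derivative D) (at x) \<longleftrightarrow> (f has_field_derivative D) (at x)" for D x
  proof
    assume "((\<lambda>z. f z - a) has_field_derivative D) (at x)"
    from DERIV_add[OF this DERIV_const[of a]] show "(f has_field_derivative D) (at x)" by simp
  next
    assume "(f has_field_derivative D) (at x)"
    from DERIV_diff[OF this DERIV_const[of a]] show "((\<lambda>z. f z - a) has_field_derivative D) (at x)" by simp
  qed
  then show ?thesis by (simp add: deriv_def fun_eq_iff)
qed

lemma zord_deriv:
  assumes "nzmero f" "zord f z \<noteq> 0"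
  shows "zord (deriv f) z = zord f z - 1"
  using zorder_deriv_minus_1[OF nzmeroD(4,5,3)[OF assms(1)], of z] assms(2) by (simp add: zord_def)

lemma zord_deriv_nonneg:
  assumes "nzmero f" "nzmero (deriv f)" "zord f z \<ge> 0"
  shows "zord (deriv f) z \<ge> 0"
proof (rule ccontr)
  assume "\<not> ?thesis"
  then have "is_pole (deriv f) z"
    using zorder_neg_imp_is_pole[of "deriv f" z] nzmeroD[OF assms(2)] by (simp add: zord_def)
  then have "is_pole f z" using is_pole_deriv_iff nzmeroD(1)[OF assms(1)] by blast
  then have "zorder f z < 0" using isolated_pole_imp_neg_zorder nzmeroD(4)[OF assms(1)] by blast
  then show False using assms(3) by (simp add: zord_def)
qed

lemma zord_log_deriv:
  assumes "nzmero h" "nzmero (\<lambda>z. deriv h z / h z)" "nzmero (deriv h)"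
  shows "zord h z \<noteq> 0 \<Longrightarrow> zord (\<lambda>z. deriv h z / h z) z = -1"
    "zord h z = 0 \<Longrightarrow> zord (\<lambda>z. deriv h z / h z) z = zord (deriv h) z"
    "zord h z = 0 \<Longrightarrow> zord (\<lambda>z. deriv h z / h z) z \<ge> 0"
  using zord_divide[OF assms(3,1), of z] zord_deriv[OF assms(1), of z] zord_deriv_nonneg[OF assms(1,3), of z] by auto

lemma cmean_le_sum_prox:
  assumes "r \<ge> 0" "finite A" "A \<noteq> {}" "C \<ge> 1" "continuous_on (sphere 0 r) u"
    "\<And>a. a \<in> A \<Longrightarrow> continuous_on (sphere 0 r) (g a)"
    "\<And>z. cmod z = r \<Longrightarrow> exp (u z) \<le> C * (\<Sum>a\<in>A. cmod (g a z))"
  shows "cmean u r \<le> (\<Sum>a\<in>A. prox (g a) r) + ln (C * real (card A))"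
proof -
  have c: "real (card A) \<ge> 1" using assms by (simp add: Suc_leI card_gt_0_iff)
  have "cmean u r \<le> cmean (\<lambda>z. (\<Sum>a\<in>A. log_plus (cmod (g a z))) + ln (C * real (card A))) r"
  proof (rule cmean_mono)
    fix z assume z: "cmod z = r"
    have "u z \<le> ln (C * (\<Sum>a\<in>A. cmod (g a z)))"
      using assms(7)[OF z] by (subst ln_ge_iff) (auto intro: less_le_trans[OF exp_gt_zero])
    also have "\<dots> \<le> log_plus (C * (\<Sum>a\<in>A. cmod (g a z)))" by (rule ln_le_log_plus)
    also have "\<dots> \<le> log_plus C + log_plus (\<Sum>a\<in>A. cmod (g a z))"
      using assms by (intro log_plus_mult sum_nonneg) auto
    also have "log_plus (\<Sum>a\<in>A. cmod (g a z)) \<le> (\<Sum>a\<in>A. log_plus (cmod (g a z))) + ln (real (card A))"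
      using assms by (intro log_plus_sum_le) auto
    finally show "u z \<le> (\<Sum>a\<in>A. log_plus (cmod (g a z))) + ln (C * real (card A))"
      using assms c by (simp add: log_plus_le_ln ln_mult)
  qed (use assms in \<open>auto intro!: continuous_on_add continuous_on_sum continuous_on_const continuous_on_log_plus\<close>)
  also have "\<dots> = cmean (\<lambda>z. \<Sum>a\<in>A. log_plus (cmod (g a z))) r + ln (C * real (card A))"
    using assms by (subst cmean_add) (auto intro!: continuous_on_sum continuous_on_log_plus)
  also have "cmean (\<lambda>z. \<Sum>a\<in>A. log_plus (cmod (g a z))) r = (\<Sum>a\<in>A. prox (g a) r)"
    unfolding prox_eq_cmean using assms by (intro cmean_sum continuous_on_log_plus)
  finally show ?thesis .
qed

text \<open>Let a be the point of A nearest to w. Every other b has |w - b| \<ge> d/2 with d the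
  least distance in A, so max 1 |w| \<le> K |w - b|; these card A - 1 factors absorb the power and
  only 1/|w - a| remains.\<close>

lemma power_le_sum_prod_dist:
  fixes A :: "complex set"
  assumes "finite A" "A \<noteq> {}"
  obtains C where "C \<ge> 1"
    "\<And>w. w \<notin> A \<Longrightarrow> max 1 (cmod w) ^ (card A - 1) / (\<Prod>a\<in>A. cmod (w - a)) \<le> C * (\<Sum>a\<in>A. 1 / cmod (w - a))"
proof -
  define M where "M = (\<Sum>a\<in>A. cmod a)"
  have M: "cmod a \<le> M" if "a \<in> A" for a unfolding M_def using assms that by (intro member_le_sum) auto
  have M0: "M \<ge> 0" unfolding M_def by (intro sum_nonneg) auto
  obtain d where d: "d > 0" "\<And>a b. a \<in> A \<Longrightarrow> b \<in> A \<Longrightarrow> a \<noteq> b \<Longrightarrow> d \<le> dist a b"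
  proof (cases "\<exists>a\<in>A. \<exists>b\<in>A. a \<noteq> b")
    case True
    let ?D = "(\<lambda>(a, b). dist a b) ` {(a, b). a \<in> A \<and> b \<in> A \<and> a \<noteq> b}"
    have fin: "finite ?D"
      by (intro finite_imageI finite_subset[OF _ finite_cartesian_product[OF assms(1) assms(1)]]) auto
    have ne: "?D \<noteq> {}" using True by auto
    have "Min ?D \<in> ?D" by (rule Min_in[OF fin ne])
    then have "Min ?D > 0" by auto
    moreover have "Min ?D \<le> dist a b" if "a \<in> A" "b \<in> A" "a \<noteq> b" for a b
      using that by (intro Min_le[OF fin]) auto
    ultimately show ?thesis using that by blast
  next
    case False
    then show ?thesis by (intro that[of 1]) auto
  qed
  define K where "K = 1 + (2 + 2 * M) / d"
  have K: "K \<ge> 1" using d M0 by (simp add: K_def)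
  have "max 1 (cmod w) ^ (card A - 1) / (\<Prod>a\<in>A. cmod (w - a)) \<le> K ^ (card A - 1) * (\<Sum>a\<in>A. 1 / cmod (w - a))"
    if w: "w \<notin> A" for w
  proof -
    obtain a where a: "a \<in> A" "\<And>b. b \<in> A \<Longrightarrow> cmod (w - a) \<le> cmod (w - b)"
    proof -
      have "Min ((\<lambda>b. cmod (w - b)) ` A) \<in> (\<lambda>b. cmod (w - b)) ` A" using assms by (intro Min_in) auto
      then obtain a where "a \<in> A" "cmod (w - a) = Min ((\<lambda>b. cmod (w - b)) ` A)" by auto
      then show ?thesis using assms by (intro that[of a]) auto
    qed
    have b: "max 1 (cmod w) \<le> K * cmod (w - b)" if "b \<in> A - {a}" for b
    proof -
      have "d \<le> dist a b" using d(2) a(1) that by auto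
      also have "\<dots> \<le> cmod (w - a) + cmod (w - b)"
        using norm_triangle_ineq4[of "w - b" "w - a"] by (simp add: dist_norm add.commute)
      also have "\<dots> \<le> 2 * cmod (w - b)" using a(2)[of b] that by auto
      finally have db: "cmod (w - b) \<ge> d / 2" by simp
      then have "1 * d \<le> 2 * cmod (w - b)" by simp
      have x: "x * d \<le> 2 * x * cmod (w - b)" if "x \<ge> 0" for x
        using mult_left_mono[OF \<open>1 * d \<le> 2 * cmod (w - b)\<close> that] by simp
      have "1 \<le> 2 / d * cmod (w - b)" using db d(1) by (simp add: field_simps)
      moreover have "M \<le> 2 * M / d * cmod (w - b)" using x[OF M0] d(1) by (simp add: field_simps)
      moreover have "cmod w \<le> cmod (w - b) + M" using norm_triangle_ineq[of "w - b" b] M[of b] that by simp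
      moreover have "K * cmod (w - b) = cmod (w - b) + 2 / d * cmod (w - b) + 2 * M / d * cmod (w - b)"
        by (simp add: K_def algebra_simps add_divide_distrib)
      moreover have "cmod (w - b) \<ge> 0" "2 / d * cmod (w - b) \<ge> 0" "2 * M / d * cmod (w - b) \<ge> 0" using d(1) M0 by auto
      ultimately show ?thesis by linarith
    qed
    have pos: "(\<Prod>b\<in>A-{a}. cmod (w - b)) > 0" "cmod (w - a) > 0" using w a(1) by (auto intro!: prod_pos)
    have "max 1 (cmod w) ^ (card A - 1) = (\<Prod>b\<in>A-{a}. max 1 (cmod w))" using a assms by simp
    also have "\<dots> \<le> (\<Prod>b\<in>A-{a}. K * cmod (w - b))" using b by (intro prod_mono) auto
    also have "\<dots> = K ^ (card A - 1) * (\<Prod>b\<in>A-{a}. cmod (w - b))" using a assms by (simp add: prod.distrib)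
    finally have "max 1 (cmod w) ^ (card A - 1) \<le> K ^ (card A - 1) * (\<Prod>b\<in>A-{a}. cmod (w - b))" .
    moreover have "(\<Prod>b\<in>A. cmod (w - b)) = cmod (w - a) * (\<Prod>b\<in>A-{a}. cmod (w - b))"
      using a assms by (intro prod.remove) auto
    ultimately have "max 1 (cmod w) ^ (card A - 1) / (\<Prod>b\<in>A. cmod (w - b)) \<le> K ^ (card A - 1) * (\<Prod>b\<in>A-{a}. cmod (w - b)) / (cmod (w - a) * (\<Prod>b\<in>A-{a}. cmod (w - b)))"
      using pos by (simp only:) (intro divide_right_mono; simp)
    also have "\<dots> = K ^ (card A - 1) * (1 / cmod (w - a))" using pos by simp
    also have "\<dots> \<le> K ^ (card A - 1) * (\<Sum>a\<in>A. 1 / cmod (w - a))"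
      using a assms K by (intro mult_left_mono member_le_sum) auto
    finally show ?thesis .
  qed
  then show ?thesis using K by (intro that[of "K ^ (card A - 1)"]) auto
qed

section \<open>Reduced divisors and ramification\<close>

definition zbar :: "(complex \<Rightarrow> complex) \<Rightarrow> complex \<Rightarrow> real" where
  "zbar h z = of_bool (zord h z > 0)"

definition pbar :: "(complex \<Rightarrow> complex) \<Rightarrow> complex \<Rightarrow> real" where
  "pbar h z = of_bool (zord h z < 0)"

text \<open>The zeros of f' over neither infinity nor A, that is, the ramification not already spent
  in passing from full to reduced counts of A-points.\<close>

definition ram :: "complex set \<Rightarrow> (complex \<Rightarrow> complex) \<Rightarrow> complex \<Rightarrow> real" where
  "ram A f z = (if zord f z < 0 \<or> (\<exists>a\<in>A. zord (\<lambda>z. f z - a) z > 0) then 0 else zord (deriv f) z)"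

lemma locfin_zbar: "nzmero h \<Longrightarrow> locfin (zbar h)" and locfin_pbar: "nzmero h \<Longrightarrow> locfin (pbar h)"
  by (rule locfin_subset[OF locfin_zord], simp, auto simp: zbar_def pbar_def)+

lemma locfin_ram: "nzmero (deriv f) \<Longrightarrow> locfin (ram A f)"
  by (rule locfin_subset[OF locfin_zord]) (auto simp: ram_def split: if_splits)

lemma ram_nonneg: "nzmero f \<Longrightarrow> nzmero (deriv f) \<Longrightarrow> ram A f z \<ge> 0"
  by (auto simp: ram_def intro!: zord_deriv_nonneg)

lemma zbar_nonneg [simp]: "zbar h z \<ge> 0" and pbar_nonneg [simp]: "pbar h z \<ge> 0"
  by (auto simp: zbar_def pbar_def)

lemma zbar_le_zeros_of: "zbar h z \<le> zeros_of h z"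
proof (cases "zorder h z > 0")
  case True
  then have "zord h z \<ge> 1" unfolding zord_def by linarith
  then show ?thesis by (simp add: zbar_def zeros_of_def)
qed (simp add: zbar_def zord_def)

lemma nev_shift_le:
  assumes "nzmero f" "nzmero (\<lambda>z. f z - a)" "r \<ge> 1" "continuous_on (sphere 0 r) f"
  shows "nev (\<lambda>z. f z - a) r \<le> nev f r + ln (1 + cmod a)"
proof -
  have "prox (\<lambda>z. f z - a) r \<le> cmean (\<lambda>z. log_plus (cmod (f z)) + ln (1 + cmod a)) r"
    unfolding prox_eq_cmean
  proof (rule cmean_mono)
    fix z
    have "cmod (f z - a) \<le> cmod (f z) + cmod a" by (rule norm_triangle_ineq4)
    also have "\<dots> \<le> (1 + cmod a) * max 1 (cmod (f z))"
      using mult_left_mono[of 1 "max 1 (cmod (f z))" "cmod a"] by (simp add: distrib_right)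
    finally have "log_plus (cmod (f z - a)) \<le> log_plus ((1 + cmod a) * max 1 (cmod (f z)))"
      by (intro log_plus_mono) auto
    also have "\<dots> \<le> log_plus (1 + cmod a) + log_plus (max 1 (cmod (f z)))" by (intro log_plus_mult) auto
    also have "log_plus (max 1 (cmod (f z))) = log_plus (cmod (f z))" by (auto simp: log_plus_alt)
    also have "log_plus (1 + cmod a) = ln (1 + cmod a)" by (rule log_plus_le_ln) simp
    finally show "log_plus (cmod (f z - a)) \<le> log_plus (cmod (f z)) + ln (1 + cmod a)" by simp
  qed (use assms in \<open>auto intro!: continuous_on_add continuous_on_diff continuous_on_const continuous_on_log_plus\<close>)
  also have "\<dots> = prox f r + ln (1 + cmod a)"
    using assms by (subst cmean_add) (auto simp: prox_eq_cmean intro!: continuous_on_log_plus)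
  finally have "prox (\<lambda>z. f z - a) r \<le> prox f r + ln (1 + cmod a)" .
  moreover have "poles_of (\<lambda>z. f z - a) = poles_of f" using zord_shift_pole[OF assms(1,2)] by (rule ext)
  ultimately show ?thesis by (simp add: nev_def)
qed

text \<open>A countable set $B$ of radii is avoided. The bound required in \<open>adm\<close> on a short interval to the right of
  each $s_k$ plays the part of Borel's growth lemma, so that no exceptional set of finite measure appears.\<close>

locale growth_sequence =
  fixes s \<phi> :: "nat \<Rightarrow> real" and B :: "real set"
  assumes countable_B: "countable B"
    and s_ge_1: "\<And>k. s k \<ge> 1" and s_good: "\<And>k. s k \<notin> B"
    and phi_ge_1: "\<And>k. \<phi> k \<ge> 1" and phi_lim: "filterlim \<phi> at_top sequentially"
begin

text \<open>One-sided on purpose: only an upper bound is asked for, so any inequality up to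
  o(\<phi>) can be stated as smallness of left side minus right side, and such statements add
  up.\<close>

definition small :: "(nat \<Rightarrow> real) \<Rightarrow> bool" where
  "small X \<longleftrightarrow> (\<forall>e>0. eventually (\<lambda>k. X k \<le> e * \<phi> k) sequentially)"

lemma small_add: "small X \<Longrightarrow> small Y \<Longrightarrow> small (\<lambda>k. X k + Y k)"
  unfolding small_def
proof (intro allI impI)
  fix e :: real
  assume *: "\<forall>e>0. eventually (\<lambda>k. X k \<le> e * \<phi> k) sequentially" "\<forall>e>0. eventually (\<lambda>k. Y k \<le> e * \<phi> k) sequentially" "e > 0"
  then have "eventually (\<lambda>k. X k \<le> e/2 * \<phi> k) sequentially" "eventually (\<lambda>k. Y k \<le> e/2 * \<phi> k) sequentially"
    by (auto dest!: spec[of _ "e/2"])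
  then show "eventually (\<lambda>k. X k + Y k \<le> e * \<phi> k) sequentially"
    by eventually_elim auto
qed

lemma small_mono: "small Y \<Longrightarrow> (\<And>k. X k \<le> Y k) \<Longrightarrow> small X"
  unfolding small_def
proof (intro allI impI)
  fix e :: real
  assume *: "\<forall>e>0. eventually (\<lambda>k. Y k \<le> e * \<phi> k) sequentially" "\<And>k. X k \<le> Y k" "e > 0"
  then have "eventually (\<lambda>k. Y k \<le> e * \<phi> k) sequentially" by blast
  then show "eventually (\<lambda>k. X k \<le> e * \<phi> k) sequentially"
    by eventually_elim (use *(2) order.trans in blast)
qed

lemma small_ln: "small (\<lambda>k. C + D * ln (\<phi> k))"
  unfolding small_def
proof (intro allI impI)
  fix e :: real assume e: "e > 0"
  have "((\<lambda>x::real. C * inverse x + D * (ln x / x)) \<longlongrightarrow> C * 0 + D * 0) at_top"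
    by (intro tendsto_intros tendsto_inverse_0_at_top filterlim_ident ln_x_over_x_tendsto_0)
  then have "eventually (\<lambda>x::real. C * inverse x + D * (ln x / x) < e) at_top"
    using e by (simp add: order_tendsto_iff)
  then have "eventually (\<lambda>x. C + D * ln x \<le> e * x) at_top"
    using eventually_gt_at_top[of 0]
  proof eventually_elim
    case (elim x)
    then have "(C * inverse x + D * (ln x / x)) * x \<le> e * x" by (intro mult_right_mono) auto
    then show ?case using elim by (simp add: field_simps)
  qed
  then show "eventually (\<lambda>k. C + D * ln (\<phi> k) \<le> e * \<phi> k) sequentially"
    using phi_lim by (rule eventually_compose_filterlim)
qed

lemma small_const: "small (\<lambda>k. C)"
  using small_ln[of C 0] by simp

lemma small_sum:
  assumes "finite A" "\<And>a. a \<in> A \<Longrightarrow> small (X a)"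
  shows "small (\<lambda>k. \<Sum>a\<in>A. X a k)"
  using assms
proof (induction A rule: finite_induct)
  case empty
  then show ?case using small_const[of 0] by simp
next
  case (insert a A)
  then show ?case by (simp add: small_add)
qed

lemma small_cmult:
  assumes "small X" "c \<ge> 0" shows "small (\<lambda>k. c * X k)"
proof (cases "c = 0")
  case True
  then show ?thesis using small_const[of 0] by simp
next
  case False
  show ?thesis unfolding small_def
  proof (intro allI impI)
    fix e :: real assume "e > 0"
    then have "e / c > 0" using False assms by simp
    then have "eventually (\<lambda>k. X k \<le> e / c * \<phi> k) sequentially" using assms(1) unfolding small_def by blast
    then show "eventually (\<lambda>k. c * X k \<le> e * \<phi> k) sequentially"
      by eventually_elim (use False assms in \<open>simp add: field_simps\<close>)
  qed
qed

text \<open>A power of \<phi> and a shrinking interval are allowed, so the class is closed under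
  products and quotients, and under derivatives at the price of one more power. Only the logarithm
  of the bound enters the estimate of logarithmic derivatives.\<close>

definition adm :: "(complex \<Rightarrow> complex) \<Rightarrow> bool" where
  "adm h \<longleftrightarrow> nzmero h \<and> bad_radii h \<subseteq> B \<and> (\<exists>C p. \<exists>\<delta>>0. \<delta> \<le> 1 \<and> C \<ge> 1 \<and>
     (\<forall>k \<rho>. s k \<le> \<rho> \<longrightarrow> \<rho> < s k * (1 + \<delta> / \<phi> k) \<longrightarrow> \<rho> \<notin> B \<longrightarrow> nev h \<rho> \<le> C * \<phi> k ^ p))"

lemma adm_nzmero: "adm h \<Longrightarrow> nzmero h" and adm_bad: "adm h \<Longrightarrow> bad_radii h \<subseteq> B"
  by (auto simp: adm_def)

lemma radius_shrink:
  assumes "\<delta> \<le> \<delta>'" "\<rho> < s k * (1 + \<delta> / \<phi> k)"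
  shows "\<rho> < s k * (1 + \<delta>' / \<phi> k)"
proof -
  have "s k * (1 + \<delta> / \<phi> k) \<le> s k * (1 + \<delta>' / \<phi> k)"
    using assms(1) s_ge_1[of k] phi_ge_1[of k] by (intro mult_left_mono add_left_mono divide_right_mono) auto
  then show ?thesis using assms by linarith
qed

lemma adm_mult:
  assumes "adm f" "adm g"
  shows "adm (\<lambda>z. f z * g z)"
proof -
  obtain C1 p1 d1 where 1: "d1 > 0" "d1 \<le> 1" "C1 \<ge> 1" "\<And>k \<rho>. s k \<le> \<rho> \<Longrightarrow> \<rho> < s k * (1 + d1 / \<phi> k) \<Longrightarrow> \<rho> \<notin> B \<Longrightarrow> nev f \<rho> \<le> C1 * \<phi> k ^ p1"
    using assms(1) unfolding adm_def by blast
  obtain C2 p2 d2 where 2: "d2 > 0" "d2 \<le> 1" "C2 \<ge> 1" "\<And>k \<rho>. s k \<le> \<rho> \<Longrightarrow> \<rho> < s k * (1 + d2 / \<phi> k) \<Longrightarrow> \<rho> \<notin> B \<Longrightarrow> nev g \<rho> \<le> C2 * \<phi> k ^ p2"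
    using assms(2) unfolding adm_def by blast
  have "nev (\<lambda>z. f z * g z) \<rho> \<le> (C1 + C2) * \<phi> k ^ (p1 + p2)"
    if r: "s k \<le> \<rho>" "\<rho> < s k * (1 + min d1 d2 / \<phi> k)" "\<rho> \<notin> B" for k \<rho>
  proof -
    have "nev (\<lambda>z. f z * g z) \<rho> \<le> nev f \<rho> + nev g \<rho>"
      using assms r s_ge_1[of k] by (intro nev_mult) (auto simp: adm_def)
    also have "\<dots> \<le> C1 * \<phi> k ^ p1 + C2 * \<phi> k ^ p2"
      using r radius_shrink[of "min d1 d2" d1 \<rho> k] radius_shrink[of "min d1 d2" d2 \<rho> k]
      by (intro add_mono 1(4) 2(4)) auto
    also have "\<dots> \<le> C1 * \<phi> k ^ (p1 + p2) + C2 * \<phi> k ^ (p1 + p2)"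
      using 1 2 phi_ge_1[of k] by (intro add_mono mult_left_mono power_increasing) auto
    finally show ?thesis by (simp add: distrib_right)
  qed
  moreover have "nzmero (\<lambda>z. f z * g z)" using assms by (intro nzmero_mult) (auto simp: adm_def)
  moreover have "bad_radii (\<lambda>z. f z * g z) \<subseteq> B" using assms bad_radii_mult[of f g] by (auto simp: adm_def)
  moreover have "min d1 d2 > 0" "min d1 d2 \<le> 1" "C1 + C2 \<ge> 1" using 1 2 by auto
  ultimately show ?thesis unfolding adm_def by blast
qed

lemma adm_inverse:
  assumes "adm f"
  shows "adm (\<lambda>z. inverse (f z))"
proof -
  obtain C p d where 1: "d > 0" "d \<le> 1" "C \<ge> 1" "\<And>k \<rho>. s k \<le> \<rho> \<Longrightarrow> \<rho> < s k * (1 + d / \<phi> k) \<Longrightarrow> \<rho> \<notin> B \<Longrightarrow> nev f \<rho> \<le> C * \<phi> k ^ p"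
    using assms(1) unfolding adm_def by blast
  obtain c where c: "\<And>r. r > 0 \<Longrightarrow> r \<notin> bad_radii f \<Longrightarrow> nev (\<lambda>z. inverse (f z)) r = nev f r + c"
    using nev_inverse assms unfolding adm_def by blast
  have "nev (\<lambda>z. inverse (f z)) \<rho> \<le> (C + \<bar>c\<bar>) * \<phi> k ^ p"
    if r: "s k \<le> \<rho>" "\<rho> < s k * (1 + d / \<phi> k)" "\<rho> \<notin> B" for k \<rho>
  proof -
    have "nev (\<lambda>z. inverse (f z)) \<rho> = nev f \<rho> + c"
      using r s_ge_1[of k] assms by (intro c) (auto simp: adm_def)
    moreover have "nev f \<rho> \<le> C * \<phi> k ^ p" using 1(4) r by blast
    moreover have "\<bar>c\<bar> * 1 \<le> \<bar>c\<bar> * \<phi> k ^ p" using phi_ge_1[of k] by (intro mult_left_mono one_le_power) auto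
    ultimately show ?thesis by (simp add: distrib_right)
  qed
  moreover have "nzmero (\<lambda>z. inverse (f z))" using assms by (intro nzmero_inverse) (auto simp: adm_def)
  moreover have "bad_radii (\<lambda>z. inverse (f z)) \<subseteq> B" using assms bad_radii_inverse[of f] by (auto simp: adm_def)
  moreover have "C + \<bar>c\<bar> \<ge> 1" using 1 by auto
  ultimately show ?thesis unfolding adm_def using 1(1,2) by blast
qed

lemma adm_divide: "adm f \<Longrightarrow> adm g \<Longrightarrow> adm (\<lambda>z. f z / g z)"
  unfolding divide_inverse by (intro adm_mult adm_inverse)

lemma adm_const:
  assumes "c \<noteq> 0" shows "adm (\<lambda>z. c)"
proof -
  have "nev (\<lambda>z. c) \<rho> \<le> (1 + log_plus (cmod c)) * \<phi> k ^ 0" for k \<rho>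
    using assms by (simp add: nev_def prox_eq_cmean vcount_def poles_of_def zord_def)
  moreover have "bad_radii (\<lambda>z. c) = {}" using assms by (auto simp: bad_radii_def regular_at_def)
  moreover have "nzmero (\<lambda>z. c)" using assms by (rule nzmero_const)
  moreover have "1 + log_plus (cmod c) \<ge> 1" by simp
  ultimately show ?thesis unfolding adm_def
    by (intro conjI exI[of _ "1 + log_plus (cmod c)"] exI[of _ 0] exI[of _ 1]) auto
qed

lemma adm_power: "adm f \<Longrightarrow> adm (\<lambda>z. f z ^ j)"
  by (induction j) (auto intro!: adm_mult adm_const)

lemma adm_prod:
  assumes "finite A" "\<And>a. a \<in> A \<Longrightarrow> adm (f a)"
  shows "adm (\<lambda>z. \<Prod>a\<in>A. f a z)"
  using assms by (induction A rule: finite_induct) (auto intro!: adm_mult adm_const)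

lemma adm_shift:
  assumes f: "adm f" and n: "nzmero (\<lambda>z. f z - a)" and b: "bad_radii (\<lambda>z. f z - a) \<subseteq> B"
  shows "adm (\<lambda>z. f z - a)"
proof -
  obtain C p d where 1: "d > 0" "d \<le> 1" "C \<ge> 1" "\<And>k \<rho>. s k \<le> \<rho> \<Longrightarrow> \<rho> < s k * (1 + d / \<phi> k) \<Longrightarrow> \<rho> \<notin> B \<Longrightarrow> nev f \<rho> \<le> C * \<phi> k ^ p"
    using f unfolding adm_def by blast
  have "nev (\<lambda>z. f z - a) \<rho> \<le> (C + ln (1 + cmod a)) * \<phi> k ^ p"
    if r: "s k \<le> \<rho>" "\<rho> < s k * (1 + d / \<phi> k)" "\<rho> \<notin> B" for k \<rho>
  proof -
    have "nev (\<lambda>z. f z - a) \<rho> \<le> nev f \<rho> + ln (1 + cmod a)"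
      using r s_ge_1[of k] f n by (intro nev_shift_le good_radius_continuous) (auto simp: adm_def)
    moreover have "nev f \<rho> \<le> C * \<phi> k ^ p" using 1(4) r by blast
    moreover have "ln (1 + cmod a) * 1 \<le> ln (1 + cmod a) * \<phi> k ^ p"
      using phi_ge_1[of k] by (intro mult_left_mono one_le_power) auto
    ultimately show ?thesis by (simp add: distrib_right)
  qed
  moreover have "C + ln (1 + cmod a) \<ge> 1" using 1 by (simp add: add_increasing2)
  ultimately show ?thesis unfolding adm_def using 1(1,2) n b by blast
qed

lemma adm_log_deriv_bound:
  assumes h: "adm h"
  obtains C \<delta> where "C \<ge> 0" "\<delta> > 0" "\<delta> \<le> 1" "\<And>k \<rho>. s k \<le> \<rho> \<Longrightarrow> \<rho> < s k * (1 + \<delta> / \<phi> k) \<Longrightarrow> \<rho> \<notin> B \<Longrightarrow>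
    prox (\<lambda>z. deriv h z / h z) \<rho> \<le> C + C * ln (\<phi> k)"
proof -
  obtain D p d where 1: "d > 0" "d \<le> 1" "D \<ge> 1" "\<And>k \<rho>. s k \<le> \<rho> \<Longrightarrow> \<rho> < s k * (1 + d / \<phi> k) \<Longrightarrow> \<rho> \<notin> B \<Longrightarrow> nev h \<rho> \<le> D * \<phi> k ^ p"
    using h unfolding adm_def by blast
  obtain A where A: "A \<ge> 1" "\<And>r \<delta> M B. 1 \<le> r \<Longrightarrow> 0 < \<delta> \<Longrightarrow> \<delta> \<le> 1 \<Longrightarrow> M \<ge> 1 \<Longrightarrow> r \<notin> bad_radii h \<Longrightarrow> countable B \<Longrightarrow>
    (\<And>\<rho>. r < \<rho> \<Longrightarrow> \<rho> < r * (1 + \<delta>) \<Longrightarrow> \<rho> \<notin> B \<Longrightarrow> nev h \<rho> \<le> M) \<Longrightarrow>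
    prox (\<lambda>z. deriv h z / h z) r \<le> A + 2 * (ln M + ln (1 / \<delta>))"
    using log_deriv_prox[OF adm_nzmero[OF h]] by blast
  define C where "C = A + 2 * ln D + 2 * ln (8 / d) + 2 * real p + 2"
  have C: "C \<ge> 0" "C \<ge> 2 * real p + 2" using A(1) 1(1-3) by (auto simp: C_def)
  have "prox (\<lambda>z. deriv h z / h z) \<rho> \<le> C + C * ln (\<phi> k)"
    if r: "s k \<le> \<rho>" "\<rho> < s k * (1 + (d/2) / \<phi> k)" "\<rho> \<notin> B" for k \<rho>
  proof -
    \<comment> \<open>Half of the interval of h is used for \<rho> and a further relative step x/8
      for the radii to its right; (1 + x/2)(1 + x/8) \<le> 1 + x keeps them where h is
      controlled.\<close>
    define x where "x = d / \<phi> k"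
    have x: "x > 0" "x \<le> 1" using 1(1,2) phi_ge_1[of k] by (auto simp: x_def field_simps)
    have "prox (\<lambda>z. deriv h z / h z) \<rho> \<le> A + 2 * (ln (D * \<phi> k ^ p) + ln (1 / (x / 8)))"
    proof (rule A(2)[OF _ _ _ _ _ countable_B])
      show "1 \<le> \<rho>" using r s_ge_1[of k] by linarith
      show "D * \<phi> k ^ p \<ge> 1" using 1(3) phi_ge_1[of k] by (metis mult_mono' mult_1 one_le_power zero_le_one)
      show "\<rho> \<notin> bad_radii h" using adm_bad[OF h] r by blast
      fix \<rho>' assume r': "\<rho> < \<rho>'" "\<rho>' < \<rho> * (1 + x / 8)" "\<rho>' \<notin> B"
      have "x * x \<le> x * 1" using x by (intro mult_left_mono) auto
      moreover have "(1 + x / 2) * (1 + x / 8) = 1 + 5 / 8 * x + x * x / 16" by (simp add: field_simps)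
      ultimately have "(1 + x / 2) * (1 + x / 8) \<le> 1 + x" using x by linarith
      have r2: "\<rho> < s k * (1 + x / 2)" using r(2) by (simp add: x_def mult.commute)
      have "\<rho> * (1 + x / 8) \<le> (s k * (1 + x / 2)) * (1 + x / 8)"
        using r2 x by (intro mult_right_mono) auto
      also have "\<dots> \<le> s k * (1 + x)"
        unfolding mult.assoc using \<open>(1 + x / 2) * (1 + x / 8) \<le> 1 + x\<close> s_ge_1[of k] by (intro mult_left_mono) auto
      finally show "nev h \<rho>' \<le> D * \<phi> k ^ p" using r r' by (intro 1(4)) (auto simp: x_def)
    qed (use x in auto)
    also have "\<dots> = A + 2 * (ln D + p * ln (\<phi> k) + (ln (8 / d) + ln (\<phi> k)))"
      using 1(1,3) phi_ge_1[of k] by (simp add: x_def ln_mult ln_div ln_realpow)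
    also have "\<dots> = (C - 2 * real p - 2) + (2 * real p + 2) * ln (\<phi> k)" by (simp add: C_def algebra_simps)
    also have "\<dots> \<le> C + C * ln (\<phi> k)"
      using C phi_ge_1[of k] by (intro add_mono mult_right_mono) auto
    finally show ?thesis .
  qed
  then show ?thesis using C 1(1,2) by (intro that[of C "d/2"]) auto
qed

lemma adm_log_deriv_small:
  assumes "adm h"
  shows "small (\<lambda>k. prox (\<lambda>z. deriv h z / h z) (s k))"
proof -
  obtain C \<delta> where C: "C \<ge> 0" "\<delta> > 0" "\<delta> \<le> 1" "\<And>k \<rho>. s k \<le> \<rho> \<Longrightarrow> \<rho> < s k * (1 + \<delta> / \<phi> k) \<Longrightarrow> \<rho> \<notin> B \<Longrightarrow>
    prox (\<lambda>z. deriv h z / h z) \<rho> \<le> C + C * ln (\<phi> k)"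
    using adm_log_deriv_bound[OF assms] by blast
  have "prox (\<lambda>z. deriv h z / h z) (s k) \<le> C + C * ln (\<phi> k)" for k
  proof (rule C(4))
    have "s k * 1 < s k * (1 + \<delta> / \<phi> k)" using s_ge_1[of k] phi_ge_1[of k] C(2) by (intro mult_strict_left_mono) auto
    then show "s k < s k * (1 + \<delta> / \<phi> k)" by simp
  qed (use s_good in auto)
  then show ?thesis by (rule small_mono[OF small_ln])
qed

text \<open>The factorisation h' = h (h'/h) bounds the proximity function, and a pole of order p
  turns into one of order p + 1 \<le> 2p.\<close>

lemma adm_deriv:
  assumes h: "adm h" and n: "nzmero (deriv h)" and b: "bad_radii (deriv h) \<subseteq> B"
  shows "adm (deriv h)"
proof -
  obtain D p d where 1: "d > 0" "d \<le> 1" "D \<ge> 1" "\<And>k \<rho>. s k \<le> \<rho> \<Longrightarrow> \<rho> < s k * (1 + d / \<phi> k) \<Longrightarrow> \<rho> \<notin> B \<Longrightarrow> nev h \<rho> \<le> D * \<phi> k ^ p"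
    using h unfolding adm_def by blast
  obtain C \<delta> where C: "C \<ge> 0" "\<delta> > 0" "\<delta> \<le> 1" "\<And>k \<rho>. s k \<le> \<rho> \<Longrightarrow> \<rho> < s k * (1 + \<delta> / \<phi> k) \<Longrightarrow> \<rho> \<notin> B \<Longrightarrow>
    prox (\<lambda>z. deriv h z / h z) \<rho> \<le> C + C * ln (\<phi> k)"
    using adm_log_deriv_bound[OF h] by blast
  have "nev (deriv h) \<rho> \<le> (2 * D + 2 * C) * \<phi> k ^ Suc p"
    if r: "s k \<le> \<rho>" "\<rho> < s k * (1 + min d \<delta> / \<phi> k)" "\<rho> \<notin> B" for k \<rho>
  proof -
    have r1: "\<rho> \<ge> 1" using r s_ge_1[of k] by linarith
    have gh: "\<rho> \<notin> bad_radii h" using adm_bad[OF h] r by blast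
    have reg: "h z \<noteq> 0" if "cmod z = \<rho>" for z using good_radius_regular[OF gh that] by (simp add: regular_at_def)
    have "prox (deriv h) \<rho> = prox (\<lambda>z. h z * (deriv h z / h z)) \<rho>"
      unfolding prox_eq_cmean using reg r1 by (intro cmean_cong) auto
    also have "\<dots> \<le> prox h \<rho> + prox (\<lambda>z. deriv h z / h z) \<rho>"
      using r1 gh by (intro prox_mult good_radius_continuous good_radius_continuous_log_deriv) auto
    finally have p: "prox (deriv h) \<rho> \<le> prox h \<rho> + prox (\<lambda>z. deriv h z / h z) \<rho>" .
    have "vcount (poles_of (deriv h)) \<rho> \<le> vcount (\<lambda>z. 2 * poles_of h z) \<rho>"
    proof (intro vcount_mono locfin_cmult locfin_poles_of n adm_nzmero[OF h] r1)
      fix z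
      show "poles_of (deriv h) z \<le> 2 * poles_of h z"
      proof (cases "zorder h z < 0")
        case True
        then have "zord h z \<le> -1" "zord h z \<noteq> 0" unfolding zord_def by linarith+
        then show ?thesis using zord_deriv[OF adm_nzmero[OF h], of z] by (simp add: poles_of_def)
      next
        case False
        then show ?thesis using zord_deriv_nonneg[OF adm_nzmero[OF h] n, of z] by (simp add: poles_of_def zord_def)
      qed
    qed
    also have "\<dots> = 2 * vcount (poles_of h) \<rho>" by (rule vcount_cmult)
    finally have "nev (deriv h) \<rho> \<le> 2 * nev h \<rho> + prox (\<lambda>z. deriv h z / h z) \<rho>"
      using p prox_nonneg[OF _ good_radius_continuous[OF gh]] r1 by (simp add: nev_def)
    also have "\<dots> \<le> 2 * (D * \<phi> k ^ p) + (C + C * ln (\<phi> k))"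
      using r radius_shrink[of "min d \<delta>" d \<rho> k] radius_shrink[of "min d \<delta>" \<delta> \<rho> k]
      by (intro add_mono mult_left_mono 1(4) C(4)) auto
    also have "\<dots> \<le> 2 * (D * \<phi> k ^ Suc p) + (C * \<phi> k ^ Suc p + C * \<phi> k ^ Suc p)"
    proof (intro add_mono mult_left_mono)
      show "\<phi> k ^ p \<le> \<phi> k ^ Suc p" using phi_ge_1[of k] by (intro power_increasing) auto
      have g: "\<phi> k \<le> \<phi> k ^ Suc p" using phi_ge_1[of k] by (intro self_le_power) auto
      then show "ln (\<phi> k) \<le> \<phi> k ^ Suc p" using ln_bound[of "\<phi> k"] phi_ge_1[of k] by linarith
      show "C \<le> C * \<phi> k ^ Suc p" using C(1) g phi_ge_1[of k] mult_left_mono[of 1 "\<phi> k ^ Suc p" C] by linarith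
    qed (use 1 C in auto)
    finally show ?thesis by (simp add: algebra_simps)
  qed
  moreover have "min d \<delta> > 0" "min d \<delta> \<le> 1" "2 * D + 2 * C \<ge> 1" using 1 C by auto
  ultimately show ?thesis unfolding adm_def using n b by blast
qed

lemma jensen_sequence:
  assumes "nzmero h" "bad_radii h \<subseteq> B"
  obtains c where "\<And>k. cmean (\<lambda>z. ln (cmod (h z))) (s k) = vcount (zord h) (s k) + c"
proof -
  obtain c where c: "\<And>r. r > 0 \<Longrightarrow> r \<notin> bad_radii h \<Longrightarrow> cmean (\<lambda>z. ln (cmod (h z))) r = vcount (zord h) r + c"
    using jensen[OF assms(1)] by blast
  show ?thesis
  proof (rule that[of c])
    fix k
    have "s k > 0" using s_ge_1[of k] by linarith
    then show "cmean (\<lambda>z. ln (cmod (h z))) (s k) = vcount (zord h) (s k) + c"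
      using s_good[of k] assms(2) by (intro c) auto
  qed
qed

text \<open>Jensen's formula together with ln \<le> log+. Applied to a logarithmic derivative it
  says that zeros exceed poles by a small count only.\<close>

lemma zord_count_small:
  assumes "nzmero h" "bad_radii h \<subseteq> B" "small (\<lambda>k. prox h (s k))"
  shows "small (\<lambda>k. vcount (zord h) (s k))"
proof -
  obtain c where c: "\<And>k. cmean (\<lambda>z. ln (cmod (h z))) (s k) = vcount (zord h) (s k) + c"
    using jensen_sequence[OF assms(1,2)] by blast
  have "vcount (zord h) (s k) \<le> prox h (s k) + (- c)" for k
  proof -
    have g: "s k \<notin> bad_radii h" using s_good[of k] assms(2) by blast
    have "cmean (\<lambda>z. ln (cmod (h z))) (s k) \<le> prox h (s k)"
      unfolding prox_eq_cmean using good_radius_regular[OF g] s_ge_1[of k]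
      by (intro cmean_mono regular_at_continuous_ln continuous_on_log_plus good_radius_continuous[OF g] ln_le_log_plus) auto
    then show ?thesis using c[of k] by linarith
  qed
  then show ?thesis by (rule small_mono[OF small_add[OF assms(3) small_const[of "-c"]]])
qed

lemma adm_poles_count_le: "adm f \<Longrightarrow> vcount (pbar f) (s k) \<le> nev f (s k)"
proof -
  assume f: "adm f"
  have "vcount (pbar f) (s k) \<le> vcount (poles_of f) (s k)"
  proof (intro vcount_mono locfin_pbar locfin_poles_of adm_nzmero[OF f] s_ge_1)
    fix z
    show "pbar f z \<le> poles_of f z"
    proof (cases "zorder f z < 0")
      case True
      then have "zord f z \<le> -1" unfolding zord_def by linarith
      then show ?thesis by (simp add: pbar_def poles_of_def)
    qed (simp add: pbar_def zord_def)
  qed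
  also have "\<dots> \<le> nev f (s k)"
    using adm_bad[OF f] s_good[of k] s_ge_1[of k] by (intro poles_count_le_nev adm_nzmero[OF f]) auto
  finally show ?thesis .
qed

lemma zeros_count_shift_le:
  assumes f: "adm f" and a: "nzmero (\<lambda>z. f z - a)" "bad_radii (\<lambda>z. f z - a) \<subseteq> B"
  obtains C where "\<And>k. vcount (zeros_of (\<lambda>z. f z - a)) (s k) \<le> nev f (s k) + C"
proof -
  obtain C where C: "\<And>r. r > 0 \<Longrightarrow> r \<notin> bad_radii (\<lambda>z. f z - a) \<Longrightarrow>
      vcount (zeros_of (\<lambda>z. f z - a)) r \<le> nev (\<lambda>z. f z - a) r + C"
    using zeros_count_le_nev[OF a(1)] by blast
  have "vcount (zeros_of (\<lambda>z. f z - a)) (s k) \<le> nev f (s k) + (ln (1 + cmod a) + C)" for k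
  proof -
    have "vcount (zeros_of (\<lambda>z. f z - a)) (s k) \<le> nev (\<lambda>z. f z - a) (s k) + C"
      using s_ge_1[of k] s_good[of k] a(2) by (intro C) auto
    also have "nev (\<lambda>z. f z - a) (s k) \<le> nev f (s k) + ln (1 + cmod a)"
      using s_ge_1[of k] s_good[of k] adm_bad[OF f]
      by (intro nev_shift_le adm_nzmero[OF f] a good_radius_continuous) auto
    finally show ?thesis by simp
  qed
  then show ?thesis by (rule that)
qed

text \<open>Jensen's formula for W = f' / prod (f - a). With q = card A, the product |W| max(1,
  |f|)^(q-1) is dominated by the logarithmic derivatives f' / (f - a), so its logarithmic mean is
  small, while the divisor of W carries all the counting terms at once.\<close>

theorem second_main_theorem:
  assumes f: "adm f" and d: "nzmero (deriv f)" "bad_radii (deriv f) \<subseteq> B"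
    and A: "finite A" "A \<noteq> {}"
    and fa: "\<And>a. a \<in> A \<Longrightarrow> nzmero (\<lambda>z. f z - a)" "\<And>a. a \<in> A \<Longrightarrow> bad_radii (\<lambda>z. f z - a) \<subseteq> B"
  shows "small (\<lambda>k. (real (card A) - 1) * nev f (s k) + vcount (ram A f) (s k)
     - (\<Sum>a\<in>A. vcount (zbar (\<lambda>z. f z - a)) (s k)) - vcount (pbar f) (s k))"
proof -
  have cA: "real (card A) \<ge> 1" using A by (simp add: Suc_leI card_gt_0_iff)
  define Q where "Q = (\<lambda>z. \<Prod>a\<in>A. f z - a)"
  define W where "W = (\<lambda>z. deriv f z / Q z)"
  have Q: "nzmero Q" unfolding Q_def using A fa by (intro nzmero_prod) auto
  have W: "nzmero W" unfolding W_def by (rule nzmero_divide[OF d(1) Q])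
  have bQ: "bad_radii Q \<subseteq> B"
  proof
    fix r assume "r \<in> bad_radii Q"
    then obtain z where z: "r = cmod z" "\<not> regular_at Q z" by (auto simp: bad_radii_def)
    have "\<exists>a\<in>A. \<not> regular_at (\<lambda>z. f z - a) z"
    proof (rule ccontr)
      assume "\<not> ?thesis"
      then have "(\<lambda>z. f z - a) analytic_on {z}" "f z - a \<noteq> 0" if "a \<in> A" for a
        using that by (auto simp: regular_at_def)
      then have "regular_at Q z" unfolding Q_def regular_at_def using A(1)
        by (intro conjI analytic_on_prod) auto
      then show False using z by blast
    qed
    then show "r \<in> B" using fa(2) z by (fastforce simp: bad_radii_def)
  qed
  have bW: "bad_radii W \<subseteq> B" unfolding W_def using bad_radii_divide[of "deriv f" Q] d bQ by blast
  \<comment> \<open>At a pole of order p both sides are (q - 1) p - 1 with q = card A; at a point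
    over A both are -1; elsewhere both are the order of f'.\<close>
  have ordW: "zord W z = (real (card A) - 1) * poles_of f z + ram A f z - (\<Sum>a\<in>A. zbar (\<lambda>z. f z - a) z) - pbar f z" for z
  proof -
    have oW: "zord W z = zord (deriv f) z - (\<Sum>a\<in>A. zord (\<lambda>z. f z - a) z)"
    proof -
      have "zord Q z = (\<Sum>a\<in>A. zord (\<lambda>z. f z - a) z)" unfolding Q_def by (rule zord_prod[OF A(1) fa(1)])
      then show ?thesis unfolding W_def zord_divide[OF d(1) Q] by simp
    qed
    consider "zord f z < 0" | a where "zord f z \<ge> 0" "a \<in> A" "zord (\<lambda>z. f z - a) z > 0"
      | "zord f z \<ge> 0" "\<And>a. a \<in> A \<Longrightarrow> \<not> zord (\<lambda>z. f z - a) z > 0" by (meson not_le)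
    then show ?thesis
    proof cases
      case 1
      have "zord (\<lambda>z. f z - a) z = zord f z" if "a \<in> A" for a
        using zord_shift_pole[OF adm_nzmero[OF f] fa(1)[OF that], of z] 1 by (auto simp: poles_of_def max_def split: if_splits)
      then have "(\<Sum>a\<in>A. zord (\<lambda>z. f z - a) z) = real (card A) * zord f z" "(\<Sum>a\<in>A. zbar (\<lambda>z. f z - a) z) = 0"
        using 1 by (auto simp: zbar_def)
      moreover have "zord (deriv f) z = zord f z - 1" using zord_deriv[OF adm_nzmero[OF f]] 1 by simp
      ultimately show ?thesis using 1 by (simp add: oW ram_def pbar_def poles_of_def algebra_simps)
    next
      case 2
      have o: "zord (\<lambda>z. f z - b) z = (if b = a then zord (\<lambda>z. f z - a) z else 0)" if "b \<in> A" for b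
        using zord_shift_zero[OF fa(1)[OF 2(2)], of b z] 2 by auto
      have "(\<Sum>b\<in>A. zord (\<lambda>z. f z - b) z) = (\<Sum>b\<in>A. if b = a then zord (\<lambda>z. f z - a) z else 0)"
        by (intro sum.cong refl o)
      then have "(\<Sum>b\<in>A. zord (\<lambda>z. f z - b) z) = zord (\<lambda>z. f z - a) z" using 2 A by simp
      moreover have "(\<Sum>b\<in>A. zbar (\<lambda>z. f z - b) z) = (\<Sum>b\<in>A. if b = a then 1 else 0)"
      proof (rule sum.cong[OF refl])
        fix b assume "b \<in> A"
        then show "zbar (\<lambda>z. f z - b) z = (if b = a then 1 else 0)" using o[of b] 2(3) by (simp add: zbar_def)
      qed
      moreover have "zord (deriv f) z = zord (\<lambda>z. f z - a) z - 1"
        using zord_deriv[OF fa(1)[OF 2(2)], of z] 2 by (simp add: deriv_shift)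
      ultimately show ?thesis using 2 A by (auto simp: oW ram_def pbar_def poles_of_def)
    next
      case 3
      have "zord (\<lambda>z. f z - a) z = 0" if "a \<in> A" for a
        using zord_shift_pole[OF adm_nzmero[OF f] fa(1)[OF that], of z] 3(1) 3(2)[OF that]
        by (auto simp: poles_of_def max_def split: if_splits)
      then have "(\<Sum>a\<in>A. zord (\<lambda>z. f z - a) z) = 0" "(\<Sum>a\<in>A. zbar (\<lambda>z. f z - a) z) = 0" by (auto simp: zbar_def)
      then show ?thesis using 3 by (auto simp: oW ram_def pbar_def poles_of_def)
    qed
  qed
  obtain c where c: "\<And>k. cmean (\<lambda>z. ln (cmod (W z))) (s k) = vcount (zord W) (s k) + c"
    using jensen_sequence[OF W bW] by blast
  obtain C where C: "C \<ge> 1"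
    "\<And>w. w \<notin> A \<Longrightarrow> max 1 (cmod w) ^ (card A - 1) / (\<Prod>a\<in>A. cmod (w - a)) \<le> C * (\<Sum>a\<in>A. 1 / cmod (w - a))"
    using power_le_sum_prod_dist[OF A] by blast
  define E where "E = (\<lambda>k. (\<Sum>a\<in>A. prox (\<lambda>z. deriv f z / (f z - a)) (s k)) + ln (C * real (card A)))"
  have "small (\<lambda>k. prox (\<lambda>z. deriv f z / (f z - a)) (s k))" if "a \<in> A" for a
    using adm_log_deriv_small[OF adm_shift[OF f fa(1)[OF that] fa(2)[OF that]]] by (simp add: deriv_shift)
  then have E: "small E" unfolding E_def using A by (intro small_add small_sum small_const) auto
  have main: "cmean (\<lambda>z. ln (cmod (W z))) (s k) + (real (card A) - 1) * prox f (s k) \<le> E k" for k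
  proof -
    have s0: "s k \<ge> 0" using s_ge_1[of k] by simp
    have gf: "s k \<notin> bad_radii f" and gW: "s k \<notin> bad_radii W" and gd: "s k \<notin> bad_radii (deriv f)"
      using s_good[of k] adm_bad[OF f] bW d by auto
    have ga: "s k \<notin> bad_radii (\<lambda>z. f z - a)" if "a \<in> A" for a using s_good[of k] fa(2)[OF that] by auto
    have contf: "continuous_on (sphere 0 (s k)) (\<lambda>z. (real (card A) - 1) * log_plus (cmod (f z)))"
      by (intro continuous_on_mult_left continuous_on_log_plus good_radius_continuous gf)
    have contW: "continuous_on (sphere 0 (s k)) (\<lambda>z. ln (cmod (W z)))"
      using good_radius_regular[OF gW] by (intro regular_at_continuous_ln) auto
    have "cmean (\<lambda>z. ln (cmod (W z))) (s k) + (real (card A) - 1) * prox f (s k)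
      = cmean (\<lambda>z. ln (cmod (W z)) + (real (card A) - 1) * log_plus (cmod (f z))) (s k)"
      unfolding prox_eq_cmean cmean_cmult[symmetric]
      by (rule cmean_add[symmetric]) (rule contW contf s0)+
    also have "\<dots> \<le> E k" unfolding E_def
    proof (rule cmean_le_sum_prox[OF s0 A C(1)])
      show "continuous_on (sphere 0 (s k)) (\<lambda>z. ln (cmod (W z)) + (real (card A) - 1) * log_plus (cmod (f z)))"
        by (intro continuous_on_add contW contf)
      fix a assume a: "a \<in> A"
      show "continuous_on (sphere 0 (s k)) (\<lambda>z. deriv f z / (f z - a))"
        using good_radius_continuous_log_deriv[OF ga[OF a]] by (simp add: deriv_shift)
    next
      fix z assume z: "cmod z = s k"
      have fz: "f z \<notin> A" using ga z good_radius_regular[of "s k" "\<lambda>w. f w - f z" z] by (auto simp: regular_at_def)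
      have Wz: "W z \<noteq> 0" using good_radius_regular[OF gW z] by (simp add: regular_at_def)
      have "exp ((real (card A) - 1) * log_plus (cmod (f z))) = max 1 (cmod (f z)) ^ (card A - 1)"
      proof -
        have "(real (card A) - 1) * log_plus (cmod (f z)) = real (card A - 1) * ln (max 1 (cmod (f z)))"
          using A by (simp add: log_plus_alt of_nat_diff Suc_leI card_gt_0_iff)
        then show ?thesis by (simp add: exp_of_nat_mult)
      qed
      then have "exp (ln (cmod (W z)) + (real (card A) - 1) * log_plus (cmod (f z)))
         = cmod (W z) * max 1 (cmod (f z)) ^ (card A - 1)" using Wz by (simp add: exp_add)
      also have "\<dots> = cmod (deriv f z) * (max 1 (cmod (f z)) ^ (card A - 1) / (\<Prod>a\<in>A. cmod (f z - a)))"
        by (simp add: W_def Q_def norm_divide prod_norm)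
      also have "\<dots> \<le> cmod (deriv f z) * (C * (\<Sum>a\<in>A. 1 / cmod (f z - a)))"
        by (intro mult_left_mono C(2) fz) auto
      also have "\<dots> = C * (\<Sum>a\<in>A. cmod (deriv f z / (f z - a)))"
        by (simp add: sum_distrib_left norm_divide mult_ac)
      finally show "exp (ln (cmod (W z)) + (real (card A) - 1) * log_plus (cmod (f z))) \<le> C * (\<Sum>a\<in>A. cmod (deriv f z / (f z - a)))" .
    qed
    finally show ?thesis .
  qed
  have cnt: "vcount (zord W) r = (real (card A) - 1) * vcount (poles_of f) r + vcount (ram A f) r
     - (\<Sum>a\<in>A. vcount (zbar (\<lambda>z. f z - a)) r) - vcount (pbar f) r" for r
  proof -
    note lf = locfin_cmult[OF locfin_poles_of[OF adm_nzmero[OF f]], of "real (card A) - 1"]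
      locfin_ram[OF d(1), of A] locfin_pbar[OF adm_nzmero[OF f]]
    have lz: "locfin (zbar (\<lambda>z. f z - a))" if "a \<in> A" for a by (rule locfin_zbar[OF fa(1)[OF that]])
    have ls: "locfin (\<lambda>z. \<Sum>a\<in>A. zbar (\<lambda>z. f z - a) z)" by (rule locfin_sum[OF A(1) lz])
    have "zord W = (\<lambda>z. (real (card A) - 1) * poles_of f z + ram A f z - (\<Sum>a\<in>A. zbar (\<lambda>z. f z - a) z) - pbar f z)"
      using ordW by (rule ext)
    then show ?thesis
      using vcount_diff[OF locfin_diff[OF locfin_add[OF lf(1,2)] ls] lf(3), of r]
        vcount_diff[OF locfin_add[OF lf(1,2)] ls, of r] vcount_add[OF lf(1,2), of r]
        vcount_sum[OF A(1) lz, where r = r] by (simp add: vcount_cmult)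
  qed
  have "(real (card A) - 1) * nev f (s k) + vcount (ram A f) (s k)
     - (\<Sum>a\<in>A. vcount (zbar (\<lambda>z. f z - a)) (s k)) - vcount (pbar f) (s k) \<le> E k + (- c)" for k
    using main[of k] c[of k] cnt[of "s k"] by (simp add: nev_def distrib_left)
  then show ?thesis by (rule small_mono[OF small_add[OF E small_const]])
qed

end

section \<open>The polynomial and the characteristic of nonconstant functions\<close>

text \<open>A sparse set does not disconnect the plane, so vanishing of the derivative off such a
  set forces one constant value, not merely a locally constant one.\<close>

lemma nzmero_deriv_or_constant:
  assumes h: "h meromorphic_on UNIV"
  obtains "nzmero (deriv h)" | c where "eventually (\<lambda>z. h z = c) (cosparse UNIV)"
proof (cases "nzmero (deriv h)")
  case False
  have d: "deriv h meromorphic_on UNIV" using h by (intro meromorphic_intros)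
  then have "\<not> eventually (\<lambda>z. deriv h z \<noteq> 0) (cosparse UNIV)" using False by (simp add: nzmero_def)
  then have "eventually (\<lambda>z. deriv h z = 0) (cosparse UNIV)"
    using meromorphic_imp_constant_or_avoid[OF d open_UNIV connected_UNIV, of 0] by blast
  moreover have "eventually (\<lambda>z. h analytic_on {z}) (cosparse UNIV)"
    using h by (rule meromorphic_on_imp_analytic_cosparse)
  ultimately have ev: "eventually (\<lambda>z. h analytic_on {z} \<and> deriv h z = 0) (cosparse UNIV)"
    by eventually_elim auto
  define X where "X = {z. \<not> (h analytic_on {z} \<and> deriv h z = 0)}"
  have X: "X sparse_in UNIV" using ev by (simp add: X_def eventually_cosparse)
  have an: "h analytic_on {z}" "deriv h z = 0" if "z \<in> UNIV - X" for z using that by (auto simp: X_def)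
  have "h analytic_on (UNIV - X)" by (subst analytic_on_analytic_at) (use an in auto)
  then have cont: "continuous_on (UNIV - X) h" by (intro holomorphic_on_imp_continuous_on analytic_imp_holomorphic)
  have "connected (UNIV - X)" using X by (intro sparse_imp_connected) auto
  moreover have "open (UNIV - X)" using X by (intro open_diff_sparse_pts) auto
  moreover have "\<forall>z\<in>(UNIV - X) - {}. DERIV h z :> 0"
  proof
    fix z assume "z \<in> UNIV - X - {}"
    then have "h analytic_on {z}" "deriv h z = 0" using an by auto
    then show "DERIV h z :> 0"
      by (metis DERIV_deriv_iff_field_differentiable analytic_on_imp_differentiable_at singletonI)
  qed
  ultimately obtain c where c: "\<And>z. z \<in> UNIV - X \<Longrightarrow> h z = c"
    using DERIV_zero_connected_constant[OF _ _ finite.emptyI cont] by metis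
  have "eventually (\<lambda>z. h z = c) (cosparse UNIV)"
    using ev by eventually_elim (use c in \<open>auto simp: X_def\<close>)
  then show ?thesis using that by blast
qed (use that in blast)

lemma nice_shift_nzmero:
  assumes "f nicely_meromorphic_on UNIV" "\<not> (\<exists>c. \<forall>z. f z = c)"
  shows "nzmero (\<lambda>z. f z - a)"
proof -
  have "eventually (\<lambda>z. f z \<noteq> a) (cosparse UNIV)"
    using nicely_meromorphic_imp_constant_or_avoid[OF assms(1) open_UNIV connected_UNIV, of a] assms(2) by blast
  moreover have "f meromorphic_on UNIV" using assms(1) by (simp add: nicely_meromorphic_on_def)
  ultimately show ?thesis by (auto simp: nzmero_def intro!: meromorphic_intros)
qed

lemma nice_nzmero:
  assumes "f nicely_meromorphic_on UNIV" "\<not> (\<exists>c. \<forall>z. f z = c)"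
  shows "nzmero f"
  using nice_shift_nzmero[OF assms, of 0] by simp

lemma nice_eventually_constant:
  assumes "f nicely_meromorphic_on UNIV" "eventually (\<lambda>z. f z = c) (cosparse UNIV)"
  shows "f z = c"
proof -
  have "eventually (\<lambda>w. f w = c) (at z)" using assms(2) by (rule eventually_cosparse_UNIV_at)
  then have "frequently (\<lambda>w. f w = c) (at z)" by (simp add: eventually_frequently)
  then show ?thesis using frequently_eq_meromorphic_imp_constant[of f c z UNIV z] assms(1) by auto
qed

lemma nice_deriv_nzmero:
  assumes "f nicely_meromorphic_on UNIV" "\<not> (\<exists>c. \<forall>z. f z = c)"
  shows "nzmero (deriv f)"
proof (rule nzmero_deriv_or_constant[of f])
  show "f meromorphic_on UNIV" using assms(1) by (simp add: nicely_meromorphic_on_def)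
  fix c assume "eventually (\<lambda>z. f z = c) (cosparse UNIV)"
  then show ?thesis using nice_eventually_constant[OF assms(1)] assms(2) by blast
qed

lemma nice_eventually_eq:
  assumes "f nicely_meromorphic_on UNIV" "g nicely_meromorphic_on UNIV"
    "eventually (\<lambda>z. f z = g z) (cosparse UNIV)"
  shows "f = g"
proof
  fix z
  have ev: "eventually (\<lambda>w. f w = g w) (at z)" using assms(3) by (rule eventually_cosparse_UNIV_at)
  have 1: "(is_pole f z \<and> f z = 0) \<or> f \<midarrow>z\<rightarrow> f z" "(is_pole g z \<and> g z = 0) \<or> g \<midarrow>z\<rightarrow> g z"
    using assms(1,2) by (auto simp: nicely_meromorphic_on_def)
  have p: "is_pole f z \<longleftrightarrow> is_pole g z" using ev by (rule is_pole_cong) simp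
  have l: "f \<midarrow>z\<rightarrow> c \<longleftrightarrow> g \<midarrow>z\<rightarrow> c" for c by (rule tendsto_cong[OF ev])
  show "f z = g z"
  proof (cases "is_pole f z")
    case True
    then have "\<not> f \<midarrow>z\<rightarrow> f z" "\<not> g \<midarrow>z\<rightarrow> g z"
      using p at_neq_bot by (auto simp: is_pole_def dest: not_tendsto_and_filterlim_at_infinity[OF at_neq_bot])
    then show ?thesis using 1 by auto
  next
    case False
    then have "f \<midarrow>z\<rightarrow> f z" "f \<midarrow>z\<rightarrow> g z" using 1 p l by auto
    then show ?thesis by (rule LIM_unique)
  qed
qed

lemma nice_pole_iff:
  assumes "f nicely_meromorphic_on UNIV" "\<not> (\<exists>c. \<forall>z. f z = c)"
  shows "is_pole f z \<longleftrightarrow> zorder f z < 0"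
  using zorder_neg_imp_is_pole[of f z] isolated_pole_imp_neg_zorder[of f z] nzmeroD[OF nice_nzmero[OF assms]] by blast

lemma nice_value_iff:
  assumes "f nicely_meromorphic_on UNIV" "\<not> (\<exists>c. \<forall>z. f z = c)"
  shows "\<not> is_pole f z \<and> f z = a \<longleftrightarrow> zorder (\<lambda>w. f w - a) z > 0"
proof (cases "is_pole f z")
  case True
  then have "poles_of (\<lambda>w. f w - a) z > 0"
    using zord_shift_pole[OF nice_nzmero[OF assms] nice_shift_nzmero[OF assms]] nice_pole_iff[OF assms, of z]
    by (simp add: poles_of_def zord_def)
  then show ?thesis using True by (simp add: poles_of_def zord_def)
next
  case False
  then have "f analytic_on {z}" using nicely_meromorphic_on_imp_analytic_at[OF assms(1)] by auto
  then have "(\<lambda>w. f w - a) analytic_on {z}" by (intro analytic_intros)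
  then have "zorder (\<lambda>w. f w - a) z > 0 \<longleftrightarrow> f z - a = 0"
    using zorder_pos_iff' nzmeroD(3)[OF nice_shift_nzmero[OF assms]] by blast
  then show ?thesis using False by simp
qed

section \<open>Translation of the given counting functions into divisors\<close>

lemma apt_mult_Some:
  assumes "f nicely_meromorphic_on UNIV" "\<not> (\<exists>c. \<forall>z. f z = c)"
  shows "real (apt_mult f (Some a) z) = zeros_of (\<lambda>w. f w - a) z"
  using nice_value_iff[OF assms, of z a] by (auto simp: apt_mult_def zeros_of_def zord_def)

lemma apt_mult_None:
  assumes "f nicely_meromorphic_on UNIV" "\<not> (\<exists>c. \<forall>z. f z = c)"
  shows "real (apt_mult f None z) = poles_of f z"
  using nice_pole_iff[OF assms, of z] by (auto simp: apt_mult_def poles_of_def zord_def)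

lemma N_count_eq:
  assumes D: "\<And>z. real (apt_mult f a z) = D z" "locfin D" and r: "r > 0"
  shows "N_count f a r = vcount D r"
  unfolding N_count_def
proof (rule integrated_count_eq_count[OF D(2) r])
  fix t
  have "apts_disc f a t = {z. cmod z \<le> t \<and> D z \<noteq> 0}"
    by (auto simp: apts_disc_def simp flip: D(1))
  then show "n_count f a t = (\<Sum>z | cmod z \<le> t \<and> D z \<noteq> 0. D z)"
    by (simp add: n_count_def D(1))
qed

lemma Nbar_count_eq:
  assumes D: "\<And>z. of_bool (apt_mult f a z > 0) = D z" "locfin D" and r: "r > 0"
  shows "Nbar_count f a r = vcount D r"
  unfolding Nbar_count_def
proof (rule integrated_count_eq_count[OF D(2) r])
  fix t
  have "apts_disc f a t = {z. cmod z \<le> t \<and> D z \<noteq> 0}"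
    by (auto simp: apts_disc_def simp flip: D(1))
  moreover have "D z = 1" if "D z \<noteq> 0" for z using that D(1)[of z] by (cases "apt_mult f a z > 0") auto
  then have "(\<Sum>z | cmod z \<le> t \<and> D z \<noteq> 0. D z) = (\<Sum>z | cmod z \<le> t \<and> D z \<noteq> 0. 1)"
    by (intro sum.cong) auto
  ultimately show "nbar_count f a t = (\<Sum>z | cmod z \<le> t \<and> D z \<noteq> 0. D z)"
    by (simp add: nbar_count_def)
qed

context
  fixes f :: "complex \<Rightarrow> complex"
  assumes nice: "f nicely_meromorphic_on UNIV" and nonconst: "\<not> (\<exists>c. \<forall>z. f z = c)"
begin

lemma nev_char_eq: "r > 0 \<Longrightarrow> nev_char f r = nev f r"
  unfolding nev_char_def nev_def
  by (subst N_count_eq[where D = "poles_of f"])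
    (auto simp: apt_mult_None[OF nice nonconst] intro: locfin_poles_of nice_nzmero[OF nice nonconst])

lemma Nbar_Some_eq: "r > 0 \<Longrightarrow> Nbar_count f (Some a) r = vcount (zbar (\<lambda>z. f z - a)) r"
proof (rule Nbar_count_eq)
  fix z
  have "apt_mult f (Some a) z > 0 \<longleftrightarrow> zeros_of (\<lambda>w. f w - a) z > 0"
    using apt_mult_Some[OF nice nonconst, of a z] by (metis of_nat_0_less_iff)
  then show "of_bool (apt_mult f (Some a) z > 0) = zbar (\<lambda>z. f z - a) z"
    by (simp add: zbar_def zeros_of_def)
qed (auto intro: locfin_zbar nice_shift_nzmero[OF nice nonconst])

lemma Nbar_None_eq: "r > 0 \<Longrightarrow> Nbar_count f None r = vcount (pbar f) r"
proof (rule Nbar_count_eq)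
  fix z
  have "apt_mult f None z > 0 \<longleftrightarrow> poles_of f z > 0"
    using apt_mult_None[OF nice nonconst, of z] by (metis of_nat_0_less_iff)
  then show "of_bool (apt_mult f None z > 0) = pbar f z"
    by (simp add: pbar_def poles_of_def)
qed (auto intro: locfin_pbar nice_nzmero[OF nice nonconst])

text \<open>A single point z0 with f(z0) = a contributes ln(r / |z0|) to the count of a-points, and
  the first main theorem passes this lower bound on to the characteristic.\<close>

lemma nice_nev_unbounded:
  obtains B where "countable B" "bad_radii f \<subseteq> B" "\<And>K. \<exists>R. \<forall>r\<ge>R. r \<notin> B \<longrightarrow> nev f r \<ge> K"
proof -
  obtain z0 where z0: "f analytic_on {z0}"
    using cosparse_UNIV_ex meromorphic_on_imp_analytic_cosparse nice unfolding nicely_meromorphic_on_def by blast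
  define a where "a = f z0"
  have fa: "nzmero (\<lambda>z. f z - a)" by (rule nice_shift_nzmero[OF nice nonconst])
  have f: "nzmero f" by (rule nice_nzmero[OF nice nonconst])
  have "\<not> is_pole f z0" using z0 analytic_at_imp_no_pole by blast
  then have "zorder (\<lambda>w. f w - a) z0 > 0" using nice_value_iff[OF nice nonconst, of z0 a] by (simp add: a_def)
  then have z0a: "zeros_of (\<lambda>w. f w - a) z0 \<ge> 1" by (simp add: zeros_of_def zord_def)
  define B where "B = bad_radii f \<union> bad_radii (\<lambda>z. f z - a)"
  obtain C where C: "\<And>r. r > 0 \<Longrightarrow> r \<notin> bad_radii (\<lambda>z. f z - a) \<Longrightarrow>
      vcount (zeros_of (\<lambda>z. f z - a)) r \<le> nev (\<lambda>z. f z - a) r + C"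
    using zeros_count_le_nev[OF fa] by blast
  have "\<exists>R. \<forall>r\<ge>R. r \<notin> B \<longrightarrow> nev f r \<ge> K" for K
  proof -
    define E where "E = K + ln (1 + cmod a) + C"
    define R where "R = max 1 (max (cmod z0) 1 * exp E)"
    have "nev f r \<ge> K" if r: "r \<ge> max R (cmod z0)" "r \<notin> B" for r
    proof -
      have r1: "r \<ge> 1" "r \<ge> cmod z0" "r > 0" using r by (auto simp: R_def)
      have "exp E \<le> r / max (cmod z0) 1" using r by (auto simp: R_def pos_le_divide_eq mult.commute)
      then have "E \<le> ln (r / max (cmod z0) 1)" using r1 by (subst ln_ge_iff) auto
      also have "\<dots> \<le> wt r z0"
        using r1 by (auto simp: wt_def intro!: divide_left_mono)
      also have "\<dots> \<le> vcount (zeros_of (\<lambda>z. f z - a)) r"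
        using r1 z0a by (intro vcount_ge_point locfin_zeros_of fa) auto
      also have "\<dots> \<le> nev (\<lambda>z. f z - a) r + C" using r1 r by (intro C) (auto simp: B_def)
      also have "nev (\<lambda>z. f z - a) r \<le> nev f r + ln (1 + cmod a)"
        using r1 r by (intro nev_shift_le f fa good_radius_continuous) (auto simp: B_def)
      finally show ?thesis by (simp add: E_def)
    qed
    then show ?thesis by blast
  qed
  moreover have "countable B" using countable_bad_radii[OF f] countable_bad_radii[OF fa] by (simp add: B_def)
  ultimately show ?thesis by (intro that[of B]) (auto simp: B_def)
qed

end

text \<open>The growth argument is applied to the sum of the characteristics, so one sequence
  controls both functions; doubling of the sum is admissibility with C = 2, p = 1 and \<delta> =
  1.\<close>

lemma growth_sequence_exists:
  assumes f: "f nicely_meromorphic_on UNIV" "\<not> (\<exists>c. \<forall>z. f z = c)"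
    and g: "g nicely_meromorphic_on UNIV" "\<not> (\<exists>c. \<forall>z. g z = c)"
    and B0: "countable B0"
  obtains s B where "B0 \<subseteq> B" "growth_sequence s (\<lambda>k. nev f (s k) + nev g (s k)) B"
    "growth_sequence.adm s (\<lambda>k. nev f (s k) + nev g (s k)) B f"
    "growth_sequence.adm s (\<lambda>k. nev f (s k) + nev g (s k)) B g"
    "filterlim s at_top sequentially"
    "filterlim (\<lambda>k. nev f (s k)) at_top sequentially" "filterlim (\<lambda>k. nev g (s k)) at_top sequentially"
proof -
  obtain Bf where Bf: "countable Bf" "bad_radii f \<subseteq> Bf" "\<And>K. \<exists>R. \<forall>r\<ge>R. r \<notin> Bf \<longrightarrow> nev f r \<ge> K"
    using nice_nev_unbounded[OF f] by blast
  obtain Bg where Bg: "countable Bg" "bad_radii g \<subseteq> Bg" "\<And>K. \<exists>R. \<forall>r\<ge>R. r \<notin> Bg \<longrightarrow> nev g r \<ge> K"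
    using nice_nev_unbounded[OF g] by blast
  have nf: "nzmero f" and ng: "nzmero g" using nice_nzmero f g by auto
  define B where "B = B0 \<union> Bf \<union> Bg"
  define T where "T = (\<lambda>r. nev f r + nev g r)"
  have cB: "countable B" using B0 Bf Bg by (simp add: B_def)
  have bdd: "\<exists>C. \<forall>r. 1 \<le> r \<longrightarrow> r \<le> R \<longrightarrow> r \<notin> B \<longrightarrow> T r \<le> C" for R
  proof -
    obtain C1 where C1: "\<And>r. 1 \<le> r \<Longrightarrow> r \<le> max 1 R \<Longrightarrow> r \<notin> bad_radii f \<Longrightarrow> nev f r \<le> C1"
      using nev_locally_bounded[OF nf, of "max 1 R"] by auto
    obtain C2 where C2: "\<And>r. 1 \<le> r \<Longrightarrow> r \<le> max 1 R \<Longrightarrow> r \<notin> bad_radii g \<Longrightarrow> nev g r \<le> C2"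
      using nev_locally_bounded[OF ng, of "max 1 R"] by auto
    have "T r \<le> C1 + C2" if "1 \<le> r" "r \<le> R" "r \<notin> B" for r
      unfolding T_def using that Bf(2) Bg(2) by (intro add_mono C1 C2) (auto simp: B_def)
    then show ?thesis by blast
  qed
  have unb: "\<exists>R. \<forall>r\<ge>R. r \<notin> B \<longrightarrow> T r \<ge> K" for K
  proof -
    obtain R where R: "\<And>r. r \<ge> R \<Longrightarrow> r \<notin> Bf \<Longrightarrow> nev f r \<ge> K" using Bf(3) by blast
    have "T r \<ge> K" if "r \<ge> max 1 R" "r \<notin> B" for r
    proof -
      have "nev g r \<ge> 0" using that Bg(2) by (intro nev_nonneg[OF ng]) (auto simp: B_def)
      then show ?thesis using R[of r] that by (simp add: T_def B_def)
    qed
    then show ?thesis by blast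
  qed
  have "\<exists>s. s \<ge> real k + 1 \<and> s \<notin> B \<and> T s \<ge> real k + 1 \<and>
     (\<forall>\<rho>. s < \<rho> \<longrightarrow> \<rho> < s * (1 + 1 / T s) \<longrightarrow> \<rho> \<notin> B \<longrightarrow> T \<rho> \<le> 2 * T s)" for k :: nat
  proof -
    have "real k + 1 \<ge> 1" by simp
    from growth_radius[OF cB bdd unb this] show ?thesis by metis
  qed
  then obtain s where s: "\<And>k. s k \<ge> real k + 1" "\<And>k. s k \<notin> B" "\<And>k. T (s k) \<ge> real k + 1"
     "\<And>k \<rho>. s k < \<rho> \<Longrightarrow> \<rho> < s k * (1 + 1 / T (s k)) \<Longrightarrow> \<rho> \<notin> B \<Longrightarrow> T \<rho> \<le> 2 * T (s k)"
    by metis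
  have s1: "s k \<ge> 1" for k using s(1)[of k] by linarith
  have klim: "filterlim (\<lambda>k. real k + 1) at_top sequentially"
    by (intro filterlim_at_top_mono[OF filterlim_real_sequentially]) auto
  have slim: "filterlim s at_top sequentially"
    by (rule filterlim_at_top_mono[OF klim]) (use s in auto)
  have nlim: "filterlim (\<lambda>k. nev h (s k)) at_top sequentially"
    if unbh: "\<And>K. \<exists>R. \<forall>r\<ge>R. r \<notin> B' \<longrightarrow> nev h r \<ge> K" and sub: "B' \<subseteq> B" for h B'
    unfolding filterlim_at_top
  proof
    fix K
    obtain R where R: "\<And>r. r \<ge> R \<Longrightarrow> r \<notin> B' \<Longrightarrow> nev h r \<ge> K" using unbh by blast
    have "eventually (\<lambda>k. s k \<ge> R) sequentially" using slim by (simp add: filterlim_at_top)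
    then show "eventually (\<lambda>k. K \<le> nev h (s k)) sequentially"
      by eventually_elim (use R s(2) sub in blast)
  qed
  interpret growth_sequence s "\<lambda>k. T (s k)" B
  proof
    show "1 \<le> T (s k)" for k using s(3)[of k] by linarith
    show "filterlim (\<lambda>k. T (s k)) at_top sequentially"
      by (rule filterlim_at_top_mono[OF klim]) (use s in auto)
  qed (use cB s1 s in auto)
  have adm: "adm h" if h: "nzmero h" "bad_radii h \<subseteq> B" "\<And>r. r \<ge> 1 \<Longrightarrow> r \<notin> B \<Longrightarrow> nev h r \<le> T r" for h
  proof -
    have "nev h \<rho> \<le> 2 * T (s k) ^ 1" if r: "s k \<le> \<rho>" "\<rho> < s k * (1 + 1 / T (s k))" "\<rho> \<notin> B" for k \<rho>
    proof -
      have "nev h \<rho> \<le> T \<rho>" using r s1[of k] by (intro h(3)) auto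
      also have "T \<rho> \<le> 2 * T (s k)"
        using r s(4)[of k \<rho>] s(3)[of k] by (cases "\<rho> = s k") auto
      finally show ?thesis by simp
    qed
    then have "\<exists>C p. \<exists>\<delta>>0. \<delta> \<le> 1 \<and> C \<ge> 1 \<and>
     (\<forall>k \<rho>. s k \<le> \<rho> \<longrightarrow> \<rho> < s k * (1 + \<delta> / T (s k)) \<longrightarrow> \<rho> \<notin> B \<longrightarrow> nev h \<rho> \<le> C * T (s k) ^ p)"
      by (rule_tac exI[of _ 2], rule_tac exI[of _ 1], rule_tac exI[of _ 1]) auto
    then show ?thesis using h(1,2) unfolding adm_def by blast
  qed
  have "adm f"
  proof (rule adm[OF nf])
    show "bad_radii f \<subseteq> B" using Bf by (auto simp: B_def)
    fix r assume "r \<ge> 1" "r \<notin> B"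
    then have "nev g r \<ge> 0" using Bg(2) by (intro nev_nonneg[OF ng]) (auto simp: B_def)
    then show "nev f r \<le> T r" by (simp add: T_def)
  qed
  moreover have "adm g"
  proof (rule adm[OF ng])
    show "bad_radii g \<subseteq> B" using Bg by (auto simp: B_def)
    fix r assume "r \<ge> 1" "r \<notin> B"
    then have "nev f r \<ge> 0" using Bf(2) by (intro nev_nonneg[OF nf]) (auto simp: B_def)
    then show "nev g r \<le> T r" by (simp add: T_def)
  qed
  moreover have "growth_sequence s (\<lambda>k. T (s k)) B" by (rule growth_sequence_axioms)
  moreover have "filterlim (\<lambda>k. nev f (s k)) at_top sequentially" by (rule nlim[OF Bf(3)]) (auto simp: B_def)
  moreover have "filterlim (\<lambda>k. nev g (s k)) at_top sequentially" by (rule nlim[OF Bg(3)]) (auto simp: B_def)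
  ultimately show ?thesis using slim unfolding T_def by (intro that[of B s]) (auto simp: B_def)
qed

section \<open>The polynomial, its critical points and its fibres\<close>

definition P_pol :: "nat \<Rightarrow> nat \<Rightarrow> complex poly" where
  "P_pol n m = (\<Sum>i\<le>m. monom (of_nat (m choose i) * (-1) ^ i / of_nat (n + m + 1 - i)) (n + m + 1 - i)) + 1"

lemma poly_P_pol: "poly (P_pol n m) z = P_poly n m z"
  by (simp add: P_pol_def P_poly_def poly_sum poly_monom atLeast0AtMost)

lemma pderiv_sum: "pderiv (\<Sum>i\<in>A. f i) = (\<Sum>i\<in>A. pderiv (f i))"
  by (induction A rule: infinite_finite_induct) (auto simp: pderiv_add)

text \<open>Differentiation cancels the denominators and leaves z^n times the binomial expansion of
  (z - 1)^m.\<close>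

lemma pderiv_P_pol: "pderiv (P_pol n m) = [:0, 1:] ^ n * [:-1, 1:] ^ m"
proof -
  have "poly (pderiv (P_pol n m)) z = poly ([:0, 1:] ^ n * [:-1, 1:] ^ m) z" for z
  proof -
    have "poly (pderiv (P_pol n m)) z = (\<Sum>i\<le>m. of_nat (m choose i) * (-1) ^ i * z ^ (n + m - i))"
    proof -
      have "of_nat (n + m + 1 - i) * (of_nat (m choose i) * (-1) ^ i / of_nat (n + m + 1 - i)) * z ^ (n + m + 1 - i - 1)
          = of_nat (m choose i) * (-1) ^ i * z ^ (n + m - i)" if "i \<le> m" for i
      proof -
        define j where "j = n + m + 1 - i"
        have j: "j \<noteq> 0" "j - 1 = n + m - i" using that by (auto simp: j_def)
        have "of_nat j * (of_nat (m choose i) * (-1) ^ i / of_nat j) * z ^ (j - 1)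
            = of_nat (m choose i) * (-1) ^ i * z ^ (j - 1)" using j(1) by simp
        then show ?thesis unfolding j(2) by (simp add: j_def)
      qed
      then have "(\<Sum>i\<le>m. of_nat (n + m + 1 - i) * (of_nat (m choose i) * (-1) ^ i / of_nat (n + m + 1 - i)) * z ^ (n + m + 1 - i - 1))
          = (\<Sum>i\<le>m. of_nat (m choose i) * (-1) ^ i * z ^ (n + m - i))"
        by (intro sum.cong) auto
      moreover have "poly (pderiv (P_pol n m)) z = (\<Sum>i\<le>m. of_nat (n + m + 1 - i) * (of_nat (m choose i) * (-1) ^ i / of_nat (n + m + 1 - i)) * z ^ (n + m + 1 - i - 1))"
        by (simp only: P_pol_def pderiv_add pderiv_1 pderiv_sum pderiv_monom poly_sum poly_monom add_0_right)
      ultimately show ?thesis by simp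
    qed
    also have "\<dots> = z ^ n * (\<Sum>i\<le>m. of_nat (m choose i) * (-1) ^ i * z ^ (m - i))"
      unfolding sum_distrib_left by (intro sum.cong) (auto simp flip: power_add)
    also have "(\<Sum>i\<le>m. of_nat (m choose i) * (-1) ^ i * z ^ (m - i)) = (-1 + z) ^ m"
      by (simp only: binomial_ring)
    finally show ?thesis by simp
  qed
  then show ?thesis by (subst poly_eq_poly_eq_iff[symmetric]) auto
qed

lemma P_poly_has_derivative: "(P_poly n m has_field_derivative z ^ n * (z - 1) ^ m) (at z)"
proof -
  have "(poly (P_pol n m) has_field_derivative poly (pderiv (P_pol n m)) z) (at z)" by (rule poly_DERIV)
  moreover have "poly (P_pol n m) = P_poly n m" by (auto simp: poly_P_pol)
  ultimately show ?thesis by (simp add: pderiv_P_pol)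
qed

lemma P_poly_0: "P_poly n m 0 = 1"
proof -
  have "(\<Sum>i=0..m. of_nat (m choose i) * (-1) ^ i / of_nat (n + m + 1 - i) * (0::complex) ^ (n + m + 1 - i)) = 0"
    by (intro sum.neutral ballI) (simp add: power_0_left)
  then show ?thesis unfolding P_poly_def by (simp only: add_0_left)
qed

text \<open>On the real segment from 0 to 1 the mean value theorem expresses $P(1) - P(0)$ as a value of
  $x^n (x-1)^m$ at an interior point, which is nonzero and of modulus less than one.\<close>

lemma P_poly_1:
  assumes "m \<ge> 1" "n \<ge> 1"
  obtains b :: real where "P_poly n m 1 = of_real b" "0 < \<bar>b - 1\<bar>" "\<bar>b - 1\<bar> < 1"
proof -
  define q where "q = (\<lambda>x::real. (\<Sum>i=0..m. of_nat (m choose i) * (-1) ^ i / of_nat (n + m + 1 - i) * x ^ (n + m + 1 - i)) + 1)"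
  have q: "P_poly n m (of_real x) = of_real (q x)" for x by (simp add: P_poly_def q_def)
  have qd: "(q has_real_derivative x ^ n * (x - 1) ^ m) (at x)" for x
  proof -
    have "((\<lambda>x. P_poly n m (of_real x)) has_vector_derivative of_real x ^ n * (of_real x - 1) ^ m) (at x)"
      by (rule has_vector_derivative_real_field[OF P_poly_has_derivative])
    then have "((\<lambda>x. Re (P_poly n m (of_real x))) has_vector_derivative Re (of_real x ^ n * (of_real x - 1) ^ m)) (at x)"
      by (rule bounded_linear.has_vector_derivative[OF bounded_linear_Re])
    moreover have "Re (of_real x ^ n * (of_real x - 1) ^ m) = x ^ n * (x - 1) ^ m"
    proof -
      have "of_real x ^ n * (of_real x - 1) ^ m = (of_real (x ^ n * (x - 1) ^ m) :: complex)" by simp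
      then show ?thesis by (simp only: Re_complex_of_real)
    qed
    ultimately show ?thesis by (simp add: q has_real_derivative_iff_has_vector_derivative)
  qed
  obtain x where x: "0 < x" "x < 1" "q 1 - q 0 = (1 - 0) * (x ^ n * (x - 1) ^ m)"
    using MVT2[of 0 1 q "\<lambda>x. x ^ n * (x - 1) ^ m"] qd by auto
  have q0: "q 0 = 1" using q[of 0] P_poly_0[of n m] by simp
  have e: "\<bar>q 1 - 1\<bar> = x ^ n * (1 - x) ^ m"
    using x q0 by (simp add: abs_mult power_abs)
  have "x ^ n * (1 - x) ^ m < 1 * 1"
    using x assms by (intro mult_strict_mono power_Suc_less_one) (auto simp: power_less_one_iff)
  moreover have "x ^ n * (1 - x) ^ m > 0" using x by simp
  ultimately show ?thesis using q[of 1] e by (intro that[of "q 1"]) auto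
qed

text \<open>Multiplicity of \<open>a\<close> as a root of P - P(a): one more than the order of z^n
  (z - 1)^m at \<open>a\<close>.\<close>

definition P_ord :: "nat \<Rightarrow> nat \<Rightarrow> complex \<Rightarrow> nat" where
  "P_ord n m a = (if a = 0 then n + 1 else if a = 1 then m + 1 else 1)"

lemma P_poly_factor:
  assumes "n \<ge> 1" "m \<ge> 1"
  obtains lc where "lc \<noteq> 0" "finite {a. P_poly n m a = v}"
    "\<And>z. P_poly n m z - v = lc * (\<Prod>a | P_poly n m a = v. (z - a) ^ P_ord n m a)"
    "(\<Sum>a | P_poly n m a = v. P_ord n m a) = n + m + 1"
proof -
  define p where "p = P_pol n m - [:v:]"
  have pd: "pderiv p = [:0, 1:] ^ n * [:-1, 1:] ^ m" by (simp add: p_def pderiv_diff pderiv_P_pol)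
  have pd0: "pderiv p \<noteq> 0" unfolding pd by simp
  then have p0: "p \<noteq> 0" by auto
  have poly_p: "poly p z = P_poly n m z - v" for z by (simp add: p_def poly_P_pol)
  have R: "{z. poly p z = 0} = {a. P_poly n m a = v}" by (auto simp: poly_p)
  have ord: "order a p = P_ord n m a" if "poly p a = 0" for a
  proof -
    have "order a (pderiv p) = order a ([:-0, 1:] ^ n) + order a ([:-1, 1:] ^ m)"
      unfolding pd using pd0[unfolded pd] by (simp add: order_mult)
    moreover have o: "order a ([:-b, 1:] ^ k) = (if a = b then k else 0)" for b k
      by (auto simp: order_power_n_n intro!: order_0I)
    ultimately have "order a (pderiv p) = (if a = 0 then n else 0) + (if a = 1 then m else 0)"
      by (simp only: o)
    then show ?thesis using order_pderiv[OF p0 that] by (auto simp: P_ord_def)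
  qed
  have "degree (pderiv p) = n + m"
    unfolding pd by (simp add: degree_mult_eq degree_power_eq)
  then have dp: "degree p = n + m + 1" using assms by (simp add: degree_pderiv)
  have fin: "finite {z. poly p z = 0}" using poly_roots_finite[OF p0] .
  have dec: "smult (lead_coeff p) (\<Prod>z|poly p z = 0. [:-z, 1:] ^ P_ord n m z) = p"
    using complex_poly_decompose[of p] ord by simp
  have "degree p = degree (\<Prod>z|poly p z = 0. [:-z, 1:] ^ P_ord n m z)"
    using arg_cong[OF dec, of degree] p0 by simp
  also have "\<dots> = (\<Sum>z|poly p z = 0. degree ([:-z, 1:] ^ P_ord n m z))"
    by (intro degree_prod_sum_eq) auto
  also have "\<dots> = (\<Sum>z|poly p z = 0. P_ord n m z)" by (simp add: degree_power_eq)
  finally have "(\<Sum>z|poly p z = 0. P_ord n m z) = n + m + 1" using dp by simp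
  moreover have "P_poly n m z - v = lead_coeff p * (\<Prod>a | poly p a = 0. (z - a) ^ P_ord n m a)" for z
    using arg_cong[OF dec, of "\<lambda>q. poly q z"] by (simp add: poly_prod poly_p)
  ultimately show ?thesis using p0 fin by (intro that[of "lead_coeff p"]) (auto simp: R)
qed

section \<open>The main inequality\<close>

lemma zorder_cong_at:
  assumes "eventually (\<lambda>x. f x = g x) (at z)"
  shows "zorder f z = zorder g z"
  by (rule zorder_cong) (use assms in auto)

text \<open>Lets an identity of functions near z be differentiated: the derivative at w depends on a
  full neighbourhood of w, and such neighbourhoods exist for every w close to but different from
  z.\<close>

lemma eventually_at_imp_eventually_nhds:
  fixes z :: "'a :: t1_space"
  assumes "eventually P (at z)"
  shows "eventually (\<lambda>w. eventually P (nhds w)) (at z)"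
proof -
  obtain U where U: "open U" "z \<in> U" "\<And>w. w \<in> U \<Longrightarrow> w \<noteq> z \<Longrightarrow> P w"
    using assms by (auto simp: eventually_at_topological)
  have "eventually (\<lambda>w. w \<in> U - {z}) (at z)" using U by (intro eventually_at_in_open) auto
  then show ?thesis
  proof eventually_elim
    case (elim w)
    have "eventually (\<lambda>x. x \<in> U - {z}) (nhds w)" using U(1) elim by (intro eventually_nhds_in_open) auto
    then show ?case by eventually_elim (use U(3) in auto)
  qed
qed

section \<open>The auxiliary functions and their local orders\<close>

definition abar :: "(complex \<Rightarrow> complex) \<Rightarrow> complex \<Rightarrow> complex \<Rightarrow> real" where
  "abar f a = zbar (\<lambda>z. f z - a)"

definition aord :: "(complex \<Rightarrow> complex) \<Rightarrow> complex \<Rightarrow> complex \<Rightarrow> real" where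
  "aord f a = zord (\<lambda>z. f z - a)"

text \<open>Minus the derivative of 1 / P(f).\<close>

definition Kfun :: "nat \<Rightarrow> nat \<Rightarrow> (complex \<Rightarrow> complex) \<Rightarrow> complex \<Rightarrow> complex" where
  "Kfun n m f z = deriv f z * f z ^ n * (f z - 1) ^ m / (P_poly n m (f z))\<^sup>2"

definition Phi :: "nat \<Rightarrow> nat \<Rightarrow> (complex \<Rightarrow> complex) \<Rightarrow> (complex \<Rightarrow> complex) \<Rightarrow> complex \<Rightarrow> complex" where
  "Phi n m f g z = Kfun n m f z / Kfun n m g z"

definition Hfun :: "nat \<Rightarrow> nat \<Rightarrow> (complex \<Rightarrow> complex) \<Rightarrow> (complex \<Rightarrow> complex) \<Rightarrow> complex \<Rightarrow> complex" where
  "Hfun n m f g z = deriv (Phi n m f g) z / Phi n m f g z"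

text \<open>\<open>AA\<close> lists the finite values that may be counted: the bad radii of all
  their shifts are absorbed in \<open>B\<close>, so the second main theorem is available for each
  nonempty finite subset.\<close>

locale nice_function = growth_sequence +
  fixes f :: "complex \<Rightarrow> complex" and AA :: "complex set" and n m :: nat
  assumes nice: "f nicely_meromorphic_on UNIV" and nonconst: "\<not> (\<exists>c. \<forall>z. f z = c)"
    and adm: "adm f" and bad_deriv: "bad_radii (deriv f) \<subseteq> B"
    and bad_shift: "\<And>a. a \<in> AA \<Longrightarrow> bad_radii (\<lambda>z. f z - a) \<subseteq> B"
    and nm: "n \<ge> 3" "m \<ge> 3"
begin

lemmas nz = nice_nzmero[OF nice nonconst]
lemmas nz_shift = nice_shift_nzmero[OF nice nonconst]
lemmas nz_deriv = nice_deriv_nzmero[OF nice nonconst]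

lemma pole_aord: "zord f z < 0 \<Longrightarrow> aord f a z = zord f z"
  using zord_shift_pole[OF nz nz_shift, of a z] by (auto simp: poles_of_def aord_def max_def split: if_splits)

lemma finite_analytic: "zord f z \<ge> 0 \<Longrightarrow> f analytic_on {z}"
  using nice_pole_iff[OF nice nonconst, of z] nicely_meromorphic_on_imp_analytic_at[OF nice, of z]
  by (auto simp: zord_def)

lemma finite_aord_ge_0: "zord f z \<ge> 0 \<Longrightarrow> aord f a z \<ge> 0"
  using zord_shift_pole[OF nz nz_shift, of a z] by (auto simp: poles_of_def aord_def max_def split: if_splits)

lemma finite_aord_pos_iff:
  assumes "zord f z \<ge> 0" shows "aord f a z > 0 \<longleftrightarrow> f z = a"
  using nice_value_iff[OF nice nonconst, of z a] nice_pole_iff[OF nice nonconst, of z] assms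
  by (auto simp: aord_def zord_def)

lemma finite_aord_other: "zord f z \<ge> 0 \<Longrightarrow> f z \<noteq> a \<Longrightarrow> aord f a z = 0"
  using finite_aord_ge_0[of z a] finite_aord_pos_iff[of z a] by force

lemma finite_aord_value:
  assumes "zord f z \<ge> 0"
  obtains p :: nat where "p \<ge> 1" "aord f (f z) z = real p" "zord (deriv f) z = real p - 1"
proof -
  have pos: "aord f (f z) z > 0" using finite_aord_pos_iff[OF assms] by simp
  define p where "p = nat (zorder (\<lambda>w. f w - f z) z)"
  have "zorder (\<lambda>w. f w - f z) z > 0" using pos by (simp add: aord_def zord_def)
  then have p: "p \<ge> 1" "aord f (f z) z = real p" by (auto simp: p_def aord_def zord_def)
  moreover have "zord (deriv f) z = real p - 1"
    using zord_deriv[OF nz_shift, of "f z" z] pos p by (simp add: deriv_shift aord_def)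
  ultimately show ?thesis by (rule that)
qed

lemma abar_eq: "abar f a z = of_bool (zord f z \<ge> 0 \<and> f z = a)"
proof (cases "zord f z \<ge> 0")
  case True
  then show ?thesis using finite_aord_pos_iff[OF True, of a] by (simp add: abar_def zbar_def aord_def)
next
  case False
  then show ?thesis using pole_aord[of z a] by (simp add: abar_def zbar_def aord_def)
qed

lemma ram_eq: "ram A f z = (if zord f z \<ge> 0 \<and> f z \<notin> A then zord (deriv f) z else 0)"
proof (cases "zord f z \<ge> 0")
  case True
  then show ?thesis using finite_aord_pos_iff[OF True] by (auto simp: ram_def aord_def)
qed (simp add: ram_def)

lemma locfin_abar: "locfin (abar f a)"
  unfolding abar_def by (rule locfin_zbar[OF nz_shift])

lemma smt:
  assumes "finite A" "A \<noteq> {}" "A \<subseteq> AA"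
  shows "small (\<lambda>k. (real (card A) - 1) * nev f (s k) + vcount (ram A f) (s k)
     - (\<Sum>a\<in>A. vcount (abar f a) (s k)) - vcount (pbar f) (s k))"
  unfolding abar_def
  by (rule second_main_theorem[OF adm nz_deriv bad_deriv assms(1,2) nz_shift bad_shift]) (use assms in auto)

lemma vcount_ram_nonneg: "vcount (ram A f) (s k) \<ge> 0"
  by (rule vcount_nonneg[OF s_ge_1]) (rule ram_nonneg[OF nz nz_deriv])

lemma smt_reduced:
  assumes "finite A" "A \<noteq> {}" "A \<subseteq> AA"
  shows "small (\<lambda>k. (real (card A) - 2) * nev f (s k) - (\<Sum>a\<in>A. vcount (abar f a) (s k)))"
proof (rule small_mono[OF smt[OF assms]])
  fix k
  show "(real (card A) - 2) * nev f (s k) - (\<Sum>a\<in>A. vcount (abar f a) (s k)) \<le>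
    (real (card A) - 1) * nev f (s k) + vcount (ram A f) (s k)
     - (\<Sum>a\<in>A. vcount (abar f a) (s k)) - vcount (pbar f) (s k)"
    using vcount_ram_nonneg[of A k] adm_poles_count_le[OF adm, of k] by (simp add: algebra_simps)
qed

lemma zeros_count_le:
  assumes "a \<in> AA"
  obtains C where "\<And>k. vcount (zeros_of (\<lambda>z. f z - a)) (s k) \<le> nev f (s k) + C"
  using zeros_count_shift_le[OF adm nz_shift bad_shift[OF assms]] by blast

text \<open>Here \<open>c\<close> acts as a lower bound for the multiplicity of the points counted
  by \<open>D\<close>; high multiplicity improves the first main theorem by the factor 1/c.\<close>

lemma fmt_weighted:
  assumes "a \<in> AA" "c > 0" "locfin D" "\<And>z. c * D z \<le> zeros_of (\<lambda>z. f z - a) z"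
  shows "small (\<lambda>k. vcount D (s k) - nev f (s k) / c)"
proof -
  obtain C where C: "\<And>k. vcount (zeros_of (\<lambda>z. f z - a)) (s k) \<le> nev f (s k) + C"
    using zeros_count_le[OF assms(1)] by blast
  have "vcount D (s k) - nev f (s k) / c \<le> C / c" for k
  proof -
    have "c * vcount D (s k) = vcount (\<lambda>z. c * D z) (s k)" by (rule vcount_cmult[symmetric])
    also have "\<dots> \<le> vcount (zeros_of (\<lambda>z. f z - a)) (s k)"
      by (intro vcount_mono locfin_cmult assms locfin_zeros_of nz_shift s_ge_1)
    also have "\<dots> \<le> nev f (s k) + C" by (rule C)
    finally have "vcount D (s k) \<le> (nev f (s k) + C) / c" using assms(2) by (simp add: pos_le_divide_eq mult.commute)
    then show ?thesis by (simp add: add_divide_distrib)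
  qed
  then show ?thesis by (rule small_mono[OF small_const])
qed

lemma fmt: "a \<in> AA \<Longrightarrow> small (\<lambda>k. vcount (abar f a) (s k) - nev f (s k))"
  using fmt_weighted[of a 1 "abar f a"] locfin_abar zbar_le_zeros_of by (simp add: abar_def)

text \<open>The divisor of f'/f is the ramification off 0 and infinity minus the reduced zeros and
  poles, and its proximity function is small. This is what makes ramification over the shared set
  payable.\<close>

lemma ram_0_small:
  "small (\<lambda>k. vcount (ram {0} f) (s k) - vcount (abar f 0) (s k) - vcount (pbar f) (s k))"
proof -
  define V where "V = (\<lambda>z. deriv f z / f z)"
  have V: "nzmero V" unfolding V_def by (rule nzmero_divide[OF nz_deriv nz])
  have b: "bad_radii V \<subseteq> B" unfolding V_def using bad_radii_divide[of "deriv f" f] bad_deriv adm_bad[OF adm] by blast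
  have "zord V = (\<lambda>z. (ram {0} f z - abar f 0 z) - pbar f z)"
  proof
    fix z
    have "zord V z = zord (deriv f) z - zord f z" unfolding V_def by (rule zord_divide[OF nz_deriv nz])
    then show "zord V z = (ram {0} f z - abar f 0 z) - pbar f z"
      using zord_deriv[OF nz, of z] finite_aord_pos_iff[of z 0]
      by (cases "zord f z" "0 :: real" rule: linorder_cases)
        (auto simp: ram_def abar_def zbar_def pbar_def)
  qed
  moreover have "small (\<lambda>k. vcount (zord V) (s k))"
    using adm_log_deriv_small[OF adm] by (intro zord_count_small V b) (simp add: V_def)
  moreover have "vcount (\<lambda>z. (ram {0} f z - abar f 0 z) - pbar f z) r
      = vcount (ram {0} f) r - vcount (abar f 0) r - vcount (pbar f) r" for r
    by (simp add: vcount_diff locfin_diff locfin_ram[OF nz_deriv] locfin_abar locfin_pbar[OF nz])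
  ultimately show ?thesis by simp
qed

abbreviation P :: "complex \<Rightarrow> complex" where "P \<equiv> P_poly n m"

lemma P_factor:
  obtains lc where "lc \<noteq> 0" "finite {a. P a = v}"
    "\<And>z. P z - v = lc * (\<Prod>a | P a = v. (z - a) ^ P_ord n m a)"
    "(\<Sum>a | P a = v. P_ord n m a) = n + m + 1"
  using P_poly_factor[of n m v] nm by auto

lemma finite_P_fiber: "finite {a. P a = v}"
  using P_factor by blast

lemma nz_P: "nzmero (\<lambda>z. P (f z) - v)"
  and zord_P: "zord (\<lambda>z. P (f z) - v) z = (\<Sum>a | P a = v. real (P_ord n m a) * aord f a z)"
proof -
  obtain lc where lc: "lc \<noteq> 0" "finite {a. P a = v}"
    "\<And>z. P z - v = lc * (\<Prod>a | P a = v. (z - a) ^ P_ord n m a)"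
    "(\<Sum>a | P a = v. P_ord n m a) = n + m + 1" using P_factor by blast
  have e: "(\<lambda>z. P (f z) - v) = (\<lambda>z. lc * (\<Prod>a | P a = v. (f z - a) ^ P_ord n m a))" using lc(3) by auto
  have np: "nzmero (\<lambda>z. \<Prod>a | P a = v. (f z - a) ^ P_ord n m a)"
    using lc(2) by (intro nzmero_prod nzmero_power nz_shift)
  show "nzmero (\<lambda>z. P (f z) - v)" unfolding e by (intro nzmero_mult nzmero_const lc(1) np)
  show "zord (\<lambda>z. P (f z) - v) z = (\<Sum>a | P a = v. real (P_ord n m a) * aord f a z)"
    unfolding e zord_mult[OF nzmero_const[OF lc(1)] np]
    using lc(1,2) by (simp add: zord_prod nzmero_power nz_shift zord_power aord_def) (simp add: zord_def)
qed

lemma zord_P_pole: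
  assumes "zord f z < 0"
  shows "zord (\<lambda>z. P (f z) - v) z = real (n + m + 1) * zord f z"
proof -
  have "zord (\<lambda>z. P (f z) - v) z = (\<Sum>a | P a = v. real (P_ord n m a)) * zord f z"
    unfolding zord_P sum_distrib_right by (intro sum.cong) (auto simp: pole_aord[OF assms])
  also have "(\<Sum>a | P a = v. real (P_ord n m a)) = real (n + m + 1)"
    using P_factor[of v] by (metis of_nat_sum)
  finally show ?thesis .
qed

lemma zord_P_finite:
  assumes "zord f z \<ge> 0"
  shows "zord (\<lambda>z. P (f z) - v) z = (if P (f z) = v then real (P_ord n m (f z)) * aord f (f z) z else 0)"
proof -
  have "zord (\<lambda>z. P (f z) - v) z = (\<Sum>a | P a = v. if a = f z then real (P_ord n m (f z)) * aord f (f z) z else 0)"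
    unfolding zord_P by (intro sum.cong) (auto simp: finite_aord_other[OF assms])
  then show ?thesis using finite_P_fiber[of v] by simp
qed

lemma P_0_1: "P 0 \<noteq> 0" "P 1 \<noteq> 0"
proof -
  show "P 0 \<noteq> 0" by (simp add: P_poly_0)
  obtain b :: real where "P 1 = of_real b" "0 < \<bar>b - 1\<bar>" "\<bar>b - 1\<bar> < 1" using P_poly_1[of m n] nm by auto
  then show "P 1 \<noteq> 0" by auto
qed

abbreviation Kf :: "complex \<Rightarrow> complex" where "Kf \<equiv> Kfun n m f"

lemma nz_P0: "nzmero (\<lambda>z. P (f z))"
  using nz_P[of 0] by simp

lemma nz_Kf: "nzmero Kf"
  unfolding Kfun_def[abs_def] by (intro nzmero_divide nzmero_mult nzmero_power nz_deriv nz nz_shift nz_P0)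

lemma zord_Kf: "zord Kf z = zord (deriv f) z + real n * zord f z + real m * aord f 1 z - 2 * zord (\<lambda>z. P (f z) - 0) z"
  unfolding Kfun_def[abs_def] aord_def
  by (simp add: zord_divide zord_mult zord_power nzmero_mult nzmero_power nz_deriv nz nz_shift nz_P0)

text \<open>With multiplicity p, f' contributes p - 1 and the square of P(f) contributes -2p.
  Consequently the order of \<open>Phi\<close> at a shared point is the difference of the two
  multiplicities.\<close>

lemma zord_Kf_S:
  assumes "zord f z \<ge> 0" "P (f z) = 0"
  shows "zord Kf z = - (aord f (f z) z + 1)"
proof -
  have w: "f z \<noteq> 0" "f z \<noteq> 1" using assms P_0_1 by metis+
  obtain p where p: "p \<ge> 1" "aord f (f z) z = real p" "zord (deriv f) z = real p - 1"
    using finite_aord_value[OF assms(1)] by blast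
  have "zord f z = 0" using finite_aord_other[OF assms(1) w(1)] by (simp add: aord_def)
  then show ?thesis
    using w p assms zord_P_finite[OF assms(1), of 0] finite_aord_other[OF assms(1) w(2)]
    by (simp add: zord_Kf P_ord_def)
qed

lemma zord_Kf_regular:
  assumes "zord f z \<ge> 0" "P (f z) \<noteq> 0" "f z \<noteq> 0" "f z \<noteq> 1"
  shows "zord Kf z = zord (deriv f) z"
proof -
  have "zord f z = 0" using finite_aord_other[OF assms(1,3)] by (simp add: aord_def)
  then show ?thesis
    using assms zord_P_finite[OF assms(1), of 0] finite_aord_other[OF assms(1,4)] by (simp add: zord_Kf)
qed

text \<open>At any point at most one root of P is taken, so this single number determines the
  weighted set at that point for every level l.\<close>

definition Smult :: "complex \<Rightarrow> nat" where
  "Smult z = (if zord f z \<ge> 0 \<and> P (f z) = 0 then nat (zorder (\<lambda>w. f w - f z) z) else 0)"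

lemma Smult_pos_iff: "Smult z > 0 \<longleftrightarrow> zord f z \<ge> 0 \<and> P (f z) = 0"
  using finite_aord_pos_iff[of z "f z"] by (auto simp: Smult_def aord_def zord_def)

lemma Smult_aord: "zord f z \<ge> 0 \<Longrightarrow> P (f z) = 0 \<Longrightarrow> aord f (f z) z = real (Smult z)"
  using finite_aord_ge_0[of z "f z"] by (simp add: Smult_def aord_def zord_def)

lemma E_weighted_eq: "E_weighted f {z. P z = 0} l z = min (enat (Smult z)) (l + 1)"
proof -
  have "real (apt_mult f (Some a) z) = (if a = f z then real (Smult z) else 0)" if "P a = 0" for a
  proof (cases "zord f z \<ge> 0")
    case True
    have "real (apt_mult f (Some a) z) = max 0 (aord f a z)"
      using apt_mult_Some[OF nice nonconst, of a z] by (simp add: zeros_of_def aord_def)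
    then show ?thesis using that Smult_aord[OF True] finite_aord_other[OF True, of a] by auto
  next
    case False
    have "real (apt_mult f (Some a) z) = max 0 (aord f a z)"
      using apt_mult_Some[OF nice nonconst, of a z] by (simp add: zeros_of_def aord_def)
    then show ?thesis using pole_aord[of z a] False by (simp add: Smult_def)
  qed
  then have 1: "apt_mult f (Some a) z = (if a = f z then Smult z else 0)" if "P a = 0" for a
    using that by (metis of_nat_0 of_nat_eq_iff)
  have "E_weighted f {z. P z = 0} l z = (\<Sum>a | P a = 0. if a = f z then min (enat (Smult z)) (l + 1) else 0)"
    unfolding E_weighted_def by (intro sum.cong) (auto simp: 1 zero_enat_def[symmetric])
  also have "\<dots> = min (enat (Smult z)) (l + 1)"
    using finite_P_fiber[of 0] by (auto simp: Smult_def zero_enat_def[symmetric])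
  finally show ?thesis .
qed

text \<open>Near a simple zero of $P(f)$ the function $P(f)'/P(f)^2$ is, up to the factor $(z-z_0)^{-2}$,
  stationary at $z_0$; this is what makes the auxiliary function vanish at common simple points.\<close>

lemma simple_point_expansion:
  assumes z: "zord f z0 \<ge> 0" "P (f z0) = 0" "Smult z0 = 1"
  obtains w where "w analytic_on {z0}" "w z0 \<noteq> 0" "deriv w z0 = 0"
    "eventually (\<lambda>z. Kf z * (z - z0)\<^sup>2 = w z) (at z0)"
proof -
  have fan: "f analytic_on {z0}" by (rule finite_analytic[OF z(1)])
  have w0: "f z0 \<noteq> 0" "f z0 \<noteq> 1" using z P_0_1 by metis+
  have "zord (\<lambda>z. P (f z) - 0) z0 = 1"
    using zord_P_finite[OF z(1), of 0] Smult_aord[OF z(1,2)] z w0 by (simp add: P_ord_def)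
  then have o1: "zorder (\<lambda>z. P (f z)) z0 = 1" by (simp add: zord_def)
  define q where "q = zor_poly (\<lambda>z. P (f z)) z0"
  obtain r where r: "q z0 \<noteq> 0" "r > 0" "q holomorphic_on cball z0 r"
    "\<forall>w\<in>cball z0 r - {z0}. P (f w) = q w * (w - z0) powi 1 \<and> q w \<noteq> 0"
    using zorder_exist[OF nzmeroD(4,5,3)[OF nz_P0], of z0] o1 unfolding q_def by auto
  obtain r' where r': "r' > 0" "f holomorphic_on ball z0 r'" using fan unfolding analytic_on_def by auto
  define U where "U = ball z0 (min r r')"
  have U: "open U" "z0 \<in> U" "q holomorphic_on U" "f holomorphic_on U"
    using r r' by (auto simp: U_def intro: holomorphic_on_subset)
  have qU: "q z \<noteq> 0" if "z \<in> U" for z using that r by (cases "z = z0") (auto simp: U_def)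
  have Pq: "P (f z) = q z * (z - z0)" if "z \<in> U" for z
    using that r z(2) by (cases "z = z0") (auto simp: U_def)
  have dq: "(q has_field_derivative deriv q z) (at z)" if "z \<in> U" for z
    using U that by (intro holomorphic_derivI) auto
  have df: "(f has_field_derivative deriv f z) (at z)" if "z \<in> U" for z
    using U that by (intro holomorphic_derivI) auto
  have dd: "(deriv q has_field_derivative deriv (deriv q) z0) (at z0)"
    using U by (intro holomorphic_derivI[of _ U] holomorphic_deriv) auto
  have key: "deriv f z * f z ^ n * (f z - 1) ^ m = deriv q z * (z - z0) + q z" if "z \<in> U" for z
  proof -
    have 1: "((\<lambda>z. P (f z)) has_field_derivative (f z ^ n * (f z - 1) ^ m) * deriv f z) (at z)"
      by (rule DERIV_chain2[OF P_poly_has_derivative df[OF that]])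
    have "((\<lambda>z. q z * (z - z0)) has_field_derivative deriv q z * (z - z0) + q z) (at z)"
      by (auto intro!: derivative_eq_intros dq[OF that])
    then have "((\<lambda>z. P (f z)) has_field_derivative deriv q z * (z - z0) + q z) (at z)"
      by (rule has_field_derivative_transform_within_open[OF _ U(1) that]) (simp add: Pq)
    from DERIV_unique[OF 1 this] show ?thesis by (simp add: mult_ac)
  qed
  \<comment> \<open>At z0 the numerator of w' is 2 q' q^2 - q (2 q q') = 0, whatever the value of q'
    there.\<close>
  define w where "w = (\<lambda>z. (deriv q z * (z - z0) + q z) / (q z)\<^sup>2)"
  show ?thesis
  proof
    have "w holomorphic_on U" unfolding w_def using U qU by (intro holomorphic_intros) auto
    then show "w analytic_on {z0}" using U by (meson analytic_at)
    show "w z0 \<noteq> 0" using r by (simp add: w_def power2_eq_square)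
    have "(w has_field_derivative ((deriv (deriv q) z0 * (z0 - z0) + deriv q z0 * 1 + deriv q z0) * (q z0)\<^sup>2
        - (deriv q z0 * (z0 - z0) + q z0) * (2 * q z0 * deriv q z0)) / ((q z0)\<^sup>2 * (q z0)\<^sup>2)) (at z0)"
      unfolding w_def using r(1)
      by (auto intro!: derivative_eq_intros dd dq[OF U(2)] simp: field_simps power2_eq_square)
    then have "(w has_field_derivative 0) (at z0)" by (simp add: power2_eq_square algebra_simps)
    then show "deriv w z0 = 0" by (rule DERIV_imp_deriv)
    have "eventually (\<lambda>z. z \<in> U - {z0}) (at z0)" using U by (intro eventually_at_in_open) auto
    then show "eventually (\<lambda>z. Kf z * (z - z0)\<^sup>2 = w z) (at z0)"
    proof eventually_elim
      case (elim z)
      then show ?case using key[of z] Pq[of z] qU[of z] by (simp add: Kfun_def w_def power_mult_distrib)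
    qed
  qed
qed

end

section \<open>The inequality for a pair of functions with shared zero set of P\<close>

locale sharing_pair = F: nice_function s \<phi> B f AA n m + G: nice_function s \<phi> B g AA n m
  for s \<phi> B f g AA n m +
  assumes AA: "{0, 1} \<union> {a. P_poly n m a = 0} \<subseteq> AA"
begin

abbreviation \<Phi> where "\<Phi> \<equiv> Phi n m f g"
abbreviation H where "H \<equiv> Hfun n m f g"

lemma nz_Phi: "nzmero \<Phi>"
  unfolding Phi_def[abs_def] by (intro nzmero_divide F.nz_Kf G.nz_Kf)

lemma zord_Phi: "zord \<Phi> z = zord F.Kf z - zord G.Kf z"
  unfolding Phi_def[abs_def] by (rule zord_divide[OF F.nz_Kf G.nz_Kf])

text \<open>The double poles of both functions cancel in the quotient and leave u/v, where u and v
  are nonzero with vanishing derivative at z0. The value of \<Phi> at z0 itself is an artefact of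
  division, so the comparison runs on a punctured neighbourhood.\<close>

lemma common_simple_point:
  assumes "F.Smult z0 = 1" "G.Smult z0 = 1" and nd: "nzmero (deriv \<Phi>)"
  shows "zord (deriv \<Phi>) z0 \<ge> 1"
proof -
  have "zord f z0 \<ge> 0" "F.P (f z0) = 0" "zord g z0 \<ge> 0" "F.P (g z0) = 0"
    using F.Smult_pos_iff[of z0] G.Smult_pos_iff[of z0] assms by auto
  obtain u where u: "u analytic_on {z0}" "u z0 \<noteq> 0" "deriv u z0 = 0"
    "eventually (\<lambda>z. F.Kf z * (z - z0)\<^sup>2 = u z) (at z0)"
    using F.simple_point_expansion[of z0] \<open>zord f z0 \<ge> 0\<close> \<open>F.P (f z0) = 0\<close> assms by blast
  obtain v where v: "v analytic_on {z0}" "v z0 \<noteq> 0" "deriv v z0 = 0"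
    "eventually (\<lambda>z. G.Kf z * (z - z0)\<^sup>2 = v z) (at z0)"
    using G.simple_point_expansion[of z0] \<open>zord g z0 \<ge> 0\<close> \<open>F.P (g z0) = 0\<close> assms by blast
  define \<psi> where "\<psi> = (\<lambda>z. u z / v z)"
  have psi: "\<psi> analytic_on {z0}" unfolding \<psi>_def using u v by (intro analytic_intros) auto
  have "eventually (\<lambda>z. z \<noteq> z0) (at z0)" by (rule eventually_neq_at_within)
  with u(4) v(4) have "eventually (\<lambda>z. \<Phi> z = \<psi> z) (at z0)"
  proof eventually_elim
    case (elim z)
    have "\<psi> z = (F.Kf z * (z - z0)\<^sup>2) / (G.Kf z * (z - z0)\<^sup>2)" using elim by (simp add: \<psi>_def)
    then show ?case using elim(3) by (simp add: Phi_def)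
  qed
  then have "eventually (\<lambda>z. eventually (\<lambda>w. \<Phi> w = \<psi> w) (nhds z)) (at z0)"
    by (rule eventually_at_imp_eventually_nhds)
  then have "eventually (\<lambda>z. deriv \<Phi> z = deriv \<psi> z) (at z0)"
    by eventually_elim (auto intro: deriv_cong_ev)
  note dev = this
  then have zo: "zorder (deriv \<Phi>) z0 = zorder (deriv \<psi>) z0" by (rule zorder_cong_at)
  have "eventually (\<lambda>z. deriv \<psi> z \<noteq> 0) (at z0)"
    using dev nzmeroD(2)[OF nd, of z0] by eventually_elim auto
  then have fr: "frequently (\<lambda>z. deriv \<psi> z \<noteq> 0) (at z0)" by (simp add: eventually_frequently)
  have "deriv \<psi> z0 = (deriv u z0 * v z0 - u z0 * deriv v z0) / (v z0)\<^sup>2"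
    unfolding \<psi>_def using u v by (intro deriv_divide analytic_on_imp_differentiable_at) auto
  then have "deriv \<psi> z0 = 0" using u v by simp
  then have "zorder (deriv \<psi>) z0 > 0"
    using zorder_pos_iff'[OF analytic_deriv[OF psi] fr] by blast
  then show ?thesis using zo by (simp add: zord_def)
qed

lemma adm_Phi:
  shows "F.adm \<Phi>"
proof -
  have fin: "finite {a. F.P a = 0}" by (rule F.finite_P_fiber)
  obtain lc where lc: "lc \<noteq> 0" "\<And>z. F.P z - 0 = lc * (\<Prod>a | F.P a = 0. (z - a) ^ P_ord n m a)"
    using F.P_factor[of 0] by metis
  have 1: "F.adm (\<lambda>z. f z - a)" "F.adm (\<lambda>z. g z - a)" if "a \<in> AA" for a
    using F.adm_shift[OF F.adm F.nz_shift F.bad_shift[OF that]] F.adm_shift[OF G.adm G.nz_shift G.bad_shift[OF that]] by auto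
  have 2: "F.adm (\<lambda>z. F.P (f z))" "F.adm (\<lambda>z. F.P (g z))"
  proof -
    have e: "(\<lambda>z. F.P (h z)) = (\<lambda>z. lc * (\<Prod>a | F.P a = 0. (h z - a) ^ P_ord n m a))" for h :: "complex \<Rightarrow> complex"
      using lc(2) by (intro ext) (metis diff_0_right)
    have S: "a \<in> AA" if "a \<in> {a. F.P a = 0}" for a using that AA by auto
    have adm_P: "F.adm (\<lambda>z. lc * (\<Prod>a | F.P a = 0. (h z - a) ^ P_ord n m a))"
      if "\<And>a. a \<in> AA \<Longrightarrow> F.adm (\<lambda>z. h z - a)" for h
      by (rule F.adm_mult[OF F.adm_const[OF lc(1)] F.adm_prod[OF fin F.adm_power[OF that[OF S]]]])
    show "F.adm (\<lambda>z. F.P (f z))" by (subst e) (rule adm_P[OF 1(1)])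
    show "F.adm (\<lambda>z. F.P (g z))" by (subst e) (rule adm_P[OF 1(2)])
  qed
  have 3: "F.adm (deriv f)" "F.adm (deriv g)"
    using F.adm_deriv[OF F.adm F.nz_deriv F.bad_deriv] F.adm_deriv[OF G.adm G.nz_deriv G.bad_deriv] by auto
  show ?thesis unfolding Phi_def[abs_def] Kfun_def[abs_def]
    using AA by (intro F.adm_divide F.adm_mult F.adm_power 1 2 3 F.adm G.adm) auto
qed

text \<open>\<open>\<alpha>\<close> and \<open>\<gamma>\<close> are the weights given to the ramification of $f$ and $g$ over the shared set; \<open>key\<close> says
  that this ramification pays for the points at which $H$ does not vanish.\<close>

lemma main_inequality:
  assumes nd: "nzmero (deriv \<Phi>)" and bH: "bad_radii H \<subseteq> B"
    and share: "\<And>z. F.Smult z = 0 \<longleftrightarrow> G.Smult z = 0"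
    and ab: "\<alpha> \<ge> 0" "\<gamma> \<ge> 1"
    and key: "\<And>z. F.Smult z > 0 \<Longrightarrow> G.Smult z > 0 \<Longrightarrow>
      1 \<le> (if F.Smult z \<noteq> G.Smult z then -1 else if F.Smult z = 1 then 1 else 0)
        + \<alpha> * (real (F.Smult z) - 1) + \<gamma> * (real (G.Smult z) - 1)"
  shows "F.small (\<lambda>k. (real n + real m + 2) * nev f (s k)
     - (2 + \<alpha>) * (vcount (abar f 0) (s k) + vcount (pbar f) (s k)) - 2 * vcount (abar f 1) (s k)
     - (1 + \<gamma>) * (vcount (abar g 0) (s k) + vcount (pbar g) (s k)) - vcount (abar g 1) (s k))"
proof -
  define S where "S = {a. F.P a = 0}"
  have finS: "finite S" unfolding S_def by (rule F.finite_P_fiber)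
  have S01: "0 \<notin> S" "1 \<notin> S" using F.P_0_1 by (auto simp: S_def)
  have cS: "card S = n + m + 1"
  proof -
    have "(\<Sum>a\<in>S. P_ord n m a) = n + m + 1" using F.P_factor[of 0] unfolding S_def by metis
    moreover have "(\<Sum>a\<in>S. P_ord n m a) = (\<Sum>a\<in>S. 1)" using S01 by (intro sum.cong) (auto simp: P_ord_def)
    ultimately show ?thesis by simp
  qed
  \<comment> \<open>Adjoining the critical points 0 and 1 raises the coefficient of the
    characteristic by two and takes the zeros of f' over them out of the ramification term; the cost
    is their reduced counts.\<close>
  define A where "A = {0, 1} \<union> S"
  have A: "finite A" "A \<noteq> {}" "A \<subseteq> AA" using finS AA by (auto simp: A_def S_def)
  have cA: "card A = n + m + 3" using S01 finS cS by (simp add: A_def)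
  have H: "nzmero H" unfolding Hfun_def[abs_def] by (intro nzmero_divide nd nz_Phi)
  have sH: "F.small (\<lambda>k. vcount (zord H) (s k))"
    using F.adm_log_deriv_small[OF adm_Phi] by (intro F.zord_count_small H bH) (simp add: Hfun_def[abs_def])
  \<comment> \<open>A logarithmic derivative has at most simple poles, and only at the zeros and
    poles of \<Phi>.\<close>
  have Hge: "zord H z \<ge> (if zord \<Phi> z \<noteq> 0 then -1 else 0)" for z
    using zord_log_deriv[OF nz_Phi _ nd, of z] H by (auto simp: Hfun_def[abs_def])
  have rint: "zord h z \<ge> 1" if "zord h z > 0" for h z
  proof -
    have "zorder h z \<ge> 1" using that by (simp add: zord_def)
    then show ?thesis by (simp add: zord_def)
  qed
  \<comment> \<open>The whole estimate in pointwise form. Over S the zeros of H pay for common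
    simple points and ramification for the rest. Off S a pole of H can only occur where f or g takes
    the value 0, 1 or \<infinity>, or where one of the derivatives vanishes.\<close>
  have pw: "(\<Sum>a\<in>S. abar f a z) \<le> zord H z + ram A f z + (abar f 0 z + abar f 1 z + pbar f z)
      + (abar g 0 z + abar g 1 z + pbar g z) + \<alpha> * ram {0} f z + \<gamma> * ram {0} g z" for z
  proof -
    have nn: "ram A f z \<ge> 0" "ram {0} f z \<ge> 0" "ram {0} g z \<ge> 0" "abar f a z \<ge> 0" "abar g a z \<ge> 0" for a
      using ram_nonneg[OF F.nz F.nz_deriv] ram_nonneg[OF G.nz G.nz_deriv] by (auto simp: abar_def)
    have nn': "\<alpha> * ram {0} f z \<ge> 0" "\<gamma> * ram {0} g z \<ge> 0" using nn ab by auto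
    show ?thesis
    proof (cases "F.Smult z = 0")
      case False
      then have fS: "zord f z \<ge> 0" "F.P (f z) = 0" and gS: "zord g z \<ge> 0" "F.P (g z) = 0"
        using F.Smult_pos_iff[of z] G.Smult_pos_iff[of z] share[of z] by auto
      have "(\<Sum>a\<in>S. abar f a z) = (\<Sum>a\<in>S. if a = f z then 1 else 0)"
        using fS by (intro sum.cong) (auto simp: F.abar_eq)
      also have "\<dots> = 1" using fS finS by (simp add: S_def)
      finally have x1: "(\<Sum>a\<in>S. abar f a z) = 1" .
      have ne: "f z \<noteq> 0" "g z \<noteq> 0" using fS gS F.P_0_1 by metis+
      have rf: "ram {0} f z = real (F.Smult z) - 1"
        using F.finite_aord_value[OF fS(1)] F.Smult_aord[OF fS] F.ram_eq[of "{0}" z] fS ne by (metis singletonD)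
      have rg: "ram {0} g z = real (G.Smult z) - 1"
        using G.finite_aord_value[OF gS(1)] G.Smult_aord[OF gS] G.ram_eq[of "{0}" z] gS ne by (metis singletonD)
      have zP: "zord \<Phi> z = real (G.Smult z) - real (F.Smult z)"
        using F.zord_Kf_S[OF fS] G.zord_Kf_S[OF gS] F.Smult_aord[OF fS] G.Smult_aord[OF gS] by (simp add: zord_Phi)
      define t :: real where "t = (if F.Smult z \<noteq> G.Smult z then -1 else if F.Smult z = 1 then 1 else 0)"
      have k: "1 \<le> t + \<alpha> * (real (F.Smult z) - 1) + \<gamma> * (real (G.Smult z) - 1)"
        using key[of z] False share[of z] by (simp add: t_def)
      have "zord H z \<ge> t"
      proof (cases "F.Smult z = 1 \<and> G.Smult z = 1")
        case True
        then have "zord H z = zord (deriv \<Phi>) z"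
          using zord_log_deriv(2)[OF nz_Phi _ nd, of z] H zP by (auto simp: Hfun_def[abs_def])
        then show ?thesis using common_simple_point[of z] True nd by (simp add: t_def)
      next
        case False
        then show ?thesis using Hge[of z] zP by (auto simp: t_def)
      qed
      then show ?thesis unfolding x1 rf rg using k nn(1) pbar_nonneg[of f z] pbar_nonneg[of g z]
        nn(4)[of 0] nn(4)[of 1] nn(5)[of 0] nn(5)[of 1] by linarith
    next
      case True
      then have gS: "G.Smult z = 0" using share by simp
      have x0: "(\<Sum>a\<in>S. abar f a z) = 0"
        using True F.Smult_pos_iff[of z] by (intro sum.neutral) (auto simp: F.abar_eq S_def)
      show ?thesis
      proof (cases "zord \<Phi> z = 0")
        case z: True
        then show ?thesis using Hge[of z] x0 nn nn'  pbar_nonneg[of f z] pbar_nonneg[of g z]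
          nn(4)[of 0] nn(4)[of 1] nn(5)[of 0] nn(5)[of 1] by auto
      next
        case z: False
        then have h1: "zord H z \<ge> -1" using Hge[of z] by auto
        have "1 \<le> ram A f z + (abar f 0 z + abar f 1 z + pbar f z)
            + (abar g 0 z + abar g 1 z + pbar g z) + \<gamma> * ram {0} g z"
        proof (cases "zord f z < 0 \<or> f z = 0 \<or> f z = 1 \<or> zord g z < 0 \<or> g z = 0 \<or> g z = 1")
          case True
          then have "1 \<le> (abar f 0 z + abar f 1 z + pbar f z) + (abar g 0 z + abar g 1 z + pbar g z)"
            by (auto simp: F.abar_eq G.abar_eq pbar_def)
          then show ?thesis using nn nn'  by auto
        next
          case reg: False
          have f1: "zord F.Kf z = zord (deriv f) z"
            using reg True F.Smult_pos_iff[of z] by (intro F.zord_Kf_regular) auto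
          have g1: "zord G.Kf z = zord (deriv g) z"
            using reg gS G.Smult_pos_iff[of z] by (intro G.zord_Kf_regular) auto
          have f2: "ram A f z = zord (deriv f) z"
            using reg True F.Smult_pos_iff[of z] by (auto simp: F.ram_eq A_def S_def)
          have g2: "ram {0} g z = zord (deriv g) z"
            using reg by (auto simp: G.ram_eq)
          \<comment> \<open>At such a point the order of \<Phi> is the difference of the orders of
            f' and g', so one of them is positive; integrality makes it at least 1.\<close>
          have "zord (deriv f) z \<noteq> zord (deriv g) z" using z f1 g1 by (simp add: zord_Phi)
          then have "ram A f z \<ge> 1 \<or> ram {0} g z \<ge> 1"
            using rint[of "deriv f" z] rint[of "deriv g" z] nn(1,3) f2 g2 by force
          moreover have "\<gamma> * ram {0} g z \<ge> 1 * ram {0} g z"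
            using nn(3) ab(2) by (intro mult_right_mono) auto
          ultimately show ?thesis
            using nn(1,3) nn'  pbar_nonneg[of f z] pbar_nonneg[of g z] nn(4)[of 0] nn(4)[of 1] nn(5)[of 0] nn(5)[of 1]
            by linarith
        qed
        then show ?thesis using h1 x0 nn' by linarith
      qed
    qed
  qed
  note lf = F.locfin_abar G.locfin_abar locfin_zord[OF H] locfin_ram[OF F.nz_deriv] locfin_ram[OF G.nz_deriv]
    locfin_pbar[OF F.nz] locfin_pbar[OF G.nz]
  have cnt: "(\<Sum>a\<in>S. vcount (abar f a) r) \<le> vcount (zord H) r + vcount (ram A f) r
      + (vcount (abar f 0) r + vcount (abar f 1) r + vcount (pbar f) r)
      + (vcount (abar g 0) r + vcount (abar g 1) r + vcount (pbar g) r)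
      + \<alpha> * vcount (ram {0} f) r + \<gamma> * vcount (ram {0} g) r" if "r \<ge> 1" for r
  proof -
    have "vcount (\<lambda>z. \<Sum>a\<in>S. abar f a z) r \<le> vcount (\<lambda>z. zord H z + ram A f z + (abar f 0 z + abar f 1 z + pbar f z)
      + (abar g 0 z + abar g 1 z + pbar g z) + \<alpha> * ram {0} f z + \<gamma> * ram {0} g z) r"
      by (intro vcount_mono pw locfin_add locfin_sum locfin_cmult lf finS that)
    moreover have "vcount (\<lambda>z. \<Sum>a\<in>S. abar f a z) r = (\<Sum>a\<in>S. vcount (abar f a) r)"
      by (intro vcount_sum lf finS)
    ultimately show ?thesis
      by (simp add: vcount_add vcount_cmult locfin_add locfin_cmult lf)
  qed
  have S1: "F.small (\<lambda>k. (real (card A) - 1) * nev f (s k) + vcount (ram A f) (s k)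
     - (\<Sum>a\<in>A. vcount (abar f a) (s k)) - vcount (pbar f) (s k))"
    by (rule F.smt[OF A])
  have sumA: "(\<Sum>a\<in>A. vcount (abar f a) r) = vcount (abar f 0) r + vcount (abar f 1) r + (\<Sum>a\<in>S. vcount (abar f a) r)" for r
    using S01 finS by (simp add: A_def)
  show ?thesis
  proof (rule F.small_mono[OF F.small_add[OF F.small_add[OF S1 sH]
        F.small_add[OF F.small_cmult[OF F.ram_0_small ab(1)] F.small_cmult[OF G.ram_0_small, of \<gamma>]]]])
    show "\<gamma> \<ge> 0" using ab by simp
    fix k
    have cA': "real (card A) - 1 = real n + real m + 2" using cA by simp
    show "(real n + real m + 2) * nev f (s k)
     - (2 + \<alpha>) * (vcount (abar f 0) (s k) + vcount (pbar f) (s k)) - 2 * vcount (abar f 1) (s k)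
     - (1 + \<gamma>) * (vcount (abar g 0) (s k) + vcount (pbar g) (s k)) - vcount (abar g 1) (s k)
     \<le> (real (card A) - 1) * nev f (s k) + vcount (ram A f) (s k)
     - (\<Sum>a\<in>A. vcount (abar f a) (s k)) - vcount (pbar f) (s k) + vcount (zord H) (s k)
     + (\<alpha> * (vcount (ram {0} f) (s k) - vcount (abar f 0) (s k) - vcount (pbar f) (s k))
      + \<gamma> * (vcount (ram {0} g) (s k) - vcount (abar g 0) (s k) - vcount (pbar g) (s k)))"
      using cnt[OF F.s_ge_1[of k]] unfolding cA' sumA by (simp add: algebra_simps)
  qed
qed

end

section \<open>An inequality on the curve P(x) = P(y)\<close>

lemma nzmero_bounded_near:
  assumes "nzmero h" "zord h z \<ge> 0"
  obtains M where "eventually (\<lambda>w. cmod (h w) \<le> M) (at z)"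
proof -
  have "\<not> is_pole h z"
    using assms(2) isolated_pole_imp_neg_zorder[of h z] nzmeroD(4)[OF assms(1)] by (auto simp: zord_def)
  then obtain c where "h \<midarrow>z\<rightarrow> c" using nzmeroD(5)[OF assms(1), of z] by (auto simp: not_essential_def)
  then have "((\<lambda>w. cmod (h w)) \<longlongrightarrow> cmod c) (at z)" by (rule tendsto_norm)
  then have "eventually (\<lambda>w. cmod (h w) < cmod c + 1) (at z)" by (rule order_tendstoD) simp
  then have "eventually (\<lambda>w. cmod (h w) \<le> cmod c + 1) (at z)" by eventually_elim simp
  then show ?thesis by (rule that)
qed

lemma zord_nonneg_if_bounded:
  assumes "nzmero h" "eventually (\<lambda>w. cmod (h w) \<le> M) (at z)"
  shows "zord h z \<ge> 0"
proof (rule ccontr)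
  assume "\<not> ?thesis"
  then have "is_pole h z"
    using zorder_neg_imp_is_pole[of h z] nzmeroD[OF assms(1)] by (simp add: zord_def)
  then have "filterlim (\<lambda>w. cmod (h w)) at_top (at z)"
    unfolding is_pole_def by (rule filterlim_at_infinity_imp_norm_at_top)
  then have "eventually (\<lambda>w. cmod (h w) > M) (at z)" by (simp add: filterlim_at_top_dense)
  with assms(2) have "eventually (\<lambda>w. False) (at z)" by eventually_elim auto
  then show False by simp
qed

text \<open>The spherical derivative. It stays bounded near poles as well, and it is dominated by
  |f'/f|; the first property yields absence of poles, the second a small proximity function.\<close>

definition spher :: "(complex \<Rightarrow> complex) \<Rightarrow> complex \<Rightarrow> real" where
  "spher f z = cmod (deriv f z) / (1 + (cmod (f z))\<^sup>2)"

lemma spher_le_deriv: "spher f z \<le> cmod (deriv f z)"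
proof -
  have "cmod (deriv f z) / (1 + (cmod (f z))\<^sup>2) \<le> cmod (deriv f z) / 1"
    by (intro divide_left_mono) (auto intro: add_pos_nonneg)
  then show ?thesis by (simp add: spher_def)
qed

lemma spher_le_pole: "f z \<noteq> 0 \<Longrightarrow> spher f z \<le> cmod (deriv f z / (f z)\<^sup>2)"
  unfolding spher_def norm_divide norm_power by (intro divide_left_mono) (auto intro!: mult_pos_pos add_pos_nonneg)

lemma spher_le_log_deriv: "f z \<noteq> 0 \<Longrightarrow> spher f z \<le> cmod (deriv f z / f z)"
proof -
  assume f: "f z \<noteq> 0"
  have "0 \<le> (cmod (f z) - 1)\<^sup>2" by simp
  then have "2 * cmod (f z) \<le> 1 + (cmod (f z))\<^sup>2" by (simp add: power2_diff)
  then have "cmod (f z) \<le> 1 + (cmod (f z))\<^sup>2" using norm_ge_zero[of "f z"] by linarith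
  then show ?thesis unfolding spher_def norm_divide using f
    by (intro divide_left_mono) (auto intro!: mult_pos_pos add_pos_nonneg)
qed

lemma (in nice_function) spher_bounded_near:
  obtains M where "eventually (\<lambda>w. spher f w \<le> M) (at z)"
proof (cases "zord f z \<ge> 0")
  case True
  obtain M where M: "eventually (\<lambda>w. cmod (deriv f w) \<le> M) (at z)"
    using nzmero_bounded_near[OF nz_deriv zord_deriv_nonneg[OF nz nz_deriv True]] by blast
  then have "eventually (\<lambda>w. spher f w \<le> M) (at z)"
    by eventually_elim (use spher_le_deriv order.trans in blast)
  then show ?thesis by (rule that)
next
  case False
  then have "zorder f z \<le> -1" by (simp add: zord_def)
  then have l: "zord f z \<le> -1" unfolding zord_def by linarith
  have q: "nzmero (\<lambda>w. deriv f w / (f w)\<^sup>2)" by (intro nzmero_divide nzmero_power nz nz_deriv)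
  have "zord (\<lambda>w. deriv f w / (f w)\<^sup>2) z = zord f z - 1 - 2 * zord f z"
    using l zord_deriv[OF nz, of z] by (simp add: zord_divide[OF nz_deriv nzmero_power[OF nz]] zord_power[OF nz])
  then have "zord (\<lambda>w. deriv f w / (f w)\<^sup>2) z \<ge> 0" using l by linarith
  then obtain M where M: "eventually (\<lambda>w. cmod (deriv f w / (f w)\<^sup>2) \<le> M) (at z)"
    using nzmero_bounded_near[OF q] by blast
  then have "eventually (\<lambda>w. spher f w \<le> M) (at z)"
    using nzmeroD(2)[OF nz, of z] by eventually_elim (use spher_le_pole order.trans in blast)
  then show ?thesis by (rule that)
qed

text \<open>Off the compact part both sides have degree $n+m-2$; on it, the right-hand side vanishes only at
  $(0,0)$ and $(1,1)$, where the left-hand side vanishes at least to the same order.\<close>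

lemma curve_inequality:
  assumes n: "n \<ge> 3" and m: "m \<ge> 3"
  obtains C where "C \<ge> 1" "\<And>x y. P_poly n m x = P_poly n m y \<Longrightarrow>
    cmod (x - y) ^ 3 * (1 + cmod y) * cmod y ^ (n - 3) * cmod (y - 1) ^ (m - 3)
    \<le> C * (cmod y ^ n * cmod (y - 1) ^ m / (1 + (cmod x)\<^sup>2) + cmod x ^ n * cmod (x - 1) ^ m / (1 + (cmod y)\<^sup>2))"
proof -
  define F where "F = (\<lambda>x y. cmod (x - y) ^ 3 * cmod y ^ (n - 3) * cmod (y - 1) ^ (m - 3))"
  define G where "G = (\<lambda>x y. cmod y ^ n * cmod (y - 1) ^ m + cmod x ^ n * cmod (x - 1) ^ m)"
  \<comment> \<open>The curve inside the polydisc of radius 2, away from (0,0) and (1,1). A zero of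
    G has both coordinates in {0, 1}, and P 0 \<noteq> P 1 rules out the mixed pairs, so G has a
    positive minimum on K.\<close>
  define K where "K = (cball 0 2 \<times> cball 0 2 \<inter> {p. P_poly n m (fst p) = P_poly n m (snd p)})
      - (ball 0 (1/2) \<times> ball 0 (1/2) \<union> ball 1 (1/2) \<times> ball 1 (1/2))"
  have contP: "continuous_on A (P_poly n m)" for A
    using P_poly_has_derivative by (meson DERIV_isCont continuous_at_imp_continuous_on)
  have P01: "P_poly n m 0 \<noteq> P_poly n m 1"
    using P_poly_1[of m n] n m P_poly_0[of n m] by fastforce
  have clP: "closed {p. P_poly n m (fst p) = P_poly n m (snd p)}"
  proof (rule closed_Collect_eq)
    show "continuous_on UNIV (\<lambda>p. P_poly n m (fst p))"
      by (rule continuous_on_compose2[OF contP[of UNIV]]) (auto intro: continuous_intros)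
    show "continuous_on UNIV (\<lambda>p. P_poly n m (snd p))"
      by (rule continuous_on_compose2[OF contP[of UNIV]]) (auto intro: continuous_intros)
  qed
  have "compact K" unfolding K_def
    by (intro compact_diff compact_Int_closed clP compact_Times compact_cball open_Un open_Times open_ball)
  have contG: "continuous_on K (\<lambda>p. G (fst p) (snd p))" unfolding G_def by (intro continuous_intros)
  obtain g0 where g0: "g0 > 0" "\<And>x y. (x, y) \<in> K \<Longrightarrow> G x y \<ge> g0"
  proof (cases "K = {}")
    case True
    then show ?thesis by (intro that[of 1]) auto
  next
    case False
    obtain p where p: "p \<in> K" "\<And>q. q \<in> K \<Longrightarrow> G (fst p) (snd p) \<le> G (fst q) (snd q)"
      using continuous_attains_inf[OF \<open>compact K\<close> False contG] by blast
    have "G (fst p) (snd p) \<noteq> 0"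
    proof
      assume z: "G (fst p) (snd p) = 0"
      have "cmod (snd p) ^ n * cmod (snd p - 1) ^ m = 0" "cmod (fst p) ^ n * cmod (fst p - 1) ^ m = 0"
        using z unfolding G_def by (simp_all add: add_nonneg_eq_0_iff)
      then have "snd p \<in> {0, 1}" "fst p \<in> {0, 1}" by auto
      then show False using p(1) P01 unfolding K_def by (cases p) auto
    qed
    moreover have "G (fst p) (snd p) \<ge> 0" unfolding G_def by (intro add_nonneg_nonneg mult_nonneg_nonneg) auto
    ultimately show ?thesis using p(2) by (intro that[of "G (fst p) (snd p)"]) force+
  qed
  define C1 where "C1 = 4 ^ 3 * 2 ^ n * 3 ^ m / g0 + 2 ^ (n + m) * 2 ^ (n + m)"
  have C1: "C1 \<ge> 0" using g0 by (simp add: C1_def)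
  have local: "F x y \<le> 2 ^ (n + m) * 2 ^ (n + m) * G x y"
    if "x \<in> ball 0 (1/2) \<and> y \<in> ball 0 (1/2) \<or> x \<in> ball 1 (1/2) \<and> y \<in> ball 1 (1/2)" for x y
  proof -
    \<comment> \<open>One real inequality serves both corners, with n and m exchanged: a and b are
      the distances of x and y to the corner, while d and e are the moduli of the other factors,
      bounded away from 0.\<close>
    have gen: "(a + b) ^ 3 * b ^ (k - 3) * d ^ (j - 3) \<le> 2 ^ (k + j) * 2 ^ (k + j) * (b ^ k * d ^ j + a ^ k * e ^ j)"
      if "a \<ge> 0" "b \<ge> 0" "d \<ge> 1/2" "d \<le> 2" "e \<ge> 1/2" "k \<ge> 3" "j \<ge> 3" for a b d e :: real and j k :: nat
    proof -
      define M where "M = max a b"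
      have "(a + b) ^ 3 * b ^ (k - 3) \<le> (2 * M) ^ 3 * M ^ (k - 3)"
        using that by (intro mult_mono power_mono) (auto simp: M_def)
      also have "\<dots> = 2 ^ 3 * M ^ k" using \<open>k \<ge> 3\<close> by (simp add: power_mult_distrib mult.assoc flip: power_add)
      also have "\<dots> \<le> 2 ^ k * M ^ k" using that by (intro mult_right_mono power_increasing) (auto simp: M_def)
      finally have 1: "(a + b) ^ 3 * b ^ (k - 3) \<le> 2 ^ k * M ^ k" .
      have "d ^ (j - 3) \<le> 2 ^ (j - 3)" using that by (intro power_mono) auto
      also have "\<dots> \<le> (2::real) ^ j" by (intro power_increasing) auto
      finally have 2: "d ^ (j - 3) \<le> 2 ^ j" .
      have 3: "(a + b) ^ 3 * b ^ (k - 3) * d ^ (j - 3) \<le> (2 ^ k * M ^ k) * 2 ^ j"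
        using that by (intro mult_mono 1 2) (auto simp: M_def)
      have h: "(1/2) ^ j \<le> d ^ j" "(1/2) ^ j \<le> e ^ j" using that by (auto intro!: power_mono)
      have "M ^ k * (1/2) ^ j \<le> b ^ k * d ^ j + a ^ k * e ^ j"
      proof (cases "a \<le> b")
        case True
        then have "M ^ k * (1/2) ^ j \<le> b ^ k * d ^ j" using h that by (intro mult_mono) (auto simp: M_def)
        then show ?thesis using that by (auto intro: add_increasing2)
      next
        case False
        then have "M ^ k * (1/2) ^ j \<le> a ^ k * e ^ j" using h that by (intro mult_mono) (auto simp: M_def)
        then show ?thesis using that by (auto intro: add_increasing)
      qed
      then have "M ^ k \<le> 2 ^ j * (b ^ k * d ^ j + a ^ k * e ^ j)" by (simp add: power_one_over field_simps)
      then have "2 ^ k * M ^ k * 2 ^ j \<le> 2 ^ k * (2 ^ j * (b ^ k * d ^ j + a ^ k * e ^ j)) * 2 ^ j"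
        by (intro mult_right_mono mult_left_mono) auto
      also have "\<dots> = 2 ^ (k + j) * 2 ^ j * (b ^ k * d ^ j + a ^ k * e ^ j)" by (simp add: power_add mult_ac)
      also have "\<dots> \<le> 2 ^ (k + j) * 2 ^ (k + j) * (b ^ k * d ^ j + a ^ k * e ^ j)"
        using that by (intro mult_right_mono mult_left_mono power_increasing add_nonneg_nonneg mult_nonneg_nonneg) auto
      finally show ?thesis using 3 by linarith
    qed
    from that show ?thesis
    proof
      assume xy: "x \<in> ball 0 (1/2) \<and> y \<in> ball 0 (1/2)"
      have b: "cmod (y - 1) \<ge> 1/2" "cmod (y - 1) \<le> 2" "cmod (x - 1) \<ge> 1/2"
        using xy norm_triangle_ineq2[of 1 y] norm_triangle_ineq4[of y 1] norm_triangle_ineq2[of 1 x]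
        by (auto simp: norm_minus_commute)
      have "F x y \<le> (cmod x + cmod y) ^ 3 * cmod y ^ (n - 3) * cmod (y - 1) ^ (m - 3)"
        unfolding F_def by (intro mult_right_mono power_mono norm_triangle_ineq4) auto
      also have "\<dots> \<le> 2 ^ (n + m) * 2 ^ (n + m) * (cmod y ^ n * cmod (y - 1) ^ m + cmod x ^ n * cmod (x - 1) ^ m)"
        by (rule gen) (use b n m in auto)
      finally show ?thesis by (simp add: G_def)
    next
      assume xy: "x \<in> ball 1 (1/2) \<and> y \<in> ball 1 (1/2)"
      have d: "cmod (1 - x) < 1/2" "cmod (1 - y) < 1/2" using xy by (auto simp: dist_norm)
      have b: "cmod y \<ge> 1/2" "cmod y \<le> 2" "cmod x \<ge> 1/2"
        using d norm_triangle_ineq2[of 1 "1 - y"] norm_triangle_ineq4[of 1 "1 - y"] norm_triangle_ineq2[of 1 "1 - x"]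
        by auto
      have "cmod (x - y) = cmod ((x - 1) - (y - 1))" by simp
      also have "\<dots> \<le> cmod (x - 1) + cmod (y - 1)" by (rule norm_triangle_ineq4)
      finally have "F x y \<le> (cmod (x - 1) + cmod (y - 1)) ^ 3 * cmod y ^ (n - 3) * cmod (y - 1) ^ (m - 3)"
        unfolding F_def by (intro mult_right_mono power_mono) auto
      also have "\<dots> = (cmod (x - 1) + cmod (y - 1)) ^ 3 * cmod (y - 1) ^ (m - 3) * cmod y ^ (n - 3)" by simp
      also have "\<dots> \<le> 2 ^ (m + n) * 2 ^ (m + n) * (cmod (y - 1) ^ m * cmod y ^ n + cmod (x - 1) ^ m * cmod x ^ n)"
        by (rule gen) (use b n m in auto)
      finally show ?thesis by (simp add: G_def mult.commute add.commute)
    qed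
  qed
  have compact_part: "F x y \<le> C1 * G x y" if xy: "cmod x \<le> 2" "cmod y \<le> 2" "P_poly n m x = P_poly n m y" for x y
  proof (cases "(x, y) \<in> K")
    case True
    have "cmod (x - y) \<le> 4" using norm_triangle_ineq4[of x y] xy by simp
    moreover have "cmod (y - 1) \<le> 3" using norm_triangle_ineq4[of y 1] xy by simp
    ultimately have "F x y \<le> 4 ^ 3 * 2 ^ (n - 3) * 3 ^ (m - 3)"
      unfolding F_def using xy by (intro mult_mono power_mono) auto
    also have "\<dots> \<le> 4 ^ 3 * 2 ^ n * 3 ^ m" by (intro mult_mono power_increasing) auto
    also have "\<dots> = 4 ^ 3 * 2 ^ n * 3 ^ m / g0 * g0" using g0 by simp
    also have "\<dots> \<le> C1 * G x y" using g0(2)[OF True] g0(1) unfolding C1_def by (intro mult_mono) auto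
    finally show ?thesis .
  next
    case False
    then have "F x y \<le> 2 ^ (n + m) * 2 ^ (n + m) * G x y" using xy by (intro local) (auto simp: K_def)
    also have "\<dots> \<le> C1 * G x y"
      using g0 unfolding C1_def G_def by (intro mult_right_mono add_nonneg_nonneg mult_nonneg_nonneg) auto
    finally show ?thesis .
  qed
  \<comment> \<open>15 = 3 * 5: for moduli at most 2, the factor 1 + |y| is at most 3 and the
    denominators are at most 5. The power of 2 serves the part where a modulus exceeds 2.\<close>
  define C where "C = 1 + 15 * C1 + 2 ^ (2 * m + 2 * n + 10)"
  show ?thesis
  proof (rule that[of C])
    show "C \<ge> 1" using C1 by (simp add: C_def)
    fix x y assume P: "P_poly n m x = P_poly n m y"
    let ?R = "cmod y ^ n * cmod (y - 1) ^ m / (1 + (cmod x)\<^sup>2) + cmod x ^ n * cmod (x - 1) ^ m / (1 + (cmod y)\<^sup>2)"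
    have R0: "?R \<ge> 0" by (intro add_nonneg_nonneg divide_nonneg_nonneg mult_nonneg_nonneg) auto
    show "cmod (x - y) ^ 3 * (1 + cmod y) * cmod y ^ (n - 3) * cmod (y - 1) ^ (m - 3) \<le> C * ?R"
    proof (cases "cmod x \<le> 2 \<and> cmod y \<le> 2")
      case True
      have sq: "(cmod x)\<^sup>2 \<le> 2\<^sup>2" "(cmod y)\<^sup>2 \<le> 2\<^sup>2" using True by (intro power_mono; simp)+
      have 1: "a / 5 \<le> a / (1 + (cmod w)\<^sup>2)" if "a \<ge> 0" "(cmod w)\<^sup>2 \<le> 2\<^sup>2" for a and w :: complex
        using that by (intro divide_left_mono) (auto intro: add_pos_nonneg)
      have G: "G x y \<le> 5 * ?R"
      proof -
        have "cmod y ^ n * cmod (y - 1) ^ m / 5 \<le> cmod y ^ n * cmod (y - 1) ^ m / (1 + (cmod x)\<^sup>2)"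
          "cmod x ^ n * cmod (x - 1) ^ m / 5 \<le> cmod x ^ n * cmod (x - 1) ^ m / (1 + (cmod y)\<^sup>2)"
          by (intro 1 sq; simp)+
        moreover have "a + b \<le> 5 * (c + d)" if "a / 5 \<le> c" "b / 5 \<le> d" for a b c d :: real
          using that by simp
        ultimately show ?thesis unfolding G_def by blast
      qed
      have "cmod (x - y) ^ 3 * (1 + cmod y) * cmod y ^ (n - 3) * cmod (y - 1) ^ (m - 3) = (1 + cmod y) * F x y"
        by (simp add: F_def mult_ac)
      also have "\<dots> \<le> 3 * (C1 * G x y)" using compact_part[of x y] True P by (intro mult_mono) (auto simp: F_def)
      also have "\<dots> \<le> 3 * (C1 * (5 * ?R))" using G C1 by (intro mult_left_mono) auto
      also have "\<dots> = 15 * C1 * ?R" by simp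
      also have "\<dots> \<le> C * ?R" using R0 C1 by (intro mult_right_mono) (auto simp: C_def)
      finally show ?thesis .
    next
      case False
      define M where "M = max (cmod x) (cmod y)"
      have M: "M > 2" "cmod x \<le> M" "cmod y \<le> M" using False by (auto simp: M_def)
      have l: "cmod (x - y) \<le> 2 * M" "1 + cmod y \<le> 2 * M" "cmod (y - 1) \<le> 2 * M"
        using norm_triangle_ineq4[of x y] norm_triangle_ineq4[of y 1] M by auto
      have "cmod (x - y) ^ 3 * (1 + cmod y) * cmod y ^ (n - 3) * cmod (y - 1) ^ (m - 3)
          \<le> (2 * M) ^ 3 * (2 * M) * M ^ (n - 3) * (2 * M) ^ (m - 3)"
        using M l by (intro mult_mono power_mono mult_nonneg_nonneg) auto
      also have "\<dots> = (2 * M) ^ 3 * (2 * M) ^ (m - 3) * (2 * M * M ^ (n - 3))" by (simp only: mult_ac)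
      also have "(2 * M) ^ 3 * (2 * M) ^ (m - 3) = (2 * M) ^ m"
        using m by (simp only: power_add[symmetric]) simp
      also have "(2 * M) ^ m * (2 * M * M ^ (n - 3)) = 2 ^ (m + 1) * M ^ (m + 1 + (n - 3))"
        by (simp add: power_mult_distrib power_add)
      also have "m + 1 + (n - 3) = n + m - 2" using n by simp
      finally have L: "cmod (x - y) ^ 3 * (1 + cmod y) * cmod y ^ (n - 3) * cmod (y - 1) ^ (m - 3)
          \<le> 2 ^ (m + 1) * M ^ (n + m - 2)" .
      have low: "M ^ (n + m - 2) / 2 ^ (m + 1) \<le> cmod u ^ n * cmod (u - 1) ^ m / (1 + (cmod w)\<^sup>2)"
        if "cmod u = M" "cmod w \<le> M" for u w :: complex
      proof -
        have "cmod (u - 1) \<ge> M / 2" using norm_triangle_ineq2[of u 1] that M by simp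
        then have "cmod (u - 1) ^ m \<ge> (M / 2) ^ m" using M by (intro power_mono) auto
        then have a: "M ^ n * (M / 2) ^ m \<le> cmod u ^ n * cmod (u - 1) ^ m" using that M by (intro mult_mono) auto
        have "(cmod w)\<^sup>2 \<le> M\<^sup>2" using that by (intro power_mono) auto
        moreover have "1 \<le> M\<^sup>2" using M by (intro one_le_power) auto
        ultimately have b: "1 + (cmod w)\<^sup>2 \<le> 2 * M\<^sup>2" by simp
        have "M ^ (n + m - 2) / 2 ^ (m + 1) = M ^ n * (M / 2) ^ m / (2 * M\<^sup>2)"
        proof -
          have "n + m - 2 + 2 = n + m" using n by simp
          then have "M ^ n * M ^ m = M ^ (n + m - 2) * M\<^sup>2" by (simp only: power_add[symmetric])
          then show ?thesis using M by (simp add: field_simps)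
        qed
        also have "\<dots> \<le> cmod u ^ n * cmod (u - 1) ^ m / (1 + (cmod w)\<^sup>2)"
          using a b M by (intro frac_le) (auto intro: add_pos_nonneg)
        finally show ?thesis .
      qed
      have n1: "cmod x ^ n * cmod (x - 1) ^ m / (1 + (cmod y)\<^sup>2) \<ge> 0" "cmod y ^ n * cmod (y - 1) ^ m / (1 + (cmod x)\<^sup>2) \<ge> 0"
        by auto
      have "M ^ (n + m - 2) / 2 ^ (m + 1) \<le> ?R"
      proof (cases "cmod y = M")
        case True
        then show ?thesis using low[of y x] M n1 by linarith
      next
        case False
        then have "cmod x = M" by (auto simp: M_def max_def split: if_splits)
        then show ?thesis using low[of x y] M n1 by linarith
      qed
      then have "2 ^ (m + 1) * M ^ (n + m - 2) \<le> 2 ^ (m + 1) * (2 ^ (m + 1) * ?R)"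
        by (intro mult_left_mono) (auto simp: field_simps)
      also have "\<dots> = 2 ^ (2 * m + 2) * ?R"
      proof -
        have "m + 1 + (m + 1) = 2 * m + 2" by simp
        then have "(2::real) ^ (m + 1) * 2 ^ (m + 1) = 2 ^ (2 * m + 2)" by (simp only: power_add[symmetric])
        then show ?thesis by (simp only: mult.assoc[symmetric])
      qed
      also have "\<dots> \<le> C * ?R"
      proof (rule mult_right_mono[OF _ R0])
        have "(2::real) ^ (2 * m + 2) \<le> 2 ^ (2 * m + 2 * n + 10)" by (intro power_increasing) auto
        then show "2 ^ (2 * m + 2) \<le> C" using C1 by (simp add: C_def)
      qed
      finally show ?thesis using L by linarith
    qed
  qed
qed

text \<open>On the curve the differentials share the quotient t = dx / P'(y) = dy / P'(x) wherever
  both denominators are nonzero. Setting dx = P'(y) t and dy = P'(x) t turns the inequality between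
  points into one between differentials after multiplication by |t|.\<close>

lemma curve_form_inequality:
  assumes n: "n \<ge> 3" and m: "m \<ge> 3"
  obtains C where "C \<ge> 1" "\<And>x y dx dy. P_poly n m x = P_poly n m y \<Longrightarrow>
    x ^ n * (x - 1) ^ m * dx = y ^ n * (y - 1) ^ m * dy \<Longrightarrow> y \<noteq> 0 \<Longrightarrow> y \<noteq> 1 \<Longrightarrow>
    cmod (x - y) ^ 3 * cmod dx * (1 + cmod y) / cmod (y * (y - 1)) ^ 3
    \<le> C * (cmod dx / (1 + (cmod x)\<^sup>2) + cmod dy / (1 + (cmod y)\<^sup>2))"
proof -
  obtain C where C: "C \<ge> 1" "\<And>x y. P_poly n m x = P_poly n m y \<Longrightarrow>
    cmod (x - y) ^ 3 * (1 + cmod y) * cmod y ^ (n - 3) * cmod (y - 1) ^ (m - 3)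
    \<le> C * (cmod y ^ n * cmod (y - 1) ^ m / (1 + (cmod x)\<^sup>2) + cmod x ^ n * cmod (x - 1) ^ m / (1 + (cmod y)\<^sup>2))"
    using curve_inequality[OF n m] by blast
  show ?thesis
  proof (rule that[OF C(1)])
    fix x y dx dy :: complex
    assume P: "P_poly n m x = P_poly n m y" and d: "x ^ n * (x - 1) ^ m * dx = y ^ n * (y - 1) ^ m * dy"
      and y: "y \<noteq> 0" "y \<noteq> 1"
    define t where "t = dx / (y ^ n * (y - 1) ^ m)"
    define \<tau> where "\<tau> = cmod t"
    have t: "dx = y ^ n * (y - 1) ^ m * t" "dy = x ^ n * (x - 1) ^ m * t"
      using y d by (simp_all add: t_def field_simps)
    have "cmod (x - y) ^ 3 * cmod dx * (1 + cmod y) / cmod (y * (y - 1)) ^ 3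
      = \<tau> * (cmod (x - y) ^ 3 * (1 + cmod y) * cmod y ^ (n - 3) * cmod (y - 1) ^ (m - 3))"
    proof -
      have "cmod y ^ n = cmod y ^ 3 * cmod y ^ (n - 3)" "cmod (y - 1) ^ m = cmod (y - 1) ^ 3 * cmod (y - 1) ^ (m - 3)"
        using n m by (simp_all flip: power_add)
      then show ?thesis using y unfolding t(1) norm_mult norm_power power_mult_distrib \<tau>_def
        by (simp add: field_simps)
    qed
    also have "\<dots> \<le> \<tau> * (C * (cmod y ^ n * cmod (y - 1) ^ m / (1 + (cmod x)\<^sup>2) + cmod x ^ n * cmod (x - 1) ^ m / (1 + (cmod y)\<^sup>2)))"
      by (intro mult_left_mono C(2) P) (auto simp: \<tau>_def)
    also have "\<dots> = C * (cmod dx / (1 + (cmod x)\<^sup>2) + cmod dy / (1 + (cmod y)\<^sup>2))"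
      unfolding t norm_mult norm_power \<tau>_def by (simp add: algebra_simps add_divide_distrib)
    finally show "cmod (x - y) ^ 3 * cmod dx * (1 + cmod y) / cmod (y * (y - 1)) ^ 3
    \<le> C * (cmod dx / (1 + (cmod x)\<^sup>2) + cmod dy / (1 + (cmod y)\<^sup>2))" .
  qed
qed

section \<open>Degenerate cases\<close>

text \<open>Let Q(x,y) = (P(x) - P(y)) / (x - y), of degree n + m. Up to sign, V dz is the pull-back
  of (x-y)^2 y^(n-3) (y-1)^(m-3) dx / Q_y under x = f, y = g. The polynomial has degree n + m - 4,
  so even after multiplication by y it meets the bound n + m - 3 for holomorphic differentials; its
  orders n - 1 at (0,0) and m - 1 at (1,1) are those required at ordinary points of multiplicity n
  and m.\<close>

definition Vfun :: "(complex \<Rightarrow> complex) \<Rightarrow> (complex \<Rightarrow> complex) \<Rightarrow> complex \<Rightarrow> complex" where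
  "Vfun f g z = (f z - g z) ^ 3 * deriv f z / (g z * (g z - 1)) ^ 3"

definition Ufun :: "(complex \<Rightarrow> complex) \<Rightarrow> (complex \<Rightarrow> complex) \<Rightarrow> complex \<Rightarrow> complex" where
  "Ufun f g z = g z * Vfun f g z"

lemma nz_Vfun_Ufun:
  assumes f: "f nicely_meromorphic_on UNIV" "\<not> (\<exists>c. \<forall>z. f z = c)"
    and g: "g nicely_meromorphic_on UNIV" "\<not> (\<exists>c. \<forall>z. g z = c)" and "f \<noteq> g"
  shows "nzmero (Vfun f g)" "nzmero (Ufun f g)"
proof -
  have mfg: "(\<lambda>z. f z - g z) meromorphic_on UNIV"
    using f g by (intro meromorphic_intros) (auto simp: nicely_meromorphic_on_def)
  have "\<not> eventually (\<lambda>z. f z - g z = 0) (cosparse UNIV)"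
    using nice_eventually_eq[OF f(1) g(1)] \<open>f \<noteq> g\<close> by auto
  then have nfg: "nzmero (\<lambda>z. f z - g z)"
    using meromorphic_imp_constant_or_avoid[OF mfg open_UNIV connected_UNIV, of 0] mfg by (auto simp: nzmero_def)
  show nV: "nzmero (Vfun f g)" unfolding Vfun_def[abs_def]
    by (intro nzmero_divide nzmero_mult nzmero_power nfg nice_deriv_nzmero[OF f] nice_nzmero[OF g] nice_shift_nzmero[OF g])
  show "nzmero (Ufun f g)" unfolding Ufun_def[abs_def] by (intro nzmero_mult nice_nzmero[OF g] nV)
qed

section \<open>Cardinalities of regular and critical fibres of P\<close>

context nice_function
begin

lemma sum_abar_fiber: "(\<Sum>a | P a = v. abar f a z) = of_bool (zord (\<lambda>z. P (f z) - v) z > 0)"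
proof (cases "zord f z \<ge> 0")
  case True
  obtain p :: nat where p: "p \<ge> 1" "aord f (f z) z = real p" using finite_aord_value[OF True] by blast
  have "(\<Sum>a | P a = v. abar f a z) = (\<Sum>a | P a = v. if a = f z then 1 else 0)"
    using True by (intro sum.cong) (auto simp: abar_eq)
  also have "\<dots> = of_bool (P (f z) = v)" using finite_P_fiber[of v] by simp
  also have "\<dots> = of_bool (zord (\<lambda>z. P (f z) - v) z > 0)"
    using p by (simp add: zord_P_finite[OF True] P_ord_def)
  finally show ?thesis .
next
  case False
  then have neg: "zord f z < 0" by simp
  have "real (n + m + 1) * zord f z < 0" using neg by (intro mult_pos_neg) auto
  then have "\<not> zord (\<lambda>z. P (f z) - v) z > 0" unfolding zord_P_pole[OF neg] by linarith
  moreover have "(\<Sum>a | P a = v. abar f a z) = 0" using neg by (intro sum.neutral) (auto simp: abar_eq)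
  ultimately show ?thesis by simp
qed

lemma sum_abar_S: "(\<Sum>a | P a = 0. abar f a z) = of_bool (Smult z > 0)"
proof -
  have "(\<Sum>a | P a = 0. abar f a z) = (\<Sum>a | P a = 0. if a = f z then of_bool (zord f z \<ge> 0) else 0)"
    by (intro sum.cong) (auto simp: abar_eq)
  then show ?thesis using finite_P_fiber[of 0] by (simp add: Smult_pos_iff)
qed

lemma P0_ne_P1: "P 0 \<noteq> P 1"
  using P_poly_1[of m n] nm P_poly_0[of n m] by fastforce

lemma card_fiber_regular:
  assumes "v \<noteq> P 0" "v \<noteq> P 1"
  shows "card {a. P a = v} = n + m + 1"
proof -
  have "(\<Sum>a | P a = v. P_ord n m a) = n + m + 1" using P_factor[of v] by metis
  moreover have "(\<Sum>a | P a = v. P_ord n m a) = (\<Sum>a | P a = v. 1)"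
    using assms by (intro sum.cong) (auto simp: P_ord_def)
  ultimately show ?thesis by simp
qed

lemma sum_P_ord_split:
  "(\<Sum>a\<in>{a. P a = v} - {0, 1}. P_ord n m a) = card ({a. P a = v} - {0, 1})"
proof -
  have "(\<Sum>a\<in>{a. P a = v} - {0, 1}. P_ord n m a) = (\<Sum>a\<in>{a. P a = v} - {0, 1}. 1)"
    by (intro sum.cong) (auto simp: P_ord_def)
  then show ?thesis by simp
qed

lemma card_fiber_split:
  "n + m + 1 = (\<Sum>a\<in>{a. P a = v} \<inter> {0, 1}. P_ord n m a) + card ({a. P a = v} - {0, 1})"
proof -
  have "n + m + 1 = (\<Sum>a | P a = v. P_ord n m a)" using P_factor[of v] by metis
  also have "\<dots> = (\<Sum>a\<in>{a. P a = v} \<inter> {0, 1}. P_ord n m a) + (\<Sum>a\<in>{a. P a = v} - {0, 1}. P_ord n m a)"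
    using finite_P_fiber[of v] by (rule sum.Int_Diff)
  finally show ?thesis by (simp add: sum_P_ord_split)
qed

lemma fiber_cases:
  "{a. P a = v} \<inter> {0, 1} = {} \<or> {a. P a = v} \<inter> {0, 1} = {0} \<or> {a. P a = v} \<inter> {0, 1} = {1}"
  using P0_ne_P1 by auto

text \<open>Taking the critical root away from its fibre leaves m or n simple roots. Three of them
  suffice, because three finite values give the second main theorem the coefficient 3 - 2 = 1 in
  reduced form.\<close>

lemma card_simple_roots_ge: "card ({a. P a = v} - {0, 1}) \<ge> 3"
proof -
  define X where "X = {a. P a = v} \<inter> {0, 1}"
  define Y where "Y = card ({a. P a = v} - {0, 1})"
  have "X = {} \<or> X = {0} \<or> X = {1}" using fiber_cases[of v] unfolding X_def .
  moreover have "n + m + 1 = (\<Sum>a\<in>X. P_ord n m a) + Y" using card_fiber_split[of v] unfolding X_def Y_def .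
  ultimately have "Y \<ge> 3" using nm by (auto simp: P_ord_def)
  then show ?thesis by (simp add: Y_def)
qed

text \<open>The fibre through 0 has m + 1 points and the one through 1 has n + 1; with n, m \<ge> 3
  either number is at most n + m - 2.\<close>

lemma card_fiber_critical:
  assumes "v = P 0 \<or> v = P 1"
  shows "card {a. P a = v} \<le> n + m - 2"
proof -
  define X where "X = {a. P a = v} \<inter> {0, 1}"
  define Y where "Y = card ({a. P a = v} - {0, 1})"
  have "card {a. P a = v} = card X + Y"
    unfolding X_def Y_def using finite_P_fiber[of v] by (metis Int_Diff_disjoint Int_Diff_Un card_Un_disjoint finite_Diff finite_Int)
  moreover have "X \<noteq> {}" using assms by (auto simp: X_def)
  moreover have "X = {} \<or> X = {0} \<or> X = {1}" using fiber_cases[of v] unfolding X_def .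
  moreover have "n + m + 1 = (\<Sum>a\<in>X. P_ord n m a) + Y" using card_fiber_split[of v] unfolding X_def Y_def .
  ultimately show ?thesis using nm by (auto simp: P_ord_def)
qed

end

context growth_sequence
begin

text \<open>The contradiction in which all degenerate cases end.\<close>

lemma not_small_phi: "d > 0 \<Longrightarrow> \<not> small (\<lambda>k. d * \<phi> k)"
proof
  assume d: "d > 0" and sm: "small (\<lambda>k. d * \<phi> k)"
  have d2: "d / 2 > 0" using d by simp
  have "eventually (\<lambda>k. d * \<phi> k \<le> d / 2 * \<phi> k) sequentially"
    by (rule sm[unfolded small_def, rule_format, OF d2])
  then obtain k where "d * \<phi> k \<le> d / 2 * \<phi> k" by (auto simp: eventually_sequentially)
  moreover have "d * \<phi> k > 0" using d phi_ge_1[of k] by simp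
  ultimately show False by simp
qed

end

section \<open>Comparison of the two characteristics and the degenerate relations\<close>

locale sharing_pair' = sharing_pair +
  assumes phi_eq: "\<And>k. \<phi> k = nev f (s k) + nev g (s k)"
    and share: "\<And>z. F.Smult z = 0 \<longleftrightarrow> G.Smult z = 0"
begin

text \<open>The second main theorem for f over \<open>A1\<close> meets the first main theorem for g
  over \<open>A2\<close>. A useful bound results when the fibre on the side of g has fewer points
  than the one on the side of f.\<close>

lemma transfer:
  assumes "finite A1" "A1 \<noteq> {}" "A1 \<subseteq> AA" "finite A2" "A2 \<subseteq> AA"
    and le: "\<And>z. (\<Sum>a\<in>A1. abar f a z) \<le> (\<Sum>a\<in>A2. abar g a z)"
  shows "F.small (\<lambda>k. (real (card A1) - 2) * nev f (s k) - real (card A2) * nev g (s k))"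
proof -
  have 1: "F.small (\<lambda>k. (real (card A1) - 2) * nev f (s k) - (\<Sum>a\<in>A1. vcount (abar f a) (s k)))"
    by (rule F.smt_reduced[OF assms(1-3)])
  have 2: "F.small (\<lambda>k. \<Sum>a\<in>A2. vcount (abar g a) (s k) - nev g (s k))"
    using assms(5) by (intro F.small_sum assms(4) G.fmt) auto
  show ?thesis
  proof (rule F.small_mono[OF F.small_add[OF 1 2]])
    fix k
    have "vcount (\<lambda>z. \<Sum>a\<in>A1. abar f a z) (s k) \<le> vcount (\<lambda>z. \<Sum>a\<in>A2. abar g a z) (s k)"
      by (intro vcount_mono locfin_sum assms F.locfin_abar G.locfin_abar F.s_ge_1 le)
    then have "(\<Sum>a\<in>A1. vcount (abar f a) (s k)) \<le> (\<Sum>a\<in>A2. vcount (abar g a) (s k))"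
      using vcount_sum[OF assms(1) F.locfin_abar, where r = "s k"] vcount_sum[OF assms(4) G.locfin_abar, where r = "s k"] by simp
    then show "(real (card A1) - 2) * nev f (s k) - real (card A2) * nev g (s k)
      \<le> (real (card A1) - 2) * nev f (s k) - (\<Sum>a\<in>A1. vcount (abar f a) (s k))
        + (\<Sum>a\<in>A2. vcount (abar g a) (s k) - nev g (s k))"
      by (simp add: sum_subtractf)
  qed
qed

lemma comparable: "F.small (\<lambda>k. (real (n + m) - 1) * nev f (s k) - real (n + m + 1) * nev g (s k))"
proof -
  have c: "card {a. F.P a = 0} = n + m + 1" using F.card_fiber_regular[of 0] F.P_0_1 by metis
  have e: "(\<Sum>a | F.P a = 0. abar f a z) \<le> (\<Sum>a | F.P a = 0. abar g a z)" for z
  proof -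
    show ?thesis unfolding F.sum_abar_S G.sum_abar_S using share[of z] by (cases "F.Smult z = 0") auto
  qed
  have ne: "{a. F.P a = 0} \<noteq> {}" using c by (metis Suc_eq_plus1 card.empty nat.distinct(1))
  show ?thesis
    using transfer[OF F.finite_P_fiber[of 0] ne _ F.finite_P_fiber[of 0] _ e] AA c by (simp add: algebra_simps)
qed

text \<open>Adding 2 (n + m) T(g) to \<open>comparable\<close> leaves (n + m - 1) (T(f) + T(g)), so
  smallness of one characteristic would make \<phi> small.\<close>

lemma nev_g_not_small:
  assumes "\<delta> > 0" "F.small (\<lambda>k. \<delta> * nev g (s k))"
  shows False
proof -
  have "F.small (\<lambda>k. (2 * real (n + m) / \<delta>) * (\<delta> * nev g (s k)))"
    by (rule F.small_cmult[OF assms(2)]) (use assms(1) in simp)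
  then have "F.small (\<lambda>k. 2 * real (n + m) * nev g (s k))" using assms(1) by simp
  from F.small_add[OF comparable this] have "F.small (\<lambda>k. (real (n + m) - 1) * \<phi> k)"
    by (rule F.small_mono) (simp add: phi_eq algebra_simps)
  then show False using F.not_small_phi[of "real (n + m) - 1"] F.nm by simp
qed

lemma no_pole_relation:
  assumes rel: "eventually (\<lambda>z. inverse (F.P (f z)) = c * inverse (F.P (g z)) + b) (cosparse UNIV)"
    and cb: "c \<noteq> 0" "b \<noteq> 0" and AAv: "{a. F.P a = - c / b} \<subseteq> AA"
  shows False
proof -
  define v where "v = - c / b"
  have v: "v \<noteq> 0" "c = - b * v" using cb by (auto simp: v_def)
  \<comment> \<open>Clearing denominators in the relation gives P(g) = b P(f) (P(g) - v).\<close>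
  have ord: "zord (\<lambda>z. F.P (g z) - 0) z = zord (\<lambda>z. F.P (f z) - 0) z + zord (\<lambda>z. F.P (g z) - v) z" for z
  proof -
    have nb: "nzmero (\<lambda>z. b)" using cb by (intro nzmero_const)
    have "eventually (\<lambda>z. F.P (g z) - 0 = b * ((F.P (f z) - 0) * (F.P (g z) - v))) (at z)"
      using eventually_cosparse_UNIV_at[OF rel, of z] nzmeroD(2)[OF F.nz_P0, of z] nzmeroD(2)[OF G.nz_P0, of z]
    proof eventually_elim
      case (elim z)
      have "1 = F.P (f z) * inverse (F.P (f z))" using elim(2) by simp
      also have "\<dots> = F.P (f z) * (c * inverse (F.P (g z)) + b)" by (simp only: elim(1))
      finally have "F.P (g z) = F.P (f z) * (c * inverse (F.P (g z)) + b) * F.P (g z)" by simp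
      also have "\<dots> = F.P (f z) * (c + b * F.P (g z))" using elim by (simp add: algebra_simps)
      finally show ?case unfolding v(2) by (simp add: algebra_simps)
    qed
    from zorder_cong_at[OF this]
    have "zord (\<lambda>z. F.P (g z) - 0) z = zord (\<lambda>z. b * ((F.P (f z) - 0) * (F.P (g z) - v))) z" by (simp add: zord_def)
    also have "\<dots> = zord (\<lambda>z. b) z + (zord (\<lambda>z. F.P (f z) - 0) z + zord (\<lambda>z. F.P (g z) - v) z)"
      unfolding zord_mult[OF nb nzmero_mult[OF F.nz_P G.nz_P]] zord_mult[OF F.nz_P G.nz_P] ..
    finally show ?thesis using cb by (simp add: zord_def)
  qed
  obtain A where A: "A \<subseteq> {a. F.P a = v} - {0, 1}" "card A = 3" "finite A"
    using obtain_subset_with_card_n[OF F.card_simple_roots_ge[of v]] by metis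
  have sub: "A \<subseteq> AA" using A(1) AAv by (auto simp: v_def)
  \<comment> \<open>Where g = a with multiplicity q, the left side P(g) = v is nonzero while P(g) -
    v vanishes to order q, so P(f) has a pole of order q. A pole of P(f) has order n + m + 1 times
    that of a pole of f.\<close>
  have mult: "real (n + m + 1) * abar g a z \<le> zeros_of (\<lambda>z. g z - a) z" if a: "a \<in> A" for a z
  proof (cases "zord g z \<ge> 0 \<and> g z = a")
    case True
    then have fin: "zord g z \<ge> 0" and ga: "g z = a" by auto
    have Pa: "F.P a = v" "a \<noteq> 0" "a \<noteq> 1" using a A by auto
    obtain q :: nat where q: "q \<ge> 1" "aord g (g z) z = real q" using G.finite_aord_value[OF fin] by blast
    have "zord (\<lambda>z. F.P (f z) - 0) z = - real q"
      using ord[of z] G.zord_P_finite[OF fin, of 0] G.zord_P_finite[OF fin, of v] Pa ga q v by (simp add: P_ord_def)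
    moreover have "zord (\<lambda>z. F.P (f z) - 0) z \<ge> 0" if "zord f z \<ge> 0"
      using F.zord_P_finite[OF that, of 0] F.finite_aord_ge_0[OF that] by simp
    ultimately have neg: "zord f z < 0" using q by force
    then have "zorder f z \<le> -1" by (simp add: zord_def)
    then have "zord f z \<le> -1" unfolding zord_def by linarith
    then have "real (n + m + 1) * zord f z \<le> real (n + m + 1) * (-1)" by (intro mult_left_mono) auto
    then have "real q \<ge> real (n + m + 1)"
      using F.zord_P_pole[OF neg, of 0] \<open>zord (\<lambda>z. F.P (f z) - 0) z = - real q\<close> by simp
    then show ?thesis using True q ga by (simp add: G.abar_eq zeros_of_def aord_def)
  next
    case False
    then show ?thesis by (auto simp: G.abar_eq)
  qed
  have 1: "F.small (\<lambda>k. (real (card A) - 2) * nev g (s k) - (\<Sum>a\<in>A. vcount (abar g a) (s k)))"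
    using A by (intro G.smt_reduced sub) auto
  have 2: "F.small (\<lambda>k. \<Sum>a\<in>A. vcount (abar g a) (s k) - nev g (s k) / real (n + m + 1))"
  proof (rule F.small_sum[OF A(3)])
    fix a assume "a \<in> A"
    then show "F.small (\<lambda>k. vcount (abar g a) (s k) - nev g (s k) / real (n + m + 1))"
      using sub by (intro G.fmt_weighted[OF _ _ G.locfin_abar mult]) auto
  qed
  have "F.small (\<lambda>k. (1 - 3 / real (n + m + 1)) * nev g (s k))"
  proof (rule F.small_mono[OF F.small_add[OF 1 2]])
    fix k
    have "(\<Sum>a\<in>A. vcount (abar g a) (s k) - nev g (s k) / real (n + m + 1))
       = (\<Sum>a\<in>A. vcount (abar g a) (s k)) - 3 * (nev g (s k) / real (n + m + 1))"
      using A(2) by (simp add: sum_subtractf)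
    then show "(1 - 3 / real (n + m + 1)) * nev g (s k) \<le> (real (card A) - 2) * nev g (s k) - (\<Sum>a\<in>A. vcount (abar g a) (s k))
        + (\<Sum>a\<in>A. vcount (abar g a) (s k) - nev g (s k) / real (n + m + 1))"
      using A(2) by (simp add: left_diff_distrib)
  qed
  moreover have "1 - 3 / real (n + m + 1) > 0" using F.nm by simp
  ultimately show False using nev_g_not_small by blast
qed

text \<open>Over the regular value v there are n + m + 1 points for f, and over the critical value c
  v at most n + m - 2 for g. The second main theorem loses 2 on the first number, which still leaves
  the two coefficients one apart.\<close>

lemma proportional_bound:
  assumes rel: "eventually (\<lambda>z. F.P (g z) = c * F.P (f z)) (cosparse UNIV)" and c: "c \<noteq> 0"
    and v: "v \<noteq> F.P 0" "v \<noteq> F.P 1" and w: "c * v = F.P 0 \<or> c * v = F.P 1"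
    and AAv: "{a. F.P a = v} \<subseteq> AA" "{a. F.P a = c * v} \<subseteq> AA"
  shows "F.small (\<lambda>k. (real (n + m) - 1) * nev f (s k) - (real (n + m) - 2) * nev g (s k))"
proof -
  have eq: "zord (\<lambda>z. F.P (f z) - v) z = zord (\<lambda>z. F.P (g z) - c * v) z" for z
  proof -
    have "eventually (\<lambda>z. F.P (g z) - c * v = c * (F.P (f z) - v)) (at z)"
      using eventually_cosparse_UNIV_at[OF rel, of z] by eventually_elim (simp add: algebra_simps)
    from zorder_cong_at[OF this] have "zord (\<lambda>z. F.P (g z) - c * v) z = zord (\<lambda>z. c * (F.P (f z) - v)) z"
      by (simp add: zord_def)
    then show ?thesis using zord_mult[OF nzmero_const[OF c] F.nz_P, of v z] c by (simp add: zord_def)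
  qed
  have cv: "card {a. F.P a = v} = n + m + 1" by (rule F.card_fiber_regular[OF v])
  have cw: "card {a. F.P a = c * v} \<le> n + m - 2" by (rule F.card_fiber_critical[OF w])
  have ne: "{a. F.P a = v} \<noteq> {}" using cv by (metis Suc_eq_plus1 card.empty nat.distinct(1))
  have "F.small (\<lambda>k. (real (card {a. F.P a = v}) - 2) * nev f (s k) - real (card {a. F.P a = c * v}) * nev g (s k))"
    by (rule transfer[OF F.finite_P_fiber ne AAv(1) F.finite_P_fiber AAv(2)])
      (simp add: F.sum_abar_fiber G.sum_abar_fiber eq)
  then show ?thesis
  proof (rule F.small_mono)
    fix k
    have "nev g (s k) \<ge> 0" using F.s_good[of k] F.s_ge_1[of k] F.adm_bad[OF G.adm]
      by (intro nev_nonneg[OF G.nz]) auto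
    then have "real (card {a. F.P a = c * v}) * nev g (s k) \<le> (real (n + m) - 2) * nev g (s k)"
      using cw F.nm by (intro mult_right_mono) auto
    then show "(real (n + m) - 1) * nev f (s k) - (real (n + m) - 2) * nev g (s k)
      \<le> (real (card {a. F.P a = v}) - 2) * nev f (s k) - real (card {a. F.P a = c * v}) * nev g (s k)"
      by (simp add: cv algebra_simps)
  qed
qed

lemma analytic_relation:
  assumes rel: "eventually (\<lambda>z. F.P (f z) = F.P (g z)) (cosparse UNIV)"
    and an: "f analytic_on {z}" "g analytic_on {z}"
  shows "F.P (f z) = F.P (g z)" "f z ^ n * (f z - 1) ^ m * deriv f z = g z ^ n * (g z - 1) ^ m * deriv g z"
proof -
  have df: "(f has_field_derivative deriv f z) (at z)" "(g has_field_derivative deriv g z) (at z)"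
    using an analytic_on_imp_differentiable_at DERIV_deriv_iff_field_differentiable by blast+
  have 1: "((\<lambda>z. F.P (f z)) has_field_derivative (f z ^ n * (f z - 1) ^ m) * deriv f z) (at z)"
    by (rule DERIV_chain2[OF P_poly_has_derivative df(1)])
  have 2: "((\<lambda>z. F.P (g z)) has_field_derivative (g z ^ n * (g z - 1) ^ m) * deriv g z) (at z)"
    by (rule DERIV_chain2[OF P_poly_has_derivative df(2)])
  have l: "(\<lambda>z. F.P (f z)) \<midarrow>z\<rightarrow> F.P (f z)" "(\<lambda>z. F.P (g z)) \<midarrow>z\<rightarrow> F.P (g z)"
    using DERIV_isCont[OF 1] DERIV_isCont[OF 2] by (auto simp: isCont_def)
  have ev: "eventually (\<lambda>z. F.P (f z) = F.P (g z)) (at z)" using rel by (rule eventually_cosparse_UNIV_at)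
  show eq: "F.P (f z) = F.P (g z)"
    using l(1) l(2) unfolding tendsto_cong[OF ev] by (rule LIM_unique)
  have ev': "eventually (\<lambda>z. F.P (f z) = F.P (g z)) (nhds z)" using ev eq by (auto simp: eventually_at_filter elim: eventually_mono)
  have "((\<lambda>z. F.P (f z)) has_field_derivative (g z ^ n * (g z - 1) ^ m) * deriv g z) (at z)"
    by (subst DERIV_cong_ev[OF refl ev' refl]) (rule 2)
  from DERIV_unique[OF 1 this] show "f z ^ n * (f z - 1) ^ m * deriv f z = g z ^ n * (g z - 1) ^ m * deriv g z" .
qed

text \<open>$V dz$ and $gV dz$ are pull-backs of holomorphic differentials of the curve $P(x) = P(y)$ with the
  diagonal removed. Hence $V$ and $gV$ are dominated by the spherical derivatives of $f$ and $g$, which makes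
  them pole-free with small proximity function, and $g = gV / V$ would have small characteristic.\<close>

lemma equal_if_P_equal:
  assumes rel: "eventually (\<lambda>z. F.P (f z) = F.P (g z)) (cosparse UNIV)"
    and bV: "bad_radii (Vfun f g) \<subseteq> B" and bU: "bad_radii (Ufun f g) \<subseteq> B"
  shows "f = g"
proof (rule ccontr)
  assume neq: "f \<noteq> g"
  have nV: "nzmero (Vfun f g)" and nU: "nzmero (Ufun f g)"
    by (rule nz_Vfun_Ufun[OF F.nice F.nonconst G.nice G.nonconst neq])+
  obtain C where C: "C \<ge> 1" "\<And>x y dx dy. P_poly n m x = P_poly n m y \<Longrightarrow>
    x ^ n * (x - 1) ^ m * dx = y ^ n * (y - 1) ^ m * dy \<Longrightarrow> y \<noteq> 0 \<Longrightarrow> y \<noteq> 1 \<Longrightarrow>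
    cmod (x - y) ^ 3 * cmod dx * (1 + cmod y) / cmod (y * (y - 1)) ^ 3
    \<le> C * (cmod dx / (1 + (cmod x)\<^sup>2) + cmod dy / (1 + (cmod y)\<^sup>2))"
    using curve_form_inequality[OF F.nm] by blast
  have bound: "cmod (Vfun f g z) \<le> C * (spher f z + spher g z)" "cmod (Ufun f g z) \<le> C * (spher f z + spher g z)"
    if an: "f analytic_on {z}" "g analytic_on {z}" for z
  proof -
    have "cmod (Vfun f g z) * (1 + cmod (g z)) \<le> C * (spher f z + spher g z)"
    proof (cases "g z = 0 \<or> g z = 1")
      case True
      then have "Vfun f g z = 0" by (auto simp: Vfun_def)
      then show ?thesis using C(1) by (auto simp: spher_def intro!: mult_nonneg_nonneg add_nonneg_nonneg)
    next
      case False
      have "cmod (Vfun f g z) * (1 + cmod (g z)) = cmod (f z - g z) ^ 3 * cmod (deriv f z) * (1 + cmod (g z)) / cmod (g z * (g z - 1)) ^ 3"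
        by (simp add: Vfun_def norm_divide norm_mult norm_power)
      then show ?thesis using C(2)[OF analytic_relation[OF rel an]] False by (simp add: spher_def)
    qed
    moreover have "cmod (Vfun f g z) * (1 + cmod (g z)) = cmod (Vfun f g z) + cmod (Ufun f g z)"
      by (simp add: Ufun_def norm_mult algebra_simps)
    ultimately show "cmod (Vfun f g z) \<le> C * (spher f z + spher g z)" "cmod (Ufun f g z) \<le> C * (spher f z + spher g z)"
      using norm_ge_zero[of "Vfun f g z"] norm_ge_zero[of "Ufun f g z"] by linarith+
  qed
  \<comment> \<open>The bound is available only where f and g are analytic, but that holds near each
    point, and the spherical derivatives stay bounded there even if f or g has a pole.\<close>
  have entire: "zord h z \<ge> 0"
    if h: "nzmero h" and hb: "\<And>z. f analytic_on {z} \<Longrightarrow> g analytic_on {z} \<Longrightarrow> cmod (h z) \<le> C * (spher f z + spher g z)" for h z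
  proof -
    obtain M1 where M1: "eventually (\<lambda>w. spher f w \<le> M1) (at z)" using F.spher_bounded_near by blast
    obtain M2 where M2: "eventually (\<lambda>w. spher g w \<le> M2) (at z)" using G.spher_bounded_near by blast
    have "eventually (\<lambda>w. f analytic_on {w}) (at z)" "eventually (\<lambda>w. g analytic_on {w}) (at z)"
      using eventually_cosparse_UNIV_at meromorphic_on_imp_analytic_cosparse nzmeroD(1) F.nz G.nz by blast+
    with M1 M2 have "eventually (\<lambda>w. cmod (h w) \<le> C * (M1 + M2)) (at z)"
    proof eventually_elim
      case (elim w)
      have "cmod (h w) \<le> C * (spher f w + spher g w)" using elim by (intro hb)
      also have "\<dots> \<le> C * (M1 + M2)" using elim C(1) by (intro mult_left_mono add_mono) auto
      finally show ?case .
    qed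
    then show ?thesis by (rule zord_nonneg_if_bounded[OF h])
  qed
  have prox: "F.small (\<lambda>k. prox h (s k))"
    if h: "bad_radii h \<subseteq> B" and hb: "\<And>z. f analytic_on {z} \<Longrightarrow> g analytic_on {z} \<Longrightarrow> cmod (h z) \<le> C * (spher f z + spher g z)" for h
  proof (rule F.small_mono[OF F.small_add[OF F.small_add[OF F.adm_log_deriv_small[OF F.adm] F.adm_log_deriv_small[OF G.adm]] F.small_const[of "ln (C * 2)"]]])
    fix k
    define G' where "G' = (\<lambda>i z. if i then deriv f z / f z else deriv g z / g z)"
    have gf: "s k \<notin> bad_radii f" "s k \<notin> bad_radii g" "s k \<notin> bad_radii h"
      using F.s_good[of k] F.adm_bad[OF F.adm] F.adm_bad[OF G.adm] h by auto
    have "prox h (s k) \<le> (\<Sum>i\<in>UNIV. prox (G' i) (s k)) + ln (C * real (card (UNIV :: bool set)))"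
    proof (rule prox_le_sum)
      show "s k \<ge> 0" using F.s_ge_1[of k] by simp
      show "continuous_on (sphere 0 (s k)) h" by (rule good_radius_continuous[OF gf(3)])
      show "continuous_on (sphere 0 (s k)) (G' i)" for i
        using good_radius_continuous_log_deriv[OF gf(1)] good_radius_continuous_log_deriv[OF gf(2)]
        by (cases i) (simp_all add: G'_def[abs_def])
      fix z assume z: "cmod z = s k"
      have r: "regular_at f z" "regular_at g z" using good_radius_regular gf z by auto
      then have "cmod (h z) \<le> C * (spher f z + spher g z)" by (intro hb) (auto simp: regular_at_def)
      also have "\<dots> \<le> C * (cmod (deriv f z / f z) + cmod (deriv g z / g z))"
        using r C(1) by (intro mult_left_mono add_mono spher_le_log_deriv) (auto simp: regular_at_def)
      finally show "cmod (h z) \<le> C * (\<Sum>i\<in>UNIV. cmod (G' i z))" by (simp add: G'_def UNIV_bool add.commute)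
    qed (use C in auto)
    then show "prox h (s k) \<le> prox (\<lambda>z. deriv f z / f z) (s k) + prox (\<lambda>z. deriv g z / g z) (s k) + ln (C * 2)"
      by (simp add: G'_def UNIV_bool)
  qed
  have eV: "zord (Vfun f g) z \<ge> 0" and eU: "zord (Ufun f g) z \<ge> 0" for z
    using entire[OF nV bound(1)] entire[OF nU bound(2)] by auto
  have sV: "F.small (\<lambda>k. prox (Vfun f g) (s k))" and sU: "F.small (\<lambda>k. prox (Ufun f g) (s k))"
    using prox[OF bV bound(1)] prox[OF bU bound(2)] by auto
  obtain c where c: "\<And>r. r > 0 \<Longrightarrow> r \<notin> bad_radii (Vfun f g) \<Longrightarrow>
    prox (\<lambda>z. inverse (Vfun f g z)) r = prox (Vfun f g) r - vcount (zeros_of (Vfun f g)) r + vcount (poles_of (Vfun f g)) r + c"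
    using prox_inverse[OF nV] by blast
  have pV: "vcount (poles_of (Vfun f g)) r = 0" for r using eV by (simp add: vcount_def poles_of_def)
  have "F.small (\<lambda>k. 1 * nev g (s k))"
  proof (rule F.small_mono[OF F.small_add[OF F.small_add[OF sU sV] F.small_const[of c]]])
    fix k
    have s0: "s k > 0" using F.s_ge_1[of k] by linarith
    have gd: "s k \<notin> bad_radii (Vfun f g)" "s k \<notin> bad_radii (Ufun f g)" using F.s_good[of k] bV bU by auto
    have Vnz: "Vfun f g z \<noteq> 0" if "cmod z = s k" for z using good_radius_regular[OF gd(1) that] by (simp add: regular_at_def)
    have "prox g (s k) = prox (\<lambda>z. Ufun f g z * inverse (Vfun f g z)) (s k)"
      unfolding prox_eq_cmean
    proof (rule cmean_cong)
      fix z assume "cmod z = s k"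
      then have "Ufun f g z * inverse (Vfun f g z) = g z" using Vnz[of z] by (simp add: Ufun_def mult.assoc)
      then show "log_plus (cmod (g z)) = log_plus (cmod (Ufun f g z * inverse (Vfun f g z)))" by simp
    qed (use s0 in simp)
    also have "\<dots> \<le> prox (Ufun f g) (s k) + prox (\<lambda>z. inverse (Vfun f g z)) (s k)"
      using s0 Vnz by (intro prox_mult good_radius_continuous gd continuous_on_inverse) auto
    also have "prox (\<lambda>z. inverse (Vfun f g z)) (s k) = prox (Vfun f g) (s k) - vcount (zeros_of (Vfun f g)) (s k) + c"
      using c[OF s0 gd(1)] pV by simp
    finally have "prox g (s k) \<le> prox (Ufun f g) (s k) + prox (Vfun f g) (s k) - vcount (zeros_of (Vfun f g)) (s k) + c" by simp
    \<comment> \<open>Since g V has no poles, each pole of g is a zero of V of at least the same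
      order. Their count is cancelled by the zeros of V that Jensen's formula subtracts in the
      proximity function of 1/V.\<close>
    moreover have "vcount (poles_of g) (s k) \<le> vcount (zeros_of (Vfun f g)) (s k)"
    proof (intro vcount_mono locfin_poles_of locfin_zeros_of G.nz nV F.s_ge_1)
      fix z
      have "zord (Ufun f g) z = zord g z + zord (Vfun f g) z" unfolding Ufun_def[abs_def] by (rule zord_mult[OF G.nz nV])
      then show "poles_of g z \<le> zeros_of (Vfun f g) z" using eU[of z] eV[of z] by (simp add: poles_of_def zeros_of_def)
    qed
    ultimately show "1 * nev g (s k) \<le> prox (Ufun f g) (s k) + prox (Vfun f g) (s k) + c" by (simp add: nev_def)
  qed
  then show False using nev_g_not_small[of 1] by simp
qed

end

section \<open>Deficiencies and uniqueness\<close>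

lemma constant_not_nzmero_deriv:
  assumes "eventually (\<lambda>z. h z = c) (cosparse UNIV)"
  shows "\<not> nzmero (deriv h)"
proof
  assume n: "nzmero (deriv h)"
  have "eventually (\<lambda>z. h z = c) (at 0)" using assms by (rule eventually_cosparse_UNIV_at)
  then have "eventually (\<lambda>z. eventually (\<lambda>w. h w = c) (nhds z)) (at 0)"
    by (rule eventually_at_imp_eventually_nhds)
  then have "eventually (\<lambda>z. deriv h z = 0) (at 0)"
  proof eventually_elim
    case (elim z)
    then have "deriv h z = deriv (\<lambda>_. c) z" by (intro deriv_cong_ev) auto
    then show ?case by simp
  qed
  with nzmeroD(2)[OF n, of 0] have "eventually (\<lambda>z. False) (at (0::complex))" by eventually_elim auto
  then show False by simp
qed

text \<open>Exchanging f and g inverts \<open>Phi\<close>, so the nondegenerate case is symmetric in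
  the two functions.\<close>

lemma nz_Phi_swap:
  assumes "nzmero (Phi n m f g)" "nzmero (deriv (Phi n m f g))"
  shows "nzmero (deriv (Phi n m g f))"
proof (rule ccontr)
  assume a: "\<not> ?thesis"
  have e: "Phi n m g f = (\<lambda>z. inverse (Phi n m f g z))" by (auto simp: Phi_def)
  have "Phi n m g f meromorphic_on UNIV" unfolding e by (rule nzmeroD(1)[OF nzmero_inverse[OF assms(1)]])
  then obtain c where "eventually (\<lambda>z. Phi n m g f z = c) (cosparse UNIV)"
    using nzmero_deriv_or_constant a by metis
  then have "eventually (\<lambda>z. Phi n m f g z = inverse c) (cosparse UNIV)"
    by eventually_elim (auto simp: e)
  then show False using constant_not_nzmero_deriv assms(2) by blast
qed

text \<open>A deficiency is bounded above by 1 but is an extended real and might be minus infinity;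
  a sum above a real number excludes this for every summand. The two halves of the minimum combine
  into one minimum.\<close>

lemma theta_real:
  fixes a b c d e g :: ereal
  assumes "a \<le> 1" "b \<le> 1" "c \<le> 1" "d \<le> 1" "e \<le> 1" "g \<le> 1"
    and gt: "(2 * a + 2 * b + c + min c g / 2) + (2 * d + 2 * e + g + min c g / 2) > ereal r"
  obtains a' b' c' d' e' g' :: real where "a = ereal a'" "b = ereal b'" "c = ereal c'" "d = ereal d'" "e = ereal e'" "g = ereal g'"
    "2 * a' + 2 * b' + c' + 2 * d' + 2 * e' + g' + min c' g' > r"
proof -
  have 2: "2 * x \<le> 2" "2 * x \<noteq> \<infinity>" if "x \<le> 1" for x :: ereal
  proof -
    show "2 * x \<le> 2" using that by (cases x) auto
    then show "2 * x \<noteq> \<infinity>" by auto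
  qed
  have i: "x \<noteq> \<infinity>" if "x \<le> 1" for x :: ereal using that by auto
  have mn: "min c g / 2 \<noteq> \<infinity>" using assms(3,6) by (cases c; cases g) (auto simp: min_def)
  note ni = 2(2)[OF assms(1)] 2(2)[OF assms(2)] 2(2)[OF assms(4)] 2(2)[OF assms(5)] i[OF assms(3)] i[OF assms(6)] mn
  have pm: "x + y \<noteq> \<infinity>" "x + y \<noteq> -\<infinity> \<Longrightarrow> x \<noteq> -\<infinity> \<and> y \<noteq> -\<infinity>"
    if "x \<noteq> \<infinity>" "y \<noteq> \<infinity>" for x y :: ereal
    using that by (cases x; cases y; simp)+
  have fin: "x1 \<noteq> -\<infinity> \<and> x2 \<noteq> -\<infinity> \<and> x3 \<noteq> -\<infinity> \<and> x5 \<noteq> -\<infinity> \<and> x6 \<noteq> -\<infinity> \<and> x7 \<noteq> -\<infinity>"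
    if "(x1 + x2 + x3 + x4) + (x5 + x6 + x7 + x4) \<noteq> -\<infinity>" "x1 \<noteq> \<infinity>" "x2 \<noteq> \<infinity>" "x5 \<noteq> \<infinity>" "x6 \<noteq> \<infinity>" "x3 \<noteq> \<infinity>" "x7 \<noteq> \<infinity>" "x4 \<noteq> \<infinity>"
    for x1 x2 x3 x4 x5 x6 x7 :: ereal
  proof -
    have l: "x1 + x2 \<noteq> \<infinity>" "x1 + x2 + x3 \<noteq> \<infinity>" "x1 + x2 + x3 + x4 \<noteq> \<infinity>" by (intro pm(1) that)+
    have r: "x5 + x6 \<noteq> \<infinity>" "x5 + x6 + x7 \<noteq> \<infinity>" "x5 + x6 + x7 + x4 \<noteq> \<infinity>" by (intro pm(1) that)+
    note lr = pm(2)[OF l(3) r(3) that(1)]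
    note l1 = pm(2)[OF l(2) that(8) conjunct1[OF lr]] and r1 = pm(2)[OF r(2) that(8) conjunct2[OF lr]]
    note l2 = pm(2)[OF l(1) that(6) conjunct1[OF l1]] and r2 = pm(2)[OF r(1) that(7) conjunct1[OF r1]]
    from pm(2)[OF that(2,3) conjunct1[OF l2]] pm(2)[OF that(4,5) conjunct1[OF r2]] l2 r2
    show ?thesis by simp
  qed
  have nm: "x \<noteq> -\<infinity>" if "ereal r < x" for x using that by auto
  have "2 * a \<noteq> -\<infinity> \<and> 2 * b \<noteq> -\<infinity> \<and> c \<noteq> -\<infinity> \<and> 2 * d \<noteq> -\<infinity> \<and> 2 * e \<noteq> -\<infinity> \<and> g \<noteq> -\<infinity>"
    by (rule fin[OF nm[OF gt] ni])
  then have f: "a \<noteq> -\<infinity>" "b \<noteq> -\<infinity>" "c \<noteq> -\<infinity>" "d \<noteq> -\<infinity>" "e \<noteq> -\<infinity>" "g \<noteq> -\<infinity>" by auto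
  obtain a' b' c' d' e' g' where r: "a = ereal a'" "b = ereal b'" "c = ereal c'" "d = ereal d'" "e = ereal e'" "g = ereal g'"
    using f i[OF assms(1)] i[OF assms(2)] i[OF assms(3)] i[OF assms(4)] i[OF assms(5)] i[OF assms(6)]
    by (metis ereal_cases)
  have two: "2 * ereal x = ereal (2 * x)" for x by simp
  have "ereal r < ereal ((2 * a' + 2 * b' + c' + min c' g' / 2) + (2 * d' + 2 * e' + g' + min c' g' / 2))"
    using gt unfolding r by (simp add: min_def split: if_splits)
  then have "2 * a' + 2 * b' + c' + 2 * d' + 2 * e' + g' + min c' g' > r" by simp
  with r show ?thesis by (rule that)
qed

text \<open>Nonnegative quotients along one sequence tending to infinity already make the limsup
  nonnegative, so radii off the sequence require no information.\<close>

lemma Theta_le_1: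
  assumes s: "filterlim s at_top sequentially"
    and ev: "eventually (\<lambda>k. Nbar_count f a (s k) / nev_char f (s k) \<ge> 0) sequentially"
  shows "Theta a f \<le> 1"
proof -
  have "Limsup at_top (\<lambda>r. ereal (Nbar_count f a r / nev_char f r)) \<ge> 0"
  proof (rule ccontr)
    assume "\<not> ?thesis"
    then have "eventually (\<lambda>r. ereal (Nbar_count f a r / nev_char f r) < 0) at_top"
      by (intro Limsup_lessD) auto
    then have "eventually (\<lambda>k. ereal (Nbar_count f a (s k) / nev_char f (s k)) < 0) sequentially"
      using s by (rule eventually_compose_filterlim)
    with ev have "eventually (\<lambda>k. False) sequentially" by eventually_elim auto
    then show False by simp
  qed
  then have "1 - Limsup at_top (\<lambda>r. ereal (Nbar_count f a r / nev_char f r)) \<le> 1 - 0"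
    by (intro ereal_minus_mono) auto
  then show ?thesis unfolding Theta_def by simp
qed

text \<open>A limsup over all radii bounds the quotient along every sequence tending to infinity, so
  the choice of radii loses nothing.\<close>

lemma Theta_eventually:
  assumes s: "filterlim s at_top sequentially" and T: "Theta a f = ereal t" and e: "\<epsilon> > 0"
    and pos: "eventually (\<lambda>k. nev_char f (s k) > 0) sequentially"
  shows "eventually (\<lambda>k. Nbar_count f a (s k) \<le> (1 - t + \<epsilon>) * nev_char f (s k)) sequentially"
proof -
  have "Limsup at_top (\<lambda>r. ereal (Nbar_count f a r / nev_char f r)) = ereal (1 - t)"
    using T unfolding Theta_def
    by (cases "Limsup at_top (\<lambda>r. ereal (Nbar_count f a r / nev_char f r))") (auto simp: one_ereal_def)
  then have "eventually (\<lambda>r. ereal (Nbar_count f a r / nev_char f r) < ereal (1 - t + \<epsilon>)) at_top"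
    using e by (intro Limsup_lessD) auto
  then have "eventually (\<lambda>k. ereal (Nbar_count f a (s k) / nev_char f (s k)) < ereal (1 - t + \<epsilon>)) sequentially"
    using s by (rule eventually_compose_filterlim)
  with pos show ?thesis
    by eventually_elim (simp add: pos_divide_less_eq less_imp_le)
qed

section \<open>Contradiction in the nondegenerate case, and integration of the degenerate
  one\<close>

definition Theta_sum :: "(complex \<Rightarrow> complex) \<Rightarrow> (complex \<Rightarrow> complex) \<Rightarrow> ereal" where
  "Theta_sum f g = (2 * Theta (Some 0) f + 2 * Theta None f + Theta (Some 1) f + min (Theta (Some 1) f) (Theta (Some 1) g) / 2)
     + (2 * Theta (Some 0) g + 2 * Theta None g + Theta (Some 1) g + min (Theta (Some 1) f) (Theta (Some 1) g) / 2)"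

lemma Theta_sum_commute: "Theta_sum f g = Theta_sum g f"
  unfolding Theta_sum_def by (simp only: min.commute[of "Theta (Some 1) f"] add.commute)

context sharing_pair'
begin

text \<open>Every count is replaced by (1 - \<Theta> + \<epsilon>) T(f). For the counts of g this
  uses T(g) \<le> T(f) and deficiencies of g at most 1, which make the factors nonnegative. The
  extra weights \<alpha> and \<gamma> - 1 are paid by the crude bound 2 T(f) for N(0) +
  N(\<infinity>).\<close>

lemma theta_contradiction:
  fixes t0f t1f tif t0g t1g tig \<alpha> \<gamma> :: real
  assumes freq: "frequently (\<lambda>k. nev g (s k) \<le> nev f (s k)) sequentially"
    and t: "t0g \<le> 1" "t1g \<le> 1" "tig \<le> 1" and ab: "\<alpha> \<ge> 0" "\<gamma> \<ge> 1"
    and main: "F.small (\<lambda>k. (real n + real m + 2) * nev f (s k)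
     - (2 + \<alpha>) * (vcount (abar f 0) (s k) + vcount (pbar f) (s k)) - 2 * vcount (abar f 1) (s k)
     - (1 + \<gamma>) * (vcount (abar g 0) (s k) + vcount (pbar g) (s k)) - vcount (abar g 1) (s k))"
    and lim: "\<And>\<epsilon>. \<epsilon> > 0 \<Longrightarrow> eventually (\<lambda>k. vcount (abar f 0) (s k) \<le> (1 - t0f + \<epsilon>) * nev f (s k)) sequentially"
      "\<And>\<epsilon>. \<epsilon> > 0 \<Longrightarrow> eventually (\<lambda>k. vcount (abar f 1) (s k) \<le> (1 - t1f + \<epsilon>) * nev f (s k)) sequentially"
      "\<And>\<epsilon>. \<epsilon> > 0 \<Longrightarrow> eventually (\<lambda>k. vcount (pbar f) (s k) \<le> (1 - tif + \<epsilon>) * nev f (s k)) sequentially"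
      "\<And>\<epsilon>. \<epsilon> > 0 \<Longrightarrow> eventually (\<lambda>k. vcount (abar g 0) (s k) \<le> (1 - t0g + \<epsilon>) * nev g (s k)) sequentially"
      "\<And>\<epsilon>. \<epsilon> > 0 \<Longrightarrow> eventually (\<lambda>k. vcount (abar g 1) (s k) \<le> (1 - t1g + \<epsilon>) * nev g (s k)) sequentially"
      "\<And>\<epsilon>. \<epsilon> > 0 \<Longrightarrow> eventually (\<lambda>k. vcount (pbar g) (s k) \<le> (1 - tig + \<epsilon>) * nev g (s k)) sequentially"
    and big: "2 * t0f + 2 * tif + 2 * t1f + 2 * t0g + 2 * tig + t1g > 9 - (real n + real m) + 2 * \<alpha> + 2 * (\<gamma> - 1)"
  shows False
proof -
  define D where "D = 2 * t0f + 2 * tif + 2 * t1f + 2 * t0g + 2 * tig + t1g - (9 - (real n + real m) + 2 * \<alpha> + 2 * (\<gamma> - 1))"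
  have D: "D > 0" using big by (simp add: D_def)
  \<comment> \<open>The coefficients of \<epsilon> add up to 11 + 2\<alpha> + 2\<gamma> in the end;
    the denominator only has to exceed this number.\<close>
  define \<epsilon> where "\<epsilon> = D / (20 + 4 * \<alpha> + 4 * \<gamma>)"
  have den: "20 + 4 * \<alpha> + 4 * \<gamma> > 0" using ab by linarith
  have e: "\<epsilon> > 0" using D den by (simp add: \<epsilon>_def)
  have eD: "\<epsilon> * (20 + 4 * \<alpha> + 4 * \<gamma>) = D" using den by (simp add: \<epsilon>_def)
  have AA0: "0 \<in> AA" using AA by auto
  have "eventually (\<lambda>k. vcount (abar f 0) (s k) - nev f (s k) \<le> \<epsilon> * \<phi> k) sequentially"
    using F.fmt[OF AA0] e unfolding F.small_def by blast
  moreover have "eventually (\<lambda>k. vcount (abar g 0) (s k) - nev g (s k) \<le> \<epsilon> * \<phi> k) sequentially"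
    using G.fmt[OF AA0] e unfolding F.small_def by blast
  moreover have "eventually (\<lambda>k. (real n + real m + 2) * nev f (s k)
     - (2 + \<alpha>) * (vcount (abar f 0) (s k) + vcount (pbar f) (s k)) - 2 * vcount (abar f 1) (s k)
     - (1 + \<gamma>) * (vcount (abar g 0) (s k) + vcount (pbar g) (s k)) - vcount (abar g 1) (s k) \<le> \<epsilon> * \<phi> k) sequentially"
    using main e unfolding F.small_def by blast
  moreover note lim(1)[OF e] lim(2)[OF e] lim(3)[OF e] lim(4)[OF e] lim(5)[OF e] lim(6)[OF e]
  ultimately have "eventually (\<lambda>k. \<not> nev g (s k) \<le> nev f (s k)) sequentially"
  proof eventually_elim
    case (elim k)
    show ?case
    proof
      assume le: "nev g (s k) \<le> nev f (s k)"
      define T where "T = nev f (s k)"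
      define U where "U = nev g (s k)"
      define x0 where "x0 = vcount (abar f 0) (s k)"
      define x1 where "x1 = vcount (abar f 1) (s k)"
      define xi where "xi = vcount (pbar f) (s k)"
      define y0 where "y0 = vcount (abar g 0) (s k)"
      define y1 where "y1 = vcount (abar g 1) (s k)"
      define yi where "yi = vcount (pbar g) (s k)"
      have UT: "U \<le> T" using le by (simp add: T_def U_def)
      have phi: "\<phi> k \<le> 2 * T" "\<phi> k \<ge> 1" using UT F.phi_ge_1[of k] by (auto simp: phi_eq T_def U_def)
      then have T: "T > 0" by linarith
      have ep: "\<epsilon> * \<phi> k \<le> 2 * \<epsilon> * T" using mult_left_mono[OF phi(1), of \<epsilon>] e by simp
      have up: "(1 - t + \<epsilon>) * U \<le> (1 - t + \<epsilon>) * T" if "t \<le> 1" for t using UT that e by (intro mult_left_mono) auto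
      have X: "x0 \<le> (1 - t0f + \<epsilon>) * T" "x1 \<le> (1 - t1f + \<epsilon>) * T" "xi \<le> (1 - tif + \<epsilon>) * T"
        using elim by (auto simp: x0_def x1_def xi_def T_def)
      have Y: "y0 \<le> (1 - t0g + \<epsilon>) * T" "y1 \<le> (1 - t1g + \<epsilon>) * T" "yi \<le> (1 - tig + \<epsilon>) * T"
        using elim up[OF t(1)] up[OF t(2)] up[OF t(3)] by (auto simp: y0_def y1_def yi_def U_def)
      have eT: "\<epsilon> * T \<ge> 0" using e T by simp
      have X': "x0 + xi \<le> (2 + 2 * \<epsilon>) * T"
        using elim(1) ep F.adm_poles_count_le[OF F.adm, of k] by (simp add: x0_def xi_def T_def algebra_simps)
      have Y': "y0 + yi \<le> (2 + 2 * \<epsilon>) * T"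
        using elim(2) ep F.adm_poles_count_le[OF G.adm, of k] UT by (simp add: y0_def yi_def U_def T_def algebra_simps)
      have aX: "\<alpha> * (x0 + xi) \<le> \<alpha> * ((2 + 2 * \<epsilon>) * T)" using X' ab by (intro mult_left_mono) auto
      have gY: "(\<gamma> - 1) * (y0 + yi) \<le> (\<gamma> - 1) * ((2 + 2 * \<epsilon>) * T)" using Y' ab by (intro mult_left_mono) auto
      have "(real n + real m + 2) * T \<le> (2 + \<alpha>) * (x0 + xi) + 2 * x1 + (1 + \<gamma>) * (y0 + yi) + y1 + 2 * \<epsilon> * T"
        using elim(3) ep by (simp add: x0_def x1_def xi_def y0_def y1_def yi_def T_def)
      also have "\<dots> = 2 * x0 + 2 * xi + \<alpha> * (x0 + xi) + 2 * x1 + 2 * y0 + 2 * yi + (\<gamma> - 1) * (y0 + yi) + y1 + 2 * \<epsilon> * T"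
        by (simp add: algebra_simps)
      also have "\<dots> \<le> 2 * ((1 - t0f + \<epsilon>) * T) + 2 * ((1 - tif + \<epsilon>) * T) + \<alpha> * ((2 + 2 * \<epsilon>) * T) + 2 * ((1 - t1f + \<epsilon>) * T)
          + 2 * ((1 - t0g + \<epsilon>) * T) + 2 * ((1 - tig + \<epsilon>) * T) + (\<gamma> - 1) * ((2 + 2 * \<epsilon>) * T) + (1 - t1g + \<epsilon>) * T + 2 * \<epsilon> * T"
        using X Y aX gY by linarith
      also have "\<dots> = (real n + real m + 2 - D + \<epsilon> * (11 + 2 * \<alpha> + 2 * \<gamma>)) * T"
        by (simp add: D_def algebra_simps)
      finally have "real n + real m + 2 \<le> real n + real m + 2 - D + \<epsilon> * (11 + 2 * \<alpha> + 2 * \<gamma>)"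
        using T by (simp only: mult_le_cancel_right_pos)
      then have "D \<le> \<epsilon> * (11 + 2 * \<alpha> + 2 * \<gamma>)" by simp
      also have "\<dots> < \<epsilon> * (20 + 4 * \<alpha> + 4 * \<gamma>)" using e ab by (intro mult_strict_left_mono) auto
      finally show False using eD by simp
    qed
  qed
  then show False using freq by (simp add: frequently_def)
qed

lemma nondegenerate_contradiction:
  assumes nd: "nzmero (deriv \<Phi>)" and bH: "bad_radii H \<subseteq> B"
    and E: "E_weighted f {a. F.P a = 0} l = E_weighted g {a. F.P a = 0} l"
    and freq: "frequently (\<lambda>k. nev g (s k) \<le> nev f (s k)) sequentially"
    and s: "filterlim s at_top sequentially"
    and nf: "filterlim (\<lambda>k. nev f (s k)) at_top sequentially" and ng: "filterlim (\<lambda>k. nev g (s k)) at_top sequentially"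
    and cond: "(l \<ge> 2 \<and> Theta_sum f g > ereal (9 - (real n + real m)))
       \<or> (l = 1 \<and> Theta_sum f g > ereal (10 - (real n + real m)))
       \<or> (l = 0 \<and> Theta_sum f g > ereal (15 - (real n + real m)))"
  shows False
proof -
  have spos: "s k > 0" for k using F.s_ge_1[of k] by linarith
  have nc: "nev_char f (s k) = nev f (s k)" "nev_char g (s k) = nev g (s k)" for k
    using nev_char_eq[OF F.nice F.nonconst spos] nev_char_eq[OF G.nice G.nonconst spos] by auto
  have pf: "eventually (\<lambda>k. nev f (s k) > 0) sequentially" and pg: "eventually (\<lambda>k. nev g (s k) > 0) sequentially"
    using nf ng by (auto simp: filterlim_at_top_dense)
  have nb: "Nbar_count f (Some a) (s k) = vcount (abar f a) (s k)" "Nbar_count f None (s k) = vcount (pbar f) (s k)"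
    "Nbar_count g (Some a) (s k) = vcount (abar g a) (s k)" "Nbar_count g None (s k) = vcount (pbar g) (s k)" for a k
    using Nbar_Some_eq[OF F.nice F.nonconst spos] Nbar_None_eq[OF F.nice F.nonconst spos]
      Nbar_Some_eq[OF G.nice G.nonconst spos] Nbar_None_eq[OF G.nice G.nonconst spos] by (auto simp: abar_def)
  have v0: "vcount (abar h a) (s k) \<ge> 0" "vcount (pbar h) (s k) \<ge> 0" for h a k
    by (intro vcount_nonneg F.s_ge_1; simp add: abar_def)+
  have le1: "Theta a f \<le> 1" "Theta a g \<le> 1" for a
  proof -
    have "eventually (\<lambda>k. Nbar_count f a (s k) / nev_char f (s k) \<ge> 0) sequentially"
      using pf by eventually_elim (cases a; simp add: nb nc v0)
    then show "Theta a f \<le> 1" by (rule Theta_le_1[OF s])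
    have "eventually (\<lambda>k. Nbar_count g a (s k) / nev_char g (s k) \<ge> 0) sequentially"
      using pg by eventually_elim (cases a; simp add: nb nc v0)
    then show "Theta a g \<le> 1" by (rule Theta_le_1[OF s])
  qed
  have Smult_le: "min (enat (F.Smult z)) (l + 1) = min (enat (G.Smult z)) (l + 1)" for z
    using fun_cong[OF E, of z] by (simp add: F.E_weighted_eq G.E_weighted_eq)
  have fin: False if gt: "Theta_sum f g > ereal (9 - (real n + real m) + (2 * \<alpha> + 2 * (\<gamma> - 1)))"
    and ab: "\<alpha> \<ge> 0" "\<gamma> \<ge> 1"
    and key: "\<And>p q. p > 0 \<Longrightarrow> q > 0 \<Longrightarrow> min (enat p) (l + 1) = min (enat q) (l + 1) \<Longrightarrow>
      1 \<le> (if p \<noteq> q then -1 else if p = 1 then 1 else 0) + \<alpha> * (real p - 1) + \<gamma> * (real q - 1)" for \<alpha> \<gamma> :: real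
  proof -
    have main: "F.small (\<lambda>k. (real n + real m + 2) * nev f (s k)
     - (2 + \<alpha>) * (vcount (abar f 0) (s k) + vcount (pbar f) (s k)) - 2 * vcount (abar f 1) (s k)
     - (1 + \<gamma>) * (vcount (abar g 0) (s k) + vcount (pbar g) (s k)) - vcount (abar g 1) (s k))"
      by (rule main_inequality[OF nd bH share ab]) (rule key[OF _ _ Smult_le])
    obtain a b c d e h where t: "Theta (Some 0) f = ereal a" "Theta None f = ereal b" "Theta (Some 1) f = ereal c"
      "Theta (Some 0) g = ereal d" "Theta None g = ereal e" "Theta (Some 1) g = ereal h"
      "2 * a + 2 * b + c + 2 * d + 2 * e + h + min c h > 9 - (real n + real m) + (2 * \<alpha> + 2 * (\<gamma> - 1))"
      using theta_real[OF le1(1) le1(1) le1(1) le1(2) le1(2) le1(2) gt[unfolded Theta_sum_def]] by metis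
    have l1: "d \<le> 1" "h \<le> 1" "e \<le> 1" using le1(2)[of "Some 0"] le1(2)[of "Some 1"] le1(2)[of None] t by auto
    have pf': "eventually (\<lambda>k. nev_char f (s k) > 0) sequentially" and pg': "eventually (\<lambda>k. nev_char g (s k) > 0) sequentially"
      using pf pg by (auto simp: nc)
    show False
    proof (rule theta_contradiction[OF freq l1(1,2,3) ab main])
      fix \<epsilon> :: real assume e: "\<epsilon> > 0"
      show "eventually (\<lambda>k. vcount (abar f 0) (s k) \<le> (1 - a + \<epsilon>) * nev f (s k)) sequentially"
        using Theta_eventually[OF s t(1) e pf'] by (simp add: nb nc)
      show "eventually (\<lambda>k. vcount (abar f 1) (s k) \<le> (1 - c + \<epsilon>) * nev f (s k)) sequentially"
        using Theta_eventually[OF s t(3) e pf'] by (simp add: nb nc)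
      show "eventually (\<lambda>k. vcount (pbar f) (s k) \<le> (1 - b + \<epsilon>) * nev f (s k)) sequentially"
        using Theta_eventually[OF s t(2) e pf'] by (simp add: nb nc)
      show "eventually (\<lambda>k. vcount (abar g 0) (s k) \<le> (1 - d + \<epsilon>) * nev g (s k)) sequentially"
        using Theta_eventually[OF s t(4) e pg'] by (simp add: nb nc)
      show "eventually (\<lambda>k. vcount (abar g 1) (s k) \<le> (1 - h + \<epsilon>) * nev g (s k)) sequentially"
        using Theta_eventually[OF s t(6) e pg'] by (simp add: nb nc)
      show "eventually (\<lambda>k. vcount (pbar g) (s k) \<le> (1 - e + \<epsilon>) * nev g (s k)) sequentially"
        using Theta_eventually[OF s t(5) e pg'] by (simp add: nb nc)
    next
      show "2 * a + 2 * b + 2 * c + 2 * d + 2 * e + h > 9 - (real n + real m) + 2 * \<alpha> + 2 * (\<gamma> - 1)"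
        using t(7) by linarith
    qed
  qed
  from cond consider "l \<ge> 2" "Theta_sum f g > ereal (9 - (real n + real m))"
    | "l = 1" "Theta_sum f g > ereal (10 - (real n + real m))"
    | "l = 0" "Theta_sum f g > ereal (15 - (real n + real m))" by blast
  then show False
  proof cases
    case 1
    show False
    proof (rule fin[of 0 1])
      fix p q :: nat assume pq: "p > 0" "q > 0" "min (enat p) (l + 1) = min (enat q) (l + 1)"
      \<comment> \<open>Multiplicities truncated at 3 or more agree, so unequal p and q are both at
        least 3 and \<gamma> = 1 suffices: -1 + (q - 1) \<ge> 1.\<close>
      have l3: "l + 1 \<ge> enat 3" using 1(1) by (cases l) (auto simp: numeral_eq_enat one_enat_def)
      have "p = q \<or> (p \<ge> 3 \<and> q \<ge> 3)"
        using pq(3) l3 by (cases "l + 1") (auto simp: min_def split: if_splits)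
      then show "1 \<le> (if p \<noteq> q then -1 else if p = 1 then 1 else 0) + 0 * (real p - 1) + 1 * (real q - 1)"
        using pq(1,2) by auto
    qed (use 1 in auto)
  next
    case 2
    show False
    proof (rule fin[of "1/2" 1])
      have eq: "9 - (real n + real m) + (2 * (1/2) + 2 * (1 - 1)) = 10 - (real n + real m)" by simp
      show "Theta_sum f g > ereal (9 - (real n + real m) + (2 * (1/2) + 2 * (1 - 1)))" using 2(2) unfolding eq .
    next
      fix p q :: nat assume pq: "p > 0" "q > 0" "min (enat p) (l + 1) = min (enat q) (l + 1)"
      have l2: "l + 1 = enat 2" using 2(1) by (simp add: one_enat_def)
      have "p = q \<or> (p \<ge> 2 \<and> q \<ge> 2)"
        using pq(3) unfolding l2 by (auto simp: min_def split: if_splits)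
      \<comment> \<open>The critical pair is p = 3, q = 2, where -1 + \<alpha> 2 + 1 = 1 holds with
        equality for \<alpha> = 1/2.\<close>
      then consider "p = q" "p = 1" | "p = q" "real p \<ge> 2" | "p \<noteq> q" "real p \<ge> 2" "real q \<ge> 3" | "p \<noteq> q" "real p \<ge> 3" "real q \<ge> 2"
        using pq(1,2) by fastforce
      then show "1 \<le> (if p \<noteq> q then -1 else if p = 1 then 1 else 0) + 1/2 * (real p - 1) + 1 * (real q - 1)"
        by cases (simp_all add: field_simps)
    qed simp_all
  next
    case 3
    show False
    proof (rule fin[of 2 2])
      have eq: "9 - (real n + real m) + (2 * 2 + 2 * (2 - 1)) = 15 - (real n + real m)" by simp
      show "Theta_sum f g > ereal (9 - (real n + real m) + (2 * 2 + 2 * (2 - 1)))" using 3(2) unfolding eq .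
    next
      fix p q :: nat assume pq: "p > 0" "q > 0" "min (enat p) (l + 1) = min (enat q) (l + 1)"
      \<comment> \<open>Sharing without multiplicities allows the pairs (1, 2) and (2, 1), which
        force \<gamma> \<ge> 2 and \<alpha> \<ge> 2 respectively.\<close>
      show "1 \<le> (if p \<noteq> q then -1 else if p = 1 then 1 else 0) + 2 * (real p - 1) + 2 * (real q - 1)"
        using pq(1,2) by (cases "p = 1"; cases "q = 1") auto
    qed simp_all
  qed
qed

text \<open>If \<Phi> is the constant c, then 1/P(f) - c/P(g) has vanishing derivative off a sparse
  set, so it is constant as well; c \<noteq> 0 because \<Phi> does not vanish identically.\<close>

lemma degenerate_relation:
  assumes "\<not> nzmero (deriv \<Phi>)"
  obtains c b where "c \<noteq> 0"
    "eventually (\<lambda>z. inverse (F.P (f z)) = c * inverse (F.P (g z)) + b) (cosparse UNIV)"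
proof -
  obtain c where c: "eventually (\<lambda>z. \<Phi> z = c) (cosparse UNIV)"
    using nzmero_deriv_or_constant[OF nzmeroD(1)[OF nz_Phi]] assms by metis
  have nzP: "eventually (\<lambda>z. \<Phi> z \<noteq> 0) (cosparse UNIV)" using nz_Phi by (simp add: nzmero_def)
  with c have "eventually (\<lambda>z. c \<noteq> 0) (cosparse (UNIV :: complex set))" by eventually_elim auto
  then have c0: "c \<noteq> 0" using cosparse_UNIV_ex by blast
  define h where "h = (\<lambda>z. inverse (F.P (f z)) - c * inverse (F.P (g z)))"
  have hm: "h meromorphic_on UNIV" unfolding h_def
    using nzmeroD(1)[OF F.nz_P0] nzmeroD(1)[OF G.nz_P0] by (intro meromorphic_intros)
  have ev: "eventually (regular_at f) (cosparse UNIV)" "eventually (regular_at g) (cosparse UNIV)"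
    "eventually (\<lambda>z. F.P (f z) \<noteq> 0) (cosparse UNIV)" "eventually (\<lambda>z. F.P (g z) \<noteq> 0) (cosparse UNIV)"
    "eventually (\<lambda>z. G.Kf z \<noteq> 0) (cosparse UNIV)"
    using eventually_regular_at[OF F.nz] eventually_regular_at[OF G.nz] F.nz_P0 G.nz_P0 G.nz_Kf by (auto simp: nzmero_def)
  have "eventually (\<lambda>z. deriv h z = 0) (cosparse UNIV)"
    using c ev
  proof eventually_elim
    case (elim z)
    have df: "(f has_field_derivative deriv f z) (at z)" "(g has_field_derivative deriv g z) (at z)"
      using elim analytic_on_imp_differentiable_at DERIV_deriv_iff_field_differentiable unfolding regular_at_def by blast+
    have 1: "((\<lambda>z. F.P (f z)) has_field_derivative (f z ^ n * (f z - 1) ^ m) * deriv f z) (at z)"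
      by (rule DERIV_chain2[OF P_poly_has_derivative df(1)])
    have 2: "((\<lambda>z. F.P (g z)) has_field_derivative (g z ^ n * (g z - 1) ^ m) * deriv g z) (at z)"
      by (rule DERIV_chain2[OF P_poly_has_derivative df(2)])
    have "(h has_field_derivative - F.Kf z + c * G.Kf z) (at z)"
      unfolding h_def
      by (rule DERIV_cong[OF DERIV_diff[OF DERIV_inverse'[OF 1 elim(4)] DERIV_cmult[OF DERIV_inverse'[OF 2 elim(5)]]]])
        (simp add: Kfun_def power2_eq_square divide_inverse algebra_simps)
    moreover have "F.Kf z = c * G.Kf z" using elim by (simp add: Phi_def field_simps)
    ultimately show "deriv h z = 0" by (simp add: DERIV_imp_deriv)
  qed
  then have "\<not> nzmero (deriv h)"
  proof (rule contrapos_pn)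
    assume "nzmero (deriv h)"
    then have "eventually (\<lambda>z. deriv h z \<noteq> 0) (cosparse UNIV)" by (simp add: nzmero_def)
    show "\<not> eventually (\<lambda>z. deriv h z = 0) (cosparse UNIV)"
    proof
      assume "eventually (\<lambda>z. deriv h z = 0) (cosparse UNIV)"
      with \<open>eventually (\<lambda>z. deriv h z \<noteq> 0) (cosparse UNIV)\<close>
      have "eventually (\<lambda>z. False) (cosparse (UNIV :: complex set))" by eventually_elim auto
      then show False using cosparse_UNIV_ex by blast
    qed
  qed
  then obtain b where b: "eventually (\<lambda>z. h z = b) (cosparse UNIV)"
    using nzmero_deriv_or_constant[OF hm] by metis
  then have "eventually (\<lambda>z. inverse (F.P (f z)) = c * inverse (F.P (g z)) + b) (cosparse UNIV)"
    by eventually_elim (simp add: h_def algebra_simps)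
  with c0 show ?thesis by (rule that)
qed

end

text \<open>As P(0) = 1, the natural choice is v = 1/c. It fails only if 1/c is the critical value
  P(1) = b, and then v = b^2 satisfies c v = b; b positive and different from 1 makes b^2 a regular
  value.\<close>

lemma (in nice_function) exists_transfer_value:
  assumes "c \<noteq> 0" "c \<noteq> 1"
  obtains v where "v \<noteq> P 0" "v \<noteq> P 1" "c * v = P 0 \<or> c * v = P 1"
proof -
  obtain b :: real where b: "P 1 = of_real b" "0 < \<bar>b - 1\<bar>" "\<bar>b - 1\<bar> < 1"
    using P_poly_1[of m n] nm by auto
  have P0: "P 0 = 1" by (rule P_poly_0)
  show ?thesis
  proof (cases "inverse c = P 1")
    case False
    then show ?thesis using assms by (intro that[of "inverse c"]) (auto simp: P0 inverse_eq_1_iff)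
  next
    case True
    have b01: "b > 0" "b \<noteq> 1" using b by auto
    have "b\<^sup>2 \<noteq> 1" using b01 by (simp add: power2_eq_1_iff)
    moreover have "b\<^sup>2 \<noteq> b" using b01 by (simp add: power2_eq_square)
    moreover have "c * (P 1)\<^sup>2 = P 1" using True assms by (metis mult.assoc mult.left_neutral power2_eq_square right_inverse)
    ultimately show ?thesis
      by (intro that[of "(P 1)\<^sup>2"]) (auto simp: P0 b(1) simp flip: of_real_power)
  qed
qed

text \<open>\<phi> is symmetric in f and g, so the same radii serve both orders of the pair.
  \<open>B0\<close> reserves room for the bad radii of functions built from f and g, such as H, V
  and U.\<close>

lemma sharing_pair_exists:
  assumes f: "f nicely_meromorphic_on UNIV" "\<not> (\<exists>c. \<forall>z. f z = c)"
    and g: "g nicely_meromorphic_on UNIV" "\<not> (\<exists>c. \<forall>z. g z = c)"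
    and nm: "n \<ge> 3" "m \<ge> 3" and AA: "countable AA" "{0, 1} \<union> {a. P_poly n m a = 0} \<subseteq> AA"
    and B0: "countable B0"
    and E: "E_weighted f {a. P_poly n m a = 0} l = E_weighted g {a. P_poly n m a = 0} l"
  obtains s \<phi> B where "B0 \<subseteq> B" "sharing_pair' s \<phi> B f g AA n m" "sharing_pair' s \<phi> B g f AA n m"
    "filterlim s at_top sequentially"
    "filterlim (\<lambda>k. nev f (s k)) at_top sequentially" "filterlim (\<lambda>k. nev g (s k)) at_top sequentially"
proof -
  define B1 where "B1 = B0 \<union> bad_radii (deriv f) \<union> bad_radii (deriv g)
    \<union> (\<Union>a\<in>AA. bad_radii (\<lambda>z. f z - a) \<union> bad_radii (\<lambda>z. g z - a))"
  have "countable B1" unfolding B1_def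
    using B0 AA(1) countable_bad_radii[OF nice_deriv_nzmero[OF f]] countable_bad_radii[OF nice_deriv_nzmero[OF g]]
      countable_bad_radii[OF nice_shift_nzmero[OF f]] countable_bad_radii[OF nice_shift_nzmero[OF g]] by auto
  then obtain s B where sB: "B1 \<subseteq> B" "growth_sequence s (\<lambda>k. nev f (s k) + nev g (s k)) B"
    "growth_sequence.adm s (\<lambda>k. nev f (s k) + nev g (s k)) B f"
    "growth_sequence.adm s (\<lambda>k. nev f (s k) + nev g (s k)) B g"
    "filterlim s at_top sequentially"
    "filterlim (\<lambda>k. nev f (s k)) at_top sequentially" "filterlim (\<lambda>k. nev g (s k)) at_top sequentially" by (rule growth_sequence_exists[OF f g])
  define \<phi> where "\<phi> = (\<lambda>k. nev f (s k) + nev g (s k))"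
  have bad: "bad_radii (deriv f) \<subseteq> B" "bad_radii (deriv g) \<subseteq> B"
    "a \<in> AA \<Longrightarrow> bad_radii (\<lambda>z. f z - a) \<subseteq> B" "a \<in> AA \<Longrightarrow> bad_radii (\<lambda>z. g z - a) \<subseteq> B" for a
    using sB(1) unfolding B1_def by blast+
  have F: "nice_function s \<phi> B f AA n m"
    using sB(2,3) f bad nm by (simp add: nice_function_def nice_function_axioms_def \<phi>_def)
  have G: "nice_function s \<phi> B g AA n m"
    using sB(2,4) g bad nm by (simp add: nice_function_def nice_function_axioms_def \<phi>_def)
  interpret F: nice_function s \<phi> B f AA n m by (rule F)
  interpret G: nice_function s \<phi> B g AA n m by (rule G)
  have share: "F.Smult z = 0 \<longleftrightarrow> G.Smult z = 0" for z
  proof -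
    have "min (enat (F.Smult z)) (l + 1) = min (enat (G.Smult z)) (l + 1)"
      using fun_cong[OF E, of z] by (simp add: F.E_weighted_eq G.E_weighted_eq)
    moreover have "min (enat p) (l + 1) = 0 \<longleftrightarrow> p = 0" for p
      by (cases l) (auto simp: min_def zero_enat_def one_enat_def)
    ultimately show ?thesis by metis
  qed
  have "sharing_pair s \<phi> B f g AA n m" "sharing_pair s \<phi> B g f AA n m"
    using F G AA(2) by (simp_all add: sharing_pair_def sharing_pair_axioms_def)
  then have "sharing_pair' s \<phi> B f g AA n m" "sharing_pair' s \<phi> B g f AA n m"
    using share by (simp_all add: sharing_pair'_def sharing_pair'_axioms_def \<phi>_def add.commute)
  then show ?thesis using sB unfolding B1_def by (intro that[of B s \<phi>]) auto
qed

section \<open>Uniqueness by cases on the auxiliary function and on the constants of the degenerate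
  relation\<close>

theorem theorem1p1:
  fixes n m :: nat and f g :: "complex \<Rightarrow> complex" and l :: enat
    and S :: "complex set" and \<Theta>f \<Theta>g :: ereal
  assumes "n \<ge> 3" and "m \<ge> 3"
    and "S = {z. P_poly n m z = 0}"
    and "f nicely_meromorphic_on UNIV" and "g nicely_meromorphic_on UNIV"
    and "\<not> (\<exists>c. \<forall>z. f z = c)" and "\<not> (\<exists>c. \<forall>z. g z = c)"
    and "E_weighted f S l = E_weighted g S l"
    and "\<Theta>f = 2 * Theta (Some 0) f + 2 * Theta None f + Theta (Some 1) f
               + min (Theta (Some 1) f) (Theta (Some 1) g) / 2"
    and "\<Theta>g = 2 * Theta (Some 0) g + 2 * Theta None g + Theta (Some 1) g
               + min (Theta (Some 1) f) (Theta (Some 1) g) / 2"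
    and "(l \<ge> 2 \<and> \<Theta>f + \<Theta>g > ereal (9 - (real n + real m)))
       \<or> (l = 1 \<and> \<Theta>f + \<Theta>g > ereal (10 - (real n + real m)))
       \<or> (l = 0 \<and> \<Theta>f + \<Theta>g > ereal (15 - (real n + real m)))"
  shows "f = g"
proof (rule ccontr)
  assume neq: "f \<noteq> g"
  note nm = assms(1,2) and f = assms(4,6) and g = assms(5,7)
  have E: "E_weighted f {a. P_poly n m a = 0} l = E_weighted g {a. P_poly n m a = 0} l"
    using assms(3,8) by simp
  have cond: "(l \<ge> 2 \<and> Theta_sum f g > ereal (9 - (real n + real m)))
       \<or> (l = 1 \<and> Theta_sum f g > ereal (10 - (real n + real m)))
       \<or> (l = 0 \<and> Theta_sum f g > ereal (15 - (real n + real m)))"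
    using assms(11) unfolding assms(9,10) Theta_sum_def .
  define R where "R = (\<lambda>v. {a. P_poly n m a = v})"
  have finR: "finite (R v)" for v using P_poly_factor[of n m v] nm unfolding R_def by auto
  define A0 where "A0 = {0, 1} \<union> R 0"
  have A0: "countable (A0 \<union> A')" "{0, 1} \<union> {a. P_poly n m a = 0} \<subseteq> A0 \<union> A'" if "finite A'" for A'
    using finR[of 0] that by (auto simp: A0_def R_def intro: countable_finite)
  have ex: "\<exists>s \<phi> B. B0 \<subseteq> B \<and> sharing_pair' s \<phi> B f g (A0 \<union> A') n m \<and> sharing_pair' s \<phi> B g f (A0 \<union> A') n m"
    if fA: "finite A'" and cB: "countable B0" for A' B0
  proof -
    obtain s \<phi> B where sp: "B0 \<subseteq> B" "sharing_pair' s \<phi> B f g (A0 \<union> A') n m" "sharing_pair' s \<phi> B g f (A0 \<union> A') n m"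
      "filterlim s at_top sequentially"
      "filterlim (\<lambda>k. nev f (s k)) at_top sequentially" "filterlim (\<lambda>k. nev g (s k)) at_top sequentially"
      by (rule sharing_pair_exists[OF f g nm A0[OF fA] cB E])
    from sp(1-3) show ?thesis by (intro exI conjI)
  qed
  have nz: "nzmero (Phi n m f g)" "nzmero (Phi n m g f)"
  proof -
    \<comment> \<open>A preliminary sequence, used only to enter the locale: the bad radii of H have
      to be known before the final radii can be chosen to avoid them.\<close>
    obtain s \<phi> B where sp: "sharing_pair' s \<phi> B f g (A0 \<union> {}) n m" "sharing_pair' s \<phi> B g f (A0 \<union> {}) n m"
      using ex[OF finite.emptyI countable_empty] by blast
    interpret FG: sharing_pair' s \<phi> B f g "A0 \<union> {}" n m by (rule sp(1))
    interpret GF: sharing_pair' s \<phi> B g f "A0 \<union> {}" n m by (rule sp(2))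
    show "nzmero (Phi n m f g)" "nzmero (Phi n m g f)" using FG.nz_Phi GF.nz_Phi by auto
  qed
  show False
  proof (cases "nzmero (deriv (Phi n m f g))")
    case True
    have nd: "nzmero (deriv (Phi n m g f))" by (rule nz_Phi_swap[OF nz(1) True])
    have "nzmero (Hfun n m f g)" "nzmero (Hfun n m g f)"
      unfolding Hfun_def[abs_def] by (intro nzmero_divide True nd nz)+
    then have cb: "countable (bad_radii (Hfun n m f g) \<union> bad_radii (Hfun n m g f))"
      using countable_bad_radii by auto
    obtain s \<phi> B where sp: "bad_radii (Hfun n m f g) \<union> bad_radii (Hfun n m g f) \<subseteq> B"
      "sharing_pair' s \<phi> B f g (A0 \<union> {}) n m" "sharing_pair' s \<phi> B g f (A0 \<union> {}) n m"
      "filterlim s at_top sequentially"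
      "filterlim (\<lambda>k. nev f (s k)) at_top sequentially" "filterlim (\<lambda>k. nev g (s k)) at_top sequentially"
      by (rule sharing_pair_exists[OF f g nm A0[OF finite.emptyI] cb E])
    interpret FG: sharing_pair' s \<phi> B f g "A0 \<union> {}" n m by (rule sp(2))
    interpret GF: sharing_pair' s \<phi> B g f "A0 \<union> {}" n m by (rule sp(3))
    have "frequently (\<lambda>k. nev g (s k) \<le> nev f (s k) \<or> nev f (s k) \<le> nev g (s k)) sequentially"
      by (intro eventually_frequently always_eventually) (auto intro: linear)
    then consider "frequently (\<lambda>k. nev g (s k) \<le> nev f (s k)) sequentially"
      | "frequently (\<lambda>k. nev f (s k) \<le> nev g (s k)) sequentially"
      unfolding frequently_disj_iff by blast
    then show False
    proof cases
      case 1
      then show False using FG.nondegenerate_contradiction[OF True _ E 1 sp(4-6) cond] sp(1) by blast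
    next
      case 2
      then show False
        using GF.nondegenerate_contradiction[OF nd _ E[symmetric] 2 sp(4,6,5)] cond[unfolded Theta_sum_commute[of f g]] sp(1) by blast
    qed
  next
    case False
    obtain c b where cb: "c \<noteq> 0"
      "eventually (\<lambda>z. inverse (P_poly n m (f z)) = c * inverse (P_poly n m (g z)) + b) (cosparse UNIV)"
    proof -
      obtain s \<phi> B where sp: "sharing_pair' s \<phi> B f g (A0 \<union> {}) n m"
        using ex[OF finite.emptyI countable_empty] by blast
      interpret FG: sharing_pair' s \<phi> B f g "A0 \<union> {}" n m by (rule sp(1))
      show ?thesis using FG.degenerate_relation[OF False] that by blast
    qed
    show False
    proof (cases "b = 0")
      case b: False
      obtain s \<phi> B where sp: "sharing_pair' s \<phi> B f g (A0 \<union> R (- c / b)) n m"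
        using ex[OF finR countable_empty] by blast
      interpret FG: sharing_pair' s \<phi> B f g "A0 \<union> R (- c / b)" n m by (rule sp)
      show False using FG.no_pole_relation[OF cb(2,1) b] by (auto simp: R_def)
    next
      case True
      have "eventually (\<lambda>z. inverse (P_poly n m (f z)) = c * inverse (P_poly n m (g z))) (cosparse UNIV)"
        using cb(2) True by simp
      then have rel: "eventually (\<lambda>z. P_poly n m (g z) = c * P_poly n m (f z)) (cosparse UNIV)"
        by eventually_elim (metis cb(1) inverse_inverse_eq inverse_mult_distrib mult.assoc mult.left_neutral right_inverse)
      show False
      proof (cases "c = 1")
        case c: True
        have nV: "nzmero (Vfun f g)" "nzmero (Ufun f g)" by (rule nz_Vfun_Ufun[OF f g neq])+
        then have cV: "countable (bad_radii (Vfun f g) \<union> bad_radii (Ufun f g))" using countable_bad_radii by auto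
        obtain s \<phi> B where sp: "bad_radii (Vfun f g) \<union> bad_radii (Ufun f g) \<subseteq> B"
          "sharing_pair' s \<phi> B f g (A0 \<union> {}) n m"
          using ex[OF finite.emptyI cV] by blast
        interpret FG: sharing_pair' s \<phi> B f g "A0 \<union> {}" n m by (rule sp(2))
        have "eventually (\<lambda>z. P_poly n m (f z) = P_poly n m (g z)) (cosparse UNIV)"
          using rel by eventually_elim (simp add: c)
        then show False using FG.equal_if_P_equal sp(1) neq by blast
      next
        case c: False
        have rel': "eventually (\<lambda>z. P_poly n m (f z) = inverse c * P_poly n m (g z)) (cosparse UNIV)"
          using rel by eventually_elim (simp add: cb(1))
        \<comment> \<open>The relation is used in both directions, with c from f to g and with its
          inverse from g to f, and each direction has its own regular value.\<close>
        obtain v1 v2 where v: "v1 \<noteq> P_poly n m 0" "v1 \<noteq> P_poly n m 1" "c * v1 = P_poly n m 0 \<or> c * v1 = P_poly n m 1"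
          "v2 \<noteq> P_poly n m 0" "v2 \<noteq> P_poly n m 1" "inverse c * v2 = P_poly n m 0 \<or> inverse c * v2 = P_poly n m 1"
        proof -
          obtain s \<phi> B where sp: "sharing_pair' s \<phi> B f g (A0 \<union> {}) n m"
            using ex[OF finite.emptyI countable_empty] by blast
          interpret FG: sharing_pair' s \<phi> B f g "A0 \<union> {}" n m by (rule sp(1))
          show ?thesis
            using FG.F.exists_transfer_value[of c] FG.F.exists_transfer_value[of "inverse c"] c cb(1) that
            by (metis inverse_eq_1_iff inverse_nonzero_iff_nonzero)
        qed
        define A' where "A' = R v1 \<union> R (c * v1) \<union> R v2 \<union> R (inverse c * v2)"
        have finA': "finite A'" using finR by (simp add: A'_def)
        obtain s \<phi> B where sp: "sharing_pair' s \<phi> B f g (A0 \<union> A') n m" "sharing_pair' s \<phi> B g f (A0 \<union> A') n m"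
          using ex[OF finA' countable_empty] by blast
        interpret FG: sharing_pair' s \<phi> B f g "A0 \<union> A'" n m by (rule sp(1))
        interpret GF: sharing_pair' s \<phi> B g f "A0 \<union> A'" n m by (rule sp(2))
        have 1: "FG.F.small (\<lambda>k. (real (n + m) - 1) * nev f (s k) - (real (n + m) - 2) * nev g (s k))"
          by (rule FG.proportional_bound[OF rel cb(1) v(1-3)]) (auto simp: A'_def R_def)
        have 2: "FG.F.small (\<lambda>k. (real (n + m) - 1) * nev g (s k) - (real (n + m) - 2) * nev f (s k))"
          by (rule GF.proportional_bound[OF rel' _ v(4-6)]) (use cb(1) in \<open>auto simp: A'_def R_def\<close>)
        \<comment> \<open>Adding the two bounds leaves (n + m - 1) - (n + m - 2) = 1 times the sum
          of the characteristics.\<close>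
        have "FG.F.small (\<lambda>k. 1 * \<phi> k)"
          by (rule FG.F.small_mono[OF FG.F.small_add[OF 1 2]]) (simp add: FG.phi_eq algebra_simps)
        then show False using FG.F.not_small_phi[of 1] by simp
      qed
    qed
  qed
qed

end
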